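(* Suppose that Assumptions A1 and A2 hold and that $L(n)\asymp\log n$ as $n\to\infty$ (i.e. $L(n)=O(\log n)$ and $\log n=O(L(n))$). Define the random process $$\mathcal K_n^{(1)}(u):=\frac{1}{\Phi(n)\sqrt{\log n}}\Big\{\mathcal K_n(u\log n)-\log n\int_0^{u\wedge 1}\Phi(n^{1-v})\,dv\Big\},\qquad u\ge0,$$ and, with $W$ a standard Brownian motion, $$Y_n^{(1)}(u):=\sigma\int_0^{u\wedge1}h_n^{(1)}(v)\,W(v)\,dv,\qquad h_n^{(1)}(u):=\frac{\Phi(n^{1-u})\log n}{\Phi(n)\,L(n^{1-u})}.$$ Then $$d_{BW}^0\big(\mathcal L(\mathcal K_n^{(1)}),\mathcal L(Y_n^{(1)})\big)\to0\quad\text{as } n\to\infty,$$ where $\mathcal L(\cdot)$ denotes the law of a process.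
   Context: Setting. $S=(S_t)_{t\ge0}$ is a subordinator (increasing càdlàg Lévy process, $S_0=0$) with zero drift, no killing and Lévy measure $\nu_0$ on $(0,\infty)$, normalised so that $\mathbb E S_t=t$, and with $\mathrm{Var}\,S_t=\sigma^2t$, $\sigma^2<\infty$. Put $N_0(x)=\nu_0[x,\infty)$ and $\Phi(s)=\int_0^\infty\big(1-e^{-s(1-e^{-x})}\big)\nu_0(dx)$ for $s\ge0$. For real $n>0$, $\Pi_n$ is a Poisson point process on $(0,\infty)$ with intensity $ne^{-x}dx$, independent of $S$. $\mathcal K_n(T)$ is the number of $t\in[0,T]$ with $\Pi_n\cap(S_{t-},S_t)\ne\emptyset$. Assumption A1: $y\mapsto N_0(1/y)$ is unbounded and slowly varying as $y\to\infty$. $L(s):=\Phi(s)/(s\Phi'(s))$ for $s>0$. Assumption A2: there exist $s_0\ge1$ and $k>0$ such that $|sL'(s)/L(s)|<k/\log s$ for all $s\ge s_0$. Bounded Wasserstein distance: for probability measures $Q,Q'$ on a metric space $(\mathcal X,\rho)$, $d_{BW}(Q,Q')=\sup_f|\int f\,dQ-\int f\,dQ'|$, the supremum over all $f:\mathcal X\to\mathbb R$ with $\sup|f|\le1$ and $|f(x)-f(x')|\le\rho(x,x')$ for all $x,x'$. $d_{BW}^0$ is this distance for $\mathcal X=D_0[0,\infty)$, the space of càdlàg functions $x:[0,\infty)\to\mathbb R$ having a finite limit at $\infty$, with $\rho_0(x,y)=\sup_{t\ge0}|x(t)-y(t)|$. *)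

theory Defs
  imports "HOL-Probability.Probability" "HOL-Library.Landau_Symbols"
begin

section \<open>Subordinators and Brownian motion\<close>

definition independent_increments ::
  "'a measure \<Rightarrow> (real \<Rightarrow> 'a \<Rightarrow> real) \<Rightarrow> bool" where
  "independent_increments M X \<longleftrightarrow>
    (\<forall>k. \<forall>t :: nat \<Rightarrow> real. 0 \<le> t 0 \<longrightarrow> (\<forall>i<k. t i \<le> t (Suc i)) \<longrightarrow>
      prob_space.indep_vars M (\<lambda>_. borel) (\<lambda>i \<omega>. X (t (Suc i)) \<omega> - X (t i) \<omega>) {..<k})"

definition stationary_increments ::
  "'a measure \<Rightarrow> (real \<Rightarrow> 'a \<Rightarrow> real) \<Rightarrow> bool" where
  "stationary_increments M X \<longleftrightarrow>
    (\<forall>s\<ge>0. \<forall>t\<ge>0. distr M borel (\<lambda>\<omega>. X (s + t) \<omega> - X s \<omega>) = distr M borel (X t))"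

text \<open>Paths are functions on the whole real line of which only the values on
  \<open>[0,\<infinity>)\<close> matter.\<close>

definition cadlag :: "(real \<Rightarrow> real) \<Rightarrow> bool" where
  "cadlag x \<longleftrightarrow>
    (\<forall>t\<ge>0. (x \<longlongrightarrow> x t) (at_right t)) \<and> (\<forall>t>0. \<exists>l. (x \<longlongrightarrow> l) (at_left t))"

definition levy_process :: "'a measure \<Rightarrow> (real \<Rightarrow> 'a \<Rightarrow> real) \<Rightarrow> bool" where
  "levy_process M X \<longleftrightarrow>
    (\<forall>t\<ge>0. X t \<in> borel_measurable M) \<and>
    (\<forall>\<omega>\<in>space M. X 0 \<omega> = 0) \<and>
    independent_increments M X \<and> stationary_increments M X \<and>
    (\<forall>\<omega>\<in>space M. cadlag (\<lambda>t. X t \<omega>))"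

text \<open>The Levy measures of subordinators: measures on \<open>(0,\<infinity>)\<close>, regarded as Borel
  measures on the real line without mass on \<open>(-\<infinity>,0]\<close>, integrating \<open>min 1 x\<close>.\<close>

definition subordinator_levy_measure :: "real measure \<Rightarrow> bool" where
  "subordinator_levy_measure \<nu> \<longleftrightarrow>
    sets \<nu> = sets borel \<and> emeasure \<nu> {..0} = 0 \<and>
    (\<integral>\<^sup>+x. ennreal (min 1 x) \<partial>\<nu>) < \<infinity>"

text \<open>A subordinator with drift \<open>d\<close> and Levy measure \<open>\<nu>\<close>, killed at rate \<open>q\<close>, has
  \<open>E exp (- s S\<^sub>t) = exp (- t (q + d s + \<integral>(1 - exp (- s x)) \<nu>(dx)))\<close>; here
  \<open>d = q = 0\<close>.\<close>

definition driftless_subordinator ::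
  "'a measure \<Rightarrow> (real \<Rightarrow> 'a \<Rightarrow> real) \<Rightarrow> real measure \<Rightarrow> bool" where
  "driftless_subordinator M S \<nu> \<longleftrightarrow>
    levy_process M S \<and>
    (\<forall>\<omega>\<in>space M. mono_on {0..} (\<lambda>t. S t \<omega>)) \<and>
    subordinator_levy_measure \<nu> \<and>
    (\<forall>t\<ge>0. \<forall>s\<ge>0. prob_space.expectation M (\<lambda>\<omega>. exp (- s * S t \<omega>)) =
        exp (- t * (\<integral>x. 1 - exp (- s * x) \<partial>\<nu>)))"

definition standard_brownian_motion ::
  "'a measure \<Rightarrow> (real \<Rightarrow> 'a \<Rightarrow> real) \<Rightarrow> bool" where
  "standard_brownian_motion M W \<longleftrightarrow>
    (\<forall>t\<ge>0. W t \<in> borel_measurable M) \<and>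
    (\<forall>\<omega>\<in>space M. W 0 \<omega> = 0) \<and>
    independent_increments M W \<and>
    (\<forall>s\<ge>0. \<forall>t>s. distributed M lborel (\<lambda>\<omega>. W t \<omega> - W s \<omega>)
        (\<lambda>x. ennreal (normal_density 0 (sqrt (t - s)) x))) \<and>
    (\<forall>\<omega>\<in>space M. continuous_on {0..} (\<lambda>t. W t \<omega>))"

section \<open>Poisson points and the number of occupied gaps\<close>

text \<open>A Poisson process with finite diffuse intensity \<open>\<mu>\<close>, as a random finite set.\<close>

definition finite_poisson_process ::
  "'a measure \<Rightarrow> 'b measure \<Rightarrow> ('a \<Rightarrow> 'b set) \<Rightarrow> bool" where
  "finite_poisson_process M \<mu> P \<longleftrightarrow>
    (\<forall>\<omega>\<in>space M. finite (P \<omega>) \<and> P \<omega> \<subseteq> space \<mu>) \<and>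
    (\<forall>B\<in>sets \<mu>. (\<lambda>\<omega>. card (P \<omega> \<inter> B)) \<in> M \<rightarrow>\<^sub>M count_space UNIV) \<and>
    (\<forall>B\<in>sets \<mu>. \<forall>k. measure M {\<omega> \<in> space M. card (P \<omega> \<inter> B) = k} =
        exp (- measure \<mu> B) * measure \<mu> B ^ k / fact k) \<and>
    (\<forall>B :: nat \<Rightarrow> 'b set. range B \<subseteq> sets \<mu> \<longrightarrow> disjoint_family B \<longrightarrow>
        prob_space.indep_vars M (\<lambda>_. count_space UNIV) (\<lambda>i \<omega>. card (P \<omega> \<inter> B i)) UNIV)"

definition exp_intensity :: "real \<Rightarrow> real measure" where
  "exp_intensity n = density (restrict_space lborel {0<..}) (\<lambda>x. ennreal (n * exp (- x)))"

text \<open>Independence of the whole path of \<open>S\<close> and the whole point configuration, the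
  latter observed through its counts on measurable sets.\<close>

definition indep_process_points ::
  "'a measure \<Rightarrow> (real \<Rightarrow> 'a \<Rightarrow> real) \<Rightarrow> 'b measure \<Rightarrow> ('a \<Rightarrow> 'b set) \<Rightarrow> bool" where
  "indep_process_points M S \<mu> P \<longleftrightarrow>
    prob_space.indep_set M
      {(\<lambda>\<omega>. \<lambda>t\<in>{0..}. S t \<omega>) -` A \<inter> space M | A.
        A \<in> sets (PiM {0..} (\<lambda>_. borel))}
      {(\<lambda>\<omega>. \<lambda>B\<in>sets \<mu>. card (P \<omega> \<inter> B)) -` A \<inter> space M | A.
        A \<in> sets (PiM (sets \<mu>) (\<lambda>_. count_space UNIV))}"

definition left_limit :: "(real \<Rightarrow> real) \<Rightarrow> real \<Rightarrow> real" where
  "left_limit x t = (if t \<le> 0 then x 0 else Lim (at_left t) x)"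

definition occupied_gaps :: "(real \<Rightarrow> real) \<Rightarrow> real set \<Rightarrow> real \<Rightarrow> nat" where
  "occupied_gaps x A T = card {t \<in> {0..T}. A \<inter> {left_limit x t <..< x t} \<noteq> {}}"

section \<open>Functionals of the Levy measure and the two assumptions\<close>

definition levy_tail :: "real measure \<Rightarrow> real \<Rightarrow> real" where
  "levy_tail \<nu> x = measure \<nu> {x..}"

definition Phi :: "real measure \<Rightarrow> real \<Rightarrow> real" where
  "Phi \<nu> s = (\<integral>x. 1 - exp (- s * (1 - exp (- x))) \<partial>\<nu>)"

definition L_fun :: "real measure \<Rightarrow> real \<Rightarrow> real" where
  "L_fun \<nu> s = Phi \<nu> s / (s * deriv (Phi \<nu>) s)"

definition slowly_varying :: "(real \<Rightarrow> real) \<Rightarrow> bool" where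
  "slowly_varying f \<longleftrightarrow>
    f \<in> borel_measurable (restrict_space borel {0<..}) \<and>
    (\<forall>\<^sub>F y in at_top. f y > 0) \<and>
    (\<forall>c>0. ((\<lambda>y. f (c * y) / f y) \<longlongrightarrow> 1) at_top)"

definition assumption_A1 :: "real measure \<Rightarrow> bool" where
  "assumption_A1 \<nu> \<longleftrightarrow>
    \<not> bdd_above ((\<lambda>y. levy_tail \<nu> (1 / y)) ` {0<..}) \<and>
    slowly_varying (\<lambda>y. levy_tail \<nu> (1 / y))"

text \<open>At \<open>s = 1\<close> the bound reads \<open>k / 0 = 0\<close> instead of \<open>\<infinity>\<close>. This is harmless because
  \<open>s0\<close> may always be enlarged.\<close>

definition assumption_A2 :: "real measure \<Rightarrow> bool" where
  "assumption_A2 \<nu> \<longleftrightarrow>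
    (\<exists>s0\<ge>1. \<exists>k>0. \<forall>s\<ge>s0. \<bar>s * deriv (L_fun \<nu>) s / L_fun \<nu> s\<bar> < k / ln s)"

section \<open>Bounded Wasserstein distance\<close>

text \<open>The upper integral of an arbitrary function. It equals the integral if the function
  is integrable. It is needed because the space of cadlag functions is not separable in
  the uniform metric: laws of jump processes live on the \<open>\<sigma>\<close>-algebra of the coordinate
  maps only, and Lipschitz functions need not be measurable for it.\<close>

definition upper_integral :: "'b measure \<Rightarrow> ('b \<Rightarrow> real) \<Rightarrow> real" where
  "upper_integral Q f =
    (INF g \<in> {g. integrable Q g \<and> (\<forall>x\<in>space Q. f x \<le> g x)}. integral\<^sup>L Q g)"

lemma upper_integral_eq_integral:
  assumes "integrable Q f"
  shows "upper_integral Q f = integral\<^sup>L Q f"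
  unfolding upper_integral_def
proof (rule cInf_eq_minimum)
  show "integral\<^sup>L Q f \<in> integral\<^sup>L Q ` {g. integrable Q g \<and> (\<forall>x\<in>space Q. f x \<le> g x)}"
    using assms by blast
qed (use assms in \<open>auto intro!: integral_mono\<close>)

definition bounded_lipschitz :: "'b set \<Rightarrow> ('b \<Rightarrow> 'b \<Rightarrow> real) \<Rightarrow> ('b \<Rightarrow> real) \<Rightarrow> bool" where
  "bounded_lipschitz X \<rho> f \<longleftrightarrow>
    (\<forall>x\<in>X. \<bar>f x\<bar> \<le> 1) \<and> (\<forall>x\<in>X. \<forall>x'\<in>X. \<bar>f x - f x'\<bar> \<le> \<rho> x x')"

text \<open>Both arguments are probability measures with the same underlying space.\<close>

definition d_BW :: "('b \<Rightarrow> 'b \<Rightarrow> real) \<Rightarrow> 'b measure \<Rightarrow> 'b measure \<Rightarrow> real" where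
  "d_BW \<rho> Q Q' =
    (SUP f \<in> {f. bounded_lipschitz (space Q) \<rho> f}. \<bar>upper_integral Q f - upper_integral Q' f\<bar>)"

lemma upper_integral_bounded:
  assumes "prob_space Q" "\<forall>x\<in>space Q. \<bar>f x\<bar> \<le> 1"
  shows "\<bar>upper_integral Q f\<bar> \<le> 1"
proof -
  interpret prob_space Q by fact
  let ?G = "{g. integrable Q g \<and> (\<forall>x\<in>space Q. f x \<le> g x)}"
  have low: "-1 \<le> integral\<^sup>L Q g" if "g \<in> ?G" for g
  proof -
    have "integral\<^sup>L Q (\<lambda>_. -1 :: real) \<le> integral\<^sup>L Q g"
      using that assms(2) by (intro integral_mono) (fastforce simp: abs_le_iff)+
    then show ?thesis by (simp add: prob_space)
  qed
  have one: "(\<lambda>_. 1) \<in> ?G" using assms(2) by (auto simp: abs_le_iff)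
  have "upper_integral Q f \<le> integral\<^sup>L Q (\<lambda>_. 1 :: real)"
    unfolding upper_integral_def
    by (rule cINF_lower[OF _ one]) (use low in \<open>auto intro!: bdd_belowI[of _ "-1"]\<close>)
  moreover have "-1 \<le> upper_integral Q f"
    unfolding upper_integral_def by (rule cINF_greatest) (use one low in auto)
  ultimately show ?thesis by (simp add: prob_space abs_le_iff)
qed

lemma d_BW_bdd_above:
  assumes "prob_space Q" "prob_space Q'" "space Q' = space Q"
  shows "bdd_above ((\<lambda>f. \<bar>upper_integral Q f - upper_integral Q' f\<bar>) `
    {f. bounded_lipschitz (space Q) \<rho> f})"
proof (rule bdd_aboveI2[of _ _ 2])
  fix f assume "f \<in> {f. bounded_lipschitz (space Q) \<rho> f}"
  then have "\<forall>x\<in>space Q. \<bar>f x\<bar> \<le> 1" by (simp add: bounded_lipschitz_def)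
  then show "\<bar>upper_integral Q f - upper_integral Q' f\<bar> \<le> 2"
    using upper_integral_bounded[of Q f] upper_integral_bounded[of Q' f] assms by simp
qed

section \<open>The space \<open>D\<^sub>0[0,\<infinity>)\<close>\<close>

text \<open>Functions on \<open>[0,\<infinity>)\<close> are extensional, so that \<open>\<rho>0\<close> is a metric on \<open>D0\<close>.\<close>

definition D0 :: "(real \<Rightarrow> real) set" where
  "D0 = {x \<in> extensional {0..}. cadlag x \<and> (\<exists>l. (x \<longlongrightarrow> l) at_top)}"

definition \<rho>0 :: "(real \<Rightarrow> real) \<Rightarrow> (real \<Rightarrow> real) \<Rightarrow> real" where
  "\<rho>0 x y = (SUP t\<in>{0..}. \<bar>x t - y t\<bar>)"

definition D0_space :: "(real \<Rightarrow> real) measure" where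
  "D0_space = restrict_space (PiM {0..} (\<lambda>_. borel)) D0"

definition process_law :: "'a measure \<Rightarrow> (real \<Rightarrow> 'a \<Rightarrow> real) \<Rightarrow> (real \<Rightarrow> real) measure" where
  "process_law M X = distr M D0_space (\<lambda>\<omega>. \<lambda>u\<in>{0..}. X u \<omega>)"

abbreviation d_BW0 :: "(real \<Rightarrow> real) measure \<Rightarrow> (real \<Rightarrow> real) measure \<Rightarrow> real" where
  "d_BW0 \<equiv> d_BW \<rho>0"

section \<open>The normalised count and its approximation\<close>

definition K1 :: "real measure \<Rightarrow> (real \<Rightarrow> 'a \<Rightarrow> real) \<Rightarrow> (real \<Rightarrow> 'a \<Rightarrow> real set) \<Rightarrow>
    real \<Rightarrow> real \<Rightarrow> 'a \<Rightarrow> real" where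
  "K1 \<nu> S P n u \<omega> =
    1 / (Phi \<nu> n * sqrt (ln n)) *
      (real (occupied_gaps (\<lambda>t. S t \<omega>) (P n \<omega>) (u * ln n)) -
       ln n * integral {0..min u 1} (\<lambda>v. Phi \<nu> (n powr (1 - v))))"

definition h1 :: "real measure \<Rightarrow> real \<Rightarrow> real \<Rightarrow> real" where
  "h1 \<nu> n u = Phi \<nu> (n powr (1 - u)) * ln n / (Phi \<nu> n * L_fun \<nu> (n powr (1 - u)))"

definition Y1 :: "real measure \<Rightarrow> real \<Rightarrow> (real \<Rightarrow> 'b \<Rightarrow> real) \<Rightarrow> real \<Rightarrow> real \<Rightarrow> 'b \<Rightarrow> real" where
  "Y1 \<nu> \<sigma> W n u \<omega> = \<sigma> * integral {0..min u 1} (\<lambda>v. h1 \<nu> n v * W v \<omega>)"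

end

theory Submission
  imports Defs "HOL-Real_Asymp.Real_Asymp"
begin

text \<open>Write \<open>x = ln n\<close>, \<open>G y = \<Phi> (exp y)\<close> and \<open>g = G'\<close>. The count of occupied gaps has the compensator
  \<open>A t = \<integral>\<^sub>0\<^sup>t G (x - S\<^sub>s) ds\<close>. On a grid, the differences of count and compensator are orthogonal, so that a
  Rademacher--Menshov inequality bounds their maximal distance by a multiple of \<open>ln x * sqrt (x * G x)\<close>,
  which is negligible against the normalisation \<open>G x * sqrt x\<close>. In \<open>A\<close> one replaces \<open>G (x - S\<^sub>s)\<close> by
  \<open>G (x - s) - (S\<^sub>s - s) * g (x - s)\<close>. The expected error is an integral of \<open>\<bar>g z - g w\<bar>\<close> against a kernel of
  width \<open>sqrt x\<close>; it is negligible because A2 and \<open>L(n) \<asymp> log n\<close> make \<open>ln g\<close> Lipschitz as a function of the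
  logarithm. Finally the centred subordinator and the Brownian motion are both replaced by step functions with
  \<open>m\<close> steps. The two approximating paths are then the same Lipschitz function of \<open>m\<close> independent increments,
  and these are compared by the central limit theorem. Every step is an estimate in expectation of a uniform
  distance of paths, which is what passes to upper integrals of nonmeasurable Lipschitz functions.\<close>

section \<open>Paths and upper integrals\<close>

text \<open>No continuous-time martingale theory enters. A grid cell is hit with a conditional
  probability that is computed by a Poisson mixture of the Laplace exponent; refining the grid turns
  the sums of these into the compensator. The obstacle is that hit cells count occupied gaps only if
  no Poisson point falls into the closed range of \<open>S\<close>. Absence of drift, in the form
  \<open>laplace_exponent k / k\<close> -> 0, makes this almost sure. The logarithm in the maximal
  inequality is harmless because L(n) = O(log n) forces \<open>G x\<close> to grow at least like a
  power of \<open>x\<close>. The kernel is a Cauchy kernel: of \<open>S\<close> only second moments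
  are available, and the indicator of the interval between \<open>x - s\<close> and
  \<open>x - S s\<close> is at most this kernel times a factor controlled by the variance. The time
  horizon is cut at a fixed multiple of \<open>x\<close>, outside an event of probability at most
  \<open>2 * exp (- x)\<close>, on which the trivial error 2 suffices because test functions lie in
  [-1,1].\<close>

lemma cadlag_const: "cadlag (\<lambda>_. c)" by (auto simp: cadlag_def)

lemma cadlag_add: "cadlag x \<Longrightarrow> cadlag y \<Longrightarrow> cadlag (\<lambda>t. x t + y t)"
  unfolding cadlag_def by (blast intro: tendsto_add)

lemma cadlag_cmult: "cadlag x \<Longrightarrow> cadlag (\<lambda>t. c * x t)"
  unfolding cadlag_def by (blast intro: tendsto_mult_left)

lemma cadlag_sum: "finite I \<Longrightarrow> (\<And>i. i \<in> I \<Longrightarrow> cadlag (x i)) \<Longrightarrow> cadlag (\<lambda>t. \<Sum>i\<in>I. x i t)"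
  by (induction I rule: finite_induct) (auto intro!: cadlag_add cadlag_const)

lemma cadlag_step: "cadlag (\<lambda>t. of_bool (e \<le> t))"
  unfolding cadlag_def
proof (intro conjI allI impI)
  fix t :: real
  show "((\<lambda>t. of_bool (e \<le> t)) \<longlongrightarrow> (of_bool (e \<le> t) :: real)) (at_right t)"
  proof (rule tendsto_eventually, cases "e \<le> t")
    case True then show "\<forall>\<^sub>F u in at_right t. (of_bool (e \<le> u) :: real) = of_bool (e \<le> t)"
      by (auto simp: eventually_at_right_field intro!: exI[of _ "t + 1"])
  next
    case False then show "\<forall>\<^sub>F u in at_right t. (of_bool (e \<le> u) :: real) = of_bool (e \<le> t)"
      by (auto simp: eventually_at_right_field intro!: exI[of _ e])
  qed
  have "\<forall>\<^sub>F u in at_left t. (of_bool (e \<le> u) :: real) = of_bool (e < t)"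
  proof (cases "e < t")
    case True then show ?thesis by (auto simp: eventually_at_left_field intro!: exI[of _ e])
  next
    case False then show ?thesis by (auto simp: eventually_at_left_field intro!: exI[of _ "t - 1"])
  qed
  then show "\<exists>l. ((\<lambda>t. of_bool (e \<le> t) :: real) \<longlongrightarrow> l) (at_left t)" by (intro exI tendsto_eventually)
qed

lemma cadlag_continuous: assumes "continuous_on {0..} c" shows "cadlag c"
  unfolding cadlag_def
proof (intro conjI allI impI)
  have lim: "(c \<longlongrightarrow> c t) (at t within A)" if "0 \<le> t" "A \<subseteq> {0..}" for t A
    using assms that by (meson atLeast_iff continuous_on_def tendsto_within_subset)
  fix t :: real
  show "(c \<longlongrightarrow> c t) (at_right t)" if "0 \<le> t" using that by (intro lim) auto
  assume "0 < t"
  then have "(c \<longlongrightarrow> c t) (at t within {0..<t})" by (intro lim) auto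
  moreover have "at t within {0..<t} = at_left t" using \<open>0 < t\<close> by (intro at_within_nhd[of t "{0<..}"]) auto
  ultimately show "\<exists>l. (c \<longlongrightarrow> l) (at_left t)" by auto
qed

lemma cadlag_restrict: assumes "cadlag x" shows "cadlag (restrict x {0..})"
proof -
  have "(restrict x {0..} \<longlongrightarrow> l) (at_right t)" if "(x \<longlongrightarrow> l) (at_right t)" "0 \<le> t" for l t
    by (rule Lim_transform_eventually[OF that(1)])
       (use that in \<open>auto simp: eventually_at_right_field intro!: exI[of _ "t + 1"]\<close>)
  moreover have "(restrict x {0..} \<longlongrightarrow> l) (at_left t)" if "(x \<longlongrightarrow> l) (at_left t)" "0 < t" for l t
    by (rule Lim_transform_eventually[OF that(1)])
       (use that in \<open>auto simp: eventually_at_left_field intro!: exI[of _ 0]\<close>)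
  ultimately show ?thesis using assms unfolding cadlag_def
    by (metis atLeast_iff restrict_apply')
qed

lemma restrict_in_D0:
  assumes "cadlag x" "(x \<longlongrightarrow> l) at_top" shows "restrict x {0..} \<in> D0"
proof -
  have "(restrict x {0..} \<longlongrightarrow> l) at_top"
    by (rule Lim_transform_eventually[OF assms(2)]) (auto simp: eventually_at_top_linorder intro!: exI[of _ 0])
  then show ?thesis using cadlag_restrict[OF assms(1)] by (auto simp: D0_def)
qed

text \<open>The bound forces \<open>F\<close> to ignore the coordinates from \<open>m\<close> on and
  to be continuous for the product topology. In this way a test function that is not measurable on
  \<open>D0\<close> becomes measurable along a finite-dimensional family of paths.\<close>

lemma lipschitz_finite_coords_measurable:
  fixes F :: "(nat \<Rightarrow> real) \<Rightarrow> real"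
  assumes lip: "\<And>z z'. \<bar>F z - F z'\<bar> \<le> (\<Sum>i<m. \<bar>z i - z' i\<bar>)"
  shows "F \<in> borel_measurable (Pi\<^sub>M {..<m} (\<lambda>_. borel))"
proof -
  have "continuous_on UNIV F"
  proof (clarsimp simp: continuous_on_def)
    fix z :: "nat \<Rightarrow> real"
    have "((\<lambda>z'. \<Sum>i<m. \<bar>z' i - z i\<bar>) \<longlongrightarrow> (\<Sum>i<m. \<bar>z i - z i\<bar>)) (at z)"
    proof (intro tendsto_intros)
      fix i
      have "continuous_on UNIV (\<lambda>z'::nat \<Rightarrow> real. z' i)" by (rule continuous_on_product_coordinates)
      then show "((\<lambda>z'. z' i) \<longlongrightarrow> z i) (at z)" by (simp add: continuous_on_def)
    qed
    then have lim: "((\<lambda>z'. \<Sum>i<m. \<bar>z' i - z i\<bar>) \<longlongrightarrow> 0) (at z)" by simp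
    have "((\<lambda>z'. F z' - F z) \<longlongrightarrow> 0) (at z)"
      by (rule Lim_null_comparison[OF _ lim]) (auto intro!: always_eventually lip)
    then show "(F \<longlongrightarrow> F z) (at z)" by (simp add: LIM_zero_iff)
  qed
  then have "F \<in> borel_measurable borel" by (rule borel_measurable_continuous_onI)
  \<comment> \<open>On a countable product of reals the Borel sets of the product topology form the
    product sigma-algebra.\<close>
  then have F: "F \<in> borel_measurable (Pi\<^sub>M UNIV (\<lambda>_. borel))"
    by (simp cong: measurable_cong_sets add: sets_PiM_equal_borel)
  have "(\<lambda>z. F (\<lambda>i. if i < m then z i else 0)) \<in> borel_measurable (Pi\<^sub>M {..<m} (\<lambda>_. borel))"
  proof (rule measurable_compose[OF _ F], rule measurable_PiM_single')
    fix i show "(\<lambda>z. if i < m then z i else 0) \<in> borel_measurable (Pi\<^sub>M {..<m} (\<lambda>_. borel :: real measure))"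
      by (cases "i < m") auto
  qed auto
  moreover have "F (\<lambda>i. if i < m then z i else 0) = F z" for z
    using lip[of "\<lambda>i. if i < m then z i else 0" z] by simp
  ultimately show ?thesis by simp
qed

section \<open>Finite-dimensional families of paths and upper integrals\<close>

lemma space_D0_space: "space D0_space = D0"
  by (auto simp: D0_space_def space_restrict_space space_PiM D0_def PiE_def)

lemma D0_space_component:
  assumes "0 \<le> q" shows "(\<lambda>x. x q) \<in> borel_measurable D0_space"
  unfolding D0_space_def
  by (rule measurable_restrict_space1) (use assms in simp)

text \<open>The common target of both approximations: only the coefficients are random, so laws on
  path space are compared through laws on a space of dimension \<open>m\<close>.\<close>

definition span_path :: "nat \<Rightarrow> (nat \<Rightarrow> real \<Rightarrow> real) \<Rightarrow> (nat \<Rightarrow> real) \<Rightarrow> real \<Rightarrow> real" where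
  "span_path m C z = (\<lambda>u\<in>{0..}. \<Sum>i<m. z i * C i u)"

lemma D0I:
  assumes cont: "continuous_on {0..} c" and const: "\<And>u. 1 \<le> u \<Longrightarrow> c u = c 1"
  shows "restrict c {0..} \<in> D0"
proof (rule restrict_in_D0[OF cadlag_continuous[OF cont]])
  have "\<forall>\<^sub>F u in at_top. c u = c 1"
    unfolding eventually_at_top_linorder using const by blast
  then show "(c \<longlongrightarrow> c 1) at_top" by (rule tendsto_eventually)
qed

lemma span_path_in_D0:
  assumes "\<And>i. i < m \<Longrightarrow> continuous_on {0..} (C i)"
    and "\<And>i u. i < m \<Longrightarrow> 1 \<le> u \<Longrightarrow> C i u = C i 1"
  shows "span_path m C z \<in> D0"
  unfolding span_path_def
proof (rule D0I)
  show "continuous_on {0..} (\<lambda>u. \<Sum>i<m. z i * C i u)"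
    by (intro continuous_on_sum continuous_on_mult_left assms(1)) simp
  fix u :: real assume "1 \<le> u"
  then have cu: "C i u = C i 1" if "i < m" for i by (rule assms(2)[OF that])
  then show "(\<Sum>i<m. z i * C i u) = (\<Sum>i<m. z i * C i 1)"
    by (intro sum.cong refl) (simp only: lessThan_iff cu)
qed

lemma \<rho>0_span_path_le:
  assumes "\<And>i u. i < m \<Longrightarrow> 0 \<le> u \<Longrightarrow> \<bar>C i u\<bar> \<le> 1"
  shows "\<rho>0 (span_path m C z) (span_path m C z') \<le> (\<Sum>i<m. \<bar>z i - z' i\<bar>)"
  unfolding \<rho>0_def
proof (rule cSUP_least)
  fix t :: real assume "t \<in> {0..}"
  then have "\<bar>span_path m C z t - span_path m C z' t\<bar> = \<bar>\<Sum>i<m. (z i - z' i) * C i t\<bar>"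
    by (simp add: span_path_def sum_subtractf left_diff_distrib)
  also have "\<dots> \<le> (\<Sum>i<m. \<bar>(z i - z' i) * C i t\<bar>)" by (rule sum_abs)
  also have "\<dots> \<le> (\<Sum>i<m. \<bar>z i - z' i\<bar>)"
  proof (rule sum_mono)
    fix i assume "i \<in> {..<m}"
    then have "\<bar>z i - z' i\<bar> * \<bar>C i t\<bar> \<le> \<bar>z i - z' i\<bar> * 1"
      using assms \<open>t \<in> {0..}\<close> by (intro mult_left_mono) auto
    then show "\<bar>(z i - z' i) * C i t\<bar> \<le> \<bar>z i - z' i\<bar>" by (simp add: abs_mult)
  qed
  finally show "\<bar>span_path m C z t - span_path m C z' t\<bar> \<le> (\<Sum>i<m. \<bar>z i - z' i\<bar>)" .
qed auto

text \<open>As the \<open>C i\<close> are bounded by 1, the parametrisation is 1-Lipschitz from the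
  l1 distance of coefficients to the uniform distance of paths.\<close>

lemma bounded_lipschitz_span_path:
  assumes f: "bounded_lipschitz D0 \<rho>0 f"
    and C: "\<And>i. i < m \<Longrightarrow> continuous_on {0..} (C i)"
      "\<And>i u. i < m \<Longrightarrow> 1 \<le> u \<Longrightarrow> C i u = C i 1"
      "\<And>i u. i < m \<Longrightarrow> 0 \<le> u \<Longrightarrow> \<bar>C i u\<bar> \<le> 1"
  shows "\<bar>f (span_path m C z) - f (span_path m C z')\<bar> \<le> (\<Sum>i<m. \<bar>z i - z' i\<bar>)"
    and "\<bar>f (span_path m C z)\<bar> \<le> 1"
proof -
  have D: "span_path m C z \<in> D0" for z by (rule span_path_in_D0) (rule C, assumption+)+
  show "\<bar>f (span_path m C z)\<bar> \<le> 1" using f D by (auto simp: bounded_lipschitz_def)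
  have "\<bar>f (span_path m C z) - f (span_path m C z')\<bar> \<le> \<rho>0 (span_path m C z) (span_path m C z')"
    using f D by (auto simp: bounded_lipschitz_def)
  also have "\<dots> \<le> (\<Sum>i<m. \<bar>z i - z' i\<bar>)" by (rule \<rho>0_span_path_le[OF C(3)])
  finally show "\<bar>f (span_path m C z) - f (span_path m C z')\<bar> \<le> (\<Sum>i<m. \<bar>z i - z' i\<bar>)" .
qed

text \<open>A value above \<open>r\<close> persists on a right neighbourhood, which contains a
  rational. So the uniform distance can be read off from countably many coordinates.\<close>

lemma rational_sup_bounds_cadlag:
  assumes x: "\<And>t. 0 \<le> t \<Longrightarrow> (x \<longlongrightarrow> x t) (at_right t)"
    and le: "\<And>q::rat. 0 \<le> q \<Longrightarrow> \<bar>x (of_rat q)\<bar> \<le> (r::real)" and t: "0 \<le> (t::real)"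
  shows "\<bar>x t\<bar> \<le> r"
proof (rule ccontr)
  assume "\<not> \<bar>x t\<bar> \<le> r"
  moreover have "((\<lambda>u. \<bar>x u\<bar>) \<longlongrightarrow> \<bar>x t\<bar>) (at_right t)" by (intro tendsto_intros x t)
  ultimately have "\<forall>\<^sub>F u in at_right t. r < \<bar>x u\<bar>" by (intro order_tendstoD) auto
  then obtain b where b: "t < b" "\<And>u. t < u \<Longrightarrow> u < b \<Longrightarrow> r < \<bar>x u\<bar>"
    unfolding eventually_at_right_field by blast
  obtain q :: rat where q: "t < of_rat q" "of_rat q < b" using of_rat_dense[OF b(1)] by blast
  then have "0 \<le> q" using t by (metis le_less_trans less_imp_le zero_less_of_rat_iff)
  then show False using le[of q] b(2)[OF q] by simp
qed

text \<open>The cover \<open>g\<close> of \<open>f\<close> is an infimum over the countably many paths with rational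
  coefficients, which makes it measurable for the coordinate maps although \<open>f\<close> need not be.\<close>

lemma upper_integral_process_law:
  fixes X :: "real \<Rightarrow> 'a \<Rightarrow> real" and \<zeta> :: "nat \<Rightarrow> 'a \<Rightarrow> real"
    and C :: "nat \<Rightarrow> real \<Rightarrow> real" and G :: "'a \<Rightarrow> ennreal"
  assumes M: "prob_space M"
    and X: "(\<lambda>\<omega>. \<lambda>u\<in>{0..}. X u \<omega>) \<in> M \<rightarrow>\<^sub>M D0_space"
    and f: "bounded_lipschitz D0 \<rho>0 f"
    and \<zeta>: "\<And>i. i < m \<Longrightarrow> \<zeta> i \<in> borel_measurable M"
    and C: "\<And>i. i < m \<Longrightarrow> continuous_on {0..} (C i)"
      "\<And>i u. i < m \<Longrightarrow> 1 \<le> u \<Longrightarrow> C i u = C i 1"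
      "\<And>i u. i < m \<Longrightarrow> 0 \<le> u \<Longrightarrow> \<bar>C i u\<bar> \<le> 1"
    and G: "G \<in> borel_measurable M"
      "\<And>\<omega>. \<omega> \<in> space M \<Longrightarrow> 2 \<le> G \<omega> \<or>
        (\<forall>u\<ge>0. ennreal \<bar>X u \<omega> - (\<Sum>i<m. \<zeta> i \<omega> * C i u)\<bar> \<le> G \<omega>)"
      "(\<integral>\<^sup>+\<omega>. G \<omega> \<partial>M) \<le> ennreal e" "0 \<le> e"
  shows "\<bar>upper_integral (process_law M X) f -
    (\<integral>\<omega>. f (span_path m C (\<lambda>i. \<zeta> i \<omega>)) \<partial>M)\<bar> \<le> e"
proof -
  interpret prob_space M by fact
  define Q where "Q = process_law M X"
  have span_D0: "span_path m C z \<in> D0" for z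
    by (rule span_path_in_D0) (rule C, assumption+)+
  define X' where "X' \<omega> = (\<lambda>u\<in>{0..}. X u \<omega>)" for \<omega>
  have X'[measurable]: "X' \<in> M \<rightarrow>\<^sub>M D0_space" using X by (simp add: X'_def[abs_def])
  have Q: "Q = distr M D0_space X'" by (simp add: Q_def process_law_def X'_def[abs_def])
  interpret Q: prob_space Q unfolding Q by (rule prob_space_distr) fact
  have spQ: "space Q = D0" by (simp add: Q space_D0_space)
  have X'D0: "X' \<omega> \<in> D0" if "\<omega> \<in> space M" for \<omega>
    using measurable_space[OF X' that] by (simp add: space_D0_space)
  define F where "F z = f (span_path m C z)" for z
  have Flip: "\<bar>F z - F z'\<bar> \<le> (\<Sum>i<m. \<bar>z i - z' i\<bar>)" for z z'
    unfolding F_def by (rule bounded_lipschitz_span_path(1)[OF f C])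
  have F1: "\<bar>F z\<bar> \<le> 1" for z
    unfolding F_def by (rule bounded_lipschitz_span_path(2)[OF f C])
  have Fm: "F \<in> borel_measurable (Pi\<^sub>M {..<m} (\<lambda>_. borel))"
    by (rule lipschitz_finite_coords_measurable) (rule Flip)
  have "(\<lambda>\<omega>. F (\<lambda>i\<in>{..<m}. \<zeta> i \<omega>)) \<in> borel_measurable M"
    by (rule measurable_compose[OF _ Fm]) (use \<zeta> in \<open>auto intro!: measurable_restrict\<close>)
  moreover have "F (\<lambda>i\<in>{..<m}. \<zeta> i \<omega>) = F (\<lambda>i. \<zeta> i \<omega>)" for \<omega>
    using Flip[of "\<lambda>i\<in>{..<m}. \<zeta> i \<omega>" "\<lambda>i. \<zeta> i \<omega>"] by simp
  ultimately have FM[measurable]: "(\<lambda>\<omega>. F (\<lambda>i. \<zeta> i \<omega>)) \<in> borel_measurable M" by simp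
  have FMi: "integrable M (\<lambda>\<omega>. F (\<lambda>i. \<zeta> i \<omega>))"
    by (rule integrable_const_bound[of _ 1]) (use F1 in auto)
  \<comment> \<open>Truncation at 2 loses nothing, since two values in [-1,1] differ by at most 2,
    and it makes \<open>r\<close> a bounded real function.\<close>
  define r where "r \<omega> = enn2real (min 2 (G \<omega>))" for \<omega>
  have [measurable]: "G \<in> borel_measurable M" by fact
  have r[measurable]: "r \<in> borel_measurable M" by (simp add: r_def[abs_def])
  have r0: "0 \<le> r \<omega>" for \<omega> by (simp add: r_def)
  have min_fin: "min 2 (G \<omega>) < \<top>" for \<omega> by (simp add: min_less_iff_disj)
  then have er: "ennreal (r \<omega>) = min 2 (G \<omega>)" for \<omega> by (simp add: r_def)
  have r2: "r \<omega> \<le> 2" for \<omega>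
    by (metis ennreal_le_iff ennreal_numeral er min.cobounded1 zero_le_numeral)
  have ri: "integrable M r"
    by (rule integrable_const_bound[of _ 2]) (use r0 r2 in auto)
  have "ennreal (\<integral>\<omega>. r \<omega> \<partial>M) = (\<integral>\<^sup>+\<omega>. ennreal (r \<omega>) \<partial>M)"
    by (rule nn_integral_eq_integral[symmetric, OF ri]) (use r0 in auto)
  also have "\<dots> \<le> (\<integral>\<^sup>+\<omega>. G \<omega> \<partial>M)" by (intro nn_integral_mono) (simp add: er)
  also have "\<dots> \<le> ennreal e" by fact
  finally have re: "(\<integral>\<omega>. r \<omega> \<partial>M) \<le> e" using G(4) by simp
  have near: "\<bar>X u \<omega> - (\<Sum>i<m. \<zeta> i \<omega> * C i u)\<bar> \<le> r \<omega>"
    if "\<omega> \<in> space M" "r \<omega> < 2" "0 \<le> u" for u \<omega>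
  proof -
    have "min 2 (G \<omega>) < 2" using that(2) by (metis ennreal_less_iff ennreal_numeral er r0)
    then have less: "G \<omega> < 2" by (simp add: min_less_iff_disj)
    then have "ennreal \<bar>X u \<omega> - (\<Sum>i<m. \<zeta> i \<omega> * C i u)\<bar> \<le> G \<omega>"
      using G(2)[OF that(1)] that(3) by auto
    moreover have "G \<omega> = ennreal (r \<omega>)" using less by (simp add: er min.absorb2 less_imp_le)
    ultimately show ?thesis using r0 by simp
  qed
  \<comment> \<open>A supremum over rational times is measurable for the coordinate maps; the cap 2
    keeps it finite for arbitrary \<open>x\<close>.\<close>
  define R where "R z x = (SUP q\<in>{q::rat. 0 \<le> q}. min 2 \<bar>x (of_rat q) - (\<Sum>i<m. z i * C i (of_rat q))\<bar>)"
    for z :: "nat \<Rightarrow> real" and x :: "real \<Rightarrow> real"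
  have Rbdd: "bdd_above ((\<lambda>q. min 2 \<bar>x (of_rat q) - (\<Sum>i<m. z i * C i (of_rat q))\<bar>) ` {q::rat. 0 \<le> q})"
    for z x by (intro bdd_aboveI[of _ 2]) auto
  have R0: "0 \<le> R z x" for z x
    unfolding R_def by (rule cSUP_upper2[OF Rbdd[of x z], of 0]) auto
  have Rm[measurable]: "R z \<in> borel_measurable D0_space" for z
  proof -
    have [measurable]: "(\<lambda>x. x (real_of_rat q)) \<in> borel_measurable D0_space" if "0 \<le> q" for q
      by (rule D0_space_component) (use that in simp)
    have "(\<lambda>x. SUP q\<in>{q::rat. 0 \<le> q}. min 2 \<bar>x (of_rat q) - (\<Sum>i<m. z i * C i (of_rat q))\<bar>)
        \<in> borel_measurable D0_space"
      using Rbdd[of _ z] by (intro borel_measurable_cSUP countable_subset[OF subset_UNIV countableI_type]) simp_all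
    then show ?thesis by (simp add: R_def[abs_def])
  qed
  have right_lim: "(x \<longlongrightarrow> x t) (at_right t)" if "x \<in> D0" "0 \<le> t" for x t
    using that by (simp add: D0_def cadlag_def)
  \<comment> \<open>Every choice of coefficients yields a majorant of \<open>f\<close>: by the
    Lipschitz property if \<open>R z x < 2\<close>, and otherwise because \<open>F z + 2\<close> is
    at least 1.\<close>
  have fF: "f x \<le> F z + R z x" if x: "x \<in> D0" for z x
  proof (cases "R z x < 2")
    case True
    have "\<rho>0 x (span_path m C z) \<le> R z x" unfolding \<rho>0_def
    proof (rule cSUP_least)
      fix t :: real assume t: "t \<in> {0..}"
      have "\<bar>(\<lambda>u. x u - span_path m C z u) t\<bar> \<le> R z x"
      proof (rule rational_sup_bounds_cadlag[where x="\<lambda>u. x u - span_path m C z u"])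
        show "((\<lambda>u. x u - span_path m C z u) \<longlongrightarrow> x t - span_path m C z t) (at_right t)" if "0 \<le> t" for t
          by (intro tendsto_diff right_lim x span_D0 that)
        fix q :: rat assume q: "0 \<le> q"
        have "min 2 \<bar>x (of_rat q) - (\<Sum>i<m. z i * C i (of_rat q))\<bar> \<le> R z x"
          unfolding R_def by (rule cSUP_upper[OF _ Rbdd[of x z]]) (use q in auto)
        then show "\<bar>x (of_rat q) - span_path m C z (of_rat q)\<bar> \<le> R z x"
          using True q by (simp add: span_path_def min_def split: if_splits)
      qed (use t in auto)
      then show "\<bar>x t - span_path m C z t\<bar> \<le> R z x" by simp
    qed auto
    moreover have "\<bar>f x - F z\<bar> \<le> \<rho>0 x (span_path m C z)"
      using f x span_D0[of z] unfolding bounded_lipschitz_def F_def by blast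
    ultimately show ?thesis by linarith
  next
    case False
    have "f x \<le> 1" using f x by (auto simp: bounded_lipschitz_def abs_le_iff)
    then show ?thesis using False F1[of z] by linarith
  qed
  \<comment> \<open>Lists of rationals are a countable index set of coefficient vectors. Positions
    beyond the end of a list have an unspecified value; this is harmless, because \<open>fF\<close>
    holds for all coefficients and lists of length \<open>m\<close> occur among them.\<close>
  define zl where "zl l i = real_of_rat (l ! i)" for l and i :: nat
  define g where "g x = min 1 (INF l. F (zl l) + R (zl l) x)" for x
  have gbdd: "bdd_below (range (\<lambda>l. F (zl l) + R (zl l) x))" for x
  proof (rule bdd_belowI2[of _ "-1"])
    fix l show "- 1 \<le> F (zl l) + R (zl l) x" using F1[of "zl l"] R0[of "zl l" x] by linarith
  qed
  have gm[measurable]: "g \<in> borel_measurable D0_space"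
    unfolding g_def[abs_def] by (intro borel_measurable_min borel_measurable_cINF) (use gbdd in auto)
  have gb: "\<bar>g x\<bar> \<le> 1" for x
  proof -
    have "-1 \<le> (INF l. F (zl l) + R (zl l) x)"
    proof (rule cINF_greatest)
      fix l show "-1 \<le> F (zl l) + R (zl l) x" using F1[of "zl l"] R0[of "zl l" x] by linarith
    qed auto
    then show ?thesis by (auto simp: g_def)
  qed
  have gi: "integrable Q g"
    by (rule Q.integrable_const_bound[of _ 1]) (use gb in \<open>auto simp: Q\<close>)
  have fg: "f x \<le> g x" if "x \<in> D0" for x
  proof -
    have "f x \<le> 1" using f that by (auto simp: bounded_lipschitz_def abs_le_iff)
    then show ?thesis unfolding g_def using fF[OF that] by (auto intro!: cINF_greatest)
  qed
  have gF: "g (X' \<omega>) \<le> F (\<lambda>i. \<zeta> i \<omega>) + r \<omega>" if \<omega>: "\<omega> \<in> space M" for \<omega>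
  proof (cases "r \<omega> < 2")
    case False
    then show ?thesis using gb[of "X' \<omega>"] F1[of "\<lambda>i. \<zeta> i \<omega>"] by linarith
  next
    case True
    show ?thesis
    proof (rule field_le_epsilon)
      fix \<epsilon> :: real assume \<epsilon>: "0 < \<epsilon>"
      \<comment> \<open>Passing to rational coefficients costs \<open>m * \<delta>\<close> in
        \<open>F\<close> and the same again in \<open>R\<close>, hence the factor 2.\<close>
      define \<delta> where "\<delta> = \<epsilon> / (2 * (real m + 1))"
      have \<delta>: "0 < \<delta>" "2 * (real m * \<delta>) \<le> \<epsilon>" using \<epsilon> by (auto simp: \<delta>_def field_simps)
      have "\<exists>q::rat. \<bar>of_rat q - \<zeta> i \<omega>\<bar> \<le> \<delta>" for i
      proof -
        obtain q :: rat where "\<zeta> i \<omega> < of_rat q" "of_rat q < \<zeta> i \<omega> + \<delta>"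
          using of_rat_dense[of "\<zeta> i \<omega>" "\<zeta> i \<omega> + \<delta>"] \<delta> by auto
        then show ?thesis by (intro exI[of _ q]) auto
      qed
      then obtain q where q: "\<And>i. \<bar>real_of_rat (q i) - \<zeta> i \<omega>\<bar> \<le> \<delta>" by metis
      define l where "l = map q [0..<m]"
      have zl: "\<bar>zl l i - \<zeta> i \<omega>\<bar> \<le> \<delta>" if "i < m" for i
        using q that by (simp add: zl_def l_def)
      have sum\<delta>: "(\<Sum>i<m. \<bar>zl l i - \<zeta> i \<omega>\<bar>) \<le> real m * \<delta>"
        using sum_mono[of "{..<m}" "\<lambda>i. \<bar>zl l i - \<zeta> i \<omega>\<bar>" "\<lambda>_. \<delta>"] zl by simp
      have "R (zl l) (X' \<omega>) \<le> r \<omega> + real m * \<delta>" unfolding R_def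
      proof (rule cSUP_least)
        fix q :: rat assume q: "q \<in> {q. 0 \<le> q}"
        define u where "u = real_of_rat q"
        have u: "0 \<le> u" using q by (simp add: u_def)
        have "\<bar>(\<Sum>i<m. \<zeta> i \<omega> * C i u) - (\<Sum>i<m. zl l i * C i u)\<bar> \<le> (\<Sum>i<m. \<bar>\<zeta> i \<omega> - zl l i\<bar>)"
          unfolding sum_subtractf[symmetric] left_diff_distrib[symmetric]
        proof (rule order_trans[OF sum_abs], rule sum_mono)
          fix i assume "i \<in> {..<m}"
          then have "\<bar>\<zeta> i \<omega> - zl l i\<bar> * \<bar>C i u\<bar> \<le> \<bar>\<zeta> i \<omega> - zl l i\<bar> * 1"
            using C(3) u by (intro mult_left_mono) auto
          then show "\<bar>(\<zeta> i \<omega> - zl l i) * C i u\<bar> \<le> \<bar>\<zeta> i \<omega> - zl l i\<bar>" by (simp add: abs_mult)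
        qed
        also have "\<dots> \<le> real m * \<delta>" using sum\<delta> by (simp add: abs_minus_commute)
        finally have "\<bar>X u \<omega> - (\<Sum>i<m. zl l i * C i u)\<bar> \<le> r \<omega> + real m * \<delta>"
          using near[OF \<omega> True u] by linarith
        then show "min 2 \<bar>X' \<omega> (real_of_rat q) - (\<Sum>i<m. zl l i * C i (real_of_rat q))\<bar> \<le> r \<omega> + real m * \<delta>"
          using u by (simp add: X'_def u_def)
      qed auto
      moreover have "F (zl l) \<le> F (\<lambda>i. \<zeta> i \<omega>) + real m * \<delta>"
        using Flip[of "zl l" "\<lambda>i. \<zeta> i \<omega>"] sum\<delta> by linarith
      moreover have "g (X' \<omega>) \<le> F (zl l) + R (zl l) (X' \<omega>)"
        unfolding g_def by (rule min.coboundedI2, rule cINF_lower[OF gbdd]) auto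
      ultimately show "g (X' \<omega>) \<le> F (\<lambda>i. \<zeta> i \<omega>) + r \<omega> + \<epsilon>" using \<delta> by linarith
    qed
  qed
  \<comment> \<open>Below, no measurable minorant is needed: the estimate holds pointwise for
    \<open>f\<close>, hence for every integrable majorant of \<open>f\<close>.\<close>
  have lowerF: "F (\<lambda>i. \<zeta> i \<omega>) - r \<omega> \<le> f (X' \<omega>)" if \<omega>: "\<omega> \<in> space M" for \<omega>
  proof (cases "r \<omega> < 2")
    case False
    have "- 1 \<le> f (X' \<omega>)" using f X'D0[OF \<omega>] by (auto simp: bounded_lipschitz_def abs_le_iff)
    then show ?thesis using False F1[of "\<lambda>i. \<zeta> i \<omega>"] by linarith
  next
    case True
    have "\<rho>0 (X' \<omega>) (span_path m C (\<lambda>i. \<zeta> i \<omega>)) \<le> r \<omega>" unfolding \<rho>0_def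
      by (rule cSUP_least) (use near[OF \<omega> True] in \<open>auto simp: X'_def span_path_def\<close>)
    moreover have "\<bar>f (X' \<omega>) - F (\<lambda>i. \<zeta> i \<omega>)\<bar> \<le> \<rho>0 (X' \<omega>) (span_path m C (\<lambda>i. \<zeta> i \<omega>))"
      using f X'D0[OF \<omega>] span_D0[of "\<lambda>i. \<zeta> i \<omega>"]
      unfolding bounded_lipschitz_def F_def by blast
    ultimately show ?thesis by linarith
  qed
  let ?I = "\<integral>\<omega>. F (\<lambda>i. \<zeta> i \<omega>) \<partial>M"
  have intQ: "integral\<^sup>L Q h = (\<integral>\<omega>. h (X' \<omega>) \<partial>M)" if "integrable Q h" for h :: "_ \<Rightarrow> real"
  proof -
    have "h \<in> borel_measurable D0_space" using that by (auto simp: Q)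
    then show ?thesis unfolding Q by (intro integral_distr) auto
  qed
  have intM: "integrable M (\<lambda>\<omega>. h (X' \<omega>))" if "integrable Q h" for h :: "_ \<Rightarrow> real"
    using integrable_distr[OF X'] that by (simp add: Q)
  have low: "?I - e \<le> integral\<^sup>L Q h" if h: "integrable Q h" "\<forall>x\<in>space Q. f x \<le> h x" for h
  proof -
    have "?I - e \<le> (\<integral>\<omega>. F (\<lambda>i. \<zeta> i \<omega>) - r \<omega> \<partial>M)" using re FMi ri by simp
    also have "\<dots> \<le> (\<integral>\<omega>. h (X' \<omega>) \<partial>M)"
    proof (rule integral_mono)
      fix \<omega> assume \<omega>: "\<omega> \<in> space M"
      have "f (X' \<omega>) \<le> h (X' \<omega>)" using h(2) X'D0[OF \<omega>] by (simp add: spQ)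
      then show "F (\<lambda>i. \<zeta> i \<omega>) - r \<omega> \<le> h (X' \<omega>)" using lowerF[OF \<omega>] by linarith
    qed (use FMi ri intM[OF h(1)] in auto)
    finally show ?thesis using intQ[OF h(1)] by simp
  qed
  have "upper_integral Q f \<le> integral\<^sup>L Q g"
    unfolding upper_integral_def
    by (rule cINF_lower) (use low fg gi in \<open>auto simp: spQ intro!: bdd_belowI[of _ "?I - e"]\<close>)
  also have "\<dots> = (\<integral>\<omega>. g (X' \<omega>) \<partial>M)" by (rule intQ[OF gi])
  also have "\<dots> \<le> (\<integral>\<omega>. F (\<lambda>i. \<zeta> i \<omega>) + r \<omega> \<partial>M)"
    by (rule integral_mono) (use FMi ri intM[OF gi] gF in auto)
  also have "\<dots> \<le> ?I + e" using re FMi ri by simp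
  finally have "upper_integral Q f \<le> ?I + e" .
  moreover have "?I - e \<le> upper_integral Q f"
    unfolding upper_integral_def by (rule cINF_greatest) (use low fg gi in \<open>auto simp: spQ\<close>)
  ultimately show ?thesis by (auto simp: Q_def F_def abs_le_iff)
qed

section \<open>Increasing paths and the counting of occupied gaps\<close>

lemma left_limit_tendsto:
  assumes "cadlag x" "0 < t" shows "(x \<longlongrightarrow> left_limit x t) (at_left t)"
proof -
  obtain l where l: "(x \<longlongrightarrow> l) (at_left t)" using assms by (auto simp: cadlag_def)
  then have "Lim (at_left t) x = l" by (intro tendsto_Lim) auto
  with l assms show ?thesis by (simp add: left_limit_def)
qed

locale increasing_path =
  fixes x :: "real \<Rightarrow> real"
  assumes cadlag: "cadlag x" and mono: "mono_on {0..} x" and zero: "x 0 = 0"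
begin

lemma monoD: "0 \<le> s \<Longrightarrow> s \<le> t \<Longrightarrow> x s \<le> x t"
  using mono by (auto simp: mono_on_def)

lemma nonneg: "0 \<le> t \<Longrightarrow> 0 \<le> x t"
  using monoD[of 0 t] zero by simp

lemma le_left_limit: assumes "0 \<le> s" "s < t" shows "x s \<le> left_limit x t"
proof (rule tendsto_lowerbound[OF left_limit_tendsto[OF cadlag]])
  show "\<forall>\<^sub>F u in at_left t. x s \<le> x u"
    using assms monoD[of s] by (auto simp: eventually_at_left_field intro!: exI[of _ s])
qed (use assms in auto)

lemma left_limit_le:
  assumes "0 < t" "\<And>s. 0 \<le> s \<Longrightarrow> s < t \<Longrightarrow> x s \<le> a" shows "left_limit x t \<le> a"
proof (rule tendsto_upperbound[OF left_limit_tendsto[OF cadlag]])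
  show "\<forall>\<^sub>F u in at_left t. x u \<le> a"
    using assms by (auto simp: eventually_at_left_field intro!: exI[of _ 0])
qed (use assms in auto)

lemma left_limit_nonneg: "0 \<le> t \<Longrightarrow> 0 \<le> left_limit x t"
  using le_left_limit[of 0 t] zero by (cases "t = 0") (auto simp: left_limit_def)

lemma gap_unique:
  assumes "0 \<le> t" "0 \<le> t'" "left_limit x t < a" "a < x t" "left_limit x t' < a" "a < x t'"
  shows "t = t'"
  using assms le_left_limit[of t t'] le_left_limit[of t' t] by (cases t t' rule: linorder_cases) auto

text \<open>The witness is the infimum of the times at which the level is reached. Right continuity
  puts it into that set, and it is positive because the path starts at 0.\<close>

lemma first_passage:
  assumes "0 < a" "a \<le> x T" "0 \<le> T"
  obtains t where "0 < t" "t \<le> T" "a \<le> x t" "\<And>s. 0 \<le> s \<Longrightarrow> s < t \<Longrightarrow> x s < a"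
proof -
  define B where "B = {t. 0 \<le> t \<and> t \<le> T \<and> a \<le> x t}"
  define t where "t = Inf B"
  have TB: "T \<in> B" using assms by (simp add: B_def)
  have bdd: "bdd_below B" by (auto simp: B_def intro!: bdd_belowI[of _ 0])
  have t0: "0 \<le> t" unfolding t_def using TB by (intro cInf_greatest) (auto simp: B_def)
  have tT: "t \<le> T" unfolding t_def by (rule cInf_lower[OF TB bdd])
  have before: "x s < a" if "0 \<le> s" "s < t" for s
  proof (rule ccontr)
    assume "\<not> x s < a"
    then have "s \<in> B" using that tT by (simp add: B_def)
    then show False using cInf_lower[OF _ bdd, of s] that by (simp add: t_def)
  qed
  have at: "a \<le> x t"
  proof (rule ccontr)
    assume "\<not> a \<le> x t"
    moreover have "(x \<longlongrightarrow> x t) (at_right t)" using cadlag t0 by (simp add: cadlag_def)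
    ultimately have "\<forall>\<^sub>F u in at_right t. x u < a" by (intro order_tendstoD) auto
    then obtain b where b: "t < b" "\<And>u. t < u \<Longrightarrow> u < b \<Longrightarrow> x u < a"
      unfolding eventually_at_right_field by blast
    obtain u where u: "u \<in> B" "u < b" using cInf_lessD[of B b] TB b(1) by (auto simp: t_def)
    have "t \<le> u" unfolding t_def by (rule cInf_lower[OF u(1) bdd])
    then show False using b(2)[of u] u \<open>\<not> a \<le> x t\<close> by (cases "t = u") (auto simp: B_def)
  qed
  have "t \<noteq> 0" using at assms(1) zero by auto
  then have "0 < t" using t0 by simp
  then show thesis by (rule that[OF _ tT at before])
qed

section \<open>Occupied gaps of an increasing path\<close>

definition occupied_times :: "real set \<Rightarrow> real set" where
  "occupied_times A = {t. 0 \<le> t \<and> A \<inter> {left_limit x t <..< x t} \<noteq> {}}"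

text \<open>Different jumps are disjoint, so choosing one point of \<open>A\<close> in each of them
  is injective.\<close>

lemma finite_occupied_times: assumes "finite A" shows "finite (occupied_times A)"
proof -
  define f where "f t = (SOME a. a \<in> A \<and> left_limit x t < a \<and> a < x t)" for t
  have f: "f t \<in> A \<and> left_limit x t < f t \<and> f t < x t" if "t \<in> occupied_times A" for t
    unfolding f_def by (rule someI_ex) (use that in \<open>auto simp: occupied_times_def\<close>)
  have "inj_on f (occupied_times A)"
  proof (rule inj_onI)
    fix t t' assume *: "t \<in> occupied_times A" "t' \<in> occupied_times A" "f t = f t'"
    then show "t = t'" using f[of t] f[of t'] gap_unique[of t t' "f t"] by (auto simp: occupied_times_def)
  qed
  moreover have "f ` occupied_times A \<subseteq> A" using f by blast
  ultimately show ?thesis using assms by (rule inj_on_finite)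
qed

lemma occupied_gaps_eq: "occupied_gaps x A T = card (occupied_times A \<inter> {..T})"
  unfolding occupied_gaps_def occupied_times_def by (intro arg_cong[where f=card]) auto

lemma occupied_gaps_sum:
  assumes "finite A"
  shows "real (occupied_gaps x A T) = (\<Sum>e\<in>occupied_times A. of_bool (e \<le> T))"
proof -
  have "(\<Sum>e\<in>occupied_times A. of_bool (e \<le> T) :: real) = (\<Sum>e\<in>occupied_times A \<inter> {..T}. 1)"
    using finite_occupied_times[OF assms] by (intro sum.mono_neutral_cong_right) auto
  then show ?thesis by (simp add: occupied_gaps_eq)
qed

lemma occupied_gaps_mono: "finite A \<Longrightarrow> s \<le> t \<Longrightarrow> occupied_gaps x A s \<le> occupied_gaps x A t"
  unfolding occupied_gaps_eq by (intro card_mono finite_Int disjI1 finite_occupied_times Int_mono) auto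

text \<open>Gaps after time \<open>s\<close> lie above \<open>x s\<close>. This freezes the count
  once the path has passed all points.\<close>

lemma occupied_gaps_const:
  assumes "A \<inter> {x s <..} = {}" "0 \<le> s" "s \<le> t"
  shows "occupied_gaps x A t = occupied_gaps x A s"
proof -
  have "occupied_times A \<inter> {..t} = occupied_times A \<inter> {..s}"
  proof safe
    fix u assume u: "u \<in> occupied_times A" "u \<le> t"
    then obtain a where a: "a \<in> A" "left_limit x u < a" by (auto simp: occupied_times_def)
    then have "a \<le> x s" using assms by force
    then show "u \<le> s" using le_left_limit[of s u] a(2) assms(2) by (meson leD le_less_trans not_le)
  qed (use assms in auto)
  then show ?thesis by (simp add: occupied_gaps_eq)
qed

text \<open>Says that a single jump up to time \<open>T\<close> bridges the interval from
  \<open>r\<close> to \<open>s\<close>, but in terms of \<open>T\<close> and rational times only,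
  which keeps it a measurable property of the path.\<close>

definition inside_gap :: "real \<Rightarrow> real \<Rightarrow> real \<Rightarrow> bool" where
  "inside_gap T r s \<longleftrightarrow> 0 \<le> r \<and> r < s \<and> s \<le> x T \<and>
    (\<forall>q::rat. 0 \<le> q \<longrightarrow> real_of_rat q \<le> T \<longrightarrow> x (of_rat q) \<le> r \<or> s \<le> x (of_rat q))"

text \<open>The jump is the first passage over \<open>s\<close>: at rational times before it the
  path is below \<open>s\<close>, hence at most \<open>r\<close>, and monotonicity fills in the
  other times.\<close>

lemma inside_gapD:
  assumes "inside_gap T r s" "0 \<le> T"
  obtains t where "0 < t" "t \<le> T" "left_limit x t \<le> r" "s \<le> x t"
proof -
  have rs: "0 \<le> r" "r < s" "s \<le> x T" using assms by (auto simp: inside_gap_def)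
  then have "0 < s" by linarith
  then obtain t where t: "0 < t" "t \<le> T" "s \<le> x t" "\<And>u. 0 \<le> u \<Longrightarrow> u < t \<Longrightarrow> x u < s"
    by (rule first_passage[OF _ rs(3) assms(2)]) blast
  have "left_limit x t \<le> r"
  proof (rule left_limit_le[OF t(1)])
    fix u assume u: "0 \<le> u" "u < t"
    obtain q :: rat where q: "u < of_rat q" "of_rat q < t" using of_rat_dense[OF u(2)] by blast
    have "0 < real_of_rat q" using u(1) q(1) by linarith
    then have q0: "0 \<le> q" by simp
    have "x (of_rat q) < s" using q u q0 by (intro t(4)) auto
    moreover have "x (of_rat q) \<le> r \<or> s \<le> x (of_rat q)"
      using assms(1) q0 q(2) t(2) by (auto simp: inside_gap_def)
    ultimately show "x u \<le> r" using monoD[of u "of_rat q"] u q by auto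
  qed
  then show thesis using that t by blast
qed

lemma inside_gapI:
  assumes "0 \<le> t" "t \<le> T" "left_limit x t \<le> r" "r < s" "s \<le> x t"
  shows "inside_gap T r s"
  unfolding inside_gap_def
proof (intro conjI allI impI)
  show "0 \<le> r" using left_limit_nonneg[OF assms(1)] assms(3) by simp
  show "s \<le> x T" using monoD[of t T] assms by simp
  fix q :: rat assume q: "0 \<le> q" "real_of_rat q \<le> T"
  show "x (of_rat q) \<le> r \<or> s \<le> x (of_rat q)"
  proof (cases "real_of_rat q < t")
    case True
    then show ?thesis using le_left_limit[of "of_rat q" t] q assms by auto
  next
    case False
    then show ?thesis using monoD[of t "of_rat q"] assms by auto
  qed
qed (rule assms(4))

text \<open>This is the source of measurability of the count: everything is expressed by countable
  operations on rational times and rational intervals. Each interval lies inside a jump and contains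
  a point, and the separating times \<open>q\<close> certify that the jumps are different.\<close>

lemma le_occupied_gaps_iff:
  assumes A: "finite A" and T: "0 \<le> T"
  shows "k \<le> occupied_gaps x A T \<longleftrightarrow> (\<exists>l::(rat \<times> rat) list.
      (\<forall>i<k. inside_gap T (of_rat (fst (l ! i))) (of_rat (snd (l ! i))) \<and>
        A \<inter> {of_rat (fst (l ! i)) <..< of_rat (snd (l ! i))} \<noteq> {}) \<and>
      (\<forall>j<k. \<forall>i<j. \<exists>q::rat. 0 \<le> q \<and> real_of_rat q \<le> T \<and>
        real_of_rat (snd (l ! i)) \<le> x (of_rat q) \<and> x (of_rat q) \<le> of_rat (fst (l ! j))))"
    (is "_ \<longleftrightarrow> (\<exists>l. ?P l)")
proof
  assume k: "k \<le> occupied_gaps x A T"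
  define J where "J = occupied_times A \<inter> {..T}"
  have J: "finite J" "k \<le> card J" using k finite_occupied_times[OF A] by (auto simp: J_def occupied_gaps_eq)
  define t where "t i = sorted_list_of_set J ! i" for i
  have tJ: "t i \<in> J" if "i < k" for i
    using J that nth_mem[of i "sorted_list_of_set J"] by (auto simp: t_def)
  have tless: "t i < t j" if "i < j" "j < k" for i j
    using J that strict_sorted_list_of_set[of J] by (auto simp: t_def sorted_wrt_iff_nth_less)
  have "\<exists>p::rat \<times> rat \<times> real. snd (snd p) \<in> A \<and> left_limit x (t i) < of_rat (fst p) \<and>
      of_rat (fst p) < snd (snd p) \<and> snd (snd p) < of_rat (fst (snd p)) \<and> of_rat (fst (snd p)) < x (t i)"
    if i: "i < k" for i
  proof -
    obtain a where a: "a \<in> A" "left_limit x (t i) < a" "a < x (t i)"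
      using tJ[OF i] by (auto simp: J_def occupied_times_def)
    obtain r :: rat where "left_limit x (t i) < of_rat r" "of_rat r < a" using of_rat_dense[OF a(2)] by blast
    moreover obtain s :: rat where "a < of_rat s" "of_rat s < x (t i)" using of_rat_dense[OF a(3)] by blast
    ultimately show ?thesis using a(1) by (intro exI[of _ "(r, s, a)"]) simp
  qed
  then obtain p :: "nat \<Rightarrow> rat \<times> rat \<times> real" where p: "\<And>i. i < k \<Longrightarrow> snd (snd (p i)) \<in> A \<and>
      left_limit x (t i) < of_rat (fst (p i)) \<and> of_rat (fst (p i)) < snd (snd (p i)) \<and>
      snd (snd (p i)) < of_rat (fst (snd (p i))) \<and> of_rat (fst (snd (p i))) < x (t i)"
    by metis
  define r where "r i = fst (p i)" for i
  define s where "s i = fst (snd (p i))" for i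
  define a where "a i = snd (snd (p i))" for i
  have rs: "a i \<in> A \<and> left_limit x (t i) < of_rat (r i) \<and>
    of_rat (r i) < a i \<and> a i < of_rat (s i) \<and> of_rat (s i) < x (t i)" if "i < k" for i
    using p[OF that] by (simp add: r_def s_def a_def)
  define l where "l = map (\<lambda>i. (r i, s i)) [0..<k]"
  have l: "fst (l ! i) = r i" "snd (l ! i) = s i" if "i < k" for i using that by (auto simp: l_def)
  have "?P l"
  proof (intro conjI allI impI)
    fix i assume i: "i < k"
    show "inside_gap T (of_rat (fst (l ! i))) (of_rat (snd (l ! i)))"
      using rs[OF i] tJ[OF i] by (intro inside_gapI[of "t i"]) (auto simp: l[OF i] J_def occupied_times_def)
    show "A \<inter> {of_rat (fst (l ! i))<..<of_rat (snd (l ! i))} \<noteq> {}"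
      using rs[OF i] by (auto simp: l[OF i])
  next
    fix j i assume ij: "j < k" "i < j"
    then have i: "i < k" by simp
    obtain q :: rat where q: "t i < of_rat q" "of_rat q < t j" using of_rat_dense[OF tless[OF ij(2,1)]] by blast
    have t0: "0 \<le> t i" "t j \<le> T" using tJ[OF i] tJ[OF ij(1)] by (auto simp: J_def occupied_times_def)
    have "0 < real_of_rat q" using t0(1) q(1) by linarith
    then have "0 \<le> q" by simp
    moreover have "real_of_rat (s i) \<le> x (of_rat q)"
      using rs[OF i] monoD[of "t i" "of_rat q"] q t0 by auto
    moreover have "x (of_rat q) \<le> of_rat (r j)"
      using rs[OF ij(1)] le_left_limit[of "of_rat q" "t j"] q \<open>0 \<le> q\<close> by auto
    ultimately show "\<exists>q::rat. 0 \<le> q \<and> real_of_rat q \<le> T \<and>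
        real_of_rat (snd (l ! i)) \<le> x (of_rat q) \<and> x (of_rat q) \<le> of_rat (fst (l ! j))"
      using q t0 by (intro exI[of _ q]) (auto simp: l[OF i] l[OF ij(1)])
  qed
  then show "\<exists>l. ?P l" by blast
next
  assume "\<exists>l. ?P l"
  then obtain l :: "(rat \<times> rat) list" where l: "?P l" by blast
  define r where "r i = real_of_rat (fst (l ! i))" for i
  define s where "s i = real_of_rat (snd (l ! i))" for i
  have ins: "inside_gap T (r i) (s i)" "A \<inter> {r i <..< s i} \<noteq> {}" if "i < k" for i
    using l that by (auto simp: r_def s_def)
  have "\<exists>t. 0 < t \<and> t \<le> T \<and> left_limit x t \<le> r i \<and> s i \<le> x t" if "i < k" for i
    by (rule inside_gapD[OF ins(1)[OF that] T]) blast
  then obtain t where t: "\<And>i. i < k \<Longrightarrow> 0 < t i \<and> t i \<le> T \<and> left_limit x (t i) \<le> r i \<and> s i \<le> x (t i)"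
    by metis
  have rs: "r i < s i" if "i < k" for i using ins(1)[OF that] by (simp add: inside_gap_def)
  \<comment> \<open>The separating time \<open>q\<close> lies strictly before \<open>t j\<close>. If
    \<open>t i\<close> were not earlier than \<open>t j\<close>, then \<open>q\<close> would precede
    \<open>t i\<close> as well, and the level at \<open>q\<close> would be at most the left limit at
    \<open>t i\<close>, hence below \<open>s i\<close>.\<close>
  have less: "t i < t j" if ij: "i < j" "j < k" for i j
  proof (rule ccontr)
    assume "\<not> t i < t j"
    have i: "i < k" using ij by simp
    have "\<exists>q::rat. 0 \<le> q \<and> real_of_rat q \<le> T \<and> s i \<le> x (of_rat q) \<and> x (of_rat q) \<le> r j"
      using conjunct2[OF l] ij unfolding r_def s_def by blast
    then obtain q :: rat where q: "0 \<le> q" "s i \<le> x (of_rat q)" "x (of_rat q) \<le> r j" by blast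
    have "of_rat q < t j"
    proof (rule ccontr)
      assume "\<not> of_rat q < t j"
      then have "x (t j) \<le> x (of_rat q)" using t[OF ij(2)] by (intro monoD) auto
      then show False using t[OF ij(2)] rs[OF ij(2)] q by linarith
    qed
    then have "of_rat q < t i" using \<open>\<not> t i < t j\<close> by simp
    then have "x (of_rat q) \<le> left_limit x (t i)" using q by (intro le_left_limit) auto
    then show False using t[OF i] rs[OF i] q by linarith
  qed
  have inj: "inj_on t {..<k}"
      proof (rule linorder_inj_onI)
    fix i j assume "i < j" "i \<in> {..<k}" "j \<in> {..<k}"
    then show "t i \<noteq> t j" using less[of i j] by simp
  qed auto
  have "t ` {..<k} \<subseteq> occupied_times A \<inter> {..T}"
  proof (rule image_subsetI, rule IntI)
    fix i assume "i \<in> {..<k}"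
    then have i: "i < k" by simp
    show "t i \<in> {..T}" using t[OF i] by simp
    obtain a where a: "a \<in> A" "r i < a" "a < s i" using ins(2)[OF i] by auto
    have "a \<in> {left_limit x (t i) <..< x (t i)}" using a t[OF i] by simp
    then show "t i \<in> occupied_times A" using t[OF i] a(1) by (auto simp: occupied_times_def)
  qed
  then have "card (t ` {..<k}) \<le> card (occupied_times A \<inter> {..T})"
    by (intro card_mono) (use finite_occupied_times[OF A] in auto)
  then show "k \<le> occupied_gaps x A T" using card_image[OF inj] by (simp add: occupied_gaps_eq)
qed

definition cell_hit :: "real set \<Rightarrow> real \<Rightarrow> nat \<Rightarrow> bool" where
  "cell_hit A \<delta> i \<longleftrightarrow> A \<inter> {x (real i * \<delta>) <..< x (real (Suc i) * \<delta>)} \<noteq> {}"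

text \<open>A point in the closed range of the path, outside all open jumps, could be seen by a cell
  although it belongs to no gap. Such points are excluded here up to the level reached at
  \<open>T\<close>.\<close>

definition all_in_gaps :: "real set \<Rightarrow> real \<Rightarrow> bool" where
  "all_in_gaps A T \<longleftrightarrow> (\<forall>a\<in>A. a \<le> x T \<longrightarrow> (\<exists>t. 0 < t \<and> t \<le> T \<and> left_limit x t < a \<and> a < x t))"

lemma cell_exists:
  assumes "0 < \<delta>" "0 < t"
  obtains i :: nat where "real i * \<delta> < t" "t \<le> real (Suc i) * \<delta>"
proof -
  define i where "i = nat (\<lceil>t / \<delta>\<rceil> - 1)"
  have pos: "0 < t / \<delta>" using assms by simp
  then have "1 \<le> \<lceil>t / \<delta>\<rceil>" by linarith
  then have i: "real i = of_int \<lceil>t / \<delta>\<rceil> - 1" by (simp add: i_def)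
  have "real i < t / \<delta>" "t / \<delta> \<le> real (Suc i)" using i by linarith+
  then show thesis using that[of i] assms by (auto simp: field_simps)
qed

text \<open>Below the least distance of two occupied times, sending an occupied time to its cell is
  injective; the hypothesis \<open>good\<close> makes this map onto the hit cells.\<close>

lemma cell_hits_eq_occupied_gaps:
  assumes A: "finite A" and good: "all_in_gaps A T"
  shows "\<exists>\<delta>0>0. \<forall>\<delta> j. 0 < \<delta> \<longrightarrow> \<delta> < \<delta>0 \<longrightarrow> real j * \<delta> \<le> T \<longrightarrow>
    card {i. i < j \<and> cell_hit A \<delta> i} = occupied_gaps x A (real j * \<delta>)"
proof -
  define J where "J = occupied_times A"
  have finJ: "finite J" using finite_occupied_times[OF A] by (simp add: J_def)
  define D where "D = (\<lambda>(s, t). \<bar>s - t\<bar>) ` {(s, t). s \<in> J \<and> t \<in> J \<and> s \<noteq> t}"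
  have finD: "finite D" unfolding D_def
    by (intro finite_imageI finite_subset[OF _ finite_cartesian_product[OF finJ finJ]]) auto
  have posD: "\<forall>d\<in>D. 0 < d" by (auto simp: D_def)
  \<comment> \<open>The 1 guards the minimum against an empty set of distances.\<close>
  define \<delta>0 where "\<delta>0 = Min (insert 1 D)"
  have \<delta>0: "0 < \<delta>0" using finD posD by (auto simp: \<delta>0_def)
  have sep: "\<delta>0 \<le> \<bar>s - t\<bar>" if "s \<in> J" "t \<in> J" "s \<noteq> t" for s t
    unfolding \<delta>0_def using that finD by (intro Min_le) (auto simp: D_def intro!: image_eqI[of _ _ "(s, t)"])
  show ?thesis
  proof (intro exI[of _ \<delta>0] conjI allI impI \<delta>0)
    fix \<delta> :: real and j :: nat
    assume \<delta>: "0 < \<delta>" "\<delta> < \<delta>0" and j: "real j * \<delta> \<le> T"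
    define c where "c t = (SOME i. real i * \<delta> < t \<and> t \<le> real (Suc i) * \<delta>)" for t
    have c: "real (c t) * \<delta> < t \<and> t \<le> real (Suc (c t)) * \<delta>" if "0 < t" for t
      unfolding c_def by (rule someI_ex, rule cell_exists[OF \<delta>(1) that]) blast
    have c_eq: "c t = i" if "real i * \<delta> < t" "t \<le> real (Suc i) * \<delta>" for t i
    proof -
      have "0 < t" using that \<delta> by (meson le_less_trans mult_nonneg_nonneg of_nat_0_le_iff less_imp_le)
      from c[OF this] that have "real i * \<delta> < real (Suc (c t)) * \<delta>" "real (c t) * \<delta> < real (Suc i) * \<delta>"
        by linarith+
      then have "real i < real (Suc (c t))" "real (c t) < real (Suc i)" using \<delta> by simp_all
      then show ?thesis by linarith
    qed
    have pos: "0 < t" if "t \<in> J" for t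
      using that by (cases "t = 0") (auto simp: J_def occupied_times_def left_limit_def)
    have "bij_betw c (J \<inter> {..real j * \<delta>}) {i. i < j \<and> cell_hit A \<delta> i}"
    proof (rule bij_betw_imageI)
      show "inj_on c (J \<inter> {..real j * \<delta>})"
      proof (rule inj_onI, rule ccontr)
        fix s t assume *: "s \<in> J \<inter> {..real j * \<delta>}" "t \<in> J \<inter> {..real j * \<delta>}" "c s = c t" "s \<noteq> t"
        have "\<bar>s - t\<bar> < \<delta>" using c[of s] c[of t] pos[of s] pos[of t] * by (auto simp: algebra_simps)
        then show False using sep[of s t] * \<delta> by auto
      qed
      show "c ` (J \<inter> {..real j * \<delta>}) = {i. i < j \<and> cell_hit A \<delta> i}"
      proof safe
        fix t assume t: "t \<in> J" "t \<le> real j * \<delta>"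
        note ct = c[OF pos[OF t(1)]]
        have "real (c t) * \<delta> < real j * \<delta>" using ct t by linarith
        then show "c t < j" using \<delta> by simp
        obtain a where a: "a \<in> A" "left_limit x t < a" "a < x t" using t by (auto simp: J_def occupied_times_def)
        have "x (real (c t) * \<delta>) \<le> left_limit x t" using ct \<delta> by (intro le_left_limit) auto
        moreover have "x t \<le> x (real (Suc (c t)) * \<delta>)" using ct pos[OF t(1)] by (intro monoD) auto
        ultimately show "cell_hit A \<delta> (c t)" using a by (auto simp: cell_hit_def)
      next
        fix i assume i: "i < j" "cell_hit A \<delta> i"
        then obtain a where a: "a \<in> A" "x (real i * \<delta>) < a" "a < x (real (Suc i) * \<delta>)"
          by (auto simp: cell_hit_def)
        have ij: "real (Suc i) * \<delta> \<le> real j * \<delta>" using i \<delta> by (intro mult_right_mono) auto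
        have "x (real (Suc i) * \<delta>) \<le> x T" proof (rule monoD)
          show "real (Suc i) * \<delta> \<le> T" using ij j by linarith
        qed (use \<delta> in simp)
        then obtain t where t: "0 < t" "left_limit x t < a" "a < x t"
          using good a by (auto simp: all_in_gaps_def)
        have "real i * \<delta> < t" using monoD[of t "real i * \<delta>"] t a by force
        moreover have "t \<le> real (Suc i) * \<delta>"
          using le_left_limit[of "real (Suc i) * \<delta>" t] t a \<delta> by force
        ultimately have "c t = i" "t \<le> real j * \<delta>" using c_eq ij by auto
        moreover have "t \<in> J" using t a by (auto simp: J_def occupied_times_def)
        ultimately show "i \<in> c ` (J \<inter> {..real j * \<delta>})" by auto
      qed
    qed
    then show "card {i. i < j \<and> cell_hit A \<delta> i} = occupied_gaps x A (real j * \<delta>)"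
      by (simp add: occupied_gaps_eq J_def bij_betw_same_card)
  qed
qed

text \<open>A point of \<open>A\<close> in the closed range of the path lies, for all fine partitions, close to
  an end point of its cell.\<close>

lemma not_all_in_gaps:
  assumes A: "A \<subseteq> {0<..}" and T: "0 < T" and bad: "\<not> all_in_gaps A T"
    and grid: "\<And>q i::nat. x (real i * (T / 2 ^ q)) \<notin> A" and \<eta>: "0 < \<eta>"
  shows "\<exists>q0. \<forall>q\<ge>q0. \<exists>i<2 ^ q. let l = x (real i * (T / 2 ^ q)); u = x (real (Suc i) * (T / 2 ^ q)) in
    A \<inter> {l <..< min (l + \<eta>) u} \<noteq> {} \<or> A \<inter> {max l (u - \<eta>) <..< u} \<noteq> {}"
proof -
  obtain a where a: "a \<in> A" "a \<le> x T" and no: "\<And>t. 0 < t \<Longrightarrow> t \<le> T \<Longrightarrow> \<not> (left_limit x t < a \<and> a < x t)"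
    using bad by (auto simp: all_in_gaps_def)
  have a0: "0 < a" using a A by auto
  obtain t where t: "0 < t" "t \<le> T" "a \<le> x t" "\<And>s. 0 \<le> s \<Longrightarrow> s < t \<Longrightarrow> x s < a"
    by (rule first_passage[OF a0 a(2) less_imp_le[OF T]]) blast
  have ll: "left_limit x t \<le> a" using t by (intro left_limit_le) (auto intro: less_imp_le)
  \<comment> \<open>A point in no open jump is the value or the left limit of the path at its first
    passage time. In the first case right continuity puts it within \<open>\<eta>\<close> below the
    value at the right end of its cell, in the second case it is within \<open>\<eta>\<close> above
    the value at the left end.\<close>
  have "x t = a \<or> left_limit x t = a" using no[OF t(1,2)] ll t(3) by linarith
  moreover have "\<exists>d>0. \<forall>u. t < u \<longrightarrow> u < t + d \<longrightarrow> x u < a + \<eta>" if "x t = a"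
  proof -
    have "(x \<longlongrightarrow> x t) (at_right t)" using cadlag t by (simp add: cadlag_def)
    then have "\<forall>\<^sub>F u in at_right t. x u < a + \<eta>" using that \<eta> by (intro order_tendstoD) auto
    then obtain b where "t < b" "\<forall>u>t. u < b \<longrightarrow> x u < a + \<eta>" unfolding eventually_at_right_field by blast
    then show ?thesis by (intro exI[of _ "b - t"]) auto
  qed
  moreover have "\<exists>d>0. \<forall>u. t - d < u \<longrightarrow> u < t \<longrightarrow> a - \<eta> < x u" if "left_limit x t = a"
  proof -
    have "\<forall>\<^sub>F u in at_left t. a - \<eta> < x u"
      using left_limit_tendsto[OF cadlag t(1)] that \<eta> by (intro order_tendstoD) auto
    then obtain b where "b < t" "\<forall>u>b. u < t \<longrightarrow> a - \<eta> < x u" unfolding eventually_at_left_field by blast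
    then show ?thesis by (intro exI[of _ "t - b"]) auto
  qed
  ultimately obtain d where d: "0 < d" "(x t = a \<and> (\<forall>u. t < u \<longrightarrow> u < t + d \<longrightarrow> x u < a + \<eta>)) \<or>
      (\<forall>u. t - d < u \<longrightarrow> u < t \<longrightarrow> a - \<eta> < x u)" by blast
  have "(\<lambda>q. T * (1 / 2) ^ q) \<longlonglongrightarrow> T * 0" by (intro tendsto_intros LIMSEQ_realpow_zero) auto
  then have "\<forall>\<^sub>F q in sequentially. T * (1 / 2) ^ q < d" using d by (intro order_tendstoD) auto
  then obtain q0 where q0: "\<And>q. q0 \<le> q \<Longrightarrow> T / 2 ^ q < d"
    by (auto simp: eventually_sequentially power_one_over field_simps)
  show ?thesis
  proof (rule exI[of _ q0], intro allI impI)
    fix q assume q: "q0 \<le> q"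
    define \<delta> where "\<delta> = T / 2 ^ q"
    have \<delta>: "0 < \<delta>" "\<delta> < d" using T q0[OF q] by (auto simp: \<delta>_def)
    obtain i :: nat where i: "real i * \<delta> < t" "t \<le> real (Suc i) * \<delta>" by (rule cell_exists[OF \<delta>(1) t(1)])
    have "real i * \<delta> < T" using i t by linarith
    then have iq: "i < 2 ^ q" using T by (auto simp: \<delta>_def field_simps)
    have lo: "x (real i * \<delta>) < a" using i \<delta> by (intro t(4)) auto
    have "a \<le> x (real (Suc i) * \<delta>)" using t(3) monoD[of t "real (Suc i) * \<delta>"] i t(1) by linarith
    \<comment> \<open>Hits are counted in open intervals, so equality must be excluded; this is what
      \<open>grid\<close> provides.\<close>
    then have hi: "a < x (real (Suc i) * \<delta>)" using grid[of "Suc i" q] a(1) unfolding \<delta>_def[symmetric] by (cases "a = x (real (Suc i) * \<delta>)") auto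
    have "a < x (real i * \<delta>) + \<eta> \<or> x (real (Suc i) * \<delta>) - \<eta> < a"
      using d(2)
    proof (elim disjE conjE)
      assume *: "x t = a" "\<forall>u. t < u \<longrightarrow> u < t + d \<longrightarrow> x u < a + \<eta>"
      have "real (Suc i) * \<delta> < t + d" using i \<delta> by (simp add: algebra_simps)
      then have "x (real (Suc i) * \<delta>) < a + \<eta>" using * i \<eta> by (cases "t = real (Suc i) * \<delta>") auto
      then show ?thesis by linarith
    next
      assume *: "\<forall>u. t - d < u \<longrightarrow> u < t \<longrightarrow> a - \<eta> < x u"
      have "t - d < real i * \<delta>" using i \<delta> by (simp add: algebra_simps)
      then have "a - \<eta> < x (real i * \<delta>)" using * i by auto
      then show ?thesis by linarith
    qed
    then have "A \<inter> {x (real i * \<delta>) <..< min (x (real i * \<delta>) + \<eta>) (x (real (Suc i) * \<delta>))} \<noteq> {} \<or>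
      A \<inter> {max (x (real i * \<delta>)) (x (real (Suc i) * \<delta>) - \<eta>) <..< x (real (Suc i) * \<delta>)} \<noteq> {}"
      using a(1) lo hi by auto
    then show "\<exists>i<2 ^ q. let l = x (real i * (T / 2 ^ q)); u = x (real (Suc i) * (T / 2 ^ q)) in
      A \<inter> {l <..< min (l + \<eta>) u} \<noteq> {} \<or> A \<inter> {max l (u - \<eta>) <..< u} \<noteq> {}"
      using iq unfolding \<delta>_def[symmetric] Let_def by blast
  qed
qed

end

section \<open>Elementary bounds for the exponential and for difference quotients\<close>

lemma abs_exp_minus_one_minus: "\<bar>exp u - 1 - u\<bar> \<le> u\<^sup>2" if "\<bar>u\<bar> \<le> 1" for u :: real
proof -
  have "1 + u \<le> exp u" by (rule exp_ge_add_one_self)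
  moreover have "exp u \<le> 1 + u + u\<^sup>2"
  proof (cases "0 \<le> u")
    case True then show ?thesis using exp_bound[of u] that by simp
  next
    case False
    then have "1 - u \<le> exp (- u)" "0 < 1 - u" using exp_ge_add_one_self[of "- u"] by auto
    then have "exp u \<le> 1 / (1 - u)" by (simp add: exp_minus field_simps)
    also have "\<dots> \<le> 1 + u + u\<^sup>2"
    proof -
      have "(1 + u + u\<^sup>2) * (1 - u) = 1 - u ^ 3" by (simp add: algebra_simps power2_eq_square power3_eq_cube)
      moreover have "u ^ 3 \<le> 0" using False by (simp add: power3_eq_cube mult_nonneg_nonpos mult_nonpos_nonpos)
      ultimately show ?thesis using \<open>0 < 1 - u\<close> by (simp add: divide_le_eq)
    qed
    finally show ?thesis .
  qed
  ultimately have "0 \<le> exp u - 1 - u" "exp u - 1 - u \<le> u\<^sup>2" by linarith+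
  then show ?thesis by simp
qed

text \<open>Takes the place of differentiation under the integral sign: a quadratic bound on the
  increment can simply be integrated.\<close>

lemma has_real_derivative_quadratic_error:
  fixes f :: "real \<Rightarrow> real"
  assumes "\<And>h. \<bar>h\<bar> \<le> 1 \<Longrightarrow> \<bar>f (r + h) - f r - h * D\<bar> \<le> C * h\<^sup>2"
  shows "(f has_real_derivative D) (at r)"
  unfolding DERIV_def
proof (rule LIM_zero_cancel, rule Lim_null_comparison)
  show "((\<lambda>h. C * \<bar>h\<bar>) \<longlongrightarrow> 0) (at (0::real))" by (auto intro!: tendsto_eq_intros)
  show "\<forall>\<^sub>F h in at 0. norm ((f (r + h) - f r) / h - D) \<le> C * \<bar>h\<bar>"
    unfolding eventually_at
  proof (intro exI[of _ 1] conjI ballI impI)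
    fix h :: real assume h: "h \<noteq> 0 \<and> dist h 0 < 1"
    have "\<bar>(f (r + h) - f r) / h - D\<bar> = \<bar>f (r + h) - f r - h * D\<bar> / \<bar>h\<bar>"
      using h by (simp add: abs_divide[symmetric] diff_divide_distrib)
    also have "\<dots> \<le> C * h\<^sup>2 / \<bar>h\<bar>"
      using assms[of h] h by (intro divide_right_mono) (auto simp: dist_real_def)
    also have "\<dots> = C * \<bar>h\<bar>" using h by (simp add: power2_eq_square field_simps abs_mult_self_eq)
    finally show "norm ((f (r + h) - f r) / h - D) \<le> C * \<bar>h\<bar>" by simp
  qed auto
qed

section \<open>Levy measures and their exponents\<close>

text \<open>Bernoulli's inequality for \<open>exp (- x) - 1\<close>. It bounds the integer Laplace
  exponents linearly and supplies the dominating function for their sublinearity.\<close>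

lemma one_minus_exp_mult_le: "1 - exp (- (real k * x)) \<le> real k * (1 - exp (- x))"
proof -
  have "1 + real k * (exp (- x) - 1) \<le> (1 + (exp (- x) - 1)) ^ k" by (rule Bernoulli_inequality) simp
  also have "\<dots> = exp (- (real k * x))" by (simp add: exp_of_nat_mult[symmetric])
  finally show ?thesis by (simp add: algebra_simps)
qed

lemma one_minus_exp_bounds: "0 < x \<Longrightarrow> 0 < 1 - exp (- x)" "1 - exp (- x) < 1" "1 - exp (- x) \<le> (x::real)"
  using exp_ge_add_one_self[of "- x"] by auto

locale levy_measure =
  fixes \<nu> :: "real measure"
  assumes levy: "subordinator_levy_measure \<nu>"
begin

lemma sets_nu [measurable_cong, simp]: "sets \<nu> = sets borel"
  using levy by (simp add: subordinator_levy_measure_def)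

lemma space_nu [simp]: "space \<nu> = UNIV"
  using sets_eq_imp_space_eq[OF sets_nu] by simp

lemma AE_pos: "AE x in \<nu>. 0 < x"
proof (rule AE_I)
  show "{x \<in> space \<nu>. \<not> 0 < x} \<subseteq> {..0}" by auto
  show "emeasure \<nu> {..0} = 0" using levy by (simp add: subordinator_levy_measure_def)
qed simp

lemma integrable_min: "integrable \<nu> (\<lambda>x. min 1 x)"
proof (rule integrableI_bounded)
  have "(\<integral>\<^sup>+x. ennreal (norm (min 1 x)) \<partial>\<nu>) = (\<integral>\<^sup>+x. ennreal (min 1 x) \<partial>\<nu>)"
    by (rule nn_integral_cong_AE) (use AE_pos in eventually_elim, simp)
  then show "(\<integral>\<^sup>+x. ennreal (norm (min 1 x)) \<partial>\<nu>) < \<infinity>"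
    using levy by (simp add: subordinator_levy_measure_def)
qed simp

lemma integrable_bounded_by_min:
  fixes f :: "real \<Rightarrow> real"
  assumes "f \<in> borel_measurable borel" "\<And>x. 0 < x \<Longrightarrow> \<bar>f x\<bar> \<le> C * min 1 x"
  shows "integrable \<nu> f"
proof (rule Bochner_Integration.integrable_bound)
  show "integrable \<nu> (\<lambda>x. C * min 1 x)" using integrable_min by simp
  show "AE x in \<nu>. norm (f x) \<le> norm (C * min 1 x)"
    using AE_pos
  proof eventually_elim
    fix x :: real assume "0 < x"
    from assms(2)[OF this] show "norm (f x) \<le> norm (C * min 1 x)" by simp
  qed
qed (use assms in simp)

definition laplace_exponent :: "real \<Rightarrow> real" where
  "laplace_exponent s = (\<integral>x. 1 - exp (- s * x) \<partial>\<nu>)"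

lemma min_one_bound: "0 < x \<Longrightarrow> 1 - exp (- x) \<le> min 1 (x::real)"
  using one_minus_exp_bounds[of x] by simp

lemma integrable_one_minus_exp_nat: "integrable \<nu> (\<lambda>x. 1 - exp (- (real k * x)))"
proof (rule integrable_bounded_by_min[where C="real k"])
  fix x :: real assume x: "0 < x"
  have "1 - exp (- (real k * x)) \<le> real k * (1 - exp (- x))" by (rule one_minus_exp_mult_le)
  also have "\<dots> \<le> real k * min 1 x" using min_one_bound[OF x] by (intro mult_left_mono) auto
  finally show "\<bar>1 - exp (- (real k * x))\<bar> \<le> real k * min 1 x" using x by simp
qed simp

lemma laplace_exponent_nat: "laplace_exponent (real k) = (\<integral>x. 1 - exp (- (real k * x)) \<partial>\<nu>)"
  by (simp add: laplace_exponent_def)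

lemma laplace_exponent_nat_nonneg: "0 \<le> laplace_exponent (real k)"
  unfolding laplace_exponent_nat
  by (rule integral_nonneg_AE) (use AE_pos in eventually_elim, simp)

lemma laplace_exponent_nat_le: "laplace_exponent (real k) \<le> real k * laplace_exponent 1"
proof -
  have "laplace_exponent (real k) \<le> (\<integral>x. real k * (1 - exp (- x)) \<partial>\<nu>)"
    unfolding laplace_exponent_nat using integrable_one_minus_exp_nat[of 1]
    by (intro integral_mono integrable_one_minus_exp_nat one_minus_exp_mult_le) auto
  then show ?thesis by (simp add: laplace_exponent_def)
qed

text \<open>This expresses that there is no drift.\<close>

lemma laplace_exponent_sublinear: "(\<lambda>k. laplace_exponent (real k) / real k) \<longlonglongrightarrow> 0"
proof -
  have "(\<lambda>k. \<integral>x. (1 - exp (- (real k * x))) / real k \<partial>\<nu>) \<longlonglongrightarrow> (\<integral>x. 0 \<partial>\<nu>)"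
  proof (rule integral_dominated_convergence[where w="\<lambda>x. 1 - exp (- x)"])
    show "integrable \<nu> (\<lambda>x. 1 - exp (- x))" using integrable_one_minus_exp_nat[of 1] by simp
    show "AE x in \<nu>. (\<lambda>k. (1 - exp (- (real k * x))) / real k) \<longlonglongrightarrow> 0"
      using AE_pos
    proof eventually_elim
      fix x :: real assume "0 < x"
      then show "(\<lambda>k. (1 - exp (- (real k * x))) / real k) \<longlonglongrightarrow> 0" by real_asymp
    qed
    show "AE x in \<nu>. norm ((1 - exp (- (real k * x))) / real k) \<le> 1 - exp (- x)" for k
      using AE_pos
    proof eventually_elim
      fix x :: real assume "0 < x"
      then show "norm ((1 - exp (- (real k * x))) / real k) \<le> 1 - exp (- x)"
        using one_minus_exp_mult_le[of k x] by (cases "k = 0") (auto simp: field_simps)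
    qed
  qed auto
  then show ?thesis by (simp add: laplace_exponent_nat)
qed

definition Phi_moment :: "nat \<Rightarrow> real \<Rightarrow> real" where
  "Phi_moment j r = (\<integral>x. (1 - exp (- x)) ^ j * exp (- r * (1 - exp (- x))) \<partial>\<nu>)"

lemma power_one_minus_exp_le: "0 < x \<Longrightarrow> 0 < j \<Longrightarrow> (1 - exp (- x)) ^ j \<le> min 1 (x::real)"
  using power_decreasing[of 1 j "1 - exp (- x)"] one_minus_exp_bounds[of x]
  by (intro order_trans[OF _ min_one_bound]) auto

lemma exp_one_minus_exp_le: "0 < x \<Longrightarrow> exp (- r * (1 - exp (- x))) \<le> exp \<bar>r\<bar>" for x r :: real
proof -
  assume "0 < x"
  then have "- r * (1 - exp (- x)) \<le> \<bar>r\<bar> * (1 - exp (- x))" "\<bar>r\<bar> * (1 - exp (- x)) \<le> \<bar>r\<bar> * 1"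
    using one_minus_exp_bounds[of x] by (intro mult_right_mono mult_left_mono; simp)+
  then show ?thesis by simp
qed

lemma integrable_Phi_moment:
  assumes "0 < j"
  shows "integrable \<nu> (\<lambda>x. (1 - exp (- x)) ^ j * exp (- r * (1 - exp (- x))))"
proof (rule integrable_bounded_by_min[where C="exp \<bar>r\<bar>"])
  fix x :: real assume x: "0 < x"
  have "(1 - exp (- x)) ^ j * exp (- r * (1 - exp (- x))) \<le> min 1 x * exp \<bar>r\<bar>"
    using x by (intro mult_mono power_one_minus_exp_le assms exp_one_minus_exp_le) auto
  then show "\<bar>(1 - exp (- x)) ^ j * exp (- r * (1 - exp (- x)))\<bar> \<le> exp \<bar>r\<bar> * min 1 x"
    using x by (simp add: mult.commute)
qed simp

lemma integrable_Phi: "integrable \<nu> (\<lambda>x. 1 - exp (- r * (1 - exp (- x))))"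
proof (rule integrable_bounded_by_min[where C="\<bar>r\<bar> * exp \<bar>r\<bar>"])
  fix x :: real assume x: "0 < x"
  let ?u = "r * (1 - exp (- x))"
  have "\<bar>?u\<bar> \<le> \<bar>r\<bar> * min 1 x"
    unfolding abs_mult using x min_one_bound[OF x] by (intro mult_left_mono) auto
  moreover have "\<bar>1 - exp (- ?u)\<bar> \<le> \<bar>?u\<bar> * exp \<bar>?u\<bar>"
  proof (cases "0 \<le> ?u")
    case True
    then have "1 - exp (- ?u) \<le> ?u" "0 \<le> 1 - exp (- ?u)" using exp_ge_add_one_self[of "- ?u"] by auto
    moreover have "?u * 1 \<le> ?u * exp \<bar>?u\<bar>" using True by (intro mult_left_mono) auto
    ultimately show ?thesis using True by linarith
  next
    case False
    have "exp (- ?u) * (1 + ?u) \<le> exp (- ?u) * exp ?u" by (intro mult_left_mono exp_ge_add_one_self) auto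
    also have "\<dots> = 1" by (simp add: exp_minus)
    finally have "exp (- ?u) - 1 \<le> - ?u * exp (- ?u)" by (simp add: algebra_simps)
    moreover have "1 \<le> exp (- ?u)" using False by simp
    ultimately show ?thesis using False by simp
  qed
  moreover have "\<bar>?u\<bar> \<le> \<bar>r\<bar>"
    using mult_left_mono[of "1 - exp (- x)" 1 "\<bar>r\<bar>"] x by (simp add: abs_mult)
  then have "\<bar>?u\<bar> * exp \<bar>?u\<bar> \<le> (\<bar>r\<bar> * min 1 x) * exp \<bar>r\<bar>"
    using calculation(1) x by (intro mult_mono) auto
  ultimately show "\<bar>1 - exp (- r * (1 - exp (- x)))\<bar> \<le> \<bar>r\<bar> * exp \<bar>r\<bar> * min 1 x"
    by (simp add: mult_ac)
qed simp

text \<open>A second-order Taylor remainder in \<open>h\<close>. Its factor \<open>y\<^sup>2\<close>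
  is at most \<open>min 1 x\<close> and hence integrable against the Levy measure.\<close>

lemma exp_increment_bound:
  fixes x r h :: real
  assumes "0 < x" "\<bar>h\<bar> \<le> 1" defines "y \<equiv> 1 - exp (- x)"
  shows "\<bar>exp (- (r + h) * y) - exp (- r * y) + h * (y * exp (- r * y))\<bar> \<le> exp \<bar>r\<bar> * (y\<^sup>2 * h\<^sup>2)"
proof -
  have y: "0 < y" "y < 1" using one_minus_exp_bounds(1)[OF assms(1)] one_minus_exp_bounds(2)[of x] by (auto simp: y_def)
  have "\<bar>- h * y\<bar> \<le> 1 * 1" unfolding abs_mult using assms y by (intro mult_mono) auto
  then have b: "\<bar>exp (- h * y) - 1 - (- h * y)\<bar> \<le> (- h * y)\<^sup>2" by (intro abs_exp_minus_one_minus) simp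
  have "exp (- (r + h) * y) - exp (- r * y) + h * (y * exp (- r * y)) =
      exp (- r * y) * (exp (- h * y) - 1 - (- h * y))"
    by (simp add: algebra_simps exp_add[symmetric])
  also have "\<bar>\<dots>\<bar> \<le> exp \<bar>r\<bar> * (- h * y)\<^sup>2"
    unfolding abs_mult using b exp_one_minus_exp_le[OF assms(1), of r] by (intro mult_mono) (auto simp: y_def)
  finally show ?thesis by (simp add: power_mult_distrib mult_ac)
qed

lemma DERIV_Phi_moment:
  assumes j: "0 < j"
  shows "(Phi_moment j has_real_derivative - Phi_moment (Suc j) r) (at r)"
proof (rule has_real_derivative_quadratic_error[where C="exp \<bar>r\<bar> * (\<integral>x. min 1 x \<partial>\<nu>)"])
  fix h :: real assume h: "\<bar>h\<bar> \<le> 1"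
  let ?y = "\<lambda>x::real. 1 - exp (- x)"
  let ?f = "\<lambda>x. ?y x ^ j * (exp (- (r + h) * ?y x) - exp (- r * ?y x) + h * (?y x * exp (- r * ?y x)))"
  have eq: "Phi_moment j (r + h) - Phi_moment j r - h * - Phi_moment (Suc j) r = (\<integral>x. ?f x \<partial>\<nu>)"
  proof -
    have "(\<integral>x. ?f x \<partial>\<nu>) = (\<integral>x. ?y x ^ j * exp (- (r + h) * ?y x) - ?y x ^ j * exp (- r * ?y x) +
        h * (?y x ^ Suc j * exp (- r * ?y x)) \<partial>\<nu>)"
      by (intro Bochner_Integration.integral_cong refl) (simp add: algebra_simps)
    then show ?thesis
      using integrable_Phi_moment[OF j, of r] integrable_Phi_moment[OF j, of "r + h"] integrable_Phi_moment[of "Suc j" r]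
      by (simp add: Phi_moment_def)
  qed
  have bound: "\<bar>?f x\<bar> \<le> exp \<bar>r\<bar> * h\<^sup>2 * min 1 x" if x: "0 < x" for x
  proof -
    have "\<bar>?f x\<bar> = ?y x ^ j * \<bar>exp (- (r + h) * ?y x) - exp (- r * ?y x) + h * (?y x * exp (- r * ?y x))\<bar>"
      using x by (simp add: abs_mult)
    also have "\<dots> \<le> ?y x ^ j * (exp \<bar>r\<bar> * (?y x ^ 2 * h\<^sup>2))"
      using x by (intro mult_left_mono exp_increment_bound h) auto
    also have "\<dots> = exp \<bar>r\<bar> * h\<^sup>2 * ?y x ^ (j + 2)" by (simp add: power_add power2_eq_square mult_ac)
    also have "\<dots> \<le> exp \<bar>r\<bar> * h\<^sup>2 * min 1 x" using x by (intro mult_left_mono power_one_minus_exp_le) auto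
    finally show ?thesis .
  qed
  have "norm (\<integral>x. ?f x \<partial>\<nu>) \<le> (\<integral>x. exp \<bar>r\<bar> * h\<^sup>2 * min 1 x \<partial>\<nu>)"
  proof (rule order_trans[OF integral_norm_bound], rule integral_mono_AE)
    show "integrable \<nu> (\<lambda>x. norm (?f x))"
      using bound by (intro integrable_norm integrable_bounded_by_min) auto
    show "AE x in \<nu>. norm (?f x) \<le> exp \<bar>r\<bar> * h\<^sup>2 * min 1 x"
      using AE_pos by eventually_elim (use bound in simp)
  qed (use integrable_min in simp)
  then show "\<bar>Phi_moment j (r + h) - Phi_moment j r - h * - Phi_moment (Suc j) r\<bar> \<le> exp \<bar>r\<bar> * (\<integral>x. min 1 x \<partial>\<nu>) * h\<^sup>2"
    unfolding eq by (simp add: mult_ac)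
qed

lemma DERIV_Phi: "(Phi \<nu> has_real_derivative Phi_moment 1 r) (at r)"
proof (rule has_real_derivative_quadratic_error[where C="exp \<bar>r\<bar> * (\<integral>x. min 1 x \<partial>\<nu>)"])
  fix h :: real assume h: "\<bar>h\<bar> \<le> 1"
  let ?y = "\<lambda>x::real. 1 - exp (- x)"
  let ?f = "\<lambda>x. exp (- (r + h) * ?y x) - exp (- r * ?y x) + h * (?y x * exp (- r * ?y x))"
  have eq: "Phi \<nu> (r + h) - Phi \<nu> r - h * Phi_moment 1 r = - (\<integral>x. ?f x \<partial>\<nu>)"
  proof -
    define A where "A x = 1 - exp (- (r + h) * ?y x)" for x
    define B where "B x = 1 - exp (- r * ?y x)" for x
    define C where "C x = ?y x ^ 1 * exp (- r * ?y x)" for x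
    have [simp]: "integrable \<nu> A" "integrable \<nu> B" "integrable \<nu> C"
      unfolding A_def B_def C_def by (intro integrable_Phi integrable_Phi_moment; simp)+
    have "(\<integral>x. ?f x \<partial>\<nu>) = (\<integral>x. B x - A x + h * C x \<partial>\<nu>)"
      by (intro Bochner_Integration.integral_cong refl) (simp add: A_def B_def C_def)
    also have "\<dots> = integral\<^sup>L \<nu> B - integral\<^sup>L \<nu> A + h * integral\<^sup>L \<nu> C" by simp
    finally have "(\<integral>x. ?f x \<partial>\<nu>) = integral\<^sup>L \<nu> B - integral\<^sup>L \<nu> A + h * integral\<^sup>L \<nu> C" .
    moreover have "Phi \<nu> (r + h) = integral\<^sup>L \<nu> A" unfolding Phi_def A_def ..
    moreover have "Phi \<nu> r = integral\<^sup>L \<nu> B" unfolding Phi_def B_def ..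
    moreover have "Phi_moment 1 r = integral\<^sup>L \<nu> C" unfolding Phi_moment_def C_def ..
    ultimately show ?thesis by simp
  qed
  have bound: "\<bar>?f x\<bar> \<le> exp \<bar>r\<bar> * h\<^sup>2 * min 1 x" if x: "0 < x" for x
  proof -
    have "\<bar>?f x\<bar> \<le> exp \<bar>r\<bar> * (?y x ^ 2 * h\<^sup>2)"
      using x by (intro exp_increment_bound h) auto
    also have "\<dots> = exp \<bar>r\<bar> * h\<^sup>2 * ?y x ^ 2" by (simp add: mult_ac)
    also have "\<dots> \<le> exp \<bar>r\<bar> * h\<^sup>2 * min 1 x" using x by (intro mult_left_mono power_one_minus_exp_le) auto
    finally show ?thesis .
  qed
  have "norm (\<integral>x. ?f x \<partial>\<nu>) \<le> (\<integral>x. exp \<bar>r\<bar> * h\<^sup>2 * min 1 x \<partial>\<nu>)"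
  proof (rule order_trans[OF integral_norm_bound], rule integral_mono_AE)
    show "integrable \<nu> (\<lambda>x. norm (?f x))"
      using bound by (intro integrable_norm integrable_bounded_by_min) auto
    show "AE x in \<nu>. norm (?f x) \<le> exp \<bar>r\<bar> * h\<^sup>2 * min 1 x"
      using AE_pos by eventually_elim (use bound in simp)
  qed (use integrable_min in simp)
  then show "\<bar>Phi \<nu> (r + h) - Phi \<nu> r - h * Phi_moment 1 r\<bar> \<le> exp \<bar>r\<bar> * (\<integral>x. min 1 x \<partial>\<nu>) * h\<^sup>2"
    unfolding eq by (simp add: mult_ac)
qed

lemma deriv_Phi: "deriv (Phi \<nu>) = Phi_moment 1"
  using DERIV_Phi by (auto intro!: ext DERIV_imp_deriv)

lemma Phi_moment_nonneg: "0 \<le> Phi_moment j r"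
  unfolding Phi_moment_def by (rule integral_nonneg_AE) (use AE_pos in eventually_elim, simp)

lemma Phi_zero: "Phi \<nu> 0 = 0" by (simp add: Phi_def)

lemma Phi_mono: assumes "r \<le> s" shows "Phi \<nu> r \<le> Phi \<nu> s"
  by (rule DERIV_nonneg_imp_nondecreasing[OF assms]) (use DERIV_Phi Phi_moment_nonneg in blast)

lemma Phi_nonneg: "0 \<le> r \<Longrightarrow> 0 \<le> Phi \<nu> r"
  using Phi_mono[of 0 r] Phi_zero by simp

lemma continuous_Phi: "continuous_on A (Phi \<nu>)"
  using DERIV_Phi by (meson DERIV_isCont continuous_at_imp_continuous_on)

lemma Phi_measurable [measurable]: "Phi \<nu> \<in> borel_measurable borel"
  by (rule borel_measurable_continuous_onI[OF continuous_Phi])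

lemma Phi_le: assumes "0 \<le> r" shows "Phi \<nu> r \<le> laplace_exponent 1 * r"
proof -
  have "Phi \<nu> r \<le> (\<integral>x. r * (1 - exp (- (real 1 * x))) \<partial>\<nu>)"
    unfolding Phi_def
  proof (rule integral_mono)
    show "integrable \<nu> (\<lambda>x. r * (1 - exp (- (real 1 * x))))"
      using integrable_one_minus_exp_nat[of 1] by simp
    fix x :: real
    show "1 - exp (- r * (1 - exp (- x))) \<le> r * (1 - exp (- (real 1 * x)))"
      using exp_ge_add_one_self[of "- r * (1 - exp (- x))"] by simp
  qed (rule integrable_Phi)
  then show ?thesis by (simp add: laplace_exponent_def mult.commute)
qed

text \<open>Both \<open>\<Phi>\<close> and its discrete approximation are Poisson mixtures of the Laplace exponent,
  because \<open>exp (- r (1 - exp (- x)))\<close> is the generating function of a Poisson variable at \<open>exp (- x)\<close>.\<close>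

definition poisson_weight :: "real \<Rightarrow> nat \<Rightarrow> real" where
  "poisson_weight r k = exp (- r) * r ^ k / fact k"

lemma poisson_weight_nonneg: "0 \<le> r \<Longrightarrow> 0 \<le> poisson_weight r k"
  by (simp add: poisson_weight_def)

lemma poisson_weight_sums: "poisson_weight r sums 1"
proof -
  have "(\<lambda>k. exp (- r) * (r ^ k /\<^sub>R fact k)) sums (exp (- r) * exp r)"
    by (intro sums_mult exp_converges)
  then show ?thesis by (simp add: poisson_weight_def[abs_def] exp_minus divide_inverse mult_ac)
qed

lemma poisson_weight_exp_sums:
  "(\<lambda>k. poisson_weight r k * (1 - exp (- (real k * x)))) sums (1 - exp (- r * (1 - exp (- x))))"
proof -
  have "(\<lambda>k. exp (- r) * ((r * exp (- x)) ^ k /\<^sub>R fact k)) sums (exp (- r) * exp (r * exp (- x)))"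
    by (intro sums_mult exp_converges)
  moreover have "exp (- r) * ((r * exp (- x)) ^ k /\<^sub>R fact k) = poisson_weight r k * exp (- (real k * x))" for k
    by (simp add: poisson_weight_def power_mult_distrib exp_of_nat_mult[symmetric] divide_inverse mult_ac)
  ultimately have "(\<lambda>k. poisson_weight r k * exp (- (real k * x))) sums (exp (- r * (1 - exp (- x))))"
    by (simp add: algebra_simps exp_add[symmetric])
  from sums_diff[OF poisson_weight_sums this] show ?thesis by (simp add: algebra_simps)
qed

text \<open>Crude but sufficient: \<open>k \<le> 2 ^ k\<close>, so the square of \<open>k\<close> is
  absorbed into \<open>r ^ k\<close> by a factor \<open>4 ^ k\<close>. The bound increases with
  \<open>r\<close> and is therefore uniform over all levels of the path.\<close>

lemma poisson_weight_times_bounds: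
  assumes "0 \<le> r"
  shows "summable (\<lambda>k. poisson_weight r k * real k)" "summable (\<lambda>k. poisson_weight r k * (real k)\<^sup>2)"
    and "(\<Sum>k. poisson_weight r k * (real k)\<^sup>2) \<le> exp (4 * r)"
proof -
  have le: "poisson_weight r k * (real k)\<^sup>2 \<le> (4 * r) ^ k / fact k" for k
  proof -
    have "real k \<le> 2 ^ k" by (simp add: of_nat_less_two_power less_imp_le)
    then have "(real k)\<^sup>2 \<le> (2 ^ k)\<^sup>2" by (intro power_mono) auto
    also have "\<dots> = (4::real) ^ k" by (simp add: power2_eq_square power_mult_distrib[symmetric])
    finally have "poisson_weight r k * (real k)\<^sup>2 \<le> poisson_weight r k * 4 ^ k"
      using poisson_weight_nonneg[OF assms] by (intro mult_left_mono) auto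
    also have "\<dots> = exp (- r) * ((4 * r) ^ k / fact k)" by (simp add: poisson_weight_def power_mult_distrib)
    also have "\<dots> \<le> 1 * ((4 * r) ^ k / fact k)" using assms by (intro mult_right_mono) auto
    finally show ?thesis by simp
  qed
  have s: "(\<lambda>k. (4 * r) ^ k / fact k) sums exp (4 * r)"
    using exp_converges[of "4 * r"] by (simp add: divide_inverse mult_ac)
  show s2: "summable (\<lambda>k. poisson_weight r k * (real k)\<^sup>2)"
    by (rule summable_comparison_test'[OF sums_summable[OF s], of 0])
       (use le poisson_weight_nonneg[OF assms] in simp)
  show "(\<Sum>k. poisson_weight r k * (real k)\<^sup>2) \<le> exp (4 * r)"
    using suminf_le[OF le s2 sums_summable[OF s]] sums_unique[OF s] by simp
  show "summable (\<lambda>k. poisson_weight r k * real k)"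
  proof (rule summable_comparison_test'[OF s2, of 0])
    fix k :: nat
    have "real k \<le> (real k)\<^sup>2" by (cases k) (auto simp: power2_eq_square)
    then show "norm (poisson_weight r k * real k) \<le> poisson_weight r k * (real k)\<^sup>2"
      using poisson_weight_nonneg[OF assms] by (simp add: mult_left_mono)
  qed
qed

lemma Phi_poisson_mixture:
  assumes "0 \<le> r"
  shows "(\<lambda>k. poisson_weight r k * laplace_exponent (real k)) sums Phi \<nu> r"
proof -
  have "(\<lambda>k. \<integral>x. poisson_weight r k * (1 - exp (- (real k * x))) \<partial>\<nu>) sums
      (\<integral>x. (\<Sum>k. poisson_weight r k * (1 - exp (- (real k * x)))) \<partial>\<nu>)"
  proof (rule sums_integral)
    show "integrable \<nu> (\<lambda>x. poisson_weight r k * (1 - exp (- (real k * x))))" for k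
      using integrable_one_minus_exp_nat[of k] by simp
    have nn: "norm (poisson_weight r k * (1 - exp (- (real k * x)))) = poisson_weight r k * (1 - exp (- (real k * x)))"
      if "0 < x" for k x using that poisson_weight_nonneg[OF assms] by simp
    show "AE x in \<nu>. summable (\<lambda>k. norm (poisson_weight r k * (1 - exp (- (real k * x)))))"
      using AE_pos by eventually_elim (use nn sums_summable[OF poisson_weight_exp_sums] in simp)
    have "(\<integral>x. norm (poisson_weight r k * (1 - exp (- (real k * x)))) \<partial>\<nu>) = poisson_weight r k * laplace_exponent (real k)" for k
    proof -
      have "(\<integral>x. norm (poisson_weight r k * (1 - exp (- (real k * x)))) \<partial>\<nu>) =
          (\<integral>x. poisson_weight r k * (1 - exp (- (real k * x))) \<partial>\<nu>)"
        by (rule integral_cong_AE) (use AE_pos nn in \<open>auto elim!: eventually_mono\<close>)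
      then show ?thesis by (simp add: laplace_exponent_nat)
    qed
    moreover have "summable (\<lambda>k. poisson_weight r k * laplace_exponent (real k))"
    proof (rule summable_comparison_test'[of "\<lambda>k. poisson_weight r k * real k * laplace_exponent 1" 0])
      show "summable (\<lambda>k. poisson_weight r k * real k * laplace_exponent 1)"
        by (intro summable_mult2 poisson_weight_times_bounds assms)
      fix k show "norm (poisson_weight r k * laplace_exponent (real k)) \<le> poisson_weight r k * real k * laplace_exponent 1"
        using mult_left_mono[OF laplace_exponent_nat_le poisson_weight_nonneg[OF assms]]
          poisson_weight_nonneg[OF assms] laplace_exponent_nat_nonneg
        by (simp add: mult_ac)
    qed
    ultimately show "summable (\<lambda>k. \<integral>x. norm (poisson_weight r k * (1 - exp (- (real k * x)))) \<partial>\<nu>)" by simp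
  qed
  then show ?thesis
    using sums_unique[OF poisson_weight_exp_sums[of r]] by (simp add: laplace_exponent_nat Phi_def)
qed

end

section \<open>Maximal inequality and exponential intensity\<close>

text \<open>Independence is stated through the product rule because \<open>indep_var\<close> requires
  variables of one type.\<close>

lemma (in prob_space) integral_independent_pair:
  fixes f :: "'b \<times> 'c \<Rightarrow> real"
  assumes A[measurable]: "A \<in> measurable M N1" and B[measurable]: "B \<in> measurable M N2"
    and ind: "\<And>X Y. X \<in> sets N1 \<Longrightarrow> Y \<in> sets N2 \<Longrightarrow>
      prob ((\<lambda>\<omega>. (A \<omega>, B \<omega>)) -` (X \<times> Y) \<inter> space M) = prob (A -` X \<inter> space M) * prob (B -` Y \<inter> space M)"
    and f[measurable]: "f \<in> borel_measurable (N1 \<Otimes>\<^sub>M N2)"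
    and bd: "\<And>z. z \<in> space (N1 \<Otimes>\<^sub>M N2) \<Longrightarrow> \<bar>f z\<bar> \<le> K"
  shows "(\<integral>\<omega>. f (A \<omega>, B \<omega>) \<partial>M) = (\<integral>\<omega>. (\<integral>\<omega>'. f (A \<omega>, B \<omega>') \<partial>M) \<partial>M)"
proof -
  interpret A: prob_space "distr M N1 A" by (rule prob_space_distr) simp
  interpret B: prob_space "distr M N2 B" by (rule prob_space_distr) simp
  interpret AB: pair_prob_space "distr M N1 A" "distr M N2 B" ..
  have eq: "distr M N1 A \<Otimes>\<^sub>M distr M N2 B = distr M (N1 \<Otimes>\<^sub>M N2) (\<lambda>\<omega>. (A \<omega>, B \<omega>))"
  proof (rule pair_measure_eqI)
    show "sigma_finite_measure (distr M N1 A)" "sigma_finite_measure (distr M N2 B)" ..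
    fix X Y assume "X \<in> sets (distr M N1 A)" "Y \<in> sets (distr M N2 B)"
    then have [measurable]: "X \<in> sets N1" "Y \<in> sets N2" by auto
    show "emeasure (distr M N1 A) X * emeasure (distr M N2 B) Y =
        emeasure (distr M (N1 \<Otimes>\<^sub>M N2) (\<lambda>\<omega>. (A \<omega>, B \<omega>))) (X \<times> Y)"
      using ind[of X Y] by (simp add: emeasure_distr emeasure_eq_measure ennreal_mult[symmetric])
  qed (auto intro!: sets_pair_measure_cong)
  have int: "integrable (distr M N1 A \<Otimes>\<^sub>M distr M N2 B) f"
    by (rule AB.P.integrable_const_bound[of _ K]) (use bd in \<open>auto simp: space_pair_measure intro!: AE_I2\<close>)
  have "(\<integral>\<omega>. f (A \<omega>, B \<omega>) \<partial>M) = (\<integral>z. f z \<partial>(distr M (N1 \<Otimes>\<^sub>M N2) (\<lambda>\<omega>. (A \<omega>, B \<omega>))))"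
    by (rule integral_distr[symmetric]) auto
  also have "\<dots> = (\<integral>z. f z \<partial>(distr M N1 A \<Otimes>\<^sub>M distr M N2 B))" by (simp only: eq)
  also have "\<dots> = (\<integral>x. \<integral>y. f (x, y) \<partial>distr M N2 B \<partial>distr M N1 A)"
    by (rule AB.integral_fst'[OF int, symmetric])
  also have "\<dots> = (\<integral>\<omega>. \<integral>y. f (A \<omega>, y) \<partial>distr M N2 B \<partial>M)"
    by (rule integral_distr) (auto intro!: B.borel_measurable_lebesgue_integral)
  also have "\<dots> = (\<integral>\<omega>. (\<integral>\<omega>'. f (A \<omega>, B \<omega>') \<partial>M) \<partial>M)"
  proof (intro Bochner_Integration.integral_cong refl integral_distr)
    fix \<omega> assume "\<omega> \<in> space M"
    then have "A \<omega> \<in> space N1" by (rule measurable_space[rotated]) simp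
    then show "(\<lambda>y. f (A \<omega>, y)) \<in> borel_measurable N2" by measurable
  qed simp
  finally show ?thesis .
qed

lemma (in prob_space) expectation_sq_le:
  fixes Y :: "'a \<Rightarrow> real"
  assumes [measurable]: "Y \<in> borel_measurable M" and "integrable M (\<lambda>\<omega>. (Y \<omega>)\<^sup>2)"
  shows "expectation Y \<le> sqrt (expectation (\<lambda>\<omega>. (Y \<omega>)\<^sup>2))"
proof -
  have i: "integrable M Y" by (rule square_integrable_imp_integrable) fact+
  have "0 \<le> variance Y" by (rule variance_positive)
  then have "(expectation Y)\<^sup>2 \<le> expectation (\<lambda>\<omega>. (Y \<omega>)\<^sup>2)" using variance_eq[OF i assms(2)] by simp
  then show ?thesis by (rule real_le_rsqrt)
qed

text \<open>The Rademacher--Menshov argument: pairing neighbouring terms halves the length and costs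
  one additional term \<open>sqrt (\<Sum>i. D\<^sub>i\<^sup>2)\<close>.\<close>

lemma (in prob_space) orthogonal_partial_sums_maximum:
  fixes D :: "nat \<Rightarrow> 'a \<Rightarrow> real"
  assumes "\<And>i. i < 2 ^ p \<Longrightarrow> D i \<in> borel_measurable M"
    and "\<And>i. i < 2 ^ p \<Longrightarrow> integrable M (\<lambda>\<omega>. (D i \<omega>)\<^sup>2)"
    and "\<And>i j. i < j \<Longrightarrow> j < 2 ^ p \<Longrightarrow> expectation (\<lambda>\<omega>. D i \<omega> * D j \<omega>) = 0"
  shows "\<exists>R. integrable M R \<and> (\<forall>\<omega>. \<forall>j\<le>2 ^ p. \<bar>\<Sum>i<j. D i \<omega>\<bar> \<le> R \<omega>) \<and>
    expectation R \<le> (real p + 1) * sqrt (\<Sum>i<2 ^ p. expectation (\<lambda>\<omega>. (D i \<omega>)\<^sup>2))"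
  using assms
proof (induction p arbitrary: D)
  case 0
  let ?R = "\<lambda>\<omega>. \<bar>D 0 \<omega>\<bar>"
  have m: "D 0 \<in> borel_measurable M" "integrable M (\<lambda>\<omega>. (D 0 \<omega>)\<^sup>2)" using 0(1,2)[of 0] by auto
  have "integrable M ?R" using square_integrable_imp_integrable[OF m] by simp
  moreover have "expectation ?R \<le> sqrt (expectation (\<lambda>\<omega>. (D 0 \<omega>)\<^sup>2))"
    using expectation_sq_le[of ?R] m by simp
  moreover have "\<bar>\<Sum>i<j. D i \<omega>\<bar> \<le> ?R \<omega>" if "j \<le> 1" for j \<omega>
    using that by (cases j) auto
  ultimately show ?case by (intro exI[of _ ?R]) simp
next
  case (Suc p)
  define D' where "D' i \<omega> = D (2 * i) \<omega> + D (2 * i + 1) \<omega>" for i \<omega>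
  have lt: "2 * i < 2 ^ Suc p" "2 * i + 1 < 2 ^ Suc p" if "i < 2 ^ p" for i :: nat
    using that by (auto simp: less_Suc_eq)
  have Dm[measurable]: "D i \<in> borel_measurable M" if "i < 2 ^ Suc p" for i using Suc.prems(1) that by blast
  have Dsq: "integrable M (\<lambda>\<omega>. (D i \<omega>)\<^sup>2)" if "i < 2 ^ Suc p" for i using Suc.prems(2) that by blast
  have prod: "integrable M (\<lambda>\<omega>. D i \<omega> * D j \<omega>)" if "i < 2 ^ Suc p" "j < 2 ^ Suc p" for i j
  proof (rule Bochner_Integration.integrable_bound[OF Bochner_Integration.integrable_add[OF Dsq[OF that(1)] Dsq[OF that(2)]]])
    show "(\<lambda>\<omega>. D i \<omega> * D j \<omega>) \<in> borel_measurable M" using that by measurable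
    have "\<bar>a * b\<bar> \<le> \<bar>a\<^sup>2 + b\<^sup>2\<bar>" for a b :: real
    proof -
      have "2 * \<bar>a * b\<bar> \<le> a\<^sup>2 + b\<^sup>2" using sum_squares_bound[of "\<bar>a\<bar>" "\<bar>b\<bar>"] by (simp add: abs_mult mult.assoc)
      then show ?thesis using abs_ge_zero[of "a * b"] abs_ge_self[of "a\<^sup>2 + b\<^sup>2"] by linarith
    qed
    then show "AE \<omega> in M. norm (D i \<omega> * D j \<omega>) \<le> norm ((D i \<omega>)\<^sup>2 + (D j \<omega>)\<^sup>2)" by simp
  qed
  have orth: "expectation (\<lambda>\<omega>. D i \<omega> * D j \<omega>) = 0" if "i \<noteq> j" "i < 2 ^ Suc p" "j < 2 ^ Suc p" for i j
    using Suc.prems(3)[of i j] Suc.prems(3)[of j i] that by (cases i j rule: linorder_cases) (auto simp: mult.commute)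
  have sq': "(D' i \<omega>)\<^sup>2 = (D (2 * i) \<omega>)\<^sup>2 + (D (2 * i + 1) \<omega>)\<^sup>2 + 2 * (D (2 * i) \<omega> * D (2 * i + 1) \<omega>)" for i \<omega>
    by (simp add: D'_def power2_eq_square algebra_simps)
  have "\<exists>R. integrable M R \<and> (\<forall>\<omega>. \<forall>j\<le>2 ^ p. \<bar>\<Sum>i<j. D' i \<omega>\<bar> \<le> R \<omega>) \<and>
    expectation R \<le> (real p + 1) * sqrt (\<Sum>i<2 ^ p. expectation (\<lambda>\<omega>. (D' i \<omega>)\<^sup>2))"
  proof (rule Suc.IH)
    fix i :: nat assume i: "i < 2 ^ p"
    show "D' i \<in> borel_measurable M" unfolding D'_def[abs_def] using lt[OF i] by measurable
    show "integrable M (\<lambda>\<omega>. (D' i \<omega>)\<^sup>2)" unfolding sq'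
      by (intro Bochner_Integration.integrable_add Dsq integrable_mult_right prod lt i)
  next
    fix i j :: nat assume ij: "i < j" "j < 2 ^ p"
    then have i: "i < 2 ^ p" by simp
    note [simp] = lt[OF i, simplified] lt[OF ij(2), simplified]
    have eq: "D' i \<omega> * D' j \<omega> = (D (2 * i) \<omega> * D (2 * j) \<omega> + D (2 * i) \<omega> * D (2 * j + 1) \<omega>) +
        (D (2 * i + 1) \<omega> * D (2 * j) \<omega> + D (2 * i + 1) \<omega> * D (2 * j + 1) \<omega>)" for \<omega>
      by (simp add: D'_def algebra_simps)
    show "expectation (\<lambda>\<omega>. D' i \<omega> * D' j \<omega>) = 0" unfolding eq
      by (subst Bochner_Integration.integral_add,
          intro Bochner_Integration.integrable_add prod lt i ij, intro Bochner_Integration.integrable_add prod lt i ij,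
          subst Bochner_Integration.integral_add, intro prod lt i ij, intro prod lt i ij,
          subst Bochner_Integration.integral_add, intro prod lt i ij, intro prod lt i ij)
         (use ij lt[OF i] lt[OF ij(2)] in \<open>simp add: orth\<close>)
  qed
  then obtain R where R: "integrable M R" "\<And>\<omega> j. j \<le> 2 ^ p \<Longrightarrow> \<bar>\<Sum>i<j. D' i \<omega>\<bar> \<le> R \<omega>"
    "expectation R \<le> (real p + 1) * sqrt (\<Sum>i<2 ^ p. expectation (\<lambda>\<omega>. (D' i \<omega>)\<^sup>2))" by blast
  define V where "V = (\<Sum>i<2 ^ Suc p. expectation (\<lambda>\<omega>. (D i \<omega>)\<^sup>2))"
  have sum_double: "(\<Sum>i<2 * N. g i) = (\<Sum>i<N. g (2 * i) + g (2 * i + 1))" for g :: "nat \<Rightarrow> real" and N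
    by (induction N) auto
  \<comment> \<open>Orthogonality within a pair preserves the total variance \<open>V\<close>, so
    every level of the recursion costs the same \<open>sqrt V\<close>.\<close>
  have "(\<Sum>i<2 ^ p. expectation (\<lambda>\<omega>. (D' i \<omega>)\<^sup>2)) =
      (\<Sum>i<2 ^ p. expectation (\<lambda>\<omega>. (D (2 * i) \<omega>)\<^sup>2) + expectation (\<lambda>\<omega>. (D (2 * i + 1) \<omega>)\<^sup>2))"
  proof (rule sum.cong[OF refl])
    fix i :: nat assume "i \<in> {..<2 ^ p}"
    then have i: "i < 2 ^ p" by simp
    show "expectation (\<lambda>\<omega>. (D' i \<omega>)\<^sup>2) = expectation (\<lambda>\<omega>. (D (2 * i) \<omega>)\<^sup>2) + expectation (\<lambda>\<omega>. (D (2 * i + 1) \<omega>)\<^sup>2)"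
      unfolding sq' using Dsq[OF lt(1)[OF i]] Dsq[OF lt(2)[OF i]] prod[OF lt[OF i]] orth[OF _ lt[OF i]] by simp
  qed
  also have "\<dots> = V" unfolding V_def power_Suc sum_double ..
  finally have V': "(\<Sum>i<2 ^ p. expectation (\<lambda>\<omega>. (D' i \<omega>)\<^sup>2)) = V" .
  define Q where "Q \<omega> = sqrt (\<Sum>i<2 ^ Suc p. (D i \<omega>)\<^sup>2)" for \<omega>
  have Qm[measurable]: "Q \<in> borel_measurable M" unfolding Q_def[abs_def] by measurable
  have Q2: "(Q \<omega>)\<^sup>2 = (\<Sum>i<2 ^ Suc p. (D i \<omega>)\<^sup>2)" for \<omega> unfolding Q_def by (simp add: sum_nonneg)
  have Q2i: "integrable M (\<lambda>\<omega>. (Q \<omega>)\<^sup>2)" unfolding Q2 by (intro Bochner_Integration.integrable_sum Dsq) simp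
  have EQ2: "expectation (\<lambda>\<omega>. (Q \<omega>)\<^sup>2) = V" unfolding Q2 V_def
    by (intro Bochner_Integration.integral_sum Dsq) simp
  have Qi: "integrable M Q" by (rule square_integrable_imp_integrable[OF Qm Q2i])
  have bound: "\<bar>\<Sum>i<j. D i \<omega>\<bar> \<le> R \<omega> + Q \<omega>" if j: "j \<le> 2 ^ Suc p" for j \<omega>
  proof -
    have half: "\<bar>\<Sum>i<2 * k. D i \<omega>\<bar> \<le> R \<omega>" if "k \<le> 2 ^ p" for k
      using R(2)[OF that, of \<omega>] by (simp only: sum_double D'_def)
    show ?thesis
    proof (cases "even j")
      case True
      then obtain k where k: "j = 2 * k" by (elim evenE)
      have "0 \<le> Q \<omega>" by (simp add: Q_def sum_nonneg)
      then show ?thesis using half[of k] j k by simp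
    next
      case False
      then obtain k where k: "j = 2 * k + 1" by (elim oddE)
      then have k2: "2 * k < 2 ^ Suc p" using j by simp
      \<comment> \<open>At an odd index one unpaired term is left over; the l2 norm \<open>Q\<close>
        of all terms bounds it whichever index it has.\<close>
      have "(D (2 * k) \<omega>)\<^sup>2 \<le> (\<Sum>i<2 ^ Suc p. (D i \<omega>)\<^sup>2)"
        by (rule member_le_sum) (use k2 in auto)
      then have "\<bar>D (2 * k) \<omega>\<bar> \<le> Q \<omega>" unfolding Q_def by (intro real_le_rsqrt) simp
      then show ?thesis using half[of k] k2 k by simp
    qed
  qed
  show ?case
  proof (intro exI[of _ "\<lambda>\<omega>. R \<omega> + Q \<omega>"] conjI allI impI bound)
    show "integrable M (\<lambda>\<omega>. R \<omega> + Q \<omega>)" using R Qi by simp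
    have "expectation (\<lambda>\<omega>. R \<omega> + Q \<omega>) = expectation R + expectation Q" using R Qi by simp
    also have "\<dots> \<le> (real p + 1) * sqrt V + sqrt V"
      using R(3) expectation_sq_le[OF Qm Q2i] by (simp add: V' EQ2)
    finally show "expectation (\<lambda>\<omega>. R \<omega> + Q \<omega>) \<le>
        (real (Suc p) + 1) * sqrt (\<Sum>i<2 ^ Suc p. expectation (\<lambda>\<omega>. (D i \<omega>)\<^sup>2))"
      by (simp add: V_def algebra_simps)
  qed
qed

section \<open>The exponential intensity\<close>

lemma space_exp_intensity: "space (exp_intensity n) = {0<..}"
  by (simp add: exp_intensity_def space_restrict_space)

lemma sets_exp_intensity: "A \<in> sets (exp_intensity n) \<longleftrightarrow> A \<in> sets borel \<and> A \<subseteq> {0<..}"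
  by (auto simp: exp_intensity_def sets_restrict_space_iff)

lemma emeasure_exp_intensity:
  assumes "A \<in> sets borel" "A \<subseteq> {0<..}"
  shows "emeasure (exp_intensity n) A = (\<integral>\<^sup>+x. ennreal (n * exp (- x)) * indicator A x \<partial>lborel)"
proof -
  have A: "A \<in> sets (restrict_space lborel {0<..})" using assms by (simp add: sets_restrict_space_iff)
  have "emeasure (exp_intensity n) A =
      (\<integral>\<^sup>+x. ennreal (n * exp (- x)) * indicator A x \<partial>restrict_space lborel {0<..})"
    unfolding exp_intensity_def by (rule emeasure_density[OF _ A]) (auto intro!: measurable_restrict_space1)
  also have "\<dots> = (\<integral>\<^sup>+x. ennreal (n * exp (- x)) * indicator A x * indicator {0<..} x \<partial>lborel)"
    by (rule nn_integral_restrict_space) simp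
  also have "\<dots> = (\<integral>\<^sup>+x. ennreal (n * exp (- x)) * indicator A x \<partial>lborel)"
    by (rule nn_integral_cong) (use assms(2) in \<open>auto simp: indicator_def\<close>)
  finally show ?thesis .
qed

lemma measure_exp_intensity_interval:
  assumes "0 \<le> a" "a \<le> b" "0 < n"
  shows "measure (exp_intensity n) {a<..<b} = n * (exp (- a) - exp (- b))"
proof -
  have "emeasure (exp_intensity n) {a<..<b} = (\<integral>\<^sup>+x. ennreal (n * exp (- x)) * indicator {a<..<b} x \<partial>lborel)"
    by (rule emeasure_exp_intensity) (use assms in auto)
  also have "\<dots> = (\<integral>\<^sup>+x. ennreal (n * exp (- x)) * indicator {a..b} x \<partial>lborel)"
    by (rule nn_integral_cong_AE)
       (use AE_lborel_singleton[of a] AE_lborel_singleton[of b] in eventually_elim, auto simp: indicator_def)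
  also have "\<dots> = ennreal (- n * exp (- b) - (- n * exp (- a)))"
    by (rule nn_integral_FTC_Icc) (use assms in \<open>auto intro!: derivative_eq_intros\<close>)
  finally show ?thesis using assms by (simp add: measure_def algebra_simps)
qed

lemma measure_exp_intensity_tail:
  assumes "0 \<le> a" "0 < n"
  shows "measure (exp_intensity n) {a<..} = n * exp (- a)"
proof -
  have "emeasure (exp_intensity n) {a<..} = (\<integral>\<^sup>+x. ennreal (n * exp (- x)) * indicator {a<..} x \<partial>lborel)"
    by (rule emeasure_exp_intensity) (use assms in auto)
  also have "\<dots> = (\<integral>\<^sup>+x. ennreal (n * exp (- x)) * indicator {a..} x \<partial>lborel)"
    by (rule nn_integral_cong_AE) (use AE_lborel_singleton[of a] in eventually_elim, auto simp: indicator_def)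
  also have "\<dots> = ennreal (0 - (- n * exp (- a)))"
  proof (rule nn_integral_FTC_atLeast)
    show "((\<lambda>x. - n * exp (- x)) \<longlongrightarrow> 0) at_top" by real_asymp
  qed (use assms in \<open>auto intro!: derivative_eq_intros\<close>)
  finally show ?thesis using assms by (simp add: measure_def)
qed

section \<open>Occupied gaps of a subordinator\<close>

locale occupancy = prob_space M + levy_measure \<nu>
  for M :: "'a measure" and \<nu> :: "real measure" +
  fixes S :: "real \<Rightarrow> 'a \<Rightarrow> real" and P :: "real \<Rightarrow> 'a \<Rightarrow> real set"
  assumes subordinator: "driftless_subordinator M S \<nu>"
    and poisson: "\<And>n. 0 < n \<Longrightarrow> finite_poisson_process M (exp_intensity n) (P n)"
    and independent: "\<And>n. 0 < n \<Longrightarrow> indep_process_points M S (exp_intensity n) (P n)"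
begin

lemma S_measurable [measurable]: "0 \<le> t \<Longrightarrow> S t \<in> borel_measurable M"
  using subordinator by (auto simp: driftless_subordinator_def levy_process_def)

lemma increasing_path_S: "\<omega> \<in> space M \<Longrightarrow> increasing_path (\<lambda>t. S t \<omega>)"
  using subordinator by (auto simp: driftless_subordinator_def levy_process_def increasing_path_def)

lemma S_zero: "\<omega> \<in> space M \<Longrightarrow> S 0 \<omega> = 0"
  using increasing_path.zero[OF increasing_path_S] by simp

lemma S_mono: "\<omega> \<in> space M \<Longrightarrow> 0 \<le> s \<Longrightarrow> s \<le> t \<Longrightarrow> S s \<omega> \<le> S t \<omega>"
  using increasing_path.monoD[OF increasing_path_S] by simp

lemma S_nonneg: "\<omega> \<in> space M \<Longrightarrow> 0 \<le> t \<Longrightarrow> 0 \<le> S t \<omega>"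
  using increasing_path.nonneg[OF increasing_path_S] by simp

lemma increments_indep:
  "0 \<le> t 0 \<Longrightarrow> (\<And>i. i < k \<Longrightarrow> t i \<le> t (Suc i)) \<Longrightarrow>
    indep_vars (\<lambda>_. borel) (\<lambda>i \<omega>. S (t (Suc i)) \<omega> - S (t i) \<omega>) {..<k}"
  using subordinator by (auto simp: driftless_subordinator_def levy_process_def independent_increments_def)

lemma increments_stationary:
  assumes "0 \<le> s" "s \<le> t"
  shows "distr M borel (\<lambda>\<omega>. S t \<omega> - S s \<omega>) = distr M borel (S (t - s))"
proof -
  have "\<forall>s\<ge>0. \<forall>t\<ge>0. distr M borel (\<lambda>\<omega>. S (s + t) \<omega> - S s \<omega>) = distr M borel (S t)"
    using subordinator unfolding driftless_subordinator_def levy_process_def stationary_increments_def by blast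
  from this[rule_format, of s "t - s"] show ?thesis using assms by simp
qed

lemma laplace_transform:
  "0 \<le> t \<Longrightarrow> 0 \<le> s \<Longrightarrow> expectation (\<lambda>\<omega>. exp (- (s * S t \<omega>))) = exp (- (t * laplace_exponent s))"
  using subordinator by (simp add: driftless_subordinator_def laplace_exponent_def)

lemma P_finite: "0 < n \<Longrightarrow> \<omega> \<in> space M \<Longrightarrow> finite (P n \<omega>)"
  and P_pos: "0 < n \<Longrightarrow> \<omega> \<in> space M \<Longrightarrow> P n \<omega> \<subseteq> {0<..}"
  using poisson[of n] by (auto simp: finite_poisson_process_def space_exp_intensity)

lemma count_measurable:
  "0 < n \<Longrightarrow> B \<in> sets (exp_intensity n) \<Longrightarrow> (\<lambda>\<omega>. card (P n \<omega> \<inter> B)) \<in> M \<rightarrow>\<^sub>M count_space UNIV"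
  using poisson[of n] by (auto simp: finite_poisson_process_def)

lemma card_P_eq_0_iff: "0 < n \<Longrightarrow> \<omega> \<in> space M \<Longrightarrow> card (P n \<omega> \<inter> B) = 0 \<longleftrightarrow> P n \<omega> \<inter> B = {}"
  using P_finite[of n \<omega>] by auto

lemma prob_hit:
  assumes "0 < n" "B \<in> sets (exp_intensity n)"
  shows "{\<omega> \<in> space M. P n \<omega> \<inter> B \<noteq> {}} \<in> events"
    and "prob {\<omega> \<in> space M. P n \<omega> \<inter> B \<noteq> {}} = 1 - exp (- measure (exp_intensity n) B)"
proof -
  have m[measurable]: "(\<lambda>\<omega>. card (P n \<omega> \<inter> B)) \<in> M \<rightarrow>\<^sub>M count_space UNIV" by (rule count_measurable[OF assms])
  have "prob {\<omega> \<in> space M. card (P n \<omega> \<inter> B) = 0} = exp (- measure (exp_intensity n) B)"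
    using poisson[OF assms(1)] assms(2) by (simp add: finite_poisson_process_def)
  moreover have "{\<omega> \<in> space M. P n \<omega> \<inter> B \<noteq> {}} = space M - {\<omega> \<in> space M. card (P n \<omega> \<inter> B) = 0}"
    using card_P_eq_0_iff[OF assms(1)] by blast
  moreover have "{\<omega> \<in> space M. card (P n \<omega> \<inter> B) = 0} \<in> events" by measurable
  ultimately show "{\<omega> \<in> space M. P n \<omega> \<inter> B \<noteq> {}} \<in> events"
    "prob {\<omega> \<in> space M. P n \<omega> \<inter> B \<noteq> {}} = 1 - exp (- measure (exp_intensity n) B)"
    by (auto simp: prob_compl)
qed

lemma prob_hit_both:
  assumes "0 < n" "B \<in> sets (exp_intensity n)" "B' \<in> sets (exp_intensity n)" "B \<inter> B' = {}"
  shows "prob {\<omega> \<in> space M. P n \<omega> \<inter> B \<noteq> {} \<and> P n \<omega> \<inter> B' \<noteq> {}} =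
    prob {\<omega> \<in> space M. P n \<omega> \<inter> B \<noteq> {}} * prob {\<omega> \<in> space M. P n \<omega> \<inter> B' \<noteq> {}}"
proof -
  define C :: "nat \<Rightarrow> real set" where "C i = (if i = 0 then B else if i = 1 then B' else {})" for i
  have "range C \<subseteq> sets (exp_intensity n)" using assms by (auto simp: C_def)
  moreover have "disjoint_family C" using assms(4) by (auto simp: C_def disjoint_family_on_def)
  ultimately have "indep_vars (\<lambda>_. count_space UNIV) (\<lambda>i \<omega>. card (P n \<omega> \<inter> C i)) UNIV"
    using poisson[OF assms(1)] by (simp add: finite_poisson_process_def)
  from indep_varsD[OF this, of "{0, 1}" "\<lambda>_. - {0}"]
  have "prob ((\<lambda>\<omega>. card (P n \<omega> \<inter> B)) -` (- {0}) \<inter> space M \<inter> ((\<lambda>\<omega>. card (P n \<omega> \<inter> B')) -` (- {0}) \<inter> space M)) =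
    prob ((\<lambda>\<omega>. card (P n \<omega> \<inter> B)) -` (- {0}) \<inter> space M) * prob ((\<lambda>\<omega>. card (P n \<omega> \<inter> B')) -` (- {0}) \<inter> space M)"
    by (simp add: C_def Int_assoc)
  moreover have "(\<lambda>\<omega>. card (P n \<omega> \<inter> A)) -` (- {0}) \<inter> space M = {\<omega> \<in> space M. P n \<omega> \<inter> A \<noteq> {}}" for A
    using card_P_eq_0_iff[OF assms(1)] by blast
  moreover have "{\<omega> \<in> space M. P n \<omega> \<inter> B \<noteq> {}} \<inter> {\<omega> \<in> space M. P n \<omega> \<inter> B' \<noteq> {}} =
      {\<omega> \<in> space M. P n \<omega> \<inter> B \<noteq> {} \<and> P n \<omega> \<inter> B' \<noteq> {}}" by blast
  ultimately show ?thesis by simp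
qed

section \<open>Path and configuration as independent random elements\<close>

definition paths :: "(real \<Rightarrow> real) measure" where "paths = PiM {0..} (\<lambda>_. borel)"

definition path :: "'a \<Rightarrow> real \<Rightarrow> real" where "path \<omega> = (\<lambda>t\<in>{0..}. S t \<omega>)"

definition configurations :: "real \<Rightarrow> (real set \<Rightarrow> nat) measure" where
  "configurations n = PiM (sets (exp_intensity n)) (\<lambda>_. count_space UNIV)"

definition configuration :: "real \<Rightarrow> 'a \<Rightarrow> real set \<Rightarrow> nat" where
  "configuration n \<omega> = (\<lambda>B\<in>sets (exp_intensity n). card (P n \<omega> \<inter> B))"

text \<open>Whether an interval contains a point, read off from the counts on rational intervals.\<close>

definition hits :: "(real set \<Rightarrow> nat) \<Rightarrow> real \<Rightarrow> real \<Rightarrow> bool" where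
  "hits c a b \<longleftrightarrow> (\<exists>r s::rat. 0 \<le> r \<and> a < of_rat r \<and> of_rat s < b \<and> c {of_rat r <..< of_rat s} \<noteq> 0)"

lemma path_measurable [measurable]: "path \<in> M \<rightarrow>\<^sub>M paths"
  unfolding path_def[abs_def] paths_def by (rule measurable_restrict) simp

lemma path_component [simp]: "0 \<le> t \<Longrightarrow> path \<omega> t = S t \<omega>" by (simp add: path_def)

lemma paths_component: "0 \<le> t \<Longrightarrow> (\<lambda>s. s t) \<in> borel_measurable paths"
  unfolding paths_def by (rule measurable_component_singleton) simp

lemma configuration_measurable [measurable]:
  "0 < n \<Longrightarrow> configuration n \<in> M \<rightarrow>\<^sub>M configurations n"
  unfolding configuration_def[abs_def] configurations_def
  by (rule measurable_restrict) (rule count_measurable)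

lemma rational_interval_sets: "0 \<le> (r::real) \<Longrightarrow> {r<..<s} \<in> sets (exp_intensity n)"
  by (auto simp: sets_exp_intensity)

lemma hits_configuration:
  assumes "0 < n" "\<omega> \<in> space M" "0 \<le> a"
  shows "hits (configuration n \<omega>) a b \<longleftrightarrow> P n \<omega> \<inter> {a<..<b} \<noteq> {}"
proof
  assume "hits (configuration n \<omega>) a b"
  then obtain r s :: rat where rs: "0 \<le> r" "a < of_rat r" "of_rat s < b"
      "configuration n \<omega> {real_of_rat r <..< of_rat s} \<noteq> 0" unfolding hits_def by blast
  then have "card (P n \<omega> \<inter> {real_of_rat r <..< of_rat s}) \<noteq> 0"
    by (simp add: configuration_def rational_interval_sets)
  then have "P n \<omega> \<inter> {real_of_rat r <..< of_rat s} \<noteq> {}" by (simp only: card_P_eq_0_iff[OF assms(1,2)] not_False_eq_True)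
  then show "P n \<omega> \<inter> {a<..<b} \<noteq> {}" using rs by auto
next
  assume "P n \<omega> \<inter> {a<..<b} \<noteq> {}"
  then obtain p where p: "p \<in> P n \<omega>" "a < p" "p < b" by auto
  obtain r :: rat where r: "a < of_rat r" "of_rat r < p" using of_rat_dense[OF p(2)] by blast
  obtain s :: rat where s: "p < of_rat s" "of_rat s < b" using of_rat_dense[OF p(3)] by blast
  have "0 < real_of_rat r" using r(1) assms(3) by linarith
  then have r0: "0 \<le> r" by simp
  have "P n \<omega> \<inter> {real_of_rat r <..< of_rat s} \<noteq> {}" using p r s by auto
  then have "card (P n \<omega> \<inter> {real_of_rat r <..< of_rat s}) \<noteq> 0" by (simp only: card_P_eq_0_iff[OF assms(1,2)] not_False_eq_True)
  then have "configuration n \<omega> {real_of_rat r <..< of_rat s} \<noteq> 0"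
    using r0 by (simp add: configuration_def rational_interval_sets)
  then show "hits (configuration n \<omega>) a b" using r s r0 unfolding hits_def
    by (intro exI[of _ r] exI[of _ s] conjI)
qed

lemma hits_measurable [measurable]:
  assumes [measurable]: "a \<in> borel_measurable paths" "b \<in> borel_measurable paths"
  shows "Measurable.pred (paths \<Otimes>\<^sub>M configurations n) (\<lambda>z. hits (snd z) (a (fst z)) (b (fst z)))"
proof -
  have [measurable]: "(\<lambda>z. snd z {real_of_rat r <..< of_rat s}) \<in>
      paths \<Otimes>\<^sub>M configurations n \<rightarrow>\<^sub>M count_space UNIV" if "0 \<le> r" for r s :: rat
    by (rule measurable_compose[OF measurable_snd], unfold configurations_def,
        rule measurable_component_singleton) (use that in \<open>simp add: rational_interval_sets\<close>)
  show ?thesis unfolding hits_def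
  proof (intro pred_intros_countable)
    fix r s :: rat
    \<comment> \<open>Only sets inside the positive half-line are coordinates of the product, hence
      the condition \<open>0 \<le> r\<close> in \<open>hits\<close>.\<close>
    show "Measurable.pred (paths \<Otimes>\<^sub>M configurations n) (\<lambda>z. 0 \<le> r \<and> a (fst z) < of_rat r \<and>
      of_rat s < b (fst z) \<and> snd z {real_of_rat r <..< of_rat s} \<noteq> 0)"
      by (cases "0 \<le> r") simp_all
  qed
qed

lemma integral_path_configuration:
  fixes f :: "(real \<Rightarrow> real) \<times> (real set \<Rightarrow> nat) \<Rightarrow> real"
  assumes n: "0 < n" and f: "f \<in> borel_measurable (paths \<Otimes>\<^sub>M configurations n)" and bd: "\<And>z. \<bar>f z\<bar> \<le> K"
  shows "(\<integral>\<omega>. f (path \<omega>, configuration n \<omega>) \<partial>M) = (\<integral>\<omega>. (\<integral>\<omega>'. f (path \<omega>, configuration n \<omega>') \<partial>M) \<partial>M)"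
proof (rule integral_independent_pair[where ?N1.0=paths and ?N2.0="configurations n"])
  fix X Y assume XY: "X \<in> sets paths" "Y \<in> sets (configurations n)"
  have "indep_set {path -` A \<inter> space M | A. A \<in> sets paths}
      {configuration n -` A \<inter> space M | A. A \<in> sets (configurations n)}"
    using independent[OF n]
    unfolding indep_process_points_def paths_def configurations_def path_def[abs_def] configuration_def[abs_def] .
  then have "prob ((path -` X \<inter> space M) \<inter> (configuration n -` Y \<inter> space M)) =
      prob (path -` X \<inter> space M) * prob (configuration n -` Y \<inter> space M)"
    by (rule indep_setD) (use XY in blast)+
  moreover have "(\<lambda>\<omega>. (path \<omega>, configuration n \<omega>)) -` (X \<times> Y) \<inter> space M =
      (path -` X \<inter> space M) \<inter> (configuration n -` Y \<inter> space M)" by auto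
  ultimately show "prob ((\<lambda>\<omega>. (path \<omega>, configuration n \<omega>)) -` (X \<times> Y) \<inter> space M) =
      prob (path -` X \<inter> space M) * prob (configuration n -` Y \<inter> space M)" by simp
qed (use n f bd in auto)

text \<open>In spite of the name this is the probability that the interval is hit, that is, one
  minus the void probability.\<close>

definition void :: "real \<Rightarrow> real \<Rightarrow> real \<Rightarrow> real" where
  "void n a b = 1 - exp (- n * (exp (- a) - exp (- b)))"

lemma prob_hit_interval:
  assumes "0 < n" "0 \<le> a" "a \<le> b"
  shows "(\<integral>\<omega>. (of_bool (P n \<omega> \<inter> {a<..<b} \<noteq> {}) :: real) \<partial>M) = void n a b"
proof -
  have B: "{a<..<b} \<in> sets (exp_intensity n)" using assms by (auto simp: sets_exp_intensity)
  have "(\<integral>\<omega>. (of_bool (P n \<omega> \<inter> {a<..<b} \<noteq> {}) :: real) \<partial>M) =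
      (\<integral>\<omega>. indicator {\<omega> \<in> space M. P n \<omega> \<inter> {a<..<b} \<noteq> {}} \<omega> \<partial>M)"
    by (intro Bochner_Integration.integral_cong refl) (auto simp: indicator_def)
  also have "\<dots> = prob {\<omega> \<in> space M. P n \<omega> \<inter> {a<..<b} \<noteq> {}}" using prob_hit(1)[OF assms(1) B] by simp
  also have "\<dots> = void n a b"
    using measure_exp_intensity_interval[OF assms(2,3,1)] by (simp add: prob_hit(2)[OF assms(1) B] void_def)
  finally show ?thesis .
qed

lemma prob_hit_intervals:
  assumes n: "0 < n" and ab: "0 \<le> a" "a \<le> b" "b \<le> a'" "a' \<le> b'"
  shows "(\<integral>\<omega>. (of_bool (P n \<omega> \<inter> {a<..<b} \<noteq> {}) * of_bool (P n \<omega> \<inter> {a'<..<b'} \<noteq> {}) :: real) \<partial>M) =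
    void n a b * void n a' b'"
proof -
  have B: "{a<..<b} \<in> sets (exp_intensity n)" "{a'<..<b'} \<in> sets (exp_intensity n)" "{a<..<b} \<inter> {a'<..<b'} = {}"
    using ab by (auto simp: sets_exp_intensity)
  have ev: "{\<omega> \<in> space M. P n \<omega> \<inter> {a<..<b} \<noteq> {} \<and> P n \<omega> \<inter> {a'<..<b'} \<noteq> {}} \<in> events"
  proof -
    have "{\<omega> \<in> space M. P n \<omega> \<inter> {a<..<b} \<noteq> {}} \<inter> {\<omega> \<in> space M. P n \<omega> \<inter> {a'<..<b'} \<noteq> {}} \<in> events"
      using prob_hit(1)[OF n B(1)] prob_hit(1)[OF n B(2)] by blast
    moreover have "{\<omega> \<in> space M. P n \<omega> \<inter> {a<..<b} \<noteq> {}} \<inter> {\<omega> \<in> space M. P n \<omega> \<inter> {a'<..<b'} \<noteq> {}} =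
      {\<omega> \<in> space M. P n \<omega> \<inter> {a<..<b} \<noteq> {} \<and> P n \<omega> \<inter> {a'<..<b'} \<noteq> {}}" by blast
    ultimately show ?thesis by simp
  qed
  have "(\<integral>\<omega>. (of_bool (P n \<omega> \<inter> {a<..<b} \<noteq> {}) * of_bool (P n \<omega> \<inter> {a'<..<b'} \<noteq> {}) :: real) \<partial>M) =
      (\<integral>\<omega>. indicator {\<omega> \<in> space M. P n \<omega> \<inter> {a<..<b} \<noteq> {} \<and> P n \<omega> \<inter> {a'<..<b'} \<noteq> {}} \<omega> \<partial>M)"
    by (intro Bochner_Integration.integral_cong refl) (auto simp: indicator_def)
  also have "\<dots> = prob {\<omega> \<in> space M. P n \<omega> \<inter> {a<..<b} \<noteq> {} \<and> P n \<omega> \<inter> {a'<..<b'} \<noteq> {}}"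
    using ev by simp
  also have "\<dots> = void n a b * void n a' b'"
    using measure_exp_intensity_interval[of a b n] measure_exp_intensity_interval[of a' b' n] n ab
    by (simp add: prob_hit_both[OF n B] prob_hit(2)[OF n B(1)] prob_hit(2)[OF n B(2)] void_def)
  finally show ?thesis .
qed

text \<open>Conditioning on the path: by independence the end points may be treated as constants
  when the Poisson points are averaged.\<close>

lemma integral_hit:
  assumes n: "0 < n" and [measurable]: "u \<in> borel_measurable paths" "a \<in> borel_measurable paths" "b \<in> borel_measurable paths"
    and u: "\<And>s. \<bar>u s\<bar> \<le> K" and ab: "\<And>\<omega>. \<omega> \<in> space M \<Longrightarrow> 0 \<le> a (path \<omega>) \<and> a (path \<omega>) \<le> b (path \<omega>)"
  shows "(\<integral>\<omega>. u (path \<omega>) * of_bool (P n \<omega> \<inter> {a (path \<omega>)<..<b (path \<omega>)} \<noteq> {}) \<partial>M) =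
    (\<integral>\<omega>. u (path \<omega>) * void n (a (path \<omega>)) (b (path \<omega>)) \<partial>M)"
proof -
  define f where "f z = u (fst z) * of_bool (hits (snd z) (a (fst z)) (b (fst z)))" for z
  have "(\<integral>\<omega>. u (path \<omega>) * of_bool (P n \<omega> \<inter> {a (path \<omega>)<..<b (path \<omega>)} \<noteq> {}) \<partial>M) =
      (\<integral>\<omega>. f (path \<omega>, configuration n \<omega>) \<partial>M)"
    by (intro Bochner_Integration.integral_cong refl) (simp add: f_def hits_configuration n ab)
  also have "\<dots> = (\<integral>\<omega>. (\<integral>\<omega>'. f (path \<omega>, configuration n \<omega>') \<partial>M) \<partial>M)"
  proof (rule integral_path_configuration[OF n])
    show "f \<in> borel_measurable (paths \<Otimes>\<^sub>M configurations n)" unfolding f_def[abs_def] by measurable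
    show "\<bar>f z\<bar> \<le> max K 0" for z using u[of "fst z"] by (auto simp: f_def)
  qed
  also have "\<dots> = (\<integral>\<omega>. u (path \<omega>) * void n (a (path \<omega>)) (b (path \<omega>)) \<partial>M)"
  proof (intro Bochner_Integration.integral_cong refl)
    fix \<omega> assume \<omega>: "\<omega> \<in> space M"
    have "(\<integral>\<omega>'. f (path \<omega>, configuration n \<omega>') \<partial>M) =
        (\<integral>\<omega>'. u (path \<omega>) * of_bool (P n \<omega>' \<inter> {a (path \<omega>)<..<b (path \<omega>)} \<noteq> {}) \<partial>M)"
      by (intro Bochner_Integration.integral_cong refl) (simp add: f_def hits_configuration n ab \<omega>)
    also have "\<dots> = u (path \<omega>) * void n (a (path \<omega>)) (b (path \<omega>))"
      using prob_hit_interval[OF n] ab[OF \<omega>] by simp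
    finally show "(\<integral>\<omega>'. f (path \<omega>, configuration n \<omega>') \<partial>M) = u (path \<omega>) * void n (a (path \<omega>)) (b (path \<omega>))" .
  qed
  finally show ?thesis .
qed

text \<open>Given the path, the two intervals are disjoint and therefore hit independently.\<close>

lemma integral_hit_hit:
  assumes n: "0 < n" and [measurable]: "a \<in> borel_measurable paths" "b \<in> borel_measurable paths"
      "a' \<in> borel_measurable paths" "b' \<in> borel_measurable paths"
    and ab: "\<And>\<omega>. \<omega> \<in> space M \<Longrightarrow> 0 \<le> a (path \<omega>) \<and> a (path \<omega>) \<le> b (path \<omega>) \<and>
      b (path \<omega>) \<le> a' (path \<omega>) \<and> a' (path \<omega>) \<le> b' (path \<omega>)"
  shows "(\<integral>\<omega>. of_bool (P n \<omega> \<inter> {a (path \<omega>)<..<b (path \<omega>)} \<noteq> {}) *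
      of_bool (P n \<omega> \<inter> {a' (path \<omega>)<..<b' (path \<omega>)} \<noteq> {}) \<partial>M) =
    (\<integral>\<omega>. void n (a (path \<omega>)) (b (path \<omega>)) * void n (a' (path \<omega>)) (b' (path \<omega>)) \<partial>M)"
proof -
  define f :: "(real \<Rightarrow> real) \<times> (real set \<Rightarrow> nat) \<Rightarrow> real" where
    "f z = of_bool (hits (snd z) (a (fst z)) (b (fst z))) * of_bool (hits (snd z) (a' (fst z)) (b' (fst z)))" for z
  have ab': "0 \<le> a' (path \<omega>)" if "\<omega> \<in> space M" for \<omega> using ab[OF that] by linarith
  have "(\<integral>\<omega>. of_bool (P n \<omega> \<inter> {a (path \<omega>)<..<b (path \<omega>)} \<noteq> {}) *
      of_bool (P n \<omega> \<inter> {a' (path \<omega>)<..<b' (path \<omega>)} \<noteq> {}) \<partial>M) = (\<integral>\<omega>. f (path \<omega>, configuration n \<omega>) \<partial>M)"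
    by (intro Bochner_Integration.integral_cong refl) (simp add: f_def hits_configuration n ab ab')
  also have "\<dots> = (\<integral>\<omega>. (\<integral>\<omega>'. f (path \<omega>, configuration n \<omega>') \<partial>M) \<partial>M)"
  proof (rule integral_path_configuration[OF n])
    show "f \<in> borel_measurable (paths \<Otimes>\<^sub>M configurations n)" unfolding f_def[abs_def] by measurable
    show "\<bar>f z\<bar> \<le> 1" for z by (auto simp: f_def)
  qed
  also have "\<dots> = (\<integral>\<omega>. void n (a (path \<omega>)) (b (path \<omega>)) * void n (a' (path \<omega>)) (b' (path \<omega>)) \<partial>M)"
  proof (intro Bochner_Integration.integral_cong refl)
    fix \<omega> assume \<omega>: "\<omega> \<in> space M"
    have "(\<integral>\<omega>'. f (path \<omega>, configuration n \<omega>') \<partial>M) =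
        (\<integral>\<omega>'. of_bool (P n \<omega>' \<inter> {a (path \<omega>)<..<b (path \<omega>)} \<noteq> {}) *
          of_bool (P n \<omega>' \<inter> {a' (path \<omega>)<..<b' (path \<omega>)} \<noteq> {}) \<partial>M)"
      by (intro Bochner_Integration.integral_cong refl) (simp add: f_def hits_configuration n ab ab' \<omega>)
    also have "\<dots> = void n (a (path \<omega>)) (b (path \<omega>)) * void n (a' (path \<omega>)) (b' (path \<omega>))"
      using prob_hit_intervals[OF n] ab[OF \<omega>] by simp
    finally show "(\<integral>\<omega>'. f (path \<omega>, configuration n \<omega>') \<partial>M) =
      void n (a (path \<omega>)) (b (path \<omega>)) * void n (a' (path \<omega>)) (b' (path \<omega>))" .
  qed
  finally show ?thesis .
qed

text \<open>The Markov property in the form needed: the increment after \<open>s3\<close> is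
  averaged while the past is kept. Three past values are allowed because the hit probability of an
  earlier cell involves both of its ends.\<close>

lemma integral_next_increment:
  fixes \<psi> :: "real \<Rightarrow> real \<Rightarrow> real \<Rightarrow> real" and \<theta> :: "real \<Rightarrow> real \<Rightarrow> real"
  assumes s: "0 \<le> s1" "s1 \<le> s2" "s2 \<le> s3" "s3 \<le> s4"
    and [measurable]: "(\<lambda>z. \<psi> (fst z) (fst (snd z)) (snd (snd z))) \<in> borel_measurable (borel \<Otimes>\<^sub>M borel \<Otimes>\<^sub>M borel)"
      "(\<lambda>z. \<theta> (fst z) (snd z)) \<in> borel_measurable (borel \<Otimes>\<^sub>M borel)"
    and bd: "\<And>a b c. \<bar>\<psi> a b c\<bar> \<le> 1" "\<And>y x. \<bar>\<theta> y x\<bar> \<le> 1"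
  shows "(\<integral>\<omega>. \<psi> (S s1 \<omega>) (S s2 \<omega>) (S s3 \<omega>) * \<theta> (S s3 \<omega>) (S s4 \<omega> - S s3 \<omega>) \<partial>M) =
    (\<integral>\<omega>. \<psi> (S s1 \<omega>) (S s2 \<omega>) (S s3 \<omega>) * (\<integral>\<omega>'. \<theta> (S s3 \<omega>) (S (s4 - s3) \<omega>') \<partial>M) \<partial>M)"
proof -
  \<comment> \<open>Starting at time 0 makes the values at \<open>s1\<close>, \<open>s2\<close>,
    \<open>s3\<close> partial sums of the first three increments, which are independent of the
    fourth.\<close>
  define t where "t i = (if i = 0 then 0 else if i = 1 then s1 else if i = 2 then s2 else if i = 3 then s3 else s4)" for i :: nat
  define Y where "Y i \<omega> = S (t (Suc i)) \<omega> - S (t i) \<omega>" for i \<omega>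
  have ind: "indep_vars (\<lambda>_. borel) Y {..<4}"
    unfolding Y_def[abs_def] by (rule increments_indep) (use s in \<open>auto simp: t_def\<close>)
  have "indep_var (PiM {0,1,2::nat} (\<lambda>_. borel)) (\<lambda>\<omega>. restrict (\<lambda>i. Y i \<omega>) {0,1,2})
      (PiM {3::nat} (\<lambda>_. borel)) (\<lambda>\<omega>. restrict (\<lambda>i. Y i \<omega>) {3})"
    by (rule indep_var_restrict[OF ind]) auto
  define A where "A \<omega> = restrict (\<lambda>i. Y i \<omega>) {0,1,2::nat}" for \<omega>
  define B where "B \<omega> = Y 3 \<omega>" for \<omega>
  define N where "N = PiM {0,1,2::nat} (\<lambda>_. borel :: real measure)"
  have i0: "indep_var N A (PiM {3::nat} (\<lambda>_. borel)) (\<lambda>\<omega>. restrict (\<lambda>i. Y i \<omega>) {3})"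
    unfolding A_def[abs_def] N_def by fact
  have Am[measurable]: "A \<in> M \<rightarrow>\<^sub>M N" using indep_var_rv1[OF i0] .
  have Bm[measurable]: "B \<in> borel_measurable M" unfolding B_def[abs_def] Y_def t_def using s by auto
  have comp[measurable]: "(\<lambda>z. z i) \<in> borel_measurable N" if "i < 3" for i :: nat
    unfolding N_def by (rule measurable_component_singleton) (use that in auto)
  define f where "f z = \<psi> (fst z 0) (fst z 0 + fst z 1) (fst z 0 + fst z 1 + fst z 2) *
      \<theta> (fst z 0 + fst z 1 + fst z 2) (snd z)" for z :: "(nat \<Rightarrow> real) \<times> real"
  have fm: "f \<in> borel_measurable (N \<Otimes>\<^sub>M borel)"
  proof -
    have [measurable]: "(\<lambda>z. fst z i) \<in> borel_measurable (N \<Otimes>\<^sub>M borel)" if "i < 3" for i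
      by (rule measurable_compose[OF measurable_fst comp[OF that]])
    let ?g = "\<lambda>z::(nat \<Rightarrow> real) \<times> real. (fst z 0, fst z 0 + fst z 1, fst z 0 + fst z 1 + fst z 2)"
    let ?h = "\<lambda>z::(nat \<Rightarrow> real) \<times> real. (fst z 0 + fst z 1 + fst z 2, snd z)"
    have g: "?g \<in> N \<Otimes>\<^sub>M borel \<rightarrow>\<^sub>M borel \<Otimes>\<^sub>M borel \<Otimes>\<^sub>M borel" by (intro measurable_Pair borel_measurable_add) auto
    have h: "?h \<in> N \<Otimes>\<^sub>M borel \<rightarrow>\<^sub>M borel \<Otimes>\<^sub>M borel" by (intro measurable_Pair borel_measurable_add) auto
    show ?thesis
      using borel_measurable_times[OF measurable_compose[OF g assms(5)] measurable_compose[OF h assms(6)]]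
      by (simp add: f_def[abs_def])
  qed
  have vals: "A \<omega> 0 = S s1 \<omega>" "A \<omega> 0 + A \<omega> 1 = S s2 \<omega>" "A \<omega> 0 + A \<omega> 1 + A \<omega> 2 = S s3 \<omega>" "B \<omega> = S s4 \<omega> - S s3 \<omega>"
    if "\<omega> \<in> space M" for \<omega>
    using S_zero[OF that] by (simp_all add: A_def B_def Y_def t_def)
  have "(\<integral>\<omega>. \<psi> (S s1 \<omega>) (S s2 \<omega>) (S s3 \<omega>) * \<theta> (S s3 \<omega>) (S s4 \<omega> - S s3 \<omega>) \<partial>M) = (\<integral>\<omega>. f (A \<omega>, B \<omega>) \<partial>M)"
    by (intro Bochner_Integration.integral_cong refl) (simp only: f_def fst_conv snd_conv vals(3,4), simp only: vals(2), simp only: vals(1))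
  also have "\<dots> = (\<integral>\<omega>. (\<integral>\<omega>'. f (A \<omega>, B \<omega>') \<partial>M) \<partial>M)"
  proof (rule integral_independent_pair[OF Am Bm _ fm])
    fix X Y' assume XY: "X \<in> sets N" "Y' \<in> sets (borel :: real measure)"
    let ?Z = "{z \<in> space (PiM {3::nat} (\<lambda>_. borel :: real measure)). z 3 \<in> Y'}"
    have "?Z \<in> sets (PiM {3::nat} (\<lambda>_. borel :: real measure))" using XY by measurable
    from indep_varD[OF i0 XY(1) this]
    have "prob ((\<lambda>\<omega>. (A \<omega>, restrict (\<lambda>i. Y i \<omega>) {3})) -` (X \<times> ?Z) \<inter> space M) =
      prob (A -` X \<inter> space M) * prob ((\<lambda>\<omega>. restrict (\<lambda>i. Y i \<omega>) {3}) -` ?Z \<inter> space M)" .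
    moreover have "(\<lambda>\<omega>. restrict (\<lambda>i. Y i \<omega>) {3}) -` ?Z \<inter> space M = B -` Y' \<inter> space M"
      by (auto simp: B_def space_PiM)
    moreover have "(\<lambda>\<omega>. (A \<omega>, restrict (\<lambda>i. Y i \<omega>) {3})) -` (X \<times> ?Z) \<inter> space M =
        (\<lambda>\<omega>. (A \<omega>, B \<omega>)) -` (X \<times> Y') \<inter> space M"
      by (auto simp: B_def space_PiM)
    ultimately show "prob ((\<lambda>\<omega>. (A \<omega>, B \<omega>)) -` (X \<times> Y') \<inter> space M) =
        prob (A -` X \<inter> space M) * prob (B -` Y' \<inter> space M)" by simp
  next
    fix z
    have "\<bar>f z\<bar> \<le> 1 * 1" unfolding f_def abs_mult by (intro mult_mono bd) auto
    then show "\<bar>f z\<bar> \<le> 1" by simp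
  qed
  also have "\<dots> = (\<integral>\<omega>. \<psi> (S s1 \<omega>) (S s2 \<omega>) (S s3 \<omega>) * (\<integral>\<omega>'. \<theta> (S s3 \<omega>) (S (s4 - s3) \<omega>') \<partial>M) \<partial>M)"
  proof (intro Bochner_Integration.integral_cong refl)
    fix \<omega> assume \<omega>: "\<omega> \<in> space M"
    have m: "\<theta> y \<in> borel_measurable borel" for y
    proof -
      have "(\<lambda>x. (y, x)) \<in> borel \<rightarrow>\<^sub>M borel \<Otimes>\<^sub>M (borel :: real measure)" by simp
      from measurable_compose[OF this assms(6)] show ?thesis by simp
    qed
    have "(\<integral>\<omega>'. f (A \<omega>, B \<omega>') \<partial>M) =
        \<psi> (S s1 \<omega>) (S s2 \<omega>) (S s3 \<omega>) * (\<integral>\<omega>'. \<theta> (S s3 \<omega>) (B \<omega>') \<partial>M)"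
      unfolding f_def fst_conv snd_conv vals(3)[OF \<omega>] unfolding vals(2)[OF \<omega>] unfolding vals(1)[OF \<omega>] by simp
    also have "(\<integral>\<omega>'. \<theta> (S s3 \<omega>) (B \<omega>') \<partial>M) = (\<integral>x. \<theta> (S s3 \<omega>) x \<partial>distr M borel B)"
      by (rule integral_distr[symmetric]) (use m in auto)
    also have "distr M borel B = distr M borel (\<lambda>\<omega>. S s4 \<omega> - S s3 \<omega>)"
      by (rule distr_cong) (auto simp: vals)
    also have "\<dots> = distr M borel (S (s4 - s3))" by (rule increments_stationary) (use s in auto)
    also have "(\<integral>x. \<theta> (S s3 \<omega>) x \<partial>distr M borel (S (s4 - s3))) = (\<integral>\<omega>'. \<theta> (S s3 \<omega>) (S (s4 - s3) \<omega>') \<partial>M)"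
      by (rule integral_distr) (use m s in auto)
    finally show "(\<integral>\<omega>'. f (A \<omega>, B \<omega>') \<partial>M) =
      \<psi> (S s1 \<omega>) (S s2 \<omega>) (S s3 \<omega>) * (\<integral>\<omega>'. \<theta> (S s3 \<omega>) (S (s4 - s3) \<omega>') \<partial>M)" .
  qed
  finally show ?thesis .
qed

end

section \<open>Compensation of the count\<close>

text \<open>For a decreasing function the difference of upper and lower sums telescopes to
  \<open>\<delta>\<close> times the total decrease.\<close>

lemma riemann_sum_decreasing:
  fixes f :: "real \<Rightarrow> real"
  assumes dec: "\<And>s t. 0 \<le> s \<Longrightarrow> s \<le> t \<Longrightarrow> f t \<le> f s" and nn: "\<And>t. 0 \<le> t \<Longrightarrow> 0 \<le> f t"
    and int: "\<And>t. f integrable_on {0..t}" and \<delta>: "0 < \<delta>"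
  shows "\<bar>integral {0..real j * \<delta>} f - (\<Sum>i<j. \<delta> * f (real i * \<delta>))\<bar> \<le> \<delta> * f 0"
proof -
  have "(\<Sum>i<j. \<delta> * f (real i * \<delta>)) - \<delta> * (f 0 - f (real j * \<delta>)) \<le> integral {0..real j * \<delta>} f \<and>
    integral {0..real j * \<delta>} f \<le> (\<Sum>i<j. \<delta> * f (real i * \<delta>))"
  proof (induction j)
    case (Suc j)
    let ?a = "real j * \<delta>" and ?b = "real (Suc j) * \<delta>"
    have ab: "0 \<le> ?a" "?a \<le> ?b" "?b - ?a = \<delta>" using \<delta> by (auto simp: algebra_simps)
    have split: "integral {0..?b} f = integral {0..?a} f + integral {?a..?b} f"
      by (rule Henstock_Kurzweil_Integration.integral_combine[symmetric, OF ab(1,2) int])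
    have i: "f integrable_on {?a..?b}" by (rule integrable_subinterval_real[OF int[of ?b]]) (use ab in auto)
    have c: "integral {?a..?b} (\<lambda>_. c) = \<delta> * c" for c :: real
      using ab \<delta> by (subst integral_const_real) (simp add: algebra_simps)
    have "integral {?a..?b} f \<le> integral {?a..?b} (\<lambda>_. f ?a)"
      by (rule integral_le[OF i integrable_const_ivl]) (use ab(1) in \<open>auto intro: dec\<close>)
    moreover have "f ?b \<le> f x" if "x \<in> {?a..?b}" for x
      by (rule dec) (use that ab(1) in \<open>meson atLeastAtMost_iff order_trans\<close>)+
    then have "integral {?a..?b} (\<lambda>_. f ?b) \<le> integral {?a..?b} f"
      by (intro integral_le i integrable_const_ivl)
    ultimately show ?case using Suc split unfolding c by (simp add: algebra_simps)
  qed (use \<delta> nn in simp)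
  moreover have "0 \<le> \<delta> * f (real j * \<delta>)" using \<delta> nn by simp
  ultimately show ?thesis by (simp add: algebra_simps abs_le_iff)
qed

lemma exp_minus_quadratic: "0 \<le> u \<Longrightarrow> exp (- u) - 1 + u \<le> u\<^sup>2" for u :: real
proof (cases "u \<le> 1")
  case True
  assume "0 \<le> u"
  then show ?thesis using abs_exp_minus_one_minus[of "- u"] True by simp
next
  case False
  then have "u * 1 \<le> u * u" by (intro mult_left_mono) auto
  moreover have "exp (- u) \<le> 1" using False by simp
  ultimately show ?thesis unfolding power2_eq_square by linarith
qed

context occupancy
begin

lemma integrable_bounded:
  fixes f :: "'a \<Rightarrow> real"
  assumes "f \<in> borel_measurable M" "\<And>\<omega>. \<omega> \<in> space M \<Longrightarrow> \<bar>f \<omega>\<bar> \<le> K"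
  shows "integrable M f"
  by (rule integrable_const_bound[of _ K]) (use assms in auto)

text \<open>The hit probability in terms of the lower end \<open>y\<close> and the length
  \<open>x\<close> of the interval. Clipping at 0 makes it lie in [0,1] for all real arguments, as
  the independence lemma demands.\<close>

definition theta :: "real \<Rightarrow> real \<Rightarrow> real \<Rightarrow> real" where
  "theta n y x = 1 - exp (- (n * exp (- max 0 y)) * (1 - exp (- max 0 x)))"

lemma theta_bounds: "0 < n \<Longrightarrow> 0 \<le> theta n y x" "theta n y x \<le> 1"
  by (auto simp: theta_def)

lemma theta_measurable [measurable]: "(\<lambda>z. theta n (fst z) (snd z)) \<in> borel_measurable (borel \<Otimes>\<^sub>M borel)"
  unfolding theta_def by measurable

lemma theta_measurable' [measurable (raw)]:
  "f \<in> borel_measurable N \<Longrightarrow> g \<in> borel_measurable N \<Longrightarrow> (\<lambda>x. theta n (f x) (g x)) \<in> borel_measurable N"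
  using measurable_compose[OF measurable_Pair[of f N borel g borel] theta_measurable, of n] by simp

lemma void_theta: "0 \<le> a \<Longrightarrow> a \<le> b \<Longrightarrow> void n a b = theta n a (b - a)"
  by (simp add: void_def theta_def algebra_simps exp_add[symmetric] exp_diff exp_minus field_simps)

text \<open>The conditional probability that the next cell is hit, given that it starts at level
  \<open>y\<close>: one step of the discrete compensator.\<close>

definition qbar :: "real \<Rightarrow> real \<Rightarrow> real \<Rightarrow> real" where
  "qbar n \<delta> y = (\<integral>\<omega>. theta n y (S \<delta> \<omega>) \<partial>M)"

lemma qbar_measurable [measurable]: assumes "0 \<le> \<delta>" shows "qbar n \<delta> \<in> borel_measurable borel"
proof -
  have [measurable]: "S \<delta> \<in> borel_measurable M" using assms by simp
  show ?thesis unfolding qbar_def[abs_def] by measurable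
qed

lemma qbar_bounds: assumes "0 < n" "0 \<le> \<delta>" shows "0 \<le> qbar n \<delta> y" "qbar n \<delta> y \<le> 1"
proof -
  have [measurable]: "S \<delta> \<in> borel_measurable M" using assms by simp
  have i: "integrable M (\<lambda>\<omega>. theta n y (S \<delta> \<omega>))"
    by (rule integrable_bounded[of _ 1]) (use theta_bounds assms in \<open>auto simp: abs_le_iff intro: order_trans[of _ 0]\<close>)
  show "0 \<le> qbar n \<delta> y" unfolding qbar_def using theta_bounds assms by (intro integral_nonneg_AE) auto
  have "qbar n \<delta> y \<le> (\<integral>\<omega>. 1 \<partial>M)" unfolding qbar_def
    by (rule integral_mono[OF i]) (use theta_bounds in auto)
  then show "qbar n \<delta> y \<le> 1" by (simp add: prob_space)
qed

text \<open>Expand \<open>theta\<close> as a Poisson mixture of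
  \<open>1 - exp (- k * S \<delta>)\<close> and take expectations termwise by the Laplace
  transform.\<close>

lemma qbar_sums:
  assumes n: "0 < n" and \<delta>: "0 \<le> \<delta>" and y: "0 \<le> y"
  shows "(\<lambda>k. poisson_weight (n * exp (- y)) k * (1 - exp (- (\<delta> * laplace_exponent (real k))))) sums qbar n \<delta> y"
proof -
  have [measurable]: "S \<delta> \<in> borel_measurable M" using \<delta> by simp
  define w where "w = poisson_weight (n * exp (- y))"
  have w0: "0 \<le> w k" for k unfolding w_def using n by (intro poisson_weight_nonneg) simp
  have f01: "0 \<le> 1 - exp (- (real k * S \<delta> \<omega>))" "1 - exp (- (real k * S \<delta> \<omega>)) \<le> 1" if "\<omega> \<in> space M" for k \<omega>
    using S_nonneg[OF that \<delta>] by auto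
  have e: "integrable M (\<lambda>\<omega>. exp (- (real k * S \<delta> \<omega>)))" for k
    by (rule integrable_bounded[of _ 1]) (use f01 in auto)
  have a: "(\<lambda>k. \<integral>\<omega>. w k * (1 - exp (- (real k * S \<delta> \<omega>))) \<partial>M) sums
      (\<integral>\<omega>. (\<Sum>k. w k * (1 - exp (- (real k * S \<delta> \<omega>)))) \<partial>M)"
  proof (rule sums_integral)
    show i: "integrable M (\<lambda>\<omega>. w k * (1 - exp (- (real k * S \<delta> \<omega>))))" for k using e by simp
    have nn: "norm (w k * (1 - exp (- (real k * S \<delta> \<omega>)))) = w k * (1 - exp (- (real k * S \<delta> \<omega>)))" if "\<omega> \<in> space M" for k \<omega>
      using f01[OF that] w0 by simp
    show "AE \<omega> in M. summable (\<lambda>k. norm (w k * (1 - exp (- (real k * S \<delta> \<omega>)))))"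
      by (rule AE_I2) (use nn sums_summable[OF poisson_weight_exp_sums] in \<open>simp add: w_def\<close>)
    show "summable (\<lambda>k. \<integral>\<omega>. norm (w k * (1 - exp (- (real k * S \<delta> \<omega>)))) \<partial>M)"
    proof (rule summable_comparison_test'[of w 0])
      show "summable w" unfolding w_def by (rule sums_summable[OF poisson_weight_sums])
      fix k
      have "(\<integral>\<omega>. norm (w k * (1 - exp (- (real k * S \<delta> \<omega>)))) \<partial>M) \<le> (\<integral>\<omega>. w k \<partial>M)"
      proof (rule integral_mono[OF integrable_norm[OF i]])
        fix \<omega> assume \<omega>: "\<omega> \<in> space M"
        show "norm (w k * (1 - exp (- (real k * S \<delta> \<omega>)))) \<le> w k"
          unfolding nn[OF \<omega>] using mult_left_mono[OF f01(2)[OF \<omega>] w0] by simp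
      qed simp
      then show "norm (\<integral>\<omega>. norm (w k * (1 - exp (- (real k * S \<delta> \<omega>)))) \<partial>M) \<le> w k"
        by (simp add: prob_space integral_nonneg_AE)
    qed
  qed
  have b: "(\<integral>\<omega>. w k * (1 - exp (- (real k * S \<delta> \<omega>))) \<partial>M) = w k * (1 - exp (- (\<delta> * laplace_exponent (real k))))" for k
    using e[of k] laplace_transform[OF \<delta>, of "real k"] by (simp add: prob_space)
  have c: "(\<integral>\<omega>. (\<Sum>k. w k * (1 - exp (- (real k * S \<delta> \<omega>)))) \<partial>M) = qbar n \<delta> y"
    unfolding qbar_def
  proof (intro Bochner_Integration.integral_cong refl)
    fix \<omega> assume "\<omega> \<in> space M"
    then show "(\<Sum>k. w k * (1 - exp (- (real k * S \<delta> \<omega>)))) = theta n y (S \<delta> \<omega>)"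
      using sums_unique[OF poisson_weight_exp_sums[of "n * exp (- y)" "S \<delta> \<omega>"]] S_nonneg[OF _ \<delta>, of \<omega>] y
      by (simp add: w_def theta_def)
  qed
  show ?thesis using a unfolding b c unfolding w_def .
qed

text \<open>Termwise, \<open>1 - exp (- u)\<close> is compared with \<open>u\<close> for
  \<open>u = \<delta> * laplace_exponent k\<close>; the difference is at most the square of
  \<open>u\<close>, which is at most a constant times the square of \<open>\<delta> * k\<close>. The
  size of \<open>exp (4 * n)\<close> does not matter, as \<open>n\<close> is fixed while
  \<open>\<delta>\<close> tends to 0.\<close>

lemma qbar_Phi:
  assumes n: "0 < n" and \<delta>: "0 \<le> \<delta>" and y: "0 \<le> y"
  shows "qbar n \<delta> y \<le> \<delta> * Phi \<nu> (n * exp (- y))"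
    and "\<delta> * Phi \<nu> (n * exp (- y)) - qbar n \<delta> y \<le> \<delta>\<^sup>2 * ((laplace_exponent 1)\<^sup>2 * exp (4 * n))"
proof -
  let ?r = "n * exp (- y)" and ?c = "laplace_exponent 1"
  have r: "0 \<le> ?r" "?r \<le> n" using n y by auto
  note q = qbar_sums[OF assms]
  have P: "(\<lambda>k. poisson_weight ?r k * (\<delta> * laplace_exponent (real k))) sums (\<delta> * Phi \<nu> ?r)"
    using sums_mult[OF Phi_poisson_mixture[OF r(1)], of \<delta>] by (simp add: mult_ac)
  show "qbar n \<delta> y \<le> \<delta> * Phi \<nu> ?r"
  proof (rule sums_le[OF _ q P])
    fix k
    have "1 - exp (- (\<delta> * laplace_exponent (real k))) \<le> \<delta> * laplace_exponent (real k)"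
      using exp_ge_add_one_self[of "- (\<delta> * laplace_exponent (real k))"] by simp
    then show "poisson_weight ?r k * (1 - exp (- (\<delta> * laplace_exponent (real k)))) \<le>
        poisson_weight ?r k * (\<delta> * laplace_exponent (real k))"
      using poisson_weight_nonneg[OF r(1)] by (rule mult_left_mono)
  qed
  have "(\<lambda>k. \<delta>\<^sup>2 * ?c\<^sup>2 * (poisson_weight ?r k * (real k)\<^sup>2)) sums (\<delta>\<^sup>2 * ?c\<^sup>2 * (\<Sum>k. poisson_weight ?r k * (real k)\<^sup>2))"
    by (intro sums_mult summable_sums poisson_weight_times_bounds r)
  then have "\<delta> * Phi \<nu> ?r - qbar n \<delta> y \<le> \<delta>\<^sup>2 * ?c\<^sup>2 * (\<Sum>k. poisson_weight ?r k * (real k)\<^sup>2)"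
  proof (rule sums_le[OF _ sums_diff[OF P q], rotated])
    fix k
    let ?u = "\<delta> * laplace_exponent (real k)"
    have u: "0 \<le> ?u" using \<delta> laplace_exponent_nat_nonneg by simp
    have "?u \<le> \<delta> * (real k * ?c)" using \<delta> by (intro mult_left_mono laplace_exponent_nat_le)
    then have "?u\<^sup>2 \<le> (\<delta> * (real k * ?c))\<^sup>2" using u by (intro power_mono)
    then have "?u - (1 - exp (- ?u)) \<le> \<delta>\<^sup>2 * ?c\<^sup>2 * (real k)\<^sup>2"
      using exp_minus_quadratic[OF u] by (simp add: power_mult_distrib mult_ac)
    then have "poisson_weight ?r k * (?u - (1 - exp (- ?u))) \<le> poisson_weight ?r k * (\<delta>\<^sup>2 * ?c\<^sup>2 * (real k)\<^sup>2)"
      using poisson_weight_nonneg[OF r(1)] by (rule mult_left_mono)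
    then show "poisson_weight ?r k * ?u - poisson_weight ?r k * (1 - exp (- ?u)) \<le>
        \<delta>\<^sup>2 * ?c\<^sup>2 * (poisson_weight ?r k * (real k)\<^sup>2)"
      by (simp add: right_diff_distrib mult_ac)
  qed
  also have "\<dots> \<le> \<delta>\<^sup>2 * ?c\<^sup>2 * exp (4 * n)"
    using poisson_weight_times_bounds(3)[OF r(1)] r by (intro mult_left_mono) (auto intro: order_trans)
  finally show "\<delta> * Phi \<nu> ?r - qbar n \<delta> y \<le> \<delta>\<^sup>2 * (?c\<^sup>2 * exp (4 * n))" by (simp add: mult_ac)
qed

lemma hit_measurable:
  assumes n: "0 < n" and [measurable]: "a \<in> borel_measurable paths" "b \<in> borel_measurable paths"
    and a: "\<And>\<omega>. \<omega> \<in> space M \<Longrightarrow> 0 \<le> a (path \<omega>)"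
  shows "(\<lambda>\<omega>. of_bool (P n \<omega> \<inter> {a (path \<omega>)<..<b (path \<omega>)} \<noteq> {}) :: real) \<in> borel_measurable M"
proof -
  have "Measurable.pred M (\<lambda>\<omega>. hits (configuration n \<omega>) (a (path \<omega>)) (b (path \<omega>)))"
    using measurable_compose[OF measurable_Pair[OF path_measurable configuration_measurable[OF n]] hits_measurable[OF assms(2,3)]]
    by simp
  then have [measurable]: "(\<lambda>\<omega>. of_bool (hits (configuration n \<omega>) (a (path \<omega>)) (b (path \<omega>))) :: real) \<in> borel_measurable M"
    by measurable
  show ?thesis
    by (rule measurable_cong[THEN iffD1, of M "\<lambda>\<omega>. of_bool (hits (configuration n \<omega>) (a (path \<omega>)) (b (path \<omega>)))"])
       (simp_all add: hits_configuration n a)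
qed

section \<open>Orthogonal deviations on a grid\<close>

definition occ :: "real \<Rightarrow> real \<Rightarrow> nat \<Rightarrow> 'a \<Rightarrow> real" where
  "occ n \<delta> i \<omega> = of_bool (P n \<omega> \<inter> {S (real i * \<delta>) \<omega> <..< S (real (Suc i) * \<delta>) \<omega>} \<noteq> {})"

definition deviation :: "real \<Rightarrow> real \<Rightarrow> nat \<Rightarrow> 'a \<Rightarrow> real" where
  "deviation n \<delta> i \<omega> = occ n \<delta> i \<omega> - qbar n \<delta> (S (real i * \<delta>) \<omega>)"

context
  fixes n \<delta> :: real
  assumes n: "0 < n" and \<delta>: "0 < \<delta>"
begin

lemma grid_measurable [measurable]: "S (real i * \<delta>) \<in> borel_measurable M" "S \<delta> \<in> borel_measurable M"
  "S (real (Suc i) * \<delta>) \<in> borel_measurable M"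
  "(\<lambda>s. s (real i * \<delta>)) \<in> borel_measurable paths" "(\<lambda>s. s (real (Suc i) * \<delta>)) \<in> borel_measurable paths"
  by (intro S_measurable paths_component; use \<delta> in simp)+

lemma grid_path: "path \<omega> (real i * \<delta>) = S (real i * \<delta>) \<omega>"
  using \<delta> by simp

lemma qbar_m [measurable]: "qbar n \<delta> \<in> borel_measurable borel" using \<delta> by simp

lemma qbar_1: "\<bar>qbar n \<delta> y\<bar> \<le> 1" using qbar_bounds[of n \<delta> y] n \<delta> by simp

lemma theta_1: "\<bar>theta n y x\<bar> \<le> 1" using theta_bounds[of n y x] n by simp

lemma grid_mono: "\<omega> \<in> space M \<Longrightarrow> i \<le> j \<Longrightarrow> S (real i * \<delta>) \<omega> \<le> S (real j * \<delta>) \<omega>"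
  using \<delta> by (intro S_mono) (auto intro: mult_right_mono)

lemma grid_nonneg: "\<omega> \<in> space M \<Longrightarrow> 0 \<le> S (real i * \<delta>) \<omega>"
  using \<delta> by (intro S_nonneg) auto

lemma occ_measurable [measurable]: "occ n \<delta> i \<in> borel_measurable M"
  using hit_measurable[OF n grid_measurable(4)[of i] grid_measurable(5)[of i]] grid_nonneg
  unfolding grid_path occ_def[abs_def] by blast

lemma deviation_measurable [measurable]: "deviation n \<delta> i \<in> borel_measurable M"
  unfolding deviation_def[abs_def] by measurable

lemma occ_01: "0 \<le> occ n \<delta> i \<omega>" "occ n \<delta> i \<omega> \<le> 1" "\<bar>occ n \<delta> i \<omega>\<bar> \<le> 1" "(occ n \<delta> i \<omega>)\<^sup>2 = occ n \<delta> i \<omega>"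
  by (auto simp: occ_def)

lemma deviation_1: "\<bar>deviation n \<delta> i \<omega>\<bar> \<le> 1"
  using occ_01(1,2)[of i \<omega>] qbar_bounds[of n \<delta> "S (real i * \<delta>) \<omega>"] n \<delta> by (auto simp: deviation_def abs_le_iff)

text \<open>Two stages of averaging: \<open>J\<close> is the hit probability of a cell given the
  whole path, and \<open>Q\<close> the one given only the level at the start of the cell.\<close>

definition J :: "nat \<Rightarrow> 'a \<Rightarrow> real" where
  "J i \<omega> = theta n (S (real i * \<delta>) \<omega>) (S (real (Suc i) * \<delta>) \<omega> - S (real i * \<delta>) \<omega>)"

definition Q :: "nat \<Rightarrow> 'a \<Rightarrow> real" where "Q i \<omega> = qbar n \<delta> (S (real i * \<delta>) \<omega>)"

lemma Q_measurable [measurable]: "Q i \<in> borel_measurable M" unfolding Q_def[abs_def] by measurable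

lemma JQ_1: "\<bar>J i \<omega>\<bar> \<le> 1" "\<bar>Q i \<omega>\<bar> \<le> 1" by (auto simp: J_def Q_def theta_1 qbar_1)

lemma product_1: "\<bar>a\<bar> \<le> 1 \<Longrightarrow> \<bar>b\<bar> \<le> 1 \<Longrightarrow> \<bar>a * b\<bar> \<le> (1::real)"
  using mult_mono[of "\<bar>a\<bar>" 1 "\<bar>b\<bar>" 1] by (simp add: abs_mult)

lemma void_J: "\<omega> \<in> space M \<Longrightarrow> void n (S (real i * \<delta>) \<omega>) (S (real (Suc i) * \<delta>) \<omega>) = J i \<omega>"
  unfolding J_def using grid_mono[of \<omega> i "Suc i"] grid_nonneg by (intro void_theta) auto

lemma products_integrable:
  "integrable M (\<lambda>\<omega>. occ n \<delta> i \<omega> * occ n \<delta> j \<omega>)" "integrable M (\<lambda>\<omega>. Q i \<omega> * occ n \<delta> j \<omega>)"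
  "integrable M (\<lambda>\<omega>. Q i \<omega> * Q j \<omega>)" "integrable M (occ n \<delta> i)" "integrable M (Q i)"
  by (rule integrable_bounded[where K=1], measurable, intro product_1 JQ_1 occ_01)+

lemma integral_occ:
  assumes [measurable]: "u \<in> borel_measurable paths" and u: "\<And>s. \<bar>u s\<bar> \<le> 1"
  shows "(\<integral>\<omega>. u (path \<omega>) * occ n \<delta> i \<omega> \<partial>M) = (\<integral>\<omega>. u (path \<omega>) * J i \<omega> \<partial>M)"
proof -
  have "(\<integral>\<omega>. u (path \<omega>) * occ n \<delta> i \<omega> \<partial>M) =
      (\<integral>\<omega>. u (path \<omega>) * void n (path \<omega> (real i * \<delta>)) (path \<omega> (real (Suc i) * \<delta>)) \<partial>M)"
    unfolding occ_def grid_path[symmetric]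
    by (rule integral_hit[OF n]) (use u grid_mono[of _ i "Suc i"] grid_nonneg in \<open>auto simp: grid_path simp del: of_nat_Suc\<close>)
  also have "\<dots> = (\<integral>\<omega>. u (path \<omega>) * J i \<omega> \<partial>M)"
    unfolding grid_path by (intro Bochner_Integration.integral_cong refl) (simp add: void_J del: of_nat_Suc)
  finally show ?thesis .
qed

lemma integral_occ_occ:
  assumes "i < j"
  shows "(\<integral>\<omega>. occ n \<delta> i \<omega> * occ n \<delta> j \<omega> \<partial>M) = (\<integral>\<omega>. J i \<omega> * J j \<omega> \<partial>M)"
proof -
  have "(\<integral>\<omega>. occ n \<delta> i \<omega> * occ n \<delta> j \<omega> \<partial>M) =
      (\<integral>\<omega>. void n (path \<omega> (real i * \<delta>)) (path \<omega> (real (Suc i) * \<delta>)) *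
        void n (path \<omega> (real j * \<delta>)) (path \<omega> (real (Suc j) * \<delta>)) \<partial>M)"
    unfolding occ_def grid_path[symmetric]
  proof (rule integral_hit_hit[OF n])
    fix \<omega> assume \<omega>: "\<omega> \<in> space M"
    show "0 \<le> path \<omega> (real i * \<delta>) \<and> path \<omega> (real i * \<delta>) \<le> path \<omega> (real (Suc i) * \<delta>) \<and>
      path \<omega> (real (Suc i) * \<delta>) \<le> path \<omega> (real j * \<delta>) \<and> path \<omega> (real j * \<delta>) \<le> path \<omega> (real (Suc j) * \<delta>)"
      unfolding grid_path
      using grid_mono[OF \<omega>, of i "Suc i"] grid_mono[OF \<omega>, of "Suc i" j] grid_mono[OF \<omega>, of j "Suc j"] grid_nonneg[OF \<omega>] assms
      by (simp del: of_nat_Suc)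
  qed measurable
  also have "\<dots> = (\<integral>\<omega>. J i \<omega> * J j \<omega> \<partial>M)"
    unfolding grid_path by (intro Bochner_Integration.integral_cong refl) (simp add: void_J del: of_nat_Suc)
  finally show ?thesis .
qed

text \<open>Averages the increment over cell \<open>j\<close> against a weight that depends on the
  path only up to the start of this cell.\<close>

lemma integral_J:
  fixes \<psi> :: "real \<Rightarrow> real \<Rightarrow> real"
  assumes m: "(\<lambda>z. \<psi> (fst z) (snd z)) \<in> borel_measurable (borel \<Otimes>\<^sub>M borel)" and \<psi>: "\<And>a b. \<bar>\<psi> a b\<bar> \<le> 1"
    and k: "i \<le> k" "k \<le> j"
  shows "(\<integral>\<omega>. \<psi> (S (real i * \<delta>) \<omega>) (S (real k * \<delta>) \<omega>) * J j \<omega> \<partial>M) =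
    (\<integral>\<omega>. \<psi> (S (real i * \<delta>) \<omega>) (S (real k * \<delta>) \<omega>) * Q j \<omega> \<partial>M)"
proof -
  have "(\<integral>\<omega>. \<psi> (S (real i * \<delta>) \<omega>) (S (real k * \<delta>) \<omega>) *
      theta n (S (real j * \<delta>) \<omega>) (S (real (Suc j) * \<delta>) \<omega> - S (real j * \<delta>) \<omega>) \<partial>M) =
    (\<integral>\<omega>. \<psi> (S (real i * \<delta>) \<omega>) (S (real k * \<delta>) \<omega>) *
      (\<integral>\<omega>'. theta n (S (real j * \<delta>) \<omega>) (S (real (Suc j) * \<delta> - real j * \<delta>) \<omega>') \<partial>M) \<partial>M)"
  proof (rule integral_next_increment[where \<psi>="\<lambda>a b c. \<psi> a b"])
    have "(\<lambda>z::real \<times> real \<times> real. (fst z, fst (snd z))) \<in> borel \<Otimes>\<^sub>M borel \<Otimes>\<^sub>M borel \<rightarrow>\<^sub>M borel \<Otimes>\<^sub>M borel" by measurable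
    from measurable_compose[OF this m]
    show "(\<lambda>z::real \<times> real \<times> real. \<psi> (fst z) (fst (snd z))) \<in> borel_measurable (borel \<Otimes>\<^sub>M borel \<Otimes>\<^sub>M borel)" by simp
  qed (use \<delta> k \<psi> theta_1 in \<open>auto intro!: mult_right_mono\<close>)
  moreover have "real (Suc j) * \<delta> - real j * \<delta> = \<delta>" by (simp add: algebra_simps)
  ultimately show ?thesis by (simp only: J_def Q_def qbar_def)
qed

text \<open>Averaging the points turns \<open>occ\<close> into \<open>J\<close>, also next to
  factors that depend on the future path. Then averaging the increment of the later cell turns
  \<open>J j\<close> into \<open>Q j\<close>, and all terms cancel.\<close>

lemma deviation_orthogonal:
  assumes "i < j"
  shows "expectation (\<lambda>\<omega>. deviation n \<delta> i \<omega> * deviation n \<delta> j \<omega>) = 0"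
proof -
  note [simp] = products_integrable
  have q: "(\<integral>\<omega>. Q k \<omega> * occ n \<delta> l \<omega> \<partial>M) = (\<integral>\<omega>. Q k \<omega> * J l \<omega> \<partial>M)" for k l
    using integral_occ[of "\<lambda>s. qbar n \<delta> (s (real k * \<delta>))" l] qbar_1 by (simp add: grid_path Q_def)
  have "expectation (\<lambda>\<omega>. deviation n \<delta> i \<omega> * deviation n \<delta> j \<omega>) =
      (\<integral>\<omega>. (occ n \<delta> i \<omega> * occ n \<delta> j \<omega> - Q j \<omega> * occ n \<delta> i \<omega>) - (Q i \<omega> * occ n \<delta> j \<omega> - Q i \<omega> * Q j \<omega>) \<partial>M)"
    by (intro Bochner_Integration.integral_cong refl) (simp add: deviation_def Q_def algebra_simps)
  also have "\<dots> = ((\<integral>\<omega>. occ n \<delta> i \<omega> * occ n \<delta> j \<omega> \<partial>M) - (\<integral>\<omega>. Q j \<omega> * occ n \<delta> i \<omega> \<partial>M)) -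
      ((\<integral>\<omega>. Q i \<omega> * occ n \<delta> j \<omega> \<partial>M) - (\<integral>\<omega>. Q i \<omega> * Q j \<omega> \<partial>M))"
    by simp
  also have "\<dots> = ((\<integral>\<omega>. J i \<omega> * J j \<omega> \<partial>M) - (\<integral>\<omega>. Q j \<omega> * J i \<omega> \<partial>M)) -
      ((\<integral>\<omega>. Q i \<omega> * J j \<omega> \<partial>M) - (\<integral>\<omega>. Q i \<omega> * Q j \<omega> \<partial>M))"
    by (simp only: q integral_occ_occ[OF assms])
  also have "(\<integral>\<omega>. J i \<omega> * J j \<omega> \<partial>M) = (\<integral>\<omega>. J i \<omega> * Q j \<omega> \<partial>M)"
    using integral_J[of "\<lambda>a b. theta n a (b - a)" i "Suc i" j] assms theta_1 by (simp add: J_def del: of_nat_Suc)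
  also have "(\<integral>\<omega>. Q i \<omega> * J j \<omega> \<partial>M) = (\<integral>\<omega>. Q i \<omega> * Q j \<omega> \<partial>M)"
    using integral_J[of "\<lambda>a b. qbar n \<delta> a" i i j] assms qbar_1 by (simp add: Q_def del: of_nat_Suc)
  finally show ?thesis by (simp add: mult.commute)
qed

lemma Q_le: "\<omega> \<in> space M \<Longrightarrow> Q i \<omega> \<le> \<delta> * Phi \<nu> n"
proof -
  assume \<omega>: "\<omega> \<in> space M"
  have "Q i \<omega> \<le> \<delta> * Phi \<nu> (n * exp (- S (real i * \<delta>) \<omega>))"
    unfolding Q_def using n \<delta> grid_nonneg[OF \<omega>] by (intro qbar_Phi) auto
  also have "\<dots> \<le> \<delta> * Phi \<nu> n" using n \<delta> grid_nonneg[OF \<omega>] by (intro mult_left_mono Phi_mono) auto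
  finally show ?thesis .
qed

text \<open>The second moment equals E Q minus E of the square of Q, since \<open>occ\<close> is an
  indicator; it is thus at most E Q.\<close>

lemma deviation_square: "expectation (\<lambda>\<omega>. (deviation n \<delta> i \<omega>)\<^sup>2) \<le> \<delta> * Phi \<nu> n"
proof -
  note [simp] = products_integrable
  have q: "(\<integral>\<omega>. Q i \<omega> * occ n \<delta> i \<omega> \<partial>M) = (\<integral>\<omega>. Q i \<omega> * J i \<omega> \<partial>M)"
    using integral_occ[of "\<lambda>s. qbar n \<delta> (s (real i * \<delta>))" i] qbar_1 by (simp add: grid_path Q_def)
  have o: "(\<integral>\<omega>. occ n \<delta> i \<omega> \<partial>M) = (\<integral>\<omega>. J i \<omega> \<partial>M)" using integral_occ[of "\<lambda>s. 1" i] by simp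
  have "expectation (\<lambda>\<omega>. (deviation n \<delta> i \<omega>)\<^sup>2) =
      (\<integral>\<omega>. occ n \<delta> i \<omega> - 2 * (Q i \<omega> * occ n \<delta> i \<omega>) + Q i \<omega> * Q i \<omega> \<partial>M)"
  proof (intro Bochner_Integration.integral_cong refl)
    fix \<omega>
    have "(deviation n \<delta> i \<omega>)\<^sup>2 = (occ n \<delta> i \<omega>)\<^sup>2 - 2 * (Q i \<omega> * occ n \<delta> i \<omega>) + Q i \<omega> * Q i \<omega>"
      by (simp add: deviation_def Q_def power2_eq_square algebra_simps)
    then show "(deviation n \<delta> i \<omega>)\<^sup>2 = occ n \<delta> i \<omega> - 2 * (Q i \<omega> * occ n \<delta> i \<omega>) + Q i \<omega> * Q i \<omega>"
      by (simp only: occ_01)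
  qed
  also have "\<dots> = (\<integral>\<omega>. occ n \<delta> i \<omega> \<partial>M) - 2 * (\<integral>\<omega>. Q i \<omega> * occ n \<delta> i \<omega> \<partial>M) + (\<integral>\<omega>. Q i \<omega> * Q i \<omega> \<partial>M)"
    by simp
  also have "\<dots> = (\<integral>\<omega>. J i \<omega> \<partial>M) - 2 * (\<integral>\<omega>. Q i \<omega> * J i \<omega> \<partial>M) + (\<integral>\<omega>. Q i \<omega> * Q i \<omega> \<partial>M)" by (simp only: q o)
  also have "(\<integral>\<omega>. J i \<omega> \<partial>M) = (\<integral>\<omega>. Q i \<omega> \<partial>M)" using integral_J[of "\<lambda>a b. 1" i i i] by simp
  also have "(\<integral>\<omega>. Q i \<omega> * J i \<omega> \<partial>M) = (\<integral>\<omega>. Q i \<omega> * Q i \<omega> \<partial>M)"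
    using integral_J[of "\<lambda>a b. qbar n \<delta> a" i i i] qbar_1 by (simp add: Q_def)
  also have "(\<integral>\<omega>. Q i \<omega> \<partial>M) - 2 * (\<integral>\<omega>. Q i \<omega> * Q i \<omega> \<partial>M) + (\<integral>\<omega>. Q i \<omega> * Q i \<omega> \<partial>M) \<le> (\<integral>\<omega>. Q i \<omega> \<partial>M)"
    by simp
  also have "\<dots> \<le> (\<integral>\<omega>. \<delta> * Phi \<nu> n \<partial>M)" by (rule integral_mono) (use Q_le in simp_all)
  finally show ?thesis by (simp add: prob_space)
qed

lemma deviation_block_orthogonal:
  assumes "finite A" "finite B" "A \<inter> B = {}"
  shows "expectation (\<lambda>\<omega>. (\<Sum>i\<in>A. deviation n \<delta> i \<omega>) * (\<Sum>j\<in>B. deviation n \<delta> j \<omega>)) = 0"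
proof -
  have i: "integrable M (\<lambda>\<omega>. deviation n \<delta> i \<omega> * deviation n \<delta> j \<omega>)" for i j
    by (rule integrable_bounded[where K=1]) (auto intro: product_1 deviation_1)
  have o: "expectation (\<lambda>\<omega>. deviation n \<delta> i \<omega> * deviation n \<delta> j \<omega>) = 0" if "i \<noteq> j" for i j
    using deviation_orthogonal[of i j] deviation_orthogonal[of j i] that
    by (cases i j rule: linorder_cases) (auto simp: mult.commute)
  have "expectation (\<lambda>\<omega>. (\<Sum>i\<in>A. deviation n \<delta> i \<omega>) * (\<Sum>j\<in>B. deviation n \<delta> j \<omega>)) =
      (\<Sum>i\<in>A. \<Sum>j\<in>B. expectation (\<lambda>\<omega>. deviation n \<delta> i \<omega> * deviation n \<delta> j \<omega>))"
    unfolding sum_product using i by (simp add: Bochner_Integration.integral_sum Bochner_Integration.integrable_sum)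
  also have "\<dots> = 0" using assms(3) by (intro sum.neutral ballI) (auto intro!: o)
  finally show ?thesis .
qed

lemma deviation_block_square:
  assumes "finite A"
  shows "expectation (\<lambda>\<omega>. (\<Sum>i\<in>A. deviation n \<delta> i \<omega>)\<^sup>2) \<le> real (card A) * (\<delta> * Phi \<nu> n)"
proof -
  have i: "integrable M (\<lambda>\<omega>. deviation n \<delta> i \<omega> * deviation n \<delta> j \<omega>)" for i j
    by (rule integrable_bounded[where K=1]) (auto intro: product_1 deviation_1)
  have o: "expectation (\<lambda>\<omega>. deviation n \<delta> i \<omega> * deviation n \<delta> j \<omega>) = 0" if "i \<noteq> j" for i j
    using deviation_orthogonal[of i j] deviation_orthogonal[of j i] that
    by (cases i j rule: linorder_cases) (auto simp: mult.commute)
  have "expectation (\<lambda>\<omega>. (\<Sum>i\<in>A. deviation n \<delta> i \<omega>)\<^sup>2) =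
      (\<Sum>i\<in>A. \<Sum>j\<in>A. expectation (\<lambda>\<omega>. deviation n \<delta> i \<omega> * deviation n \<delta> j \<omega>))"
    unfolding power2_eq_square sum_product using i
    by (simp add: Bochner_Integration.integral_sum Bochner_Integration.integrable_sum)
  also have "\<dots> = (\<Sum>i\<in>A. expectation (\<lambda>\<omega>. (deviation n \<delta> i \<omega>)\<^sup>2))"
  proof (rule sum.cong[OF refl])
    fix i assume "i \<in> A"
    have "(\<Sum>j\<in>A. expectation (\<lambda>\<omega>. deviation n \<delta> i \<omega> * deviation n \<delta> j \<omega>)) =
        (\<Sum>j\<in>{i}. expectation (\<lambda>\<omega>. deviation n \<delta> i \<omega> * deviation n \<delta> j \<omega>))"
      using \<open>i \<in> A\<close> assms by (intro sum.mono_neutral_right) (auto intro!: o)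
    then show "(\<Sum>j\<in>A. expectation (\<lambda>\<omega>. deviation n \<delta> i \<omega> * deviation n \<delta> j \<omega>)) = expectation (\<lambda>\<omega>. (deviation n \<delta> i \<omega>)\<^sup>2)"
      by (simp add: power2_eq_square)
  qed
  also have "\<dots> \<le> (\<Sum>i\<in>A. \<delta> * Phi \<nu> n)" by (intro sum_mono deviation_square)
  finally show ?thesis by simp
qed

text \<open>Cells are grouped into \<open>2 ^ p\<close> blocks of \<open>k\<close>, and only block
  ends enter the maximum. So the mesh may tend to 0, as the compensator requires, while the
  logarithmic factor depends on the number of blocks alone.\<close>

lemma deviation_maximum:
  "\<exists>R. integrable M R \<and> (\<forall>\<omega>. \<forall>j\<le>2 ^ p. \<bar>\<Sum>i<j * k. deviation n \<delta> i \<omega>\<bar> \<le> R \<omega>) \<and>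
    expectation R \<le> (real p + 1) * sqrt (2 ^ p * real k * \<delta> * Phi \<nu> n)"
proof -
  define D where "D b \<omega> = (\<Sum>i\<in>{b * k..<b * k + k}. deviation n \<delta> i \<omega>)" for b \<omega>
  have D_bound: "\<bar>D b \<omega>\<bar> \<le> real k" for b \<omega>
  proof -
    have "\<bar>D b \<omega>\<bar> \<le> (\<Sum>i\<in>{b * k..<b * k + k}. 1)"
      unfolding D_def by (rule order_trans[OF sum_abs], rule sum_mono) (rule deviation_1)
    then show ?thesis by simp
  qed
  have "\<exists>R. integrable M R \<and> (\<forall>\<omega>. \<forall>j\<le>2 ^ p. \<bar>\<Sum>b<j. D b \<omega>\<bar> \<le> R \<omega>) \<and>
    expectation R \<le> (real p + 1) * sqrt (\<Sum>b<2 ^ p. expectation (\<lambda>\<omega>. (D b \<omega>)\<^sup>2))"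
  proof (rule orthogonal_partial_sums_maximum)
    show m: "D b \<in> borel_measurable M" for b unfolding D_def[abs_def] by measurable
    show "integrable M (\<lambda>\<omega>. (D b \<omega>)\<^sup>2)" for b
    proof (rule integrable_bounded[where K="(real k)\<^sup>2"])
      show "\<bar>(D b \<omega>)\<^sup>2\<bar> \<le> (real k)\<^sup>2" for \<omega> using power_mono[OF D_bound[of b \<omega>], of 2] by simp
    qed (use m in measurable)
    fix b c :: nat assume "b < c"
    then have "Suc b * k \<le> c * k" by (intro mult_right_mono) auto
    then show "expectation (\<lambda>\<omega>. D b \<omega> * D c \<omega>) = 0"
      unfolding D_def by (intro deviation_block_orthogonal) auto
  qed
  then obtain R where R: "integrable M R" "\<And>\<omega> j. j \<le> 2 ^ p \<Longrightarrow> \<bar>\<Sum>b<j. D b \<omega>\<bar> \<le> R \<omega>"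
    "expectation R \<le> (real p + 1) * sqrt (\<Sum>b<2 ^ p. expectation (\<lambda>\<omega>. (D b \<omega>)\<^sup>2))" by blast
  have "(\<Sum>b<2 ^ p. expectation (\<lambda>\<omega>. (D b \<omega>)\<^sup>2)) \<le> (\<Sum>b<(2::nat) ^ p. real k * (\<delta> * Phi \<nu> n))"
  proof (rule sum_mono)
    fix b show "expectation (\<lambda>\<omega>. (D b \<omega>)\<^sup>2) \<le> real k * (\<delta> * Phi \<nu> n)"
      using deviation_block_square[of "{b * k..<b * k + k}"] by (simp add: D_def)
  qed
  then have "expectation R \<le> (real p + 1) * sqrt (2 ^ p * real k * \<delta> * Phi \<nu> n)"
    by (intro order_trans[OF R(3)] mult_left_mono real_sqrt_le_mono) (auto simp: mult_ac)
  moreover have "\<bar>\<Sum>i<j * k. deviation n \<delta> i \<omega>\<bar> \<le> R \<omega>" if "j \<le> 2 ^ p" for j \<omega>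
    using R(2)[OF that, of \<omega>] by (simp add: D_def sum.nat_group)
  ultimately show ?thesis using R(1) by blast
qed

end

declare grid_measurable [measurable del] qbar_m [measurable del]

end

text \<open>Approximate the time from the right by multiples of \<open>1 / Suc k\<close>, of which
  there are countably many. The clipping at 0 extends the process to all real times.\<close>

lemma right_continuous_joint_measurable:
  fixes S :: "real \<Rightarrow> 'a \<Rightarrow> real"
  assumes X[measurable]: "\<And>t. 0 \<le> t \<Longrightarrow> S t \<in> borel_measurable M"
    and right: "\<And>\<omega> t. \<omega> \<in> space M \<Longrightarrow> 0 \<le> t \<Longrightarrow> ((\<lambda>t. S t \<omega>) \<longlongrightarrow> S t \<omega>) (at_right t)"
  shows "(\<lambda>z. S (max 0 (snd z)) (fst z)) \<in> borel_measurable (M \<Otimes>\<^sub>M borel)"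
proof (rule borel_measurable_LIMSEQ_metric)
  define g where "g k z = \<lfloor>real (Suc k) * max 0 (snd z)\<rfloor>" for k :: nat and z :: "'a \<times> real"
  define f where "f k (i::int) z = S (max 0 ((of_int i + 1) / real (Suc k))) (fst z)" for k :: nat and i and z :: "'a \<times> real"
  show "(\<lambda>z. f k (g k z) z) \<in> borel_measurable (M \<Otimes>\<^sub>M borel)" for k
  proof (rule measurable_compose_countable)
    show "f k i \<in> borel_measurable (M \<Otimes>\<^sub>M borel)" for i
      unfolding f_def by (rule measurable_compose[OF measurable_fst X]) simp
    show "g k \<in> M \<Otimes>\<^sub>M borel \<rightarrow>\<^sub>M count_space UNIV"
      unfolding g_def[abs_def] by measurable
  qed
  fix z :: "'a \<times> real" assume "z \<in> space (M \<Otimes>\<^sub>M borel)"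
  then have \<omega>: "fst z \<in> space M" by (auto simp: space_pair_measure)
  define s where "s = max 0 (snd z)"
  \<comment> \<open>Floor plus one rather than the ceiling: the filter \<open>at_right s\<close>
    excludes \<open>s\<close> itself, so the approximation has to be strictly larger.\<close>
  define t where "t k = (of_int \<lfloor>real (Suc k) * s\<rfloor> + 1) / real (Suc k)" for k
  have t: "s < t k" "t k \<le> s + 1 / real (Suc k)" for k
  proof -
    have "real (Suc k) * s < of_int \<lfloor>real (Suc k) * s\<rfloor> + 1" "of_int \<lfloor>real (Suc k) * s\<rfloor> \<le> real (Suc k) * s" by linarith+
    then show "s < t k" "t k \<le> s + 1 / real (Suc k)" by (auto simp: t_def field_simps simp del: of_nat_Suc)
  qed
  have "(\<lambda>k. s + 1 / real (Suc k)) \<longlonglongrightarrow> s + 0" by (intro tendsto_intros LIMSEQ_inverse_real_of_nat[unfolded inverse_eq_divide])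
  then have "t \<longlonglongrightarrow> s"
    by (intro tendsto_sandwich[of "\<lambda>_. s" t sequentially "\<lambda>k. s + 1 / real (Suc k)"])
       (auto intro!: always_eventually less_imp_le t simp del: of_nat_Suc)
  then have "filterlim t (at_right s) sequentially"
    unfolding filterlim_at using t(1) by (auto intro!: always_eventually simp: less_imp_neq[symmetric])
  moreover have "((\<lambda>t. S t (fst z)) \<longlongrightarrow> S s (fst z)) (at_right s)"
    using right[OF \<omega>] by (simp add: s_def)
  ultimately have "(\<lambda>k. S (t k) (fst z)) \<longlonglongrightarrow> S s (fst z)" by (rule filterlim_compose[rotated])
  moreover have "f k (g k z) z = S (t k) (fst z)" for k
  proof -
    have "0 \<le> t k" using t(1)[of k] by (simp add: s_def)
    then show ?thesis by (simp add: f_def g_def t_def s_def max_def)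
  qed
  ultimately show "(\<lambda>k. f k (g k z) z) \<longlonglongrightarrow> S (max 0 (snd z)) (fst z)" by (simp add: s_def)
qed

context occupancy
begin

lemma S_joint_measurable:
  "(\<lambda>z. S (max 0 (snd z)) (fst z)) \<in> borel_measurable (M \<Otimes>\<^sub>M borel)"
  by (rule right_continuous_joint_measurable)
     (use increasing_path.cadlag[OF increasing_path_S] in \<open>auto simp: cadlag_def\<close>)

lemma S_joint_measurable' [measurable (raw)]:
  assumes "f \<in> N \<rightarrow>\<^sub>M M" "g \<in> borel_measurable N"
  shows "(\<lambda>x. S (max 0 (g x)) (f x)) \<in> borel_measurable N"
  using measurable_compose[OF measurable_Pair[OF assms] S_joint_measurable] by simp

section \<open>The compensator\<close>

definition intensity :: "real \<Rightarrow> 'a \<Rightarrow> real \<Rightarrow> real" where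
  "intensity n \<omega> s = Phi \<nu> (n * exp (- S (max 0 s) \<omega>))"

definition compensator :: "real \<Rightarrow> real \<Rightarrow> 'a \<Rightarrow> real" where
  "compensator n t \<omega> = integral {0..t} (intensity n \<omega>)"

lemma intensity_measurable: "\<omega> \<in> space M \<Longrightarrow> intensity n \<omega> \<in> borel_measurable borel"
  unfolding intensity_def[abs_def] by measurable

lemma intensity_bounds:
  assumes "0 < n" "\<omega> \<in> space M"
  shows "0 \<le> intensity n \<omega> s" "intensity n \<omega> s \<le> Phi \<nu> n"
    "0 \<le> s \<Longrightarrow> s \<le> t \<Longrightarrow> intensity n \<omega> t \<le> intensity n \<omega> s"
  using S_nonneg[OF assms(2), of "max 0 s"] S_mono[OF assms(2), of s t] assms(1)
  by (auto simp: intensity_def intro!: Phi_nonneg Phi_mono)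

lemma set_integrable_intensity:
  assumes "0 < n" "\<omega> \<in> space M" shows "set_integrable lborel {0..t} (intensity n \<omega>)"
proof -
  have [measurable]: "intensity n \<omega> \<in> borel_measurable borel" by (rule intensity_measurable[OF assms(2)])
  show ?thesis unfolding set_integrable_def
    by (rule integrableI_bounded_set_indicator[where B="Phi \<nu> n"])
       (use intensity_bounds(1,2)[OF assms] in \<open>auto simp: emeasure_lborel_Icc_eq\<close>)
qed

lemma integrable_intensity: "0 < n \<Longrightarrow> \<omega> \<in> space M \<Longrightarrow> intensity n \<omega> integrable_on {0..t}"
  by (rule set_borel_integral_eq_integral(1)[OF set_integrable_intensity])

lemma compensator_measurable [measurable]: assumes "0 < n" shows "compensator n t \<in> borel_measurable M"
proof -
  have "(\<lambda>\<omega>. \<integral>s. indicator {0..t} s *\<^sub>R intensity n \<omega> s \<partial>lborel) \<in> borel_measurable M"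
    unfolding intensity_def by measurable
  then show ?thesis
    by (rule measurable_cong[THEN iffD1, rotated])
       (simp add: compensator_def set_borel_integral_eq_integral(2)[OF set_integrable_intensity[OF assms], symmetric] set_lebesgue_integral_def)
qed

lemma compensator_le:
  assumes "0 < n" "\<omega> \<in> space M" "0 \<le> s" "s \<le> t"
  shows "compensator n s \<omega> \<le> compensator n t \<omega>" "compensator n t \<omega> \<le> compensator n s \<omega> + (t - s) * Phi \<nu> n"
proof -
  have split: "compensator n t \<omega> = compensator n s \<omega> + integral {s..t} (intensity n \<omega>)"
    unfolding compensator_def
    by (rule Henstock_Kurzweil_Integration.integral_combine[symmetric, OF assms(3,4) integrable_intensity[OF assms(1,2)]])
  have i: "intensity n \<omega> integrable_on {s..t}"
    by (rule integrable_subinterval_real[OF integrable_intensity[OF assms(1,2), of t]]) (use assms in auto)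
  have "0 \<le> integral {s..t} (intensity n \<omega>)"
    by (rule integral_nonneg[OF i]) (rule intensity_bounds[OF assms(1,2)])
  moreover have "integral {s..t} (intensity n \<omega>) \<le> integral {s..t} (\<lambda>_. Phi \<nu> n)"
    by (rule integral_le[OF i integrable_const_ivl]) (rule intensity_bounds[OF assms(1,2)])
  moreover have "integral {s..t} (\<lambda>_. Phi \<nu> n) = (t - s) * Phi \<nu> n" using assms by (simp add: integral_const_real)
  ultimately show "compensator n s \<omega> \<le> compensator n t \<omega>" "compensator n t \<omega> \<le> compensator n s \<omega> + (t - s) * Phi \<nu> n"
    using split by auto
qed

text \<open>Two errors of order \<open>\<delta>\<close>: replacing each \<open>qbar\<close> by
  \<open>\<delta>\<close> times the intensity costs order \<open>\<delta>\<^sup>2\<close> per cell,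
  and the Riemann sum of the decreasing intensity costs at most
  \<open>\<delta> * Phi \<nu> n\<close>.\<close>

lemma qbar_sum_compensator:
  assumes n: "0 < n" and \<delta>: "0 < \<delta>" and \<omega>: "\<omega> \<in> space M"
  shows "\<bar>(\<Sum>i<j. qbar n \<delta> (S (real i * \<delta>) \<omega>)) - compensator n (real j * \<delta>) \<omega>\<bar> \<le>
    \<delta> * (real j * \<delta> * ((laplace_exponent 1)\<^sup>2 * exp (4 * n)) + Phi \<nu> n)"
proof -
  let ?C = "(laplace_exponent 1)\<^sup>2 * exp (4 * n)"
  have s0: "0 \<le> S (real i * \<delta>) \<omega>" for i using \<delta> by (intro S_nonneg[OF \<omega>]) simp
  have int: "intensity n \<omega> (real i * \<delta>) = Phi \<nu> (n * exp (- S (real i * \<delta>) \<omega>))" for i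
    using \<delta> by (simp add: intensity_def)
  have r: "\<bar>compensator n (real j * \<delta>) \<omega> - (\<Sum>i<j. \<delta> * intensity n \<omega> (real i * \<delta>))\<bar> \<le> \<delta> * intensity n \<omega> 0"
    unfolding compensator_def
    by (rule riemann_sum_decreasing) (use intensity_bounds[OF n \<omega>] integrable_intensity[OF n \<omega>] \<delta> in auto)
  have q: "\<bar>qbar n \<delta> (S (real i * \<delta>) \<omega>) - \<delta> * intensity n \<omega> (real i * \<delta>)\<bar> \<le> \<delta>\<^sup>2 * ?C" for i
    using qbar_Phi[OF n less_imp_le[OF \<delta>] s0[of i]] unfolding int by (simp add: abs_le_iff)
  have "\<bar>(\<Sum>i<j. qbar n \<delta> (S (real i * \<delta>) \<omega>)) - (\<Sum>i<j. \<delta> * intensity n \<omega> (real i * \<delta>))\<bar> \<le> (\<Sum>i<j. \<delta>\<^sup>2 * ?C)"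
    unfolding sum_subtractf[symmetric] by (rule order_trans[OF sum_abs], rule sum_mono) (rule q)
  moreover have "\<delta> * intensity n \<omega> 0 \<le> \<delta> * Phi \<nu> n"
    using \<delta> intensity_bounds(2)[OF n \<omega>] by (intro mult_left_mono) auto
  ultimately have "\<bar>(\<Sum>i<j. qbar n \<delta> (S (real i * \<delta>) \<omega>)) - compensator n (real j * \<delta>) \<omega>\<bar> \<le>
      real j * (\<delta>\<^sup>2 * ?C) + \<delta> * Phi \<nu> n"
    using r by simp
  also have "\<dots> = \<delta> * (real j * \<delta> * ?C + Phi \<nu> n)" by (simp add: power2_eq_square algebra_simps)
  finally show ?thesis .
qed

section \<open>No Poisson point in the closed range\<close>

lemma AE_small_exceptions:
  assumes "\<And>\<epsilon>. 0 < \<epsilon> \<Longrightarrow> \<exists>E\<in>events. {\<omega> \<in> space M. \<not> R \<omega>} \<subseteq> E \<and> prob E \<le> \<epsilon>"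
  shows "AE \<omega> in M. R \<omega>"
proof -
  have "\<exists>E\<in>events. {\<omega> \<in> space M. \<not> R \<omega>} \<subseteq> E \<and> prob E \<le> 1 / real (Suc k)" for k
    by (rule assms) simp
  then obtain E where E: "\<And>k. E k \<in> events" "\<And>k. {\<omega> \<in> space M. \<not> R \<omega>} \<subseteq> E k" "\<And>k. prob (E k) \<le> 1 / real (Suc k)"
    by metis
  \<comment> \<open>The exceptional set itself may fail to be measurable; it is only contained in
    this null set.\<close>
  let ?N = "\<Inter>k. E k"
  have N: "?N \<in> events" using E(1) by auto
  have "prob ?N \<le> 1 / real (Suc k)" for k
    using finite_measure_mono[of ?N "E k"] E(1)[of k] E(3)[of k] by (meson INT_lower UNIV_I order_trans)
  then have "prob ?N \<le> 0"
    by (intro LIMSEQ_le_const[OF LIMSEQ_inverse_real_of_nat[unfolded inverse_eq_divide]]) auto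
  then have "emeasure M ?N = 0" by (simp add: emeasure_eq_measure measure_le_0_iff)
  then show ?thesis using E(2) N by (intro AE_I[of _ _ ?N]) auto
qed

lemma void_le: assumes "0 < n" "0 \<le> a" "a \<le> b" shows "void n a b \<le> n * (b - a)"
proof -
  have "1 - exp (- (b - a)) \<le> b - a" by (rule one_minus_exp_bounds)
  moreover have "exp (- a) * (1 - exp (- (b - a))) \<le> 1 - exp (- (b - a))"
    using assms mult_right_mono[of "exp (- a)" 1 "1 - exp (- (b - a))"] by simp
  moreover have "exp (- a) - exp (- b) = exp (- a) * (1 - exp (- (b - a)))"
    by (simp add: algebra_simps exp_add[symmetric])
  ultimately have "exp (- a) - exp (- b) \<le> b - a" by (metis order_trans)
  then have "n * (exp (- a) - exp (- b)) \<le> n * (b - a)" using assms by (intro mult_left_mono) auto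
  moreover have "void n a b \<le> n * (exp (- a) - exp (- b))"
    unfolding void_def using one_minus_exp_bounds(3)[of "n * (exp (- a) - exp (- b))"] by simp
  ultimately show ?thesis by linarith
qed

lemma integral_hit_le:
  assumes n: "0 < n" and [measurable]: "a \<in> borel_measurable paths" "b \<in> borel_measurable paths"
    "l \<in> borel_measurable M"
    and ab: "\<And>\<omega>. \<omega> \<in> space M \<Longrightarrow> 0 \<le> a (path \<omega>) \<and> a (path \<omega>) \<le> b (path \<omega>)"
    and l: "\<And>\<omega>. \<omega> \<in> space M \<Longrightarrow> b (path \<omega>) - a (path \<omega>) \<le> l \<omega>" "\<And>\<omega>. \<omega> \<in> space M \<Longrightarrow> \<bar>l \<omega>\<bar> \<le> K"
  shows "(\<integral>\<omega>. of_bool (P n \<omega> \<inter> {a (path \<omega>)<..<b (path \<omega>)} \<noteq> {}) \<partial>M) \<le> n * (\<integral>\<omega>. l \<omega> \<partial>M)"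
proof -
  have "(\<integral>\<omega>. (1::real) * of_bool (P n \<omega> \<inter> {a (path \<omega>)<..<b (path \<omega>)} \<noteq> {}) \<partial>M) =
      (\<integral>\<omega>. 1 * void n (a (path \<omega>)) (b (path \<omega>)) \<partial>M)"
    by (rule integral_hit[where u="\<lambda>_. 1", OF n]) (use ab in auto)
  also have "\<dots> \<le> (\<integral>\<omega>. n * l \<omega> \<partial>M)"
  proof (rule integral_mono)
    have v: "\<bar>void n (a (path \<omega>)) (b (path \<omega>))\<bar> \<le> 1" if "\<omega> \<in> space M" for \<omega>
      using ab[OF that] theta_bounds[of n] n by (simp add: void_theta)
    show "integrable M (\<lambda>\<omega>. 1 * void n (a (path \<omega>)) (b (path \<omega>)))"
      by (rule integrable_bounded[where K=1]) (use v in \<open>auto simp: void_def\<close>)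
    show "integrable M (\<lambda>\<omega>. n * l \<omega>)" using l(2) by (intro integrable_mult_right integrable_bounded[where K=K]) auto
    fix \<omega> assume \<omega>: "\<omega> \<in> space M"
    have "void n (a (path \<omega>)) (b (path \<omega>)) \<le> n * (b (path \<omega>) - a (path \<omega>))" using ab[OF \<omega>] by (intro void_le n) auto
    also have "\<dots> \<le> n * l \<omega>" using n l(1)[OF \<omega>] by (intro mult_left_mono) auto
    finally show "1 * void n (a (path \<omega>)) (b (path \<omega>)) \<le> n * l \<omega>" by simp
  qed
  finally show ?thesis by simp
qed

text \<open>Given the path, a window of half width \<open>h\<close> around the level is hit with
  probability at most \<open>2 * h * n\<close>, because the intensity is bounded by
  \<open>n\<close>; and \<open>h\<close> is arbitrary.\<close>

lemma AE_grid_not_in_P: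
  assumes n: "0 < n" and t: "0 \<le> t" shows "AE \<omega> in M. S t \<omega> \<notin> P n \<omega>"
proof (rule AE_small_exceptions)
  fix \<epsilon> :: real assume \<epsilon>: "0 < \<epsilon>"
  define h where "h = \<epsilon> / (2 * n)"
  have h: "0 < h" using \<epsilon> n by (simp add: h_def)
  have [measurable]: "(\<lambda>s. s t) \<in> borel_measurable paths" using t by (rule paths_component)
  define a where "a s = max 0 (s t - h)" for s :: "real \<Rightarrow> real"
  define b where "b s = s t + h" for s :: "real \<Rightarrow> real"
  have [measurable]: "a \<in> borel_measurable paths" "b \<in> borel_measurable paths" by (simp_all add: a_def[abs_def] b_def[abs_def])
  have ab: "0 \<le> a (path \<omega>) \<and> a (path \<omega>) \<le> b (path \<omega>)" if "\<omega> \<in> space M" for \<omega>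
    using S_nonneg[OF that t] t h by (simp add: a_def b_def)
  define E where "E = {\<omega> \<in> space M. P n \<omega> \<inter> {a (path \<omega>)<..<b (path \<omega>)} \<noteq> {}}"
  have m: "(\<lambda>\<omega>. of_bool (P n \<omega> \<inter> {a (path \<omega>)<..<b (path \<omega>)} \<noteq> {}) :: real) \<in> borel_measurable M"
    by (rule hit_measurable[OF n]) (use ab in auto)
  have ind: "indicator E \<omega> = (of_bool (P n \<omega> \<inter> {a (path \<omega>)<..<b (path \<omega>)} \<noteq> {}) :: real)" if "\<omega> \<in> space M" for \<omega>
    using that by (simp add: E_def indicator_def)
  have "(indicator E :: _ \<Rightarrow> real) \<in> borel_measurable M"
    using m by (rule measurable_cong[THEN iffD1, rotated]) (simp add: ind)
  then have E: "E \<in> events" unfolding borel_measurable_indicator_iff by (simp add: E_def Int_absorb2 Collect_restrict)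
  have "prob E = (\<integral>\<omega>. indicator E \<omega> \<partial>M)" using E by simp
  also have "\<dots> = (\<integral>\<omega>. of_bool (P n \<omega> \<inter> {a (path \<omega>)<..<b (path \<omega>)} \<noteq> {}) \<partial>M)"
    by (intro Bochner_Integration.integral_cong refl) (rule ind)
  also have "\<dots> \<le> n * (\<integral>\<omega>. 2 * h \<partial>M)"
    by (rule integral_hit_le[where K="2 * h"]) (use n h t ab in \<open>auto simp: a_def b_def\<close>)
  also have "\<dots> = \<epsilon>" using n by (simp add: prob_space h_def)
  finally have "prob E \<le> \<epsilon>" .
  moreover have "{\<omega> \<in> space M. \<not> S t \<omega> \<notin> P n \<omega>} \<subseteq> E"
  proof clarsimp
    fix \<omega> assume \<omega>: "\<omega> \<in> space M" "S t \<omega> \<in> P n \<omega>"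
    then have "0 < S t \<omega>" using P_pos[OF n \<omega>(1)] by auto
    then have "S t \<omega> \<in> {a (path \<omega>)<..<b (path \<omega>)}" using h t by (simp add: a_def b_def)
    then show "\<omega> \<in> E" using \<omega> unfolding E_def by blast
  qed
  ultimately show "\<exists>E\<in>events. {\<omega> \<in> space M. \<not> S t \<omega> \<notin> P n \<omega>} \<subseteq> E \<and> prob E \<le> \<epsilon>" using E by blast
qed

text \<open>The inequality \<open>min 1 y \<le> 2 * (1 - exp (- y))\<close> at
  \<open>y = m * S (t - s)\<close> turns a truncated mean into a Laplace transform. After division
  by \<open>m\<close> the exponent is small by sublinearity.\<close>

lemma integral_min_increment:
  assumes "0 \<le> s" "s \<le> t" "0 < m"
  shows "(\<integral>\<omega>. min (1 / real m) (S t \<omega> - S s \<omega>) \<partial>M) \<le> 2 * (t - s) * (laplace_exponent (real m) / real m)"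
proof -
  have [measurable]: "S s \<in> borel_measurable M" "S t \<in> borel_measurable M" "S (t - s) \<in> borel_measurable M" using assms by auto
  have min_le: "min 1 y \<le> 2 * (1 - exp (- y))" if "0 \<le> y" for y :: real
  proof -
    have "exp (- y) * (1 + y) \<le> exp (- y) * exp y" by (intro mult_left_mono exp_ge_add_one_self) auto
    also have "\<dots> = 1" by (simp add: exp_minus)
    finally have "exp (- y) \<le> 1 / (1 + y)" using that by (simp add: field_simps)
    moreover have "min 1 y \<le> 2 * (1 - 1 / (1 + y))"
    proof (cases "y \<le> 1")
      case True
      then have "y * y \<le> 1 * y" using that by (intro mult_right_mono)
      then show ?thesis using that True by (simp add: field_simps)
    next
      case False
      then show ?thesis by (simp add: field_simps)
    qed
    moreover have "2 * (1 - 1 / (1 + y)) \<le> 2 * (1 - exp (- y))" using calculation(1) by simp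
    ultimately show ?thesis by (meson order_trans)
  qed
  have "(\<integral>\<omega>. min (1 / real m) (S t \<omega> - S s \<omega>) \<partial>M) =
      (\<integral>x. min (1 / real m) x \<partial>distr M borel (\<lambda>\<omega>. S t \<omega> - S s \<omega>))"
    by (rule integral_distr[symmetric]) auto
  also have "\<dots> = (\<integral>\<omega>. min (1 / real m) (S (t - s) \<omega>) \<partial>M)"
    unfolding increments_stationary[OF assms(1,2)] by (rule integral_distr) auto
  also have "\<dots> \<le> (\<integral>\<omega>. 2 / real m * (1 - exp (- (real m * S (t - s) \<omega>))) \<partial>M)"
  proof (rule integral_mono)
    have nn: "0 \<le> S (t - s) \<omega>" if "\<omega> \<in> space M" for \<omega> using S_nonneg[OF that] assms by simp
    show "integrable M (\<lambda>\<omega>. min (1 / real m) (S (t - s) \<omega>))"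
      by (rule integrable_bounded[where K="1 / real m"]) (use nn in auto)
    show "integrable M (\<lambda>\<omega>. 2 / real m * (1 - exp (- (real m * S (t - s) \<omega>))))"
      by (intro integrable_mult_right integrable_bounded[where K=1]) (use nn in auto)
    fix \<omega> assume "\<omega> \<in> space M"
    then have "min 1 (real m * S (t - s) \<omega>) \<le> 2 * (1 - exp (- (real m * S (t - s) \<omega>)))"
      using nn by (intro min_le) auto
    then show "min (1 / real m) (S (t - s) \<omega>) \<le> 2 / real m * (1 - exp (- (real m * S (t - s) \<omega>)))"
      using assms(3) by (auto simp: min_def field_simps split: if_splits)
  qed
  also have "\<dots> = 2 / real m * (1 - exp (- ((t - s) * laplace_exponent (real m))))"
  proof -
    have "integrable M (\<lambda>\<omega>. exp (- (real m * S (t - s) \<omega>)))"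
      by (rule integrable_bounded[where K=1]) (use S_nonneg assms in auto)
    then show ?thesis using laplace_transform[of "t - s" "real m"] assms by (simp add: prob_space)
  qed
  also have "\<dots> \<le> 2 / real m * ((t - s) * laplace_exponent (real m))"
    by (intro mult_left_mono one_minus_exp_bounds) simp
  also have "\<dots> = 2 * (t - s) * (laplace_exponent (real m) / real m)"
    by (simp only: times_divide_eq_left times_divide_eq_right mult.assoc)
  finally show ?thesis .
qed

text \<open>A bad point lies, for every fine dyadic grid, within \<open>1 / m\<close> of an end
  value of its cell. For every mesh the expected number of such edge intervals that are hit is at
  most \<open>4 * n * T * laplace_exponent m / m\<close>, which is small for large \<open>m\<close>
  because there is no drift.\<close>

lemma AE_all_in_gaps:
  assumes n: "0 < n" and T: "0 < T"
  shows "AE \<omega> in M. increasing_path.all_in_gaps (\<lambda>t. S t \<omega>) (P n \<omega>) T"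
proof -
  define grid where "grid q i = real i * (T / 2 ^ q)" for q i :: nat
  have grid0: "0 \<le> grid q i" "grid q i \<le> grid q (Suc i)" "grid q (Suc i) - grid q i = T / 2 ^ q" for q i
    using T by (auto simp: grid_def field_simps)
  have [measurable]: "S (grid q i) \<in> borel_measurable M" "(\<lambda>s. s (grid q i)) \<in> borel_measurable paths" for q i
    using grid0 by (auto intro: paths_component)
  have gpath: "path \<omega> (grid q i) = S (grid q i) \<omega>" for \<omega> q i using grid0 by simp
  have "AE \<omega> in M. \<forall>q i. S (grid q i) \<omega> \<notin> P n \<omega>"
    unfolding AE_all_countable using AE_grid_not_in_P[OF n grid0(1)] by blast
  moreover have "AE \<omega> in M. (\<forall>q i. S (grid q i) \<omega> \<notin> P n \<omega>) \<longrightarrow>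
      increasing_path.all_in_gaps (\<lambda>t. S t \<omega>) (P n \<omega>) T"
  proof (rule AE_small_exceptions)
    fix \<epsilon> :: real assume \<epsilon>: "0 < \<epsilon>"
    \<comment> \<open>The 4 comes from two edges per cell and the factor 2 in
      \<open>integral_min_increment\<close>.\<close>
    have "(\<lambda>m. 4 * n * T * (laplace_exponent (real m) / real m)) \<longlonglongrightarrow> 4 * n * T * 0"
      by (intro tendsto_intros laplace_exponent_sublinear)
    then have "\<forall>\<^sub>F m in sequentially. 4 * n * T * (laplace_exponent (real m) / real m) < \<epsilon>"
      using \<epsilon> by (intro order_tendstoD) auto
    then have "\<forall>\<^sub>F m in sequentially. 4 * n * T * (laplace_exponent (real m) / real m) < \<epsilon> \<and> 0 < m"
      using eventually_gt_at_top[of 0] by eventually_elim simp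
    then obtain m where m: "4 * n * T * (laplace_exponent (real m) / real m) < \<epsilon>" "0 < m"
      by (metis (no_types, lifting) eventually_sequentially order_refl)
    define \<eta> where "\<eta> = 1 / real m"
    have \<eta>: "0 < \<eta>" using m by (simp add: \<eta>_def)
    define a1 b1 a2 b2 where "a1 q i s = s (grid q i)" and "b1 q i s = min (s (grid q i) + \<eta>) (s (grid q (Suc i)))"
      and "a2 q i s = max (s (grid q i)) (s (grid q (Suc i)) - \<eta>)" and "b2 q i s = s (grid q (Suc i))"
      for q i :: nat and s :: "real \<Rightarrow> real"
    have m12[measurable]: "a1 q i \<in> borel_measurable paths" "b1 q i \<in> borel_measurable paths"
        "a2 q i \<in> borel_measurable paths" "b2 q i \<in> borel_measurable paths" for q i
      by (simp_all add: a1_def[abs_def] b1_def[abs_def] a2_def[abs_def] b2_def[abs_def])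
    define l where "l q i \<omega> = min (1 / real m) (S (grid q (Suc i)) \<omega> - S (grid q i) \<omega>)" for q i \<omega>
    have [measurable]: "l q i \<in> borel_measurable M" for q i by (simp add: l_def[abs_def])
    have gm: "0 \<le> S (grid q i) \<omega>" "S (grid q i) \<omega> \<le> S (grid q (Suc i)) \<omega>" if "\<omega> \<in> space M" for \<omega> q i
      using S_nonneg[OF that grid0(1)] S_mono[OF that grid0(1,2)] by auto
    have ab: "0 \<le> a1 q i (path \<omega>) \<and> a1 q i (path \<omega>) \<le> b1 q i (path \<omega>)"
        "0 \<le> a2 q i (path \<omega>) \<and> a2 q i (path \<omega>) \<le> b2 q i (path \<omega>)"
        "b1 q i (path \<omega>) - a1 q i (path \<omega>) \<le> l q i \<omega>" "b2 q i (path \<omega>) - a2 q i (path \<omega>) \<le> l q i \<omega>"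
        "\<bar>l q i \<omega>\<bar> \<le> \<eta>" if "\<omega> \<in> space M" for \<omega> q i
      using gm[OF that, of q i] \<eta> by (auto simp: a1_def b1_def a2_def b2_def gpath l_def \<eta>_def[symmetric])
    define h1 h2 :: "nat \<Rightarrow> nat \<Rightarrow> 'a \<Rightarrow> real"
      where "h1 q i \<omega> = of_bool (P n \<omega> \<inter> {a1 q i (path \<omega>)<..<b1 q i (path \<omega>)} \<noteq> {})"
        and "h2 q i \<omega> = of_bool (P n \<omega> \<inter> {a2 q i (path \<omega>)<..<b2 q i (path \<omega>)} \<noteq> {})" for q i \<omega>
    have hm[measurable]: "h1 q i \<in> borel_measurable M" "h2 q i \<in> borel_measurable M" for q i
      unfolding h1_def[abs_def] h2_def[abs_def] using ab by (intro hit_measurable n m12; blast)+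
    have hb: "0 \<le> h1 q i \<omega>" "h1 q i \<omega> \<le> 1" "0 \<le> h2 q i \<omega>" "h2 q i \<omega> \<le> 1" for q i \<omega>
      by (auto simp: h1_def h2_def)
    have hi: "integrable M (h1 q i)" "integrable M (h2 q i)" for q i
      by (rule integrable_bounded[where K=1]; use hb in simp)+
    have Eh: "(\<integral>\<omega>. h1 q i \<omega> \<partial>M) + (\<integral>\<omega>. h2 q i \<omega> \<partial>M) \<le> 4 * n * (T / 2 ^ q) * (laplace_exponent (real m) / real m)" for q i
    proof -
      have "(\<integral>\<omega>. h1 q i \<omega> \<partial>M) \<le> n * (\<integral>\<omega>. l q i \<omega> \<partial>M)" unfolding h1_def
        by (rule integral_hit_le[where K=\<eta>]) (use n ab in auto)
      moreover have "(\<integral>\<omega>. h2 q i \<omega> \<partial>M) \<le> n * (\<integral>\<omega>. l q i \<omega> \<partial>M)" unfolding h2_def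
        by (rule integral_hit_le[where K=\<eta>]) (use n ab in auto)
      moreover have "n * (\<integral>\<omega>. l q i \<omega> \<partial>M) \<le> n * (2 * (T / 2 ^ q) * (laplace_exponent (real m) / real m))"
        unfolding l_def using integral_min_increment[OF grid0(1,2) m(2), of q i] n
        by (intro mult_left_mono) (simp_all only: grid0(3))
      moreover have "4 * n * a * b = n * (2 * a * b) + n * (2 * a * b)" for a b by simp
      from this[of "T / 2 ^ q" "laplace_exponent (real m) / real m"] show ?thesis
        using calculation by linarith
    qed
    define Z where "Z q \<omega> = (\<Sum>i<2 ^ q. h1 q i \<omega> + h2 q i \<omega>)" for q \<omega>
    have Zm[measurable]: "Z q \<in> borel_measurable M" for q unfolding Z_def[abs_def] by measurable
    have Zi: "integrable M (Z q)" for q unfolding Z_def[abs_def] using hi by auto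
    have Z0: "0 \<le> Z q \<omega>" for q \<omega> unfolding Z_def using hb by (intro sum_nonneg) (simp add: add_nonneg_nonneg)
    define H where "H q = {\<omega> \<in> space M. 1 \<le> Z q \<omega>}" for q
    have H[measurable]: "H q \<in> events" for q unfolding H_def by measurable
    have PH: "prob (H q) \<le> \<epsilon>" for q
    proof -
      have "prob (H q) = (\<integral>\<omega>. indicator (H q) \<omega> \<partial>M)" by simp
      also have "\<dots> \<le> (\<integral>\<omega>. Z q \<omega> \<partial>M)"
      proof (rule integral_mono)
        show "integrable M (indicator (H q) :: _ \<Rightarrow> real)" by (simp add: emeasure_eq_measure)
        show "indicator (H q) \<omega> \<le> Z q \<omega>" for \<omega> using Z0[of q \<omega>] by (auto simp: H_def indicator_def)
      qed (rule Zi)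
      also have "\<dots> = (\<Sum>i<2 ^ q. (\<integral>\<omega>. h1 q i \<omega> \<partial>M) + (\<integral>\<omega>. h2 q i \<omega> \<partial>M))"
        unfolding Z_def using hi by simp
      also have "\<dots> \<le> (\<Sum>i<(2::nat) ^ q. 4 * n * (T / 2 ^ q) * (laplace_exponent (real m) / real m))"
        by (rule sum_mono) (rule Eh)
      also have "\<dots> = 4 * n * T * (laplace_exponent (real m) / real m)" by simp
      finally show ?thesis using m by simp
    qed
    \<comment> \<open>A bad outcome lies in \<open>H q\<close> for all large \<open>q\<close>, so
      these intersections increase to an event that contains all bad outcomes off the grid
      exceptions. Each of them has probability at most \<open>\<epsilon>\<close>.\<close>
    define B where "B q0 = (\<Inter>q\<in>{q0..}. H q)" for q0
    have B: "B q0 \<in> events" for q0 unfolding B_def by (intro sets.countable_INT) auto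
    have "incseq B" by (auto simp: incseq_def B_def)
    then have "(\<lambda>q0. prob (B q0)) \<longlonglongrightarrow> prob (\<Union>q0. B q0)" using B by (intro finite_Lim_measure_incseq) auto
    moreover have "prob (B q0) \<le> \<epsilon>" for q0
      using finite_measure_mono[of "B q0" "H q0"] PH[of q0] by (force simp: B_def)
    ultimately have "prob (\<Union>q0. B q0) \<le> \<epsilon>" by (intro LIMSEQ_le_const2) auto
    moreover have "(\<Union>q0. B q0) \<in> events" using B by auto
    moreover have "{\<omega> \<in> space M. \<not> ((\<forall>q i. S (grid q i) \<omega> \<notin> P n \<omega>) \<longrightarrow>
        increasing_path.all_in_gaps (\<lambda>t. S t \<omega>) (P n \<omega>) T)} \<subseteq> (\<Union>q0. B q0)"
    proof (rule subsetI)
      fix \<omega> assume "\<omega> \<in> {\<omega> \<in> space M. \<not> ((\<forall>q i. S (grid q i) \<omega> \<notin> P n \<omega>) \<longrightarrow>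
        increasing_path.all_in_gaps (\<lambda>t. S t \<omega>) (P n \<omega>) T)}"
      then have \<omega>: "\<omega> \<in> space M" and g: "\<forall>q i. S (grid q i) \<omega> \<notin> P n \<omega>"
        and bad: "\<not> increasing_path.all_in_gaps (\<lambda>t. S t \<omega>) (P n \<omega>) T" by simp_all
      from increasing_path.not_all_in_gaps[OF increasing_path_S[OF \<omega>] P_pos[OF n \<omega>] T bad _ \<eta>] g
      obtain q0 where q0: "\<And>q. q0 \<le> q \<Longrightarrow> \<exists>i<2 ^ q. P n \<omega> \<inter> {a1 q i (path \<omega>)<..<b1 q i (path \<omega>)} \<noteq> {} \<or>
          P n \<omega> \<inter> {a2 q i (path \<omega>)<..<b2 q i (path \<omega>)} \<noteq> {}"
        unfolding a1_def b1_def a2_def b2_def gpath grid_def[symmetric] Let_def by blast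
      have "\<omega> \<in> H q" if q: "q0 \<le> q" for q
      proof -
        obtain i where i: "i < 2 ^ q" "P n \<omega> \<inter> {a1 q i (path \<omega>)<..<b1 q i (path \<omega>)} \<noteq> {} \<or>
          P n \<omega> \<inter> {a2 q i (path \<omega>)<..<b2 q i (path \<omega>)} \<noteq> {}" using q0[OF q] by blast
        from i(2) have "h1 q i \<omega> = 1 \<or> h2 q i \<omega> = 1" unfolding h1_def h2_def by (elim disjE) simp_all
        then have one: "1 \<le> h1 q i \<omega> + h2 q i \<omega>" using hb(1)[of q i \<omega>] hb(3)[of q i \<omega>] by linarith
        have "h1 q i \<omega> + h2 q i \<omega> \<le> Z q \<omega>" unfolding Z_def
          by (rule member_le_sum) (use i hb in \<open>auto simp: add_nonneg_nonneg\<close>)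
        then show ?thesis using \<omega> one by (simp add: H_def)
      qed
      then show "\<omega> \<in> (\<Union>q0. B q0)" by (auto simp: B_def)
    qed
    ultimately show "\<exists>E\<in>events. {\<omega> \<in> space M. \<not> ((\<forall>q i. S (grid q i) \<omega> \<notin> P n \<omega>) \<longrightarrow>
        increasing_path.all_in_gaps (\<lambda>t. S t \<omega>) (P n \<omega>) T)} \<subseteq> E \<and> prob E \<le> \<epsilon>" by blast
  qed
  ultimately show ?thesis by eventually_elim blast
qed

section \<open>The count as a random variable and its maximal deviation from the compensator\<close>

lemma occupied_gaps_measurable [measurable]:
  assumes n: "0 < n" and T: "0 \<le> T"
  shows "(\<lambda>\<omega>. real (occupied_gaps (\<lambda>t. S t \<omega>) (P n \<omega>) T)) \<in> borel_measurable M"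
proof -
  have Sq[measurable]: "S (real_of_rat q) \<in> borel_measurable M" if "0 \<le> q" for q using that by simp
  have ST[measurable]: "S T \<in> borel_measurable M" using T by simp
  have ins: "Measurable.pred M (\<lambda>\<omega>. 0 \<le> r \<and> r < s \<and> s \<le> S T \<omega> \<and>
      (\<forall>q::rat. 0 \<le> q \<longrightarrow> real_of_rat q \<le> T \<longrightarrow> S (of_rat q) \<omega> \<le> r \<or> s \<le> S (of_rat q) \<omega>))" for r s
  proof -
    have "Measurable.pred M (\<lambda>\<omega>. 0 \<le> q \<longrightarrow> real_of_rat q \<le> T \<longrightarrow> S (of_rat q) \<omega> \<le> r \<or> s \<le> S (of_rat q) \<omega>)" for q :: rat
    proof (cases "0 \<le> q")
      case True
      note [measurable] = Sq[OF True]
      show ?thesis by measurable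
    qed simp
    then have [measurable]: "Measurable.pred M (\<lambda>\<omega>. \<forall>q::rat. 0 \<le> q \<longrightarrow> real_of_rat q \<le> T \<longrightarrow>
        S (of_rat q) \<omega> \<le> r \<or> s \<le> S (of_rat q) \<omega>)"
      by (rule pred_intros_countable)
    show ?thesis by measurable
  qed
  have hit: "Measurable.pred M (\<lambda>\<omega>. (0 \<le> r \<and> r < s \<and> s \<le> S T \<omega> \<and>
      (\<forall>q::rat. 0 \<le> q \<longrightarrow> real_of_rat q \<le> T \<longrightarrow> S (of_rat q) \<omega> \<le> r \<or> s \<le> S (of_rat q) \<omega>)) \<and> P n \<omega> \<inter> {r<..<s} \<noteq> {})" for r s
  proof (cases "0 \<le> r")
    case True
    have "{\<omega> \<in> space M. P n \<omega> \<inter> {r<..<s} \<noteq> {}} \<in> events"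
      by (rule prob_hit(1)[OF n rational_interval_sets[OF True]])
    then have "Measurable.pred M (\<lambda>\<omega>. P n \<omega> \<inter> {r<..<s} \<noteq> {})" by (simp add: pred_def)
    with ins[of r s] show ?thesis by (rule pred_intros_logic)
  qed simp
  have sep: "Measurable.pred M (\<lambda>\<omega>. \<exists>q::rat. 0 \<le> q \<and> real_of_rat q \<le> T \<and> s \<le> S (of_rat q) \<omega> \<and> S (of_rat q) \<omega> \<le> r)" for r s
  proof (rule pred_intros_countable)
    fix q :: rat
    show "Measurable.pred M (\<lambda>\<omega>. 0 \<le> q \<and> real_of_rat q \<le> T \<and> s \<le> S (of_rat q) \<omega> \<and> S (of_rat q) \<omega> \<le> r)"
    proof (cases "0 \<le> q")
      case True
      note [measurable] = Sq[OF True]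
      show ?thesis by measurable
    qed simp
  qed
  have k: "{\<omega> \<in> space M. k \<le> occupied_gaps (\<lambda>t. S t \<omega>) (P n \<omega>) T} \<in> events" for k
  proof -
    have p: "Measurable.pred M (\<lambda>\<omega>.
      (\<forall>i\<in>{..<k}. (0 \<le> real_of_rat (fst (l ! i)) \<and> real_of_rat (fst (l ! i)) < of_rat (snd (l ! i)) \<and> of_rat (snd (l ! i)) \<le> S T \<omega> \<and>
      (\<forall>q::rat. 0 \<le> q \<longrightarrow> real_of_rat q \<le> T \<longrightarrow> S (of_rat q) \<omega> \<le> of_rat (fst (l ! i)) \<or> of_rat (snd (l ! i)) \<le> S (of_rat q) \<omega>)) \<and>
        P n \<omega> \<inter> {of_rat (fst (l ! i)) <..< of_rat (snd (l ! i))} \<noteq> {}) \<and>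
      (\<forall>j\<in>{..<k}. \<forall>i\<in>{..<j}. \<exists>q::rat. 0 \<le> q \<and> real_of_rat q \<le> T \<and>
        real_of_rat (snd (l ! i)) \<le> S (of_rat q) \<omega> \<and> S (of_rat q) \<omega> \<le> of_rat (fst (l ! j))))"
      for l :: "(rat \<times> rat) list"
    proof -
      have "Measurable.pred M (\<lambda>\<omega>. \<forall>i\<in>{..<k}. (0 \<le> real_of_rat (fst (l ! i)) \<and> real_of_rat (fst (l ! i)) < of_rat (snd (l ! i)) \<and> of_rat (snd (l ! i)) \<le> S T \<omega> \<and>
        (\<forall>q::rat. 0 \<le> q \<longrightarrow> real_of_rat q \<le> T \<longrightarrow> S (of_rat q) \<omega> \<le> of_rat (fst (l ! i)) \<or> of_rat (snd (l ! i)) \<le> S (of_rat q) \<omega>)) \<and>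
        P n \<omega> \<inter> {of_rat (fst (l ! i)) <..< of_rat (snd (l ! i))} \<noteq> {})"
        by (intro pred_intros_finite finite_lessThan hit)
      moreover have "Measurable.pred M (\<lambda>\<omega>. \<forall>j\<in>{..<k}. \<forall>i\<in>{..<j}. \<exists>q::rat. 0 \<le> q \<and> real_of_rat q \<le> T \<and>
        real_of_rat (snd (l ! i)) \<le> S (of_rat q) \<omega> \<and> S (of_rat q) \<omega> \<le> of_rat (fst (l ! j)))"
        by (intro pred_intros_finite finite_lessThan sep)
      ultimately show ?thesis by (rule pred_intros_logic)
    qed
    have "Measurable.pred M (\<lambda>\<omega>. \<exists>l::(rat \<times> rat) list.
      (\<forall>i\<in>{..<k}. (0 \<le> real_of_rat (fst (l ! i)) \<and> real_of_rat (fst (l ! i)) < of_rat (snd (l ! i)) \<and> of_rat (snd (l ! i)) \<le> S T \<omega> \<and>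
      (\<forall>q::rat. 0 \<le> q \<longrightarrow> real_of_rat q \<le> T \<longrightarrow> S (of_rat q) \<omega> \<le> of_rat (fst (l ! i)) \<or> of_rat (snd (l ! i)) \<le> S (of_rat q) \<omega>)) \<and>
        P n \<omega> \<inter> {of_rat (fst (l ! i)) <..< of_rat (snd (l ! i))} \<noteq> {}) \<and>
      (\<forall>j\<in>{..<k}. \<forall>i\<in>{..<j}. \<exists>q::rat. 0 \<le> q \<and> real_of_rat q \<le> T \<and>
        real_of_rat (snd (l ! i)) \<le> S (of_rat q) \<omega> \<and> S (of_rat q) \<omega> \<le> of_rat (fst (l ! j))))"
      by (rule pred_intros_countable) (rule p)
    then have "{\<omega> \<in> space M. \<exists>l::(rat \<times> rat) list.
      (\<forall>i\<in>{..<k}. (0 \<le> real_of_rat (fst (l ! i)) \<and> real_of_rat (fst (l ! i)) < of_rat (snd (l ! i)) \<and> of_rat (snd (l ! i)) \<le> S T \<omega> \<and>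
      (\<forall>q::rat. 0 \<le> q \<longrightarrow> real_of_rat q \<le> T \<longrightarrow> S (of_rat q) \<omega> \<le> of_rat (fst (l ! i)) \<or> of_rat (snd (l ! i)) \<le> S (of_rat q) \<omega>)) \<and>
        P n \<omega> \<inter> {of_rat (fst (l ! i)) <..< of_rat (snd (l ! i))} \<noteq> {}) \<and>
      (\<forall>j\<in>{..<k}. \<forall>i\<in>{..<j}. \<exists>q::rat. 0 \<le> q \<and> real_of_rat q \<le> T \<and>
        real_of_rat (snd (l ! i)) \<le> S (of_rat q) \<omega> \<and> S (of_rat q) \<omega> \<le> of_rat (fst (l ! j)))} \<in> events"
      by (simp only: pred_def)
    also have "?this \<longleftrightarrow> ?thesis"
    proof (rule arg_cong[where f="\<lambda>A. A \<in> events"], rule Collect_cong, rule conj_cong[OF refl])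
      fix \<omega> assume \<omega>: "\<omega> \<in> space M"
      note path = increasing_path_S[OF \<omega>]
      show "(\<exists>l::(rat \<times> rat) list.
      (\<forall>i\<in>{..<k}. (0 \<le> real_of_rat (fst (l ! i)) \<and> real_of_rat (fst (l ! i)) < of_rat (snd (l ! i)) \<and> of_rat (snd (l ! i)) \<le> S T \<omega> \<and>
      (\<forall>q::rat. 0 \<le> q \<longrightarrow> real_of_rat q \<le> T \<longrightarrow> S (of_rat q) \<omega> \<le> of_rat (fst (l ! i)) \<or> of_rat (snd (l ! i)) \<le> S (of_rat q) \<omega>)) \<and>
        P n \<omega> \<inter> {of_rat (fst (l ! i)) <..< of_rat (snd (l ! i))} \<noteq> {}) \<and>
      (\<forall>j\<in>{..<k}. \<forall>i\<in>{..<j}. \<exists>q::rat. 0 \<le> q \<and> real_of_rat q \<le> T \<and>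
        real_of_rat (snd (l ! i)) \<le> S (of_rat q) \<omega> \<and> S (of_rat q) \<omega> \<le> of_rat (fst (l ! j)))) \<longleftrightarrow>
        k \<le> occupied_gaps (\<lambda>t. S t \<omega>) (P n \<omega>) T"
        unfolding increasing_path.le_occupied_gaps_iff[OF path P_finite[OF n \<omega>] T]
          increasing_path.inside_gap_def[OF path] Ball_def lessThan_iff ..
    qed
    finally show ?thesis .
  qed
  show ?thesis unfolding borel_measurable_iff_ge
  proof
    fix a :: real
    have "{\<omega> \<in> space M. a \<le> real (occupied_gaps (\<lambda>t. S t \<omega>) (P n \<omega>) T)} =
        {\<omega> \<in> space M. nat \<lceil>a\<rceil> \<le> occupied_gaps (\<lambda>t. S t \<omega>) (P n \<omega>) T}"
      by (simp add: nat_ceiling_le_eq)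
    then show "{\<omega> \<in> space M. a \<le> real (occupied_gaps (\<lambda>t. S t \<omega>) (P n \<omega>) T)} \<in> events" using k by (simp only:)
  qed
qed

lemma AE_cell_counts:
  assumes n: "0 < n" and T: "0 < T" and \<omega>: "\<omega> \<in> space M"
    and good: "increasing_path.all_in_gaps (\<lambda>t. S t \<omega>) (P n \<omega>) T" and j: "j \<le> 2 ^ p"
  shows "(\<lambda>q. \<Sum>i<j * 2 ^ q. occ n (T / 2 ^ (p + q)) i \<omega>) \<longlonglongrightarrow>
    real (occupied_gaps (\<lambda>t. S t \<omega>) (P n \<omega>) (real j * (T / 2 ^ p)))"
proof (rule tendsto_eventually)
  note path = increasing_path_S[OF \<omega>]
  obtain \<delta>0 where \<delta>0: "0 < \<delta>0" "\<And>\<delta> j. 0 < \<delta> \<Longrightarrow> \<delta> < \<delta>0 \<Longrightarrow> real j * \<delta> \<le> T \<Longrightarrow>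
      card {i. i < j \<and> increasing_path.cell_hit (\<lambda>t. S t \<omega>) (P n \<omega>) \<delta> i} = occupied_gaps (\<lambda>t. S t \<omega>) (P n \<omega>) (real j * \<delta>)"
    using increasing_path.cell_hits_eq_occupied_gaps[OF path P_finite[OF n \<omega>] good] by blast
  have "(\<lambda>q. T / 2 ^ p * (1 / 2) ^ q) \<longlonglongrightarrow> T / 2 ^ p * 0" by (intro tendsto_intros LIMSEQ_realpow_zero) auto
  then have "\<forall>\<^sub>F q in sequentially. T / 2 ^ p * (1 / 2) ^ q < \<delta>0" using \<delta>0 by (intro order_tendstoD) auto
  then show "\<forall>\<^sub>F q in sequentially. (\<Sum>i<j * 2 ^ q. occ n (T / 2 ^ (p + q)) i \<omega>) =
    real (occupied_gaps (\<lambda>t. S t \<omega>) (P n \<omega>) (real j * (T / 2 ^ p)))"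
  proof eventually_elim
    fix q assume q: "T / 2 ^ p * (1 / 2) ^ q < \<delta>0"
    define \<delta> where "\<delta> = T / 2 ^ (p + q)"
    have eq: "real (j * 2 ^ q) * \<delta> = real j * (T / 2 ^ p)" by (simp add: \<delta>_def power_add)
    have "real j * (T / 2 ^ p) \<le> 2 ^ p * (T / 2 ^ p)" using j T by (intro mult_right_mono) (auto simp: of_nat_le_iff[symmetric] simp del: of_nat_le_iff)
    then have le: "real (j * 2 ^ q) * \<delta> \<le> T" unfolding eq by simp
    have \<delta>: "0 < \<delta>" "\<delta> < \<delta>0" using T q by (simp_all add: \<delta>_def power_add power_one_over field_simps)
    have "(\<Sum>i<j * 2 ^ q. occ n \<delta> i \<omega>) = (\<Sum>i\<in>{i. i < j * 2 ^ q \<and> increasing_path.cell_hit (\<lambda>t. S t \<omega>) (P n \<omega>) \<delta> i}. 1)"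
      by (rule sum.mono_neutral_cong_right) (auto simp: occ_def increasing_path.cell_hit_def[OF path])
    also have "\<dots> = real (occupied_gaps (\<lambda>t. S t \<omega>) (P n \<omega>) (real j * (T / 2 ^ p)))"
      using \<delta>0(2)[OF \<delta> le] unfolding eq by simp
    finally show "(\<Sum>i<j * 2 ^ q. occ n (T / 2 ^ (p + q)) i \<omega>) =
      real (occupied_gaps (\<lambda>t. S t \<omega>) (P n \<omega>) (real j * (T / 2 ^ p)))" by (simp only: \<delta>_def)
  qed
qed

text \<open>With \<open>p\<close> fixed, each block is refined into \<open>2 ^ q\<close> cells. The
  bound of \<open>deviation_maximum\<close> does not depend on \<open>q\<close>, since the block
  lengths add up to \<open>T\<close>. As \<open>q\<close> grows, the sums of deviations converge
  almost surely to count minus compensator, and Fatou's lemma transfers the bound.\<close>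

lemma expected_maximal_deviation:
  assumes n: "0 < n" and T: "0 < T"
  shows "(\<integral>\<^sup>+\<omega>. (SUP j\<in>{..2 ^ p}. ennreal \<bar>real (occupied_gaps (\<lambda>t. S t \<omega>) (P n \<omega>) (real j * (T / 2 ^ p))) -
      compensator n (real j * (T / 2 ^ p)) \<omega>\<bar>) \<partial>M) \<le> ennreal ((real p + 1) * sqrt (T * Phi \<nu> n))"
    (is "(\<integral>\<^sup>+\<omega>. (SUP j\<in>?J. ennreal \<bar>?K j \<omega> - ?A j \<omega>\<bar>) \<partial>M) \<le> ennreal ?b")
proof -
  define \<delta> where "\<delta> q = T / 2 ^ (p + q)" for q :: nat
  have \<delta>: "0 < \<delta> q" for q using T by (simp add: \<delta>_def)
  define U where "U q j \<omega> = (\<Sum>i<j * 2 ^ q. deviation n (\<delta> q) i \<omega>)" for q j \<omega>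
  have Um[measurable]: "U q j \<in> borel_measurable M" for q j
    unfolding U_def[abs_def] using deviation_measurable[OF n \<delta>] by measurable
  have EU: "(\<integral>\<^sup>+\<omega>. (SUP j\<in>?J. ennreal \<bar>U q j \<omega>\<bar>) \<partial>M) \<le> ennreal ?b" for q
  proof -
    obtain R where R: "integrable M R" "\<And>\<omega> j. j \<le> 2 ^ p \<Longrightarrow> \<bar>U q j \<omega>\<bar> \<le> R \<omega>"
      "expectation R \<le> (real p + 1) * sqrt (2 ^ p * real (2 ^ q) * \<delta> q * Phi \<nu> n)"
      using deviation_maximum[OF n \<delta>[of q], of p "2 ^ q"] unfolding U_def by blast
    have R0: "0 \<le> R \<omega>" for \<omega> using R(2)[of 0 \<omega>] by simp
    have "(\<integral>\<^sup>+\<omega>. (SUP j\<in>?J. ennreal \<bar>U q j \<omega>\<bar>) \<partial>M) \<le> (\<integral>\<^sup>+\<omega>. ennreal (R \<omega>) \<partial>M)"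
      by (intro nn_integral_mono SUP_least ennreal_leI R(2)) auto
    also have "\<dots> = ennreal (expectation R)" by (rule nn_integral_eq_integral[OF R(1)]) (use R0 in auto)
    also have "\<dots> \<le> ennreal ?b"
      using R(3) by (intro ennreal_leI) (simp add: \<delta>_def power_add)
    finally show ?thesis .
  qed
  have lim: "AE \<omega> in M. \<forall>j\<in>?J. (\<lambda>q. U q j \<omega>) \<longlonglongrightarrow> ?K j \<omega> - ?A j \<omega>"
    using AE_all_in_gaps[OF n T] AE_space
  proof eventually_elim
    case (elim \<omega>)
    show ?case
    proof
      fix j :: nat assume "j \<in> ?J"
      then have j: "j \<le> 2 ^ p" by simp
      have t: "real (j * 2 ^ q) * \<delta> q = real j * (T / 2 ^ p)" for q by (simp add: \<delta>_def power_add)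
      let ?C = "real j * (T / 2 ^ p) * ((laplace_exponent 1)\<^sup>2 * exp (4 * n)) + Phi \<nu> n"
      have "(\<lambda>q. T / 2 ^ p * (1 / 2) ^ q * ?C) \<longlonglongrightarrow> T / 2 ^ p * 0 * ?C"
        by (intro tendsto_intros LIMSEQ_realpow_zero) auto
      then have z: "(\<lambda>q. \<delta> q * ?C) \<longlonglongrightarrow> 0" by (simp add: \<delta>_def power_add power_one_over)
      have "(\<lambda>q. (\<Sum>i<j * 2 ^ q. qbar n (\<delta> q) (S (real i * \<delta> q) \<omega>)) - ?A j \<omega>) \<longlonglongrightarrow> 0"
      proof (rule Lim_null_comparison[OF _ z], rule always_eventually, rule allI)
        fix q
        show "norm ((\<Sum>i<j * 2 ^ q. qbar n (\<delta> q) (S (real i * \<delta> q) \<omega>)) - ?A j \<omega>) \<le> \<delta> q * ?C"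
          using qbar_sum_compensator[OF n \<delta>[of q] elim(2), of "j * 2 ^ q"] unfolding t real_norm_def .
      qed
      then have "(\<lambda>q. \<Sum>i<j * 2 ^ q. qbar n (\<delta> q) (S (real i * \<delta> q) \<omega>)) \<longlonglongrightarrow> ?A j \<omega>" by (rule LIM_zero_cancel)
      from tendsto_diff[OF AE_cell_counts[OF n T elim(2,1) j] this]
      show "(\<lambda>q. U q j \<omega>) \<longlonglongrightarrow> ?K j \<omega> - ?A j \<omega>"
        by (simp add: U_def deviation_def sum_subtractf \<delta>_def)
    qed
  qed
  have "(\<integral>\<^sup>+\<omega>. (SUP j\<in>?J. ennreal \<bar>?K j \<omega> - ?A j \<omega>\<bar>) \<partial>M) \<le>
      (\<integral>\<^sup>+\<omega>. liminf (\<lambda>q. SUP j\<in>?J. ennreal \<bar>U q j \<omega>\<bar>) \<partial>M)"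
  proof (rule nn_integral_mono_AE)
    show "AE \<omega> in M. (SUP j\<in>?J. ennreal \<bar>?K j \<omega> - ?A j \<omega>\<bar>) \<le> liminf (\<lambda>q. SUP j\<in>?J. ennreal \<bar>U q j \<omega>\<bar>)"
      using lim
    proof eventually_elim
      case (elim \<omega>)
      show ?case
      proof (rule SUP_least)
        fix j assume j: "j \<in> ?J"
        have "(\<lambda>q. ennreal \<bar>U q j \<omega>\<bar>) \<longlonglongrightarrow> ennreal \<bar>?K j \<omega> - ?A j \<omega>\<bar>"
          using elim j by (intro tendsto_ennrealI tendsto_rabs) auto
        then have "ennreal \<bar>?K j \<omega> - ?A j \<omega>\<bar> = liminf (\<lambda>q. ennreal \<bar>U q j \<omega>\<bar>)"
          by (intro lim_imp_Liminf[symmetric]) auto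
        also have "\<dots> \<le> liminf (\<lambda>q. SUP j\<in>?J. ennreal \<bar>U q j \<omega>\<bar>)"
          by (intro Liminf_mono always_eventually allI SUP_upper j)
        finally show "ennreal \<bar>?K j \<omega> - ?A j \<omega>\<bar> \<le> liminf (\<lambda>q. SUP j\<in>?J. ennreal \<bar>U q j \<omega>\<bar>)" .
      qed
    qed
  qed
  also have "\<dots> \<le> liminf (\<lambda>q. \<integral>\<^sup>+\<omega>. (SUP j\<in>?J. ennreal \<bar>U q j \<omega>\<bar>) \<partial>M)"
    by (rule nn_integral_liminf) measurable
  also have "\<dots> \<le> ennreal ?b"
    using Liminf_mono[OF always_eventually[OF allI[OF EU]], of sequentially] by (simp add: Liminf_const)
  finally show ?thesis .
qed

end

section \<open>Analysis of the exponent on the logarithmic scale\<close>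

text \<open>An unnormalised Cauchy density of scale \<open>sqrt x\<close>, restricted to distances
  of at least \<open>a\<close>.\<close>

definition cauchy_kernel :: "real \<Rightarrow> real \<Rightarrow> real \<Rightarrow> real" where
  "cauchy_kernel x a u = (if a \<le> \<bar>u\<bar> then x / (u\<^sup>2 + x) else 0)"

lemma cauchy_kernel_measurable [measurable]: "cauchy_kernel x a \<in> borel_measurable borel"
  unfolding cauchy_kernel_def[abs_def] by measurable

lemma cauchy_kernel_nonneg: "0 < x \<Longrightarrow> 0 \<le> cauchy_kernel x a u"
  by (auto simp: cauchy_kernel_def intro!: divide_nonneg_pos add_nonneg_pos)

lemma cauchy_kernel_minus: "cauchy_kernel x a (- u) = cauchy_kernel x a u"
  by (simp add: cauchy_kernel_def)

text \<open>The mass of the kernel beyond \<open>Y * sqrt x\<close>, in units of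
  \<open>sqrt x\<close>; the full mass is \<open>kernel_mass 0 = pi\<close>.\<close>

definition kernel_mass :: "real \<Rightarrow> real" where "kernel_mass Y = pi - 2 * arctan Y"

lemma kernel_mass_nonneg: "0 \<le> kernel_mass Y"
  using arctan_ubound[of Y] by (simp add: kernel_mass_def)

lemma kernel_mass_tendsto: "(kernel_mass \<longlongrightarrow> 0) at_top"
proof -
  have "((\<lambda>Y. pi - 2 * arctan Y) \<longlongrightarrow> pi - 2 * (pi / 2)) at_top"
    by (intro tendsto_intros tendsto_arctan_at_top)
  then show ?thesis by (simp add: kernel_mass_def[abs_def])
qed

lemma nn_integral_cauchy_kernel:
  assumes x: "0 < x" and Y: "0 \<le> Y"
  shows "(\<integral>\<^sup>+u. ennreal (cauchy_kernel x (Y * sqrt x) u) \<partial>lborel) \<le> ennreal (sqrt x * kernel_mass Y)"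
proof -
  let ?a = "Y * sqrt x"
  let ?k = "\<lambda>u. x / (u\<^sup>2 + x)"
  have half: "(\<integral>\<^sup>+u. ennreal (?k u) * indicator {?a..} u \<partial>lborel) = ennreal (sqrt x * (pi / 2) - sqrt x * arctan (?a / sqrt x))"
  proof (rule nn_integral_FTC_atLeast)
    show "?k \<in> borel_measurable borel" by measurable
    fix u
    have "x + u\<^sup>2 \<noteq> 0" using x by (metis add_pos_nonneg less_irrefl zero_le_power2)
    then show "((\<lambda>u. sqrt x * arctan (u / sqrt x)) has_real_derivative ?k u) (at u)"
      using x by (auto intro!: derivative_eq_intros simp: field_simps power_divide)
    show "0 \<le> ?k u" using x by (intro divide_nonneg_pos add_nonneg_pos) auto
  next
    have "filterlim (\<lambda>u. u / sqrt x) at_top at_top" using x by real_asymp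
    then have "((\<lambda>u. arctan (u / sqrt x)) \<longlongrightarrow> pi / 2) at_top" by (rule filterlim_compose[OF tendsto_arctan_at_top])
    then show "((\<lambda>u. sqrt x * arctan (u / sqrt x)) \<longlongrightarrow> sqrt x * (pi / 2)) at_top" by (intro tendsto_intros)
  qed
  have refl: "(\<integral>\<^sup>+u. ennreal (?k u) * indicator {..- ?a} u \<partial>lborel) = (\<integral>\<^sup>+u. ennreal (?k u) * indicator {?a..} u \<partial>lborel)"
  proof -
    have "(\<integral>\<^sup>+u. ennreal (?k u) * indicator {..- ?a} u \<partial>lborel) =
        (\<integral>\<^sup>+u. ennreal (?k (0 + (-1) * u)) * indicator {..- ?a} (0 + (-1) * u) \<partial>lborel)"
      by (subst nn_integral_real_affine[where c="-1" and t=0]) auto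
    also have "\<dots> = (\<integral>\<^sup>+u. ennreal (?k u) * indicator {?a..} u \<partial>lborel)"
      by (intro nn_integral_cong) (auto simp: indicator_def)
    finally show ?thesis .
  qed
  have "(\<integral>\<^sup>+u. ennreal (cauchy_kernel x ?a u) \<partial>lborel) \<le>
      (\<integral>\<^sup>+u. ennreal (?k u) * indicator {?a..} u + ennreal (?k u) * indicator {..- ?a} u \<partial>lborel)"
    by (intro nn_integral_mono) (auto simp: cauchy_kernel_def indicator_def abs_if)
  also have "\<dots> = (\<integral>\<^sup>+u. ennreal (?k u) * indicator {?a..} u \<partial>lborel) + (\<integral>\<^sup>+u. ennreal (?k u) * indicator {..- ?a} u \<partial>lborel)"
    by (rule nn_integral_add) auto
  also have "\<dots> = ennreal (sqrt x * (pi / 2) - sqrt x * arctan Y) + ennreal (sqrt x * (pi / 2) - sqrt x * arctan Y)"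
    using x by (simp add: refl half)
  also have "\<dots> = ennreal (sqrt x * kernel_mass Y)"
    using x kernel_mass_nonneg[of Y]
    by (subst ennreal_plus[symmetric])
       (auto simp: kernel_mass_def algebra_simps simp flip: right_diff_distrib intro!: mult_left_mono less_imp_le arctan_ubound)
  finally show ?thesis .
qed

lemma nn_integral_kernel_left:
  fixes f :: "real \<Rightarrow> ennreal"
  assumes [measurable]: "f \<in> borel_measurable borel" and x: "0 < x" and Y: "0 \<le> Y"
  shows "(\<integral>\<^sup>+w. \<integral>\<^sup>+z. f w * ennreal (cauchy_kernel x (Y * sqrt x) (z - w)) \<partial>lborel \<partial>lborel) \<le>
    (\<integral>\<^sup>+w. f w \<partial>lborel) * ennreal (sqrt x * kernel_mass Y)"
proof -
  have shift: "(\<integral>\<^sup>+z. ennreal (cauchy_kernel x (Y * sqrt x) (z - w)) \<partial>lborel) \<le> ennreal (sqrt x * kernel_mass Y)" for w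
  proof -
    have "(\<integral>\<^sup>+z. ennreal (cauchy_kernel x (Y * sqrt x) (z - w)) \<partial>lborel) =
        (\<integral>\<^sup>+u. ennreal (cauchy_kernel x (Y * sqrt x) (w + 1 * u - w)) \<partial>lborel)"
      by (subst nn_integral_real_affine[where c=1 and t=w]) auto
    then show ?thesis using nn_integral_cauchy_kernel[OF x Y] by simp
  qed
  have "(\<integral>\<^sup>+w. \<integral>\<^sup>+z. f w * ennreal (cauchy_kernel x (Y * sqrt x) (z - w)) \<partial>lborel \<partial>lborel) =
      (\<integral>\<^sup>+w. f w * (\<integral>\<^sup>+z. ennreal (cauchy_kernel x (Y * sqrt x) (z - w)) \<partial>lborel) \<partial>lborel)"
    by (intro nn_integral_cong nn_integral_cmult) measurable
  also have "\<dots> \<le> (\<integral>\<^sup>+w. f w * ennreal (sqrt x * kernel_mass Y) \<partial>lborel)"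
    by (intro nn_integral_mono mult_left_mono shift) auto
  also have "\<dots> = (\<integral>\<^sup>+w. f w \<partial>lborel) * ennreal (sqrt x * kernel_mass Y)" by (rule nn_integral_multc) measurable
  finally show ?thesis .
qed

lemma nn_integral_kernel_right:
  fixes f :: "real \<Rightarrow> ennreal"
  assumes [measurable]: "f \<in> borel_measurable borel" and x: "0 < x" and Y: "0 \<le> Y"
  shows "(\<integral>\<^sup>+w. \<integral>\<^sup>+z. f z * ennreal (cauchy_kernel x (Y * sqrt x) (z - w)) \<partial>lborel \<partial>lborel) \<le>
    (\<integral>\<^sup>+z. f z \<partial>lborel) * ennreal (sqrt x * kernel_mass Y)"
proof -
  have "(\<integral>\<^sup>+w. \<integral>\<^sup>+z. f z * ennreal (cauchy_kernel x (Y * sqrt x) (z - w)) \<partial>lborel \<partial>lborel) =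
      (\<integral>\<^sup>+z. \<integral>\<^sup>+w. f z * ennreal (cauchy_kernel x (Y * sqrt x) (z - w)) \<partial>lborel \<partial>lborel)"
    by (rule lborel_pair.Fubini') measurable
  also have "\<dots> = (\<integral>\<^sup>+z. \<integral>\<^sup>+w. f z * ennreal (cauchy_kernel x (Y * sqrt x) (w - z)) \<partial>lborel \<partial>lborel)"
    by (intro nn_integral_cong) (metis cauchy_kernel_minus minus_diff_eq)
  also have "\<dots> \<le> (\<integral>\<^sup>+z. f z \<partial>lborel) * ennreal (sqrt x * kernel_mass Y)"
    by (rule nn_integral_kernel_left[OF assms])
  finally show ?thesis .
qed

text \<open>In the application \<open>G y = \<Phi> (exp y)\<close> and \<open>g\<close> is its derivative; the first hypothesis
  past \<open>y0\<close> is \<open>L(n) = O(log n)\<close>, the second one combines A2 with \<open>log n = O(L(n))\<close>.\<close>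

locale regular_growth =
  fixes G g :: "real \<Rightarrow> real" and C K y0 :: real
  assumes DERIV_G: "\<And>y. (G has_real_derivative g y) (at y)"
    and g_pos: "\<And>y. 0 < g y" and G_pos: "\<And>y. 0 < G y" and G_at_bot: "(G \<longlongrightarrow> 0) at_bot"
    and y0: "1 \<le> y0" and C: "0 < C" and K: "0 \<le> K"
    and G_le: "\<And>y. y0 \<le> y \<Longrightarrow> G y \<le> C * y * g y"
    and ln_g: "\<And>z w. y0 \<le> z \<Longrightarrow> y0 \<le> w \<Longrightarrow> \<bar>ln (g z) - ln (g w)\<bar> \<le> K * \<bar>ln z - ln w\<bar>"
    and g_measurable [measurable]: "g \<in> borel_measurable borel"
begin

lemma nn_integral_g: "(\<integral>\<^sup>+z. ennreal (g z) * indicator {..A} z \<partial>lborel) = ennreal (G A)"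
proof -
  have "(\<integral>\<^sup>+z. ennreal (g z) * indicator {..A} z \<partial>lborel) =
      (\<integral>\<^sup>+t. ennreal (g (0 + (-1) * t)) * indicator {..A} (0 + (-1) * t) \<partial>lborel)"
    by (subst nn_integral_real_affine[where c="-1" and t=0]) auto
  also have "\<dots> = (\<integral>\<^sup>+t. ennreal (g (- t)) * indicator {- A..} t \<partial>lborel)"
    by (intro nn_integral_cong) (auto simp: indicator_def)
  also have "\<dots> = ennreal (0 - (- G (- (- A))))"
  proof (rule nn_integral_FTC_atLeast)
    show "((\<lambda>t. - G (- t)) has_real_derivative g (- t)) (at t)" for t
    proof -
      have "((\<lambda>t. G (- t)) has_real_derivative g (- t) * - 1) (at t)"
        by (rule DERIV_chain2[OF DERIV_G]) (auto intro!: derivative_eq_intros)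
      from DERIV_minus[OF this] show ?thesis by simp
    qed
    have "((\<lambda>t. G (- t)) \<longlongrightarrow> 0) at_top"
      by (rule filterlim_compose[OF G_at_bot filterlim_uminus_at_bot_at_top])
    from tendsto_minus[OF this] show "((\<lambda>t. - G (- t)) \<longlongrightarrow> 0) at_top" by simp
  qed (use g_pos less_imp_le in auto)
  finally show ?thesis by simp
qed

text \<open>The bound \<open>G_le\<close> says that the derivative of \<open>ln (G y)\<close> is at
  least \<open>1 / (C * y)\<close>, so \<open>G y / y powr (1 / C)\<close> increases.\<close>

lemma G_ratio: assumes "y0 \<le> a" "a \<le> b" shows "G a \<le> (a / b) powr (1 / C) * G b"
proof -
  define F where "F y = ln (G y) - 1 / C * ln y" for y
  have "F a \<le> F b"
  proof (rule DERIV_nonneg_imp_nondecreasing[OF assms(2)])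
    fix y assume y: "a \<le> y" "y \<le> b"
    then have y1: "y0 \<le> y" "0 < y" using assms y0 by auto
    have "(F has_real_derivative 1 / G y * g y - 1 / C * (1 / y)) (at y)"
      unfolding F_def using y1 C G_pos[of y] by (auto intro!: derivative_eq_intros DERIV_G)
    moreover have "1 / C * (1 / y) \<le> 1 / G y * g y"
    proof -
      have "g y / (C * y * g y) \<le> g y / G y"
        using y1 C G_pos[of y] g_pos[of y] by (intro divide_left_mono G_le mult_pos_pos) auto
      then show ?thesis using g_pos[of y] by (simp add: field_simps)
    qed
    ultimately show "\<exists>D. (F has_real_derivative D) (at y) \<and> 0 \<le> D" by auto
  qed
  then have "ln (G a) \<le> ln (G b) + 1 / C * (ln a - ln b)" by (simp add: F_def algebra_simps diff_divide_distrib)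
  also have "\<dots> = ln ((a / b) powr (1 / C) * G b)"
    using assms y0 G_pos[of b] by (simp add: ln_mult ln_powr ln_div)
  finally show ?thesis using assms y0 G_pos[of a] G_pos[of b] by (subst (asm) ln_le_cancel_iff) auto
qed

lemma ln_diff_le: "0 < z \<Longrightarrow> 0 < w \<Longrightarrow> m \<le> z \<Longrightarrow> m \<le> w \<Longrightarrow> 0 < m \<Longrightarrow> \<bar>ln z - ln w\<bar> \<le> \<bar>z - w\<bar> / (m::real)"
proof -
  have main: "ln z - ln w \<le> (z - w) / m" if "0 < m" "m \<le> w" "w \<le> z" for z w
  proof -
    have "ln z - ln w = ln (z / w)" using that by (simp add: ln_div)
    also have "\<dots> \<le> z / w - 1" using that by (intro ln_le_minus_one) auto
    also have "\<dots> = (z - w) / w" using that by (simp add: diff_divide_distrib)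
    also have "\<dots> \<le> (z - w) / m" using that by (intro divide_left_mono) auto
    finally show ?thesis .
  qed
  assume "0 < z" "0 < w" "m \<le> z" "m \<le> w" "0 < m"
  then show ?thesis using main[of w z] main[of z w] by (cases "w \<le> z") (auto simp: abs_if)
qed

text \<open>For \<open>w \<ge> \<eta> * x\<close> a shift by \<open>Y * sqrt x\<close> is a relative
  change of order \<open>1 / sqrt x\<close>. It hardly moves \<open>ln w\<close>, hence hardly moves
  \<open>ln (g w)\<close>.\<close>

lemma g_close:
  assumes \<epsilon>: "0 < \<epsilon>" and \<eta>: "0 < \<eta>" and Y: "0 \<le> Y"
  shows "\<forall>\<^sub>F x in at_top. Y * sqrt x \<le> \<eta> * x \<and>
    (\<forall>w z. \<eta> * x \<le> w \<longrightarrow> \<bar>z - w\<bar> \<le> Y * sqrt x \<longrightarrow> \<bar>g z - g w\<bar> \<le> \<epsilon> * g w)"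
proof -
  \<comment> \<open>The radius is chosen such that a change of \<open>ln\<close> by
    \<open>\<rho>\<close> changes \<open>g\<close> by a factor of at most
    \<open>1 + \<epsilon>\<close>; dividing by \<open>K + 1\<close> covers
    \<open>K = 0\<close>.\<close>
  define \<rho> where "\<rho> = ln (1 + \<epsilon>) / (K + 1)"
  have \<rho>: "0 < \<rho>" "exp (K * \<rho>) \<le> 1 + \<epsilon>"
  proof -
    show "0 < \<rho>" using \<epsilon> K by (simp add: \<rho>_def)
    then have "K * \<rho> \<le> (K + 1) * \<rho>" by (intro mult_right_mono) auto
    also have "\<dots> = ln (1 + \<epsilon>)" using K by (simp add: \<rho>_def)
    finally show "exp (K * \<rho>) \<le> 1 + \<epsilon>" using \<epsilon> by (simp add: ln_ge_iff)
  qed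
  have "\<forall>\<^sub>F x in at_top. y0 \<le> \<eta> * x - Y * sqrt x" using \<eta> by real_asymp
  moreover have "\<forall>\<^sub>F x in at_top. Y * sqrt x \<le> \<rho> * (\<eta> * x - Y * sqrt x)" using \<eta> \<rho> by real_asymp
  ultimately show ?thesis
  proof eventually_elim
    case (elim x)
    let ?m = "\<eta> * x - Y * sqrt x"
    have m: "1 \<le> ?m" using elim(1) y0 by linarith
    show ?case
    proof (intro conjI allI impI)
      show "Y * sqrt x \<le> \<eta> * x" using m by linarith
      fix w z assume wz: "\<eta> * x \<le> w" "\<bar>z - w\<bar> \<le> Y * sqrt x"
      have x0: "0 \<le> Y * sqrt x" using wz(2) by linarith
      have mz: "?m \<le> z" "?m \<le> w" using wz x0 by (auto simp: abs_le_iff)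
      then have y: "y0 \<le> z" "y0 \<le> w" using elim(1) by auto
      have "\<bar>ln z - ln w\<bar> \<le> \<bar>z - w\<bar> / ?m" using mz m by (intro ln_diff_le) auto
      also have "\<dots> \<le> Y * sqrt x / ?m" using wz m by (intro divide_right_mono) auto
      also have "\<dots> \<le> \<rho>" using elim(2) m by (simp add: divide_le_eq)
      finally have "K * \<bar>ln z - ln w\<bar> \<le> K * \<rho>" using K by (intro mult_left_mono)
      with ln_g[OF y] have d: "\<bar>ln (g z) - ln (g w)\<bar> \<le> K * \<rho>" by linarith
      have up: "g a \<le> (1 + \<epsilon>) * g b" if "ln (g a) - ln (g b) \<le> K * \<rho>" for a b
      proof -
        have "g a = exp (ln (g a) - ln (g b)) * g b" using g_pos[of a] g_pos[of b] by (simp add: exp_diff)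
        also have "\<dots> \<le> exp (K * \<rho>) * g b" using that g_pos[of b] by (intro mult_right_mono) auto
        also have "\<dots> \<le> (1 + \<epsilon>) * g b" using \<rho> g_pos[of b] by (intro mult_right_mono) auto
        finally show ?thesis .
      qed
      have 1: "g z \<le> (1 + \<epsilon>) * g w" "g w \<le> (1 + \<epsilon>) * g z" using d by (auto intro!: up simp: abs_le_iff)
      have "g w - g z \<le> \<epsilon> * g w"
      proof (cases "g z \<le> g w")
        case True
        then have "\<epsilon> * g z \<le> \<epsilon> * g w" using \<epsilon> by simp
        then show ?thesis using 1 by (simp add: algebra_simps)
      next
        case False
        moreover have "0 \<le> \<epsilon> * g w" using \<epsilon> g_pos[of w] by simp
        ultimately show ?thesis by linarith
      qed
      then show "\<bar>g z - g w\<bar> \<le> \<epsilon> * g w" using 1 by (simp add: algebra_simps abs_le_iff)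
    qed
  qed
qed

definition kern :: "real \<Rightarrow> real \<Rightarrow> real" where "kern x u = cauchy_kernel x 0 u"

lemma kern_measurable [measurable]: "kern x \<in> borel_measurable borel"
  unfolding kern_def[abs_def] by measurable

lemma kern_nonneg: "0 < x \<Longrightarrow> 0 \<le> kern x u"
  unfolding kern_def by (rule cauchy_kernel_nonneg)

lemma kern_eq: "kern x u = x / (u\<^sup>2 + x)"
  by (simp add: kern_def cauchy_kernel_def)

text \<open>The two error terms below dominate, respectively, the linearisation error of the
  compensator before time \<open>x\<close> and its growth after time \<open>x\<close>.\<close>

definition fluctuation :: "real \<Rightarrow> ennreal" where
  "fluctuation x = (\<integral>\<^sup>+w. \<integral>\<^sup>+z. ennreal (\<bar>g z - g w\<bar> * kern x (z - w)) * indicator {..x} z * indicator {0..x} w \<partial>lborel \<partial>lborel)"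

definition overshoot :: "real \<Rightarrow> ennreal" where
  "overshoot x = (\<integral>\<^sup>+w. \<integral>\<^sup>+z. ennreal (g z * kern x (z - w)) * indicator {..x} z * indicator {..0} w \<partial>lborel \<partial>lborel)"

text \<open>Three regions. Where \<open>\<bar>z - w\<bar>\<close> is at least
  \<open>Y * sqrt x\<close>, only the tail mass of the kernel counts. Where the points are close and
  \<open>w \<ge> \<eta> * x\<close>, the values of \<open>g\<close> differ by the factor
  \<open>\<epsilon>\<close>. Otherwise both points are below \<open>2 * \<eta> * x\<close>, where
  \<open>g\<close> has mass \<open>G (2 * \<eta> * x)\<close>. For the overshoot,
  \<open>w \<le> 0\<close> leaves only the first and the third case.\<close>

lemma error_bounds:
  assumes x: "0 < x" and Y: "0 \<le> Y" and \<epsilon>: "0 \<le> \<epsilon>" and \<eta>: "0 < \<eta>"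
    and Yx: "Y * sqrt x \<le> \<eta> * x"
    and close: "\<And>w z. \<eta> * x \<le> w \<Longrightarrow> \<bar>z - w\<bar> \<le> Y * sqrt x \<Longrightarrow> \<bar>g z - g w\<bar> \<le> \<epsilon> * g w"
  shows "fluctuation x \<le> ennreal (sqrt x * (G x * (2 * kernel_mass Y + \<epsilon> * pi) + 2 * pi * G (2 * \<eta> * x)))"
    and "overshoot x \<le> ennreal (sqrt x * (G x * kernel_mass Y + pi * G (2 * \<eta> * x)))"
proof -
  define f where "f A z = ennreal (g z) * indicator {..A} z" for A z
  have fm[measurable]: "f A \<in> borel_measurable borel" for A unfolding f_def[abs_def] by measurable
  have fi: "(\<integral>\<^sup>+z. f A z \<partial>lborel) = ennreal (G A)" for A unfolding f_def by (rule nn_integral_g)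
  define h where "h u = ennreal (kern x u)" for u
  define h' where "h' u = ennreal (cauchy_kernel x (Y * sqrt x) u)" for u
  have hm[measurable]: "h \<in> borel_measurable borel" "h' \<in> borel_measurable borel"
    unfolding h_def[abs_def] h'_def[abs_def] by measurable
  have pi0: "kernel_mass 0 = pi" by (simp add: kernel_mass_def)
  have b1: "(\<integral>\<^sup>+w. \<integral>\<^sup>+z. f A z * h (z - w) \<partial>lborel \<partial>lborel) \<le> ennreal (G A * (sqrt x * pi))"
    "(\<integral>\<^sup>+w. \<integral>\<^sup>+z. f A w * h (z - w) \<partial>lborel \<partial>lborel) \<le> ennreal (G A * (sqrt x * pi))"
    "(\<integral>\<^sup>+w. \<integral>\<^sup>+z. f A z * h' (z - w) \<partial>lborel \<partial>lborel) \<le> ennreal (G A * (sqrt x * kernel_mass Y))"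
    "(\<integral>\<^sup>+w. \<integral>\<^sup>+z. f A w * h' (z - w) \<partial>lborel \<partial>lborel) \<le> ennreal (G A * (sqrt x * kernel_mass Y))" for A
    using nn_integral_kernel_right[OF fm x order_refl, of A] nn_integral_kernel_left[OF fm x order_refl, of A]
      nn_integral_kernel_right[OF fm x Y, of A] nn_integral_kernel_left[OF fm x Y, of A]
    unfolding h_def h'_def kern_def fi
    by (simp_all add: ennreal_mult[symmetric] less_imp_le[OF G_pos] pi0 kernel_mass_nonneg x less_imp_le)
  have kern': "kern x u = cauchy_kernel x (Y * sqrt x) u" if "Y * sqrt x \<le> \<bar>u\<bar>" for u
    using that by (simp add: kern_def cauchy_kernel_def)
  have point: "ennreal (\<bar>g z - g w\<bar> * kern x (z - w)) * indicator {..x} z * indicator {0..x} w \<le>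
      (f x z * h' (z - w) + f x w * h' (z - w)) +
      (ennreal \<epsilon> * (f x w * h (z - w)) + (f (2 * \<eta> * x) z * h (z - w) + f (2 * \<eta> * x) w * h (z - w)))" for z w
  proof (cases "z \<le> x \<and> 0 \<le> w \<and> w \<le> x")
    case False
    then show ?thesis by (auto simp: indicator_def)
  next
    case zw: True
    have k0: "0 \<le> kern x (z - w)" by (rule kern_nonneg[OF x])
    have sum: "\<bar>g z - g w\<bar> * kern x (z - w) \<le> g z * kern x (z - w) + g w * kern x (z - w)"
      using g_pos[of z] g_pos[of w] k0 by (auto simp: distrib_right[symmetric] intro!: mult_right_mono)
    consider "Y * sqrt x \<le> \<bar>z - w\<bar>" | "\<bar>z - w\<bar> \<le> Y * sqrt x" "\<eta> * x \<le> w" | "\<bar>z - w\<bar> \<le> Y * sqrt x" "w \<le> \<eta> * x"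
      by linarith
    then show ?thesis
    proof cases
      case 1
      have "ennreal (\<bar>g z - g w\<bar> * kern x (z - w)) \<le> f x z * h' (z - w) + f x w * h' (z - w)"
        using sum zw k0 g_pos[of z] g_pos[of w] kern'[OF 1]
        by (simp add: f_def h'_def indicator_def ennreal_mult[symmetric] ennreal_plus[symmetric] ennreal_leI less_imp_le del: ennreal_plus)
      then show ?thesis using zw by (simp add: indicator_def add_increasing2)
    next
      case 2
      have "\<bar>g z - g w\<bar> * kern x (z - w) \<le> \<epsilon> * g w * kern x (z - w)"
        by (rule mult_right_mono[OF close[OF 2(2,1)] k0])
      then have "ennreal (\<bar>g z - g w\<bar> * kern x (z - w)) \<le> ennreal \<epsilon> * (f x w * h (z - w))"
        using zw k0 g_pos[of w] \<epsilon>
        by (simp add: f_def h_def indicator_def ennreal_mult[symmetric] ennreal_leI less_imp_le mult.assoc)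
      then show ?thesis using zw by (simp add: indicator_def add_increasing add_increasing2)
    next
      case 3
      have "z \<le> 2 * \<eta> * x" "w \<le> 2 * \<eta> * x" using 3 Yx x \<eta> by (auto simp: abs_le_iff)
      then have "ennreal (\<bar>g z - g w\<bar> * kern x (z - w)) \<le> f (2 * \<eta> * x) z * h (z - w) + f (2 * \<eta> * x) w * h (z - w)"
        using sum k0 g_pos[of z] g_pos[of w]
        by (simp add: f_def h_def indicator_def ennreal_mult[symmetric] ennreal_plus[symmetric] ennreal_leI less_imp_le del: ennreal_plus)
      then show ?thesis using zw by (simp add: indicator_def add_increasing)
    qed
  qed
  have nnG: "0 \<le> G x" "0 \<le> G (2 * \<eta> * x)" using G_pos less_imp_le by blast+
  have km: "0 \<le> kernel_mass Y" by (rule kernel_mass_nonneg)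
  have "fluctuation x \<le> (\<integral>\<^sup>+w. \<integral>\<^sup>+z. (f x z * h' (z - w) + f x w * h' (z - w)) +
      (ennreal \<epsilon> * (f x w * h (z - w)) + (f (2 * \<eta> * x) z * h (z - w) + f (2 * \<eta> * x) w * h (z - w))) \<partial>lborel \<partial>lborel)"
    unfolding fluctuation_def by (intro nn_integral_mono point)
  also have "\<dots> = ((\<integral>\<^sup>+w. \<integral>\<^sup>+z. f x z * h' (z - w) \<partial>lborel \<partial>lborel) + (\<integral>\<^sup>+w. \<integral>\<^sup>+z. f x w * h' (z - w) \<partial>lborel \<partial>lborel)) +
      (ennreal \<epsilon> * (\<integral>\<^sup>+w. \<integral>\<^sup>+z. f x w * h (z - w) \<partial>lborel \<partial>lborel) +
      ((\<integral>\<^sup>+w. \<integral>\<^sup>+z. f (2 * \<eta> * x) z * h (z - w) \<partial>lborel \<partial>lborel) + (\<integral>\<^sup>+w. \<integral>\<^sup>+z. f (2 * \<eta> * x) w * h (z - w) \<partial>lborel \<partial>lborel)))"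
    by (simp add: nn_integral_add nn_integral_cmult)
  also have "\<dots> \<le> (ennreal (G x * (sqrt x * kernel_mass Y)) + ennreal (G x * (sqrt x * kernel_mass Y))) +
      (ennreal \<epsilon> * ennreal (G x * (sqrt x * pi)) + (ennreal (G (2 * \<eta> * x) * (sqrt x * pi)) + ennreal (G (2 * \<eta> * x) * (sqrt x * pi))))"
    by (intro add_mono mult_left_mono b1) auto
  also have "\<dots> = ennreal (sqrt x * (G x * (2 * kernel_mass Y + \<epsilon> * pi) + 2 * pi * G (2 * \<eta> * x)))"
    using nnG km x \<epsilon>
    by (simp add: ennreal_mult[symmetric] ennreal_plus[symmetric] del: ennreal_plus) (simp add: algebra_simps)
  finally show "fluctuation x \<le> ennreal (sqrt x * (G x * (2 * kernel_mass Y + \<epsilon> * pi) + 2 * pi * G (2 * \<eta> * x)))" .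
  have point': "ennreal (g z * kern x (z - w)) * indicator {..x} z * indicator {..0} w \<le>
      f x z * h' (z - w) + f (2 * \<eta> * x) z * h (z - w)" for z w
  proof (cases "z \<le> x \<and> w \<le> 0")
    case False
    then show ?thesis by (auto simp: indicator_def)
  next
    case zw: True
    have k0: "0 \<le> kern x (z - w)" by (rule kern_nonneg[OF x])
    show ?thesis
    proof (cases "z \<le> 2 * \<eta> * x")
      case True
      then have "ennreal (g z * kern x (z - w)) \<le> f (2 * \<eta> * x) z * h (z - w)"
        using k0 g_pos[of z] by (simp add: f_def h_def ennreal_mult[symmetric] less_imp_le)
      then show ?thesis using zw by (simp add: indicator_def add_increasing)
    next
      case False
      moreover have "0 \<le> \<eta> * x" using \<eta> x by simp
      ultimately have "Y * sqrt x \<le> \<bar>z - w\<bar>" using zw Yx by linarith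
      then have "ennreal (g z * kern x (z - w)) \<le> f x z * h' (z - w)"
        using k0 g_pos[of z] zw kern'[of "z - w"] by (simp add: f_def h'_def ennreal_mult[symmetric] less_imp_le)
      then show ?thesis using zw by (simp add: indicator_def add_increasing2)
    qed
  qed
  have "overshoot x \<le> (\<integral>\<^sup>+w. \<integral>\<^sup>+z. f x z * h' (z - w) + f (2 * \<eta> * x) z * h (z - w) \<partial>lborel \<partial>lborel)"
    unfolding overshoot_def by (intro nn_integral_mono point')
  also have "\<dots> = (\<integral>\<^sup>+w. \<integral>\<^sup>+z. f x z * h' (z - w) \<partial>lborel \<partial>lborel) + (\<integral>\<^sup>+w. \<integral>\<^sup>+z. f (2 * \<eta> * x) z * h (z - w) \<partial>lborel \<partial>lborel)"
    by (simp add: nn_integral_add)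
  also have "\<dots> \<le> ennreal (G x * (sqrt x * kernel_mass Y)) + ennreal (G (2 * \<eta> * x) * (sqrt x * pi))"
    by (intro add_mono b1)
  also have "\<dots> = ennreal (sqrt x * (G x * kernel_mass Y + pi * G (2 * \<eta> * x)))"
    using nnG km x by (simp add: ennreal_plus[symmetric] del: ennreal_plus) (simp add: algebra_simps)
  finally show "overshoot x \<le> ennreal (sqrt x * (G x * kernel_mass Y + pi * G (2 * \<eta> * x)))" .
qed

lemma errors_negligible:
  assumes e: "0 < e"
  shows "\<forall>\<^sub>F x in at_top. fluctuation x \<le> ennreal (e * (G x * sqrt x)) \<and> overshoot x \<le> ennreal (e * (G x * sqrt x))"
proof -
  have "\<forall>\<^sub>F Y in at_top. kernel_mass Y < e / 6"
    using kernel_mass_tendsto e by (intro order_tendstoD) auto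
  then have "\<forall>\<^sub>F Y in at_top. kernel_mass Y < e / 6 \<and> 0 \<le> Y" using eventually_ge_at_top[of 0] by eventually_elim simp
  from eventually_happens'[OF trivial_limit_at_top_linorder this]
  obtain Y where Y: "kernel_mass Y < e / 6" "0 \<le> Y" by blast
  \<comment> \<open>The budget for the fluctuation: twice \<open>e / 6\<close> from the kernel tail,
    \<open>e / 3\<close> from \<open>\<epsilon> * pi\<close>, and twice \<open>e / 6\<close> from
    \<open>pi * G (2 * \<eta> * x)\<close>, where \<open>2 * \<eta> = q\<close> is adjusted to the
    exponent \<open>1 / C\<close> of \<open>G_ratio\<close>.\<close>
  define \<epsilon> where "\<epsilon> = e / (3 * pi)"
  have \<epsilon>: "0 < \<epsilon>" "\<epsilon> * pi = e / 3" using e by (auto simp: \<epsilon>_def)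
  define q where "q = min 1 ((e / (6 * pi)) powr C)"
  have q: "0 < q" "q \<le> 1" "q powr (1 / C) \<le> e / (6 * pi)"
  proof -
    show "0 < q" "q \<le> 1" using e by (auto simp: q_def)
    then have "q powr (1 / C) \<le> ((e / (6 * pi)) powr C) powr (1 / C)"
      using C by (intro powr_mono2) (auto simp: q_def)
    then show "q powr (1 / C) \<le> e / (6 * pi)" using e C by (simp add: powr_powr)
  qed
  define \<eta> where "\<eta> = q / 2"
  have \<eta>: "0 < \<eta>" using q by (simp add: \<eta>_def)
  have "\<forall>\<^sub>F x in at_top. y0 \<le> q * x" using q(1) by real_asymp
  then show ?thesis using g_close[OF \<epsilon>(1) \<eta> Y(2)] eventually_gt_at_top[of 0]
  proof eventually_elim
    case (elim x)
    have "2 * \<eta> * x = q * x" by (simp add: \<eta>_def)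
    have "G (q * x) \<le> (q * x / x) powr (1 / C) * G x" using elim q by (intro G_ratio) auto
    also have "\<dots> = q powr (1 / C) * G x" using elim by simp
    also have "\<dots> \<le> e / (6 * pi) * G x" using q G_pos[of x] by (intro mult_right_mono) auto
    finally have G2: "pi * G (2 * \<eta> * x) \<le> e / 6 * G x" by (simp add: \<eta>_def field_simps)
    have km: "G x * kernel_mass Y \<le> G x * (e / 6)" using Y G_pos[of x] by (intro mult_left_mono) auto
    have "sqrt x * (G x * (2 * kernel_mass Y + \<epsilon> * pi) + 2 * pi * G (2 * \<eta> * x)) \<le> sqrt x * (e * G x)"
      using km G2 elim unfolding \<epsilon>(2) by (intro mult_left_mono) (auto simp: algebra_simps)
    then have 1: "fluctuation x \<le> ennreal (e * (G x * sqrt x))"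
      by (intro order_trans[OF error_bounds(1)[OF elim(3) Y(2) less_imp_le[OF \<epsilon>(1)] \<eta>]] ennreal_leI)
         (use elim in \<open>auto simp: mult_ac\<close>)
    have "G x * kernel_mass Y + pi * G (2 * \<eta> * x) \<le> e / 6 * G x + e / 6 * G x"
      using km G2 by (simp add: mult.commute)
    also have "\<dots> = e / 3 * G x" by simp
    also have "\<dots> \<le> e * G x" using e G_pos[of x] by (intro mult_right_mono) auto
    finally have "G x * kernel_mass Y + pi * G (2 * \<eta> * x) \<le> e * G x" .
    then have "sqrt x * (G x * kernel_mass Y + pi * G (2 * \<eta> * x)) \<le> sqrt x * (e * G x)"
      using elim by (intro mult_left_mono) auto
    then have 2: "overshoot x \<le> ennreal (e * (G x * sqrt x))"
      by (intro order_trans[OF error_bounds(2)[OF elim(3) Y(2) less_imp_le[OF \<epsilon>(1)] \<eta>]] ennreal_leI)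
         (use elim in \<open>auto simp: mult_ac\<close>)
    show ?case using 1 2 by simp
  qed
qed

text \<open>The ratio bound read from \<open>y0\<close>: growth at least like a power of exponent
  \<open>1 / C\<close>, which outweighs the logarithm of the maximal inequality.\<close>

lemma G_lower: assumes "y0 \<le> x" shows "G y0 / y0 powr (1 / C) * x powr (1 / C) \<le> G x"
proof -
  have "G y0 \<le> (y0 / x) powr (1 / C) * G x" by (rule G_ratio) (use assms in auto)
  also have "(y0 / x) powr (1 / C) = y0 powr (1 / C) / x powr (1 / C)" using y0 assms by (simp add: powr_divide)
  finally show ?thesis using y0 assms by (simp add: field_simps)
qed

end

section \<open>Regular growth from the assumptions on the Levy measure\<close>

context levy_measure
begin

text \<open>The tail of the zero measure is 0, hence bounded. Non-triviality of the measure yields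
  the strict positivity of \<open>Phi\<close> and \<open>Phi_moment\<close> below.\<close>

lemma not_AE_False: assumes "assumption_A1 \<nu>" shows "\<not> (AE x in \<nu>. False)"
proof
  assume "AE x in \<nu>. False"
  then have "emeasure \<nu> UNIV = 0" using AE_iff_measurable[of UNIV \<nu> "\<lambda>_. False"] by simp
  then have "measure \<nu> A = 0" for A
    using emeasure_mono[of A UNIV \<nu>] by (simp add: measure_def)
  then have "bdd_above ((\<lambda>y. levy_tail \<nu> (1 / y)) ` {0<..})"
    by (intro bdd_aboveI[of _ 0]) (auto simp: levy_tail_def)
  then show False using assms by (simp add: assumption_A1_def)
qed

lemma Phi_moment_pos:
  assumes "assumption_A1 \<nu>" "0 < j" shows "0 < Phi_moment j r"
proof (rule ccontr)
  assume "\<not> 0 < Phi_moment j r"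
  then have "Phi_moment j r = 0" using Phi_moment_nonneg[of j r] by simp
  moreover have "AE x in \<nu>. 0 \<le> (1 - exp (- x)) ^ j * exp (- r * (1 - exp (- x)))"
    using AE_pos by eventually_elim simp
  ultimately have "AE x in \<nu>. (1 - exp (- x)) ^ j * exp (- r * (1 - exp (- x))) = 0"
    using integral_nonneg_eq_0_iff_AE[OF integrable_Phi_moment[OF assms(2)]] by (simp add: Phi_moment_def)
  with AE_pos have "AE x in \<nu>. False" by eventually_elim (use assms(2) in simp)
  then show False using not_AE_False[OF assms(1)] by simp
qed

lemma Phi_pos: assumes "assumption_A1 \<nu>" "0 < r" shows "0 < Phi \<nu> r"
  using DERIV_pos_imp_increasing[OF assms(2), of "Phi \<nu>"] DERIV_Phi Phi_moment_pos[OF assms(1)] Phi_zero by auto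

lemma laplace_exponent_one: "laplace_exponent 1 = Phi_moment 1 0"
  by (simp add: laplace_exponent_def Phi_moment_def)

definition log_Phi :: "real \<Rightarrow> real" where "log_Phi y = Phi \<nu> (exp y)"

definition log_phi :: "real \<Rightarrow> real" where "log_phi y = exp y * Phi_moment 1 (exp y)"

lemma DERIV_log_Phi: "(log_Phi has_real_derivative log_phi y) (at y)"
  unfolding log_Phi_def[abs_def] log_phi_def
  using DERIV_chain2[OF DERIV_Phi DERIV_exp] by (simp add: mult.commute)

lemma DERIV_log_phi: "\<exists>D. (log_phi has_real_derivative D) (at y)"
  unfolding log_phi_def[abs_def]
  by (rule exI, rule DERIV_mult[OF DERIV_exp DERIV_chain2[OF DERIV_Phi_moment DERIV_exp]]) simp

lemma continuous_log_phi: "continuous_on A log_phi"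
  using DERIV_log_phi by (meson DERIV_isCont continuous_at_imp_continuous_on)

lemma log_phi_measurable [measurable]: "log_phi \<in> borel_measurable borel"
  by (rule borel_measurable_continuous_onI[OF continuous_log_phi])

lemma log_Phi_tendsto: "(log_Phi \<longlongrightarrow> 0) at_bot"
proof -
  have "isCont (Phi \<nu>) 0" using DERIV_Phi DERIV_isCont by blast
  then have "((\<lambda>y. Phi \<nu> (exp y)) \<longlongrightarrow> Phi \<nu> 0) at_bot"
    by (rule isCont_tendsto_compose[OF _ exp_at_bot])
  then show ?thesis by (simp add: log_Phi_def[abs_def] Phi_zero)
qed

lemma log_Phi_le_exp: "log_Phi y \<le> laplace_exponent 1 * exp y"
  unfolding log_Phi_def by (rule Phi_le) simp

lemma L_fun_eq: "L_fun \<nu> s = Phi \<nu> s / (s * Phi_moment 1 s)"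
  by (simp add: L_fun_def deriv_Phi)

text \<open>On the logarithmic scale \<open>L\<close> is the reciprocal of the logarithmic
  derivative of \<open>log_Phi\<close>.\<close>

lemma L_fun_exp: "L_fun \<nu> (exp y) = log_Phi y / log_phi y"
  by (simp add: L_fun_eq log_Phi_def log_phi_def)

lemma DERIV_L_fun:
  assumes "assumption_A1 \<nu>" "0 < s"
  shows "(L_fun \<nu> has_real_derivative deriv (L_fun \<nu>) s) (at s)"
proof -
  have "s * Phi_moment 1 s \<noteq> 0" using assms Phi_moment_pos[OF assms(1), of 1 s] by simp
  moreover have "((\<lambda>s. s * Phi_moment 1 s) has_real_derivative 1 * Phi_moment 1 s + - Phi_moment (Suc 1) s * s) (at s)"
    by (rule DERIV_mult[OF DERIV_ident DERIV_Phi_moment]) simp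
  ultimately have "\<exists>D. ((\<lambda>s. Phi \<nu> s / (s * Phi_moment 1 s)) has_real_derivative D) (at s)"
    using DERIV_divide[OF DERIV_Phi] by blast
  then show ?thesis unfolding L_fun_eq[abs_def, symmetric] using DERIV_imp_deriv by blast
qed

lemma eventually_at_top_exp:
  assumes "\<forall>\<^sub>F n in at_top. Q (n::real)" shows "\<forall>\<^sub>F y in at_top. Q (exp (y::real))"
  using assms exp_at_top by (auto simp: filterlim_iff)

text \<open>Since \<open>ln log_phi = ln log_Phi - ln L\<close>, its derivative at \<open>y\<close>
  has two parts: \<open>1 / L\<close>, which is at most \<open>C' / y\<close> by log n = O(L(n)),
  and the logarithmic derivative of \<open>L\<close>, which A2 bounds by \<open>k / y\<close>. This
  gives \<open>K = C' + k\<close>.\<close>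

lemma regular_growth_log_Phi:
  assumes A1: "assumption_A1 \<nu>" and A2: "assumption_A2 \<nu>"
    and O1: "(\<lambda>n. L_fun \<nu> n) \<in> O(\<lambda>n. ln n)" and O2: "(\<lambda>n. ln n) \<in> O(\<lambda>n. L_fun \<nu> n)"
  shows "\<exists>C K y0. regular_growth log_Phi log_phi C K y0"
proof -
  have g_pos: "0 < log_phi y" for y using Phi_moment_pos[OF A1, of 1] by (simp add: log_phi_def)
  have G_pos: "0 < log_Phi y" for y using Phi_pos[OF A1] by (simp add: log_Phi_def)
  have L_pos: "0 < L_fun \<nu> (exp y)" for y using g_pos G_pos by (simp add: L_fun_exp)
  obtain C where C: "0 < C" "\<forall>\<^sub>F n in at_top. norm (L_fun \<nu> n) \<le> C * norm (ln n)" using O1 by (rule landau_o.bigE)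
  obtain C' where C': "0 < C'" "\<forall>\<^sub>F n in at_top. norm (ln n) \<le> C' * norm (L_fun \<nu> n)" using O2 by (rule landau_o.bigE)
  obtain s0 k where k: "1 \<le> s0" "0 < k" "\<And>s. s0 \<le> s \<Longrightarrow> \<bar>s * deriv (L_fun \<nu>) s / L_fun \<nu> s\<bar> < k / ln s"
    using A2 by (auto simp: assumption_A2_def)
  have "\<forall>\<^sub>F y in at_top. norm (L_fun \<nu> (exp y)) \<le> C * norm (ln (exp y)) \<and>
      norm (ln (exp y)) \<le> C' * norm (L_fun \<nu> (exp y)) \<and> s0 \<le> exp y \<and> 1 \<le> y"
    by (intro eventually_conj eventually_at_top_exp[OF C(2)] eventually_at_top_exp[OF C'(2)]
        eventually_at_top_exp[OF eventually_ge_at_top] eventually_ge_at_top)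
  then obtain y1 where y1: "\<And>y. y1 \<le> y \<Longrightarrow> norm (L_fun \<nu> (exp y)) \<le> C * norm (ln (exp y)) \<and>
      norm (ln (exp y)) \<le> C' * norm (L_fun \<nu> (exp y)) \<and> s0 \<le> exp y \<and> 1 \<le> y"
    unfolding eventually_at_top_linorder by blast
  define y0 where "y0 = max 1 y1"
  have y0: "L_fun \<nu> (exp y) \<le> C * y" "y \<le> C' * L_fun \<nu> (exp y)" "s0 \<le> exp y" "0 < y" if "y0 \<le> y" for y
    using y1[of y] that L_pos[of y] by (auto simp: y0_def)
  define K where "K = C' + k"
  have K: "0 < K" using C' k by (simp add: K_def)
  have D: "\<exists>D. ((\<lambda>y. ln (log_phi y)) has_real_derivative D) (at y) \<and> \<bar>D\<bar> \<le> K / y" if y: "y0 \<le> y" for y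
  proof -
    let ?D = "log_phi y / log_Phi y - deriv (L_fun \<nu>) (exp y) * exp y / L_fun \<nu> (exp y)"
    have "((\<lambda>y. L_fun \<nu> (exp y)) has_real_derivative deriv (L_fun \<nu>) (exp y) * exp y) (at y)"
      by (rule DERIV_chain2[OF DERIV_L_fun[OF A1] DERIV_exp]) simp
    then have "((\<lambda>y. ln (log_Phi y) - ln (L_fun \<nu> (exp y))) has_real_derivative ?D) (at y)"
      using G_pos[of y] L_pos[of y] by (auto intro!: derivative_eq_intros DERIV_log_Phi)
    moreover have "ln (log_Phi y) - ln (L_fun \<nu> (exp y)) = ln (log_phi y)" for y
      using G_pos[of y] g_pos[of y] by (simp add: L_fun_exp ln_div)
    ultimately have "((\<lambda>y. ln (log_phi y)) has_real_derivative ?D) (at y)" by simp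
    moreover have "\<bar>?D\<bar> \<le> K / y"
    proof -
      have "\<bar>deriv (L_fun \<nu>) (exp y) * exp y / L_fun \<nu> (exp y)\<bar> \<le> k / y"
        using k(3)[OF y0(3)[OF y]] by (simp add: mult.commute less_imp_le)
      moreover have "log_phi y / log_Phi y \<le> C' / y"
      proof -
        have "y * log_phi y \<le> C' * log_Phi y"
          using y0(2)[OF y] g_pos[of y] by (simp add: L_fun_exp field_simps)
        then show ?thesis using y0(4)[OF y] G_pos[of y] by (simp add: field_simps)
      qed
      moreover have "0 \<le> log_phi y / log_Phi y" using G_pos[of y] g_pos[of y] by simp
      ultimately show ?thesis unfolding K_def add_divide_distrib by linarith
    qed
    ultimately show ?thesis by blast
  qed
  have ln_g: "\<bar>ln (log_phi z) - ln (log_phi w)\<bar> \<le> K * \<bar>ln z - ln w\<bar>" if zw: "y0 \<le> w" "w \<le> z" for z w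
  proof -
    \<comment> \<open>The derivative bound \<open>K / y\<close> is integrated by showing that
      \<open>K * ln y\<close> plus or minus \<open>ln (log_phi y)\<close> is nondecreasing.\<close>
    have mono: "K * ln w + e * ln (log_phi w) \<le> K * ln z + e * ln (log_phi z)" if e: "\<bar>e\<bar> = 1" for e
    proof (rule DERIV_nonneg_imp_nondecreasing[OF zw(2)])
      fix y assume "w \<le> y" "y \<le> z"
      then have y: "y0 \<le> y" using zw by simp
      obtain D' where D': "((\<lambda>y. ln (log_phi y)) has_real_derivative D') (at y)" "\<bar>D'\<bar> \<le> K / y" using D[OF y] by blast
      have "((\<lambda>y. K * ln y + e * ln (log_phi y)) has_real_derivative K * (1 / y) + e * D') (at y)"
        by (rule DERIV_add[OF DERIV_cmult[OF DERIV_ln_divide[OF y0(4)[OF y]]] DERIV_cmult[OF D'(1)]])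
      moreover have "0 \<le> K * (1 / y) + e * D'"
      proof -
        have "\<bar>e * D'\<bar> \<le> K / y" using D'(2) e by (simp add: abs_mult)
        then show ?thesis by (simp add: abs_le_iff)
      qed
      ultimately show "\<exists>D. ((\<lambda>y. K * ln y + e * ln (log_phi y)) has_real_derivative D) (at y) \<and> 0 \<le> D" by blast
    qed
    have "0 < w" using y0(4)[OF zw(1)] .
    then have "ln w \<le> ln z" using zw by simp
    then show ?thesis using mono[of 1] mono[of "-1"] by (simp add: abs_le_iff right_diff_distrib)
  qed
  have "regular_growth log_Phi log_phi C K y0"
  proof
    show "log_Phi y \<le> C * y * log_phi y" if "y0 \<le> y" for y
      using y0(1)[OF that] g_pos[of y] by (simp add: L_fun_exp divide_le_eq)
    show "\<bar>ln (log_phi z) - ln (log_phi w)\<bar> \<le> K * \<bar>ln z - ln w\<bar>" if "y0 \<le> z" "y0 \<le> w" for z w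
      using ln_g[of w z] ln_g[of z w] that by (cases "w \<le> z") (auto simp: abs_minus_commute)
  qed (use DERIV_log_Phi g_pos G_pos log_Phi_tendsto C K in \<open>auto simp: y0_def\<close>)
  then show ?thesis by blast
qed

end

section \<open>Coupling in the central limit theorem\<close>

lemma distr_PiM_maps:
  assumes "prob_space \<Lambda>" and [measurable]: "A \<in> borel_measurable \<Lambda>" and I: "finite I"
  shows "distr (PiM I (\<lambda>_. \<Lambda>)) (PiM I (\<lambda>_. borel)) (\<lambda>\<omega>. \<lambda>i\<in>I. A (\<omega> i)) = PiM I (\<lambda>_. distr \<Lambda> borel A)"
proof -
  interpret L: prob_space \<Lambda> by fact
  interpret D: prob_space "distr \<Lambda> borel A" by (rule L.prob_space_distr) simp
  interpret PL: product_sigma_finite "\<lambda>_. \<Lambda>" ..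
  interpret PD: product_sigma_finite "\<lambda>_. distr \<Lambda> borel A" ..
  have m[measurable]: "(\<lambda>\<omega>. \<lambda>i\<in>I. A (\<omega> i)) \<in> PiM I (\<lambda>_. \<Lambda>) \<rightarrow>\<^sub>M PiM I (\<lambda>_. borel)"
    by (rule measurable_restrict) measurable
  show ?thesis
  proof (rule PD.PiM_eqI[OF I])
    show "sets (distr (PiM I (\<lambda>_. \<Lambda>)) (PiM I (\<lambda>_. borel)) (\<lambda>\<omega>. \<lambda>i\<in>I. A (\<omega> i))) = sets (PiM I (\<lambda>_. distr \<Lambda> borel A))"
      by (simp cong: sets_PiM_cong)
    fix B assume "\<And>i. i \<in> I \<Longrightarrow> B i \<in> sets (distr \<Lambda> borel A)"
    then have B: "B i \<in> sets borel" if "i \<in> I" for i using that by simp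
    have AB: "A -` B i \<inter> space \<Lambda> \<in> sets \<Lambda>" if "i \<in> I" for i using B[OF that] by measurable
    have "emeasure (distr (PiM I (\<lambda>_. \<Lambda>)) (PiM I (\<lambda>_. borel)) (\<lambda>\<omega>. \<lambda>i\<in>I. A (\<omega> i))) (Pi\<^sub>E I B) =
        emeasure (PiM I (\<lambda>_. \<Lambda>)) ((\<lambda>\<omega>. \<lambda>i\<in>I. A (\<omega> i)) -` Pi\<^sub>E I B \<inter> space (PiM I (\<lambda>_. \<Lambda>)))"
      by (rule emeasure_distr[OF m]) (use B I in \<open>auto intro!: sets_PiM_I_finite\<close>)
    also have "(\<lambda>\<omega>. \<lambda>i\<in>I. A (\<omega> i)) -` Pi\<^sub>E I B \<inter> space (PiM I (\<lambda>_. \<Lambda>)) = (\<Pi>\<^sub>E i\<in>I. A -` B i \<inter> space \<Lambda>)"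
      by (auto simp: space_PiM PiE_iff)
    also have "emeasure (PiM I (\<lambda>_. \<Lambda>)) \<dots> = (\<Prod>i\<in>I. emeasure \<Lambda> (A -` B i \<inter> space \<Lambda>))"
      by (rule PL.emeasure_PiM[OF I]) (rule AB)
    also have "\<dots> = (\<Prod>i\<in>I. emeasure (distr \<Lambda> borel A) (B i))"
      by (rule prod.cong[OF refl]) (use B in \<open>simp add: emeasure_distr\<close>)
    finally show "emeasure (distr (PiM I (\<lambda>_. \<Lambda>)) (PiM I (\<lambda>_. borel)) (\<lambda>\<omega>. \<lambda>i\<in>I. A (\<omega> i))) (Pi\<^sub>E I B) =
        (\<Prod>i\<in>I. emeasure (distr \<Lambda> borel A) (B i))" .
  qed
qed

text \<open>Realises an independent vector with identical marginals on a power of the space on which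
  one marginal is represented, so that two such vectors can later share this power.\<close>

lemma (in prob_space) integral_iid:
  fixes F :: "(nat \<Rightarrow> real) \<Rightarrow> real"
  assumes lip: "\<And>z z'. \<bar>F z - F z'\<bar> \<le> (\<Sum>i<m. \<bar>z i - z' i\<bar>)" and m: "0 < m"
    and ind: "indep_vars (\<lambda>_. borel) X {..<m}"
    and \<Lambda>: "prob_space \<Lambda>" and A[measurable]: "A \<in> borel_measurable \<Lambda>"
    and law: "\<And>i. i < m \<Longrightarrow> distr M borel (X i) = distr \<Lambda> borel A"
  shows "(\<integral>\<omega>. F (\<lambda>i. X i \<omega>) \<partial>M) = (\<integral>\<omega>. F (\<lambda>i. A (\<omega> i)) \<partial>PiM {..<m} (\<lambda>_. \<Lambda>))"
proof -
  have Fm[measurable]: "F \<in> borel_measurable (PiM {..<m} (\<lambda>_. borel))"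
    by (rule lipschitz_finite_coords_measurable) (rule lip)
  have Fr: "F (\<lambda>i\<in>{..<m}. z i) = F z" for z using lip[of "\<lambda>i\<in>{..<m}. z i" z] by simp
  have Xm: "X i \<in> borel_measurable M" if "i \<in> {..<m}" for i using ind that by (simp add: indep_vars_def2)
  have "(\<integral>\<omega>. F (\<lambda>i. X i \<omega>) \<partial>M) = (\<integral>\<omega>. F (\<lambda>i\<in>{..<m}. X i \<omega>) \<partial>M)" by (simp only: Fr)
  also have "\<dots> = (\<integral>z. F z \<partial>distr M (PiM {..<m} (\<lambda>_. borel)) (\<lambda>\<omega>. \<lambda>i\<in>{..<m}. X i \<omega>))"
    by (rule integral_distr[symmetric, OF measurable_restrict]) (use Xm in simp_all)
  also have "distr M (PiM {..<m} (\<lambda>_. borel)) (\<lambda>\<omega>. \<lambda>i\<in>{..<m}. X i \<omega>) = PiM {..<m} (\<lambda>i. distr M borel (X i))"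
    using indep_vars_iff_distr_eq_PiM'[where I="{..<m}" and M'="\<lambda>_. borel" and X=X] ind Xm m by (simp add: lessThan_empty_iff)
  also have "\<dots> = PiM {..<m} (\<lambda>_. distr \<Lambda> borel A)" by (rule PiM_cong) (simp_all add: law)
  also have "\<dots> = distr (PiM {..<m} (\<lambda>_. \<Lambda>)) (PiM {..<m} (\<lambda>_. borel)) (\<lambda>\<omega>. \<lambda>i\<in>{..<m}. A (\<omega> i))"
    by (rule distr_PiM_maps[OF \<Lambda> A, symmetric]) simp
  also have "(\<integral>z. F z \<partial>\<dots>) = (\<integral>\<omega>. F (\<lambda>i\<in>{..<m}. A (\<omega> i)) \<partial>PiM {..<m} (\<lambda>_. \<Lambda>))"
    by (rule integral_distr[OF measurable_restrict]) simp_all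
  also have "\<dots> = (\<integral>\<omega>. F (\<lambda>i. A (\<omega> i)) \<partial>PiM {..<m} (\<lambda>_. \<Lambda>))" by (simp only: Fr)
  finally show ?thesis .
qed

text \<open>Both vectors are realised on one power of \<open>\<Lambda>\<close>, so each coordinate
  contributes the cost of the coupling of \<open>A\<close> and \<open>B\<close>. The cap 2 in the
  cost is what lets almost sure convergence suffice, without uniform integrability.\<close>

lemma iid_comparison:
  fixes F :: "(nat \<Rightarrow> real) \<Rightarrow> real" and M :: "'a measure" and M' :: "'b measure" and \<Lambda> :: "'c measure"
  assumes lip: "\<And>z z'. \<bar>F z - F z'\<bar> \<le> (\<Sum>i<m. \<bar>z i - z' i\<bar>)" and F1: "\<And>z. \<bar>F z\<bar> \<le> 1" and m: "0 < m"
    and M: "prob_space M" "prob_space.indep_vars M (\<lambda>_. borel) X {..<m}"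
    and M': "prob_space M'" "prob_space.indep_vars M' (\<lambda>_. borel) X' {..<m}"
    and \<Lambda>: "prob_space \<Lambda>" and A[measurable]: "A \<in> borel_measurable \<Lambda>" and B[measurable]: "B \<in> borel_measurable \<Lambda>"
    and law: "\<And>i. i < m \<Longrightarrow> distr M borel (X i) = distr \<Lambda> borel A"
    and law': "\<And>i. i < m \<Longrightarrow> distr M' borel (X' i) = distr \<Lambda> borel B"
  shows "\<bar>(\<integral>\<omega>. F (\<lambda>i. X i \<omega>) \<partial>M) - (\<integral>\<omega>. F (\<lambda>i. X' i \<omega>) \<partial>M')\<bar> \<le> real m * (\<integral>\<omega>. min 2 \<bar>A \<omega> - B \<omega>\<bar> \<partial>\<Lambda>)"
proof -
  interpret L: prob_space \<Lambda> by fact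
  interpret P: product_prob_space "\<lambda>_. \<Lambda>" "{..<m}" ..
  let ?P = "PiM {..<m} (\<lambda>_. \<Lambda>)"
  have Fm[measurable]: "F \<in> borel_measurable (PiM {..<m} (\<lambda>_. borel))"
    by (rule lipschitz_finite_coords_measurable) (rule lip)
  have Fr: "F (\<lambda>i\<in>{..<m}. z i) = F z" for z using lip[of "\<lambda>i\<in>{..<m}. z i" z] by simp
  have int: "integrable ?P (\<lambda>\<omega>. F (\<lambda>i. Z (\<omega> i)))" if [measurable]: "Z \<in> borel_measurable \<Lambda>" for Z
  proof -
    have "(\<lambda>\<omega>. F (\<lambda>i\<in>{..<m}. Z (\<omega> i))) \<in> borel_measurable ?P"
      by (rule measurable_compose[OF _ Fm]) (auto intro!: measurable_restrict)
    then show ?thesis unfolding Fr by (rule P.P.integrable_const_bound[rotated, of _ 1]) (use F1 in simp)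
  qed
  \<comment> \<open>If one coordinate differs by more than 2, its capped term alone covers the
    trivial bound 2.\<close>
  have le: "\<bar>a - b\<bar> \<le> (\<Sum>i<m. min 2 (c i))" if abc: "\<bar>a - b\<bar> \<le> (\<Sum>i<m. c i)" "\<bar>a\<bar> \<le> 1" "\<bar>b\<bar> \<le> 1" "\<And>i. 0 \<le> c i"
    for a b :: real and c :: "nat \<Rightarrow> real"
  proof (cases "\<exists>i<m. 2 < c i")
    case True
    then obtain i where i: "i < m" "2 < c i" by blast
    then have "2 = min 2 (c i)" by simp
    also have "\<dots> \<le> (\<Sum>i<m. min 2 (c i))" by (rule member_le_sum) (use i abc(4) in auto)
    finally show ?thesis using abc by linarith
  next
    case False
    then have "c i \<le> 2" if "i < m" for i using that by (metis not_less)
    then have "min 2 (c i) = c i" if "i < m" for i using that by (simp add: min_absorb2)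
    then have "(\<Sum>i<m. min 2 (c i)) = (\<Sum>i<m. c i)" by (intro sum.cong) simp_all
    then show ?thesis using abc by simp
  qed
  have mint: "integrable \<Lambda> (\<lambda>\<omega>. min 2 \<bar>A \<omega> - B \<omega>\<bar>)"
    by (rule L.integrable_const_bound[of _ 2]) auto
  have coord: "distr ?P \<Lambda> (\<lambda>\<omega>. \<omega> i) = \<Lambda>" if "i < m" for i
    using P.PiM_component[of i] that by simp
  have cint: "integrable ?P (\<lambda>\<omega>. min 2 \<bar>A (\<omega> i) - B (\<omega> i)\<bar>)" if "i < m" for i
  proof -
    have "(\<lambda>\<omega>. \<omega> i) \<in> ?P \<rightarrow>\<^sub>M \<Lambda>" using that by simp
    from integrable_distr[OF this, of "\<lambda>\<omega>. min 2 \<bar>A \<omega> - B \<omega>\<bar>"] show ?thesis using mint coord[OF that] by simp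
  qed
  have ceq: "(\<integral>\<omega>. min 2 \<bar>A (\<omega> i) - B (\<omega> i)\<bar> \<partial>?P) = (\<integral>\<omega>. min 2 \<bar>A \<omega> - B \<omega>\<bar> \<partial>\<Lambda>)" if "i < m" for i
  proof -
    have "(\<lambda>\<omega>. \<omega> i) \<in> ?P \<rightarrow>\<^sub>M \<Lambda>" using that by simp
    from integral_distr[OF this, of "\<lambda>\<omega>. min 2 \<bar>A \<omega> - B \<omega>\<bar>"] show ?thesis unfolding coord[OF that] by simp
  qed
  have "\<bar>(\<integral>\<omega>. F (\<lambda>i. X i \<omega>) \<partial>M) - (\<integral>\<omega>. F (\<lambda>i. X' i \<omega>) \<partial>M')\<bar> =
      \<bar>(\<integral>\<omega>. F (\<lambda>i. A (\<omega> i)) \<partial>?P) - (\<integral>\<omega>. F (\<lambda>i. B (\<omega> i)) \<partial>?P)\<bar>"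
    using prob_space.integral_iid[OF M(1) lip m M(2) \<Lambda> A law] prob_space.integral_iid[OF M'(1) lip m M'(2) \<Lambda> B law'] by simp
  also have "\<dots> = \<bar>\<integral>\<omega>. F (\<lambda>i. A (\<omega> i)) - F (\<lambda>i. B (\<omega> i)) \<partial>?P\<bar>"
    using int[OF A] int[OF B] by simp
  also have "\<dots> \<le> (\<integral>\<omega>. \<bar>F (\<lambda>i. A (\<omega> i)) - F (\<lambda>i. B (\<omega> i))\<bar> \<partial>?P)" by (rule integral_abs_bound)
  also have "\<dots> \<le> (\<integral>\<omega>. (\<Sum>i<m. min 2 \<bar>A (\<omega> i) - B (\<omega> i)\<bar>) \<partial>?P)"
    by (rule integral_mono) (use int[OF A] int[OF B] cint lip F1 in \<open>auto intro!: le\<close>)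
  also have "\<dots> = (\<Sum>i<m. \<integral>\<omega>. min 2 \<bar>A (\<omega> i) - B (\<omega> i)\<bar> \<partial>?P)"
    by (rule Bochner_Integration.integral_sum) (use cint in simp)
  also have "\<dots> = real m * (\<integral>\<omega>. min 2 \<bar>A \<omega> - B \<omega>\<bar> \<partial>\<Lambda>)"
    by (simp add: ceq)
  finally show ?thesis .
qed

context occupancy
begin

text \<open>Weak convergence in the central limit theorem is only used through a Skorohod coupling,
  which makes the comparison uniform over Lipschitz functions.\<close>

lemma clt_coupling:
  assumes sq: "\<And>t. 0 \<le> t \<Longrightarrow> integrable M (\<lambda>\<omega>. (S t \<omega>)\<^sup>2)"
    and mean: "\<And>t. 0 \<le> t \<Longrightarrow> expectation (S t) = t"
    and var: "\<And>t. 0 \<le> t \<Longrightarrow> variance (S t) = \<sigma>\<^sup>2 * t" and \<sigma>: "0 < \<sigma>"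
  obtains \<Lambda> :: "real measure" and Z Z' where "prob_space \<Lambda>" "\<And>k. Z k \<in> borel_measurable \<Lambda>" "Z' \<in> borel_measurable \<Lambda>"
    "\<And>k. 0 < k \<Longrightarrow> distr \<Lambda> borel (Z k) = distr M borel (\<lambda>\<omega>. - (S (real k) \<omega> - real k) / sqrt (real k))"
    "distr \<Lambda> borel Z' = density lborel (normal_density 0 \<sigma>)"
    "(\<lambda>k. \<integral>\<omega>. min 2 \<bar>Z k \<omega> - Z' \<omega>\<bar> \<partial>\<Lambda>) \<longlonglongrightarrow> 0"
proof -
  \<comment> \<open>The limit theorem is applied to increments over unit time, so the coupling runs
    along integer times.\<close>
  define X where "X i \<omega> = S (real (Suc i)) \<omega> - S (real i) \<omega>" for i \<omega>
  have Xm[measurable]: "X i \<in> borel_measurable M" for i unfolding X_def[abs_def] by simp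
  have Xd: "distr M borel (X i) = distr M borel (S 1)" for i
    unfolding X_def[abs_def] using increments_stationary[of "real i" "real (Suc i)"] by simp
  have trans: "(\<integral>\<omega>. h (X i \<omega>) \<partial>M) = (\<integral>\<omega>. h (S 1 \<omega>) \<partial>M)" if [measurable]: "h \<in> borel_measurable borel" for h :: "real \<Rightarrow> real" and i
  proof -
    have "(\<integral>\<omega>. h (X i \<omega>) \<partial>M) = (\<integral>x. h x \<partial>distr M borel (X i))" by (rule integral_distr[symmetric]) auto
    also have "\<dots> = (\<integral>\<omega>. h (S 1 \<omega>) \<partial>M)" unfolding Xd by (rule integral_distr) auto
    finally show ?thesis .
  qed
  have "indep_vars (\<lambda>_. borel) X {..<k}" for k
    unfolding X_def[abs_def] using increments_indep[of real k] by simp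
  \<comment> \<open>Independence of the infinite family concerns finite subfamilies only, and each
    of them lies in an initial segment.\<close>
  then have "indep_vars (\<lambda>_. borel) X J" if "finite J" for J
    using that by (meson finite_nat_iff_bounded indep_vars_subset)
  then have ind: "indep_vars (\<lambda>_. borel) X UNIV"
    unfolding indep_vars_def2 by (subst indep_sets_finite_index_sets) auto
  have sqX: "integrable M (\<lambda>\<omega>. (X i \<omega>)\<^sup>2)" for i
  proof -
    have "integrable (distr M borel (X i)) (\<lambda>x. x\<^sup>2)" unfolding Xd using sq[of 1] by (subst integrable_distr_eq) auto
    then show ?thesis by (subst (asm) integrable_distr_eq) auto
  qed
  have meanX: "expectation (X i) = 1" for i using trans[of "\<lambda>x. x" i] mean[of 1] by simp
  have varX: "variance (X i) = \<sigma>\<^sup>2" for i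
    using trans[of "\<lambda>x. (x - 1)\<^sup>2" i] var[of 1] mean[of 1] meanX[of i] by simp
  let ?\<mu> = "\<lambda>n. distr M borel (\<lambda>x. (\<Sum>i<n. X i x - 1) / sqrt (real n * \<sigma>\<^sup>2))"
  have wc: "weak_conv_m ?\<mu> std_normal_distribution"
    using central_limit_theorem[OF ind meanX \<sigma> sqX varX Xd] .
  have rd: "real_distribution (?\<mu> n)" for n
    by (rule real_distribution_distr) measurable
  have rn: "real_distribution std_normal_distribution" by (rule real_dist_normal_dist)
  obtain \<Lambda> :: "real measure" and V V' where V': "prob_space \<Lambda> \<and> (\<forall>n. V n \<in> borel_measurable \<Lambda>) \<and>
      (\<forall>n. distr \<Lambda> borel (V n) = ?\<mu> n) \<and> V' \<in> measurable \<Lambda> lborel \<and>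
      distr \<Lambda> borel V' = std_normal_distribution \<and> (\<forall>x\<in>space \<Lambda>. (\<lambda>n. V n x) \<longlonglongrightarrow> V' x)"
    using Skorohod[OF rd rn wc] by (elim exE) (rule that)
  have V: "prob_space \<Lambda>" "\<And>n. V n \<in> borel_measurable \<Lambda>" "\<And>n. distr \<Lambda> borel (V n) = ?\<mu> n"
      "V' \<in> measurable \<Lambda> lborel" "distr \<Lambda> borel V' = std_normal_distribution"
      "\<And>x. x \<in> space \<Lambda> \<Longrightarrow> (\<lambda>n. V n x) \<longlonglongrightarrow> V' x"
    using V' by blast+
  interpret L: prob_space \<Lambda> by fact
  have [measurable]: "V n \<in> borel_measurable \<Lambda>" "V' \<in> borel_measurable \<Lambda>" for n using V by simp_all
  \<comment> \<open>The factor \<open>- \<sigma>\<close> undoes the standardisation and supplies the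
    sign of the linearisation: a larger subordinator lowers \<open>log_Phi (x - S s)\<close>. The
    normal limit is symmetric.\<close>
  define Z where "Z k \<omega> = - \<sigma> * V k \<omega>" for k \<omega>
  define Z' where "Z' \<omega> = - \<sigma> * V' \<omega>" for \<omega>
  have Zm[measurable]: "Z k \<in> borel_measurable \<Lambda>" "Z' \<in> borel_measurable \<Lambda>" for k
    by (simp_all add: Z_def[abs_def] Z'_def[abs_def])
  show thesis
  proof (rule that[OF V(1) Zm])
    fix k :: nat assume k: "0 < k"
    have "distr \<Lambda> borel (Z k) = distr (distr \<Lambda> borel (V k)) borel (\<lambda>v. - \<sigma> * v)"
      by (subst distr_distr) (auto simp: Z_def[abs_def] comp_def)
    also have "\<dots> = distr M borel (\<lambda>\<omega>. - \<sigma> * ((\<Sum>i<k. X i \<omega> - 1) / sqrt (k * \<sigma>\<^sup>2)))"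
      unfolding V(3) by (subst distr_distr) (auto simp: comp_def)
    also have "\<dots> = distr M borel (\<lambda>\<omega>. - (S (real k) \<omega> - real k) / sqrt (real k))"
    proof (rule distr_cong)
      fix \<omega> assume \<omega>: "\<omega> \<in> space M"
      have "(\<Sum>i<k. X i \<omega> - 1) = S (real k) \<omega> - real k"
        using sum_lessThan_telescope[of "\<lambda>i. S (real i) \<omega>" k] S_zero[OF \<omega>] by (simp add: X_def sum_subtractf)
      moreover have "sqrt (real k * \<sigma>\<^sup>2) = sqrt (real k) * \<sigma>" using \<sigma> by (simp add: real_sqrt_mult)
      ultimately show "- \<sigma> * ((\<Sum>i<k. X i \<omega> - 1) / sqrt (real k * \<sigma>\<^sup>2)) = - (S (real k) \<omega> - real k) / sqrt (real k)"
        using \<sigma> k by (simp add: field_simps)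
    qed auto
    finally show "distr \<Lambda> borel (Z k) = distr M borel (\<lambda>\<omega>. - (S (real k) \<omega> - real k) / sqrt (real k))" .
  next
    have "distributed \<Lambda> lborel V' (normal_density 0 1)"
      using V(4,5) by (auto simp: distributed_def std_normal_density_def cong: distr_cong)
    from L.normal_density_affine[OF this, of "- \<sigma>" 0] \<sigma>
    have "distributed \<Lambda> lborel Z' (normal_density 0 \<sigma>)" by (simp add: Z'_def[abs_def])
    then show "distr \<Lambda> borel Z' = density lborel (normal_density 0 \<sigma>)"
      by (auto simp: distributed_def cong: distr_cong)
  next
    have "(\<lambda>k. \<integral>\<omega>. min 2 \<bar>Z k \<omega> - Z' \<omega>\<bar> \<partial>\<Lambda>) \<longlonglongrightarrow> (\<integral>\<omega>. 0 \<partial>\<Lambda>)"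
    proof (rule integral_dominated_convergence[where w="\<lambda>_. 2"])
      show "AE \<omega> in \<Lambda>. (\<lambda>k. min 2 \<bar>Z k \<omega> - Z' \<omega>\<bar>) \<longlonglongrightarrow> 0"
      proof (rule AE_I2)
        fix \<omega> assume "\<omega> \<in> space \<Lambda>"
        from V(6)[OF this] have "(\<lambda>k. min 2 \<bar>Z k \<omega> - Z' \<omega>\<bar>) \<longlonglongrightarrow> min 2 \<bar>- \<sigma> * V' \<omega> - Z' \<omega>\<bar>"
          unfolding Z_def by (intro tendsto_intros)
        then show "(\<lambda>k. min 2 \<bar>Z k \<omega> - Z' \<omega>\<bar>) \<longlonglongrightarrow> 0" by (simp add: Z'_def)
      qed
    qed auto
    then show "(\<lambda>k. \<integral>\<omega>. min 2 \<bar>Z k \<omega> - Z' \<omega>\<bar> \<partial>\<Lambda>) \<longlonglongrightarrow> 0" by simp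
  qed
qed

end

section \<open>Linearisation of the compensator\<close>

lemma (in prob_space) nn_integral_swap:
  assumes "(\<lambda>z. f (fst z) (snd z)) \<in> borel_measurable (M \<Otimes>\<^sub>M lborel)"
  shows "(\<integral>\<^sup>+\<omega>. \<integral>\<^sup>+s. f \<omega> s \<partial>lborel \<partial>M) = (\<integral>\<^sup>+s. \<integral>\<^sup>+\<omega>. f \<omega> s \<partial>M \<partial>lborel)"
proof -
  interpret pair_sigma_finite M lborel ..
  show ?thesis using Fubini'[of f] assms by (simp add: case_prod_beta')
qed

lemma nn_integral_reflect:
  fixes f :: "real \<Rightarrow> ennreal"
  assumes [measurable]: "f \<in> borel_measurable borel"
  shows "(\<integral>\<^sup>+s. f (x - s) \<partial>lborel) = (\<integral>\<^sup>+w. f w \<partial>lborel)"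
  by (subst (2) nn_integral_real_affine[where c="-1" and t=x]) auto

locale occupancy_moments = occupancy M \<nu> S P
  for M :: "'a measure" and \<nu> S P +
  fixes \<sigma> :: real
  assumes square_integrable: "\<And>t. 0 \<le> t \<Longrightarrow> integrable M (\<lambda>\<omega>. (S t \<omega>)\<^sup>2)"
    and mean: "\<And>t. 0 \<le> t \<Longrightarrow> expectation (S t) = t"
    and var: "\<And>t. 0 \<le> t \<Longrightarrow> variance (S t) = \<sigma>\<^sup>2 * t"
    and \<sigma>_nonneg: "0 \<le> \<sigma>"
    and A1: "assumption_A1 \<nu>"
begin

lemma nn_increment_square:
  assumes "0 \<le> s" "s \<le> t"
  shows "(\<integral>\<^sup>+\<omega>. ennreal ((S t \<omega> - S s \<omega> - (t - s))\<^sup>2) \<partial>M) = ennreal (\<sigma>\<^sup>2 * (t - s))"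
proof -
  have m[measurable]: "S t \<in> borel_measurable M" "S s \<in> borel_measurable M" "S (t - s) \<in> borel_measurable M"
    using assms by auto
  let ?u = "t - s"
  have "(\<integral>\<^sup>+\<omega>. ennreal ((S t \<omega> - S s \<omega> - ?u)\<^sup>2) \<partial>M) =
      (\<integral>\<^sup>+x. ennreal ((x - ?u)\<^sup>2) \<partial>distr M borel (\<lambda>\<omega>. S t \<omega> - S s \<omega>))"
    by (rule nn_integral_distr[symmetric]) auto
  also have "\<dots> = (\<integral>\<^sup>+\<omega>. ennreal ((S ?u \<omega> - ?u)\<^sup>2) \<partial>M)"
    unfolding increments_stationary[OF assms] by (rule nn_integral_distr) auto
  also have "\<dots> = ennreal (\<integral>\<omega>. (S ?u \<omega> - ?u)\<^sup>2 \<partial>M)"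
  proof (rule nn_integral_eq_integral)
    have "integrable M (S ?u)"
      by (rule square_integrable_imp_integrable[OF m(3) square_integrable]) (use assms in simp)
    then show "integrable M (\<lambda>\<omega>. (S ?u \<omega> - ?u)\<^sup>2)"
      using square_integrable[of ?u] assms by (simp add: power2_diff)
  qed auto
  also have "\<dots> = ennreal (\<sigma>\<^sup>2 * ?u)" using var[of ?u] mean[of ?u] assms by simp
  finally show ?thesis .
qed

lemma nn_abs_le_of_square:
  fixes f :: "'a \<Rightarrow> real"
  assumes [measurable]: "f \<in> borel_measurable M" and sq: "(\<integral>\<^sup>+\<omega>. ennreal ((f \<omega>)\<^sup>2) \<partial>M) \<le> ennreal (a\<^sup>2)" and a: "0 \<le> a"
  shows "(\<integral>\<^sup>+\<omega>. ennreal \<bar>f \<omega>\<bar> \<partial>M) \<le> ennreal a"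
proof -
  have i2: "integrable M (\<lambda>\<omega>. (f \<omega>)\<^sup>2)"
    by (rule integrableI_bounded) (use sq in \<open>auto simp: le_less_trans\<close>)
  have i: "integrable M f" by (rule square_integrable_imp_integrable[OF assms(1) i2])
  have "ennreal (expectation (\<lambda>\<omega>. (f \<omega>)\<^sup>2)) \<le> ennreal (a\<^sup>2)"
    using sq by (subst (asm) nn_integral_eq_integral[OF i2]) auto
  then have "expectation (\<lambda>\<omega>. (f \<omega>)\<^sup>2) \<le> a\<^sup>2" by simp
  then have "sqrt (expectation (\<lambda>\<omega>. \<bar>f \<omega>\<bar>\<^sup>2)) \<le> a" using a real_le_lsqrt by simp
  moreover have "expectation (\<lambda>\<omega>. \<bar>f \<omega>\<bar>) \<le> sqrt (expectation (\<lambda>\<omega>. \<bar>f \<omega>\<bar>\<^sup>2))"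
    by (rule expectation_sq_le) (use i2 in auto)
  moreover have "(\<integral>\<^sup>+\<omega>. ennreal \<bar>f \<omega>\<bar> \<partial>M) = ennreal (expectation (\<lambda>\<omega>. \<bar>f \<omega>\<bar>))"
    by (rule nn_integral_eq_integral) (use i in auto)
  ultimately show ?thesis by (auto intro: ennreal_leI)
qed

lemma nn_abs_increment:
  assumes "0 \<le> s" "s \<le> t"
  shows "(\<integral>\<^sup>+\<omega>. ennreal \<bar>S t \<omega> - S s \<omega> - (t - s)\<bar> \<partial>M) \<le> ennreal (\<sigma> * sqrt (t - s))"
proof (rule nn_abs_le_of_square)
  show "(\<integral>\<^sup>+\<omega>. ennreal ((S t \<omega> - S s \<omega> - (t - s))\<^sup>2) \<partial>M) \<le> ennreal ((\<sigma> * sqrt (t - s))\<^sup>2)"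
    using nn_increment_square[OF assms] assms by (simp add: power_mult_distrib)
  have [measurable]: "S t \<in> borel_measurable M" "S s \<in> borel_measurable M" using assms by auto
  show "(\<lambda>\<omega>. S t \<omega> - S s \<omega> - (t - s)) \<in> borel_measurable M" by measurable
qed (use \<sigma>_nonneg assms in simp)

text \<open>With zero variance \<open>S 1\<close> would equal 1 almost surely, so the Laplace
  exponent would be the identity on integers, against its sublinearity. The central limit theorem
  needs a positive variance.\<close>

lemma \<sigma>_pos: "0 < \<sigma>"
proof (rule ccontr)
  assume "\<not> 0 < \<sigma>"
  then have "\<sigma> = 0" using \<sigma>_nonneg by simp
  have [measurable]: "S 1 \<in> borel_measurable M" "S 0 \<in> borel_measurable M" by auto
  have "(\<integral>\<^sup>+\<omega>. ennreal ((S 1 \<omega> - S 0 \<omega> - (1 - 0))\<^sup>2) \<partial>M) = 0"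
    using nn_increment_square[of 0 1] \<open>\<sigma> = 0\<close> by simp
  then have "AE \<omega> in M. ennreal ((S 1 \<omega> - S 0 \<omega> - (1 - 0))\<^sup>2) = 0" by (subst (asm) nn_integral_0_iff_AE) auto
  then have one: "AE \<omega> in M. S 1 \<omega> = 1" using AE_space by eventually_elim (simp add: S_zero)
  have "laplace_exponent (real k) = real k" for k
  proof -
    have "exp (- (1 * laplace_exponent (real k))) = expectation (\<lambda>\<omega>. exp (- (real k * S 1 \<omega>)))"
      by (rule laplace_transform[symmetric]) auto
    also have "\<dots> = expectation (\<lambda>\<omega>. exp (- real k))"
      by (rule integral_cong_AE) (use one in \<open>auto elim!: eventually_mono\<close>)
    finally show ?thesis by (simp add: prob_space)
  qed
  then have "(\<lambda>k. laplace_exponent (real k) / real k) \<longlonglongrightarrow> 1"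
    by (intro tendsto_eventually) (auto simp: eventually_sequentially intro!: exI[of _ 1])
  from LIMSEQ_unique[OF this laplace_exponent_sublinear] show False by simp
qed

lemma log_phi_interval:
  assumes "a \<le> b"
  shows "ennreal \<bar>log_Phi b - log_Phi a - (b - a) * c\<bar> \<le> (\<integral>\<^sup>+z. ennreal \<bar>log_phi z - c\<bar> * indicator {a..b} z \<partial>lborel)"
proof -
  have cont: "continuous_on {a..b} (\<lambda>z. log_phi z - c)" by (intro continuous_intros continuous_log_phi)
  have i: "integrable lborel (\<lambda>z. indicator {a..b} z *\<^sub>R (log_phi z - c))"
    using borel_integrable_atLeastAtMost'[OF cont] by (simp add: set_integrable_def)
  have "(\<integral>z. indicator {a..b} z *\<^sub>R (log_phi z - c) \<partial>lborel) = (log_Phi b - c * b) - (log_Phi a - c * a)"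
  proof (rule integral_FTC_atLeastAtMost[OF assms _ cont])
    fix z
    have "((\<lambda>z. log_Phi z - c * z) has_real_derivative log_phi z - c * 1) (at z)"
      by (intro DERIV_diff DERIV_log_Phi DERIV_cmult DERIV_ident)
    then show "((\<lambda>z. log_Phi z - c * z) has_vector_derivative log_phi z - c) (at z within {a..b})"
      by (simp add: has_real_derivative_iff_has_vector_derivative[symmetric] has_field_derivative_at_within)
  qed
  then have "ennreal \<bar>log_Phi b - log_Phi a - (b - a) * c\<bar> = ennreal (norm (\<integral>z. indicator {a..b} z *\<^sub>R (log_phi z - c) \<partial>lborel))"
    by (simp add: algebra_simps)
  also have "\<dots> \<le> (\<integral>\<^sup>+z. ennreal (norm (indicator {a..b} z *\<^sub>R (log_phi z - c))) \<partial>lborel)"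
    by (rule integral_norm_bound_ennreal[OF i])
  also have "\<dots> = (\<integral>\<^sup>+z. ennreal \<bar>log_phi z - c\<bar> * indicator {a..b} z \<partial>lborel)"
    by (intro nn_integral_cong) (auto simp: indicator_def)
  finally show ?thesis .
qed

text \<open>The indicator of the interval between \<open>w\<close> and \<open>w - d\<close> is replaced by a smooth kernel times
  a factor whose expectation is bounded by the variance of \<open>d\<close>.\<close>

lemma log_phi_between:
  assumes x: "0 < x" and w: "w \<le> x" "w - d \<le> x"
  shows "ennreal \<bar>log_Phi (w - d) - log_Phi w + d * c\<bar> \<le>
    (\<integral>\<^sup>+z. ennreal (\<bar>log_phi z - c\<bar> * (x / ((z - w)\<^sup>2 + x))) * indicator {..x} z \<partial>lborel) * ennreal (d\<^sup>2 / x + 1)"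
proof -
  define a b where "a = min w (w - d)" and "b = max w (w - d)"
  have "\<bar>log_Phi (w - d) - log_Phi w + d * c\<bar> = \<bar>log_Phi b - log_Phi a - (b - a) * c\<bar>"
  proof (cases "0 \<le> d")
    case True
    then have ab: "a = w - d" "b = w" by (auto simp: a_def b_def)
    have "log_Phi b - log_Phi a - (b - a) * c = - (log_Phi (w - d) - log_Phi w + d * c)" unfolding ab by simp
    then show ?thesis by (simp only: abs_minus_cancel)
  next
    case False
    then have "a = w" "b = w - d" by (auto simp: a_def b_def)
    then show ?thesis by simp
  qed
  also have "ennreal \<dots> \<le> (\<integral>\<^sup>+z. ennreal \<bar>log_phi z - c\<bar> * indicator {a..b} z \<partial>lborel)"
    by (rule log_phi_interval) (simp add: a_def b_def)
  also have "\<dots> \<le> (\<integral>\<^sup>+z. ennreal (\<bar>log_phi z - c\<bar> * (x / ((z - w)\<^sup>2 + x))) * indicator {..x} z * ennreal (d\<^sup>2 / x + 1) \<partial>lborel)"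
  proof (rule nn_integral_mono)
    fix z
    show "ennreal \<bar>log_phi z - c\<bar> * indicator {a..b} z \<le>
      ennreal (\<bar>log_phi z - c\<bar> * (x / ((z - w)\<^sup>2 + x))) * indicator {..x} z * ennreal (d\<^sup>2 / x + 1)"
    proof (cases "z \<in> {a..b}")
      case True
      have "\<bar>z - w\<bar> \<le> \<bar>d\<bar>" "z \<le> x" using True w by (auto simp: a_def b_def abs_if split: if_splits)
      then have "(z - w)\<^sup>2 \<le> d\<^sup>2" by (simp add: abs_le_square_iff)
      have pos: "0 < (z - w)\<^sup>2 + x" using x by (simp add: add_nonneg_pos)
      \<comment> \<open>On the interval \<open>\<bar>z - w\<bar>\<close> is at most
        \<open>\<bar>d\<bar>\<close>, which makes the product of the kernel and
        \<open>d\<^sup>2 / x + 1\<close> at least 1.\<close>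
      have "1 \<le> (d\<^sup>2 + x) / ((z - w)\<^sup>2 + x)" using \<open>(z - w)\<^sup>2 \<le> d\<^sup>2\<close> pos by simp
      also have "\<dots> = x / ((z - w)\<^sup>2 + x) * (d\<^sup>2 / x + 1)"
      proof -
        have "d\<^sup>2 / x + 1 = (d\<^sup>2 + x) / x" using x by (simp add: field_simps)
        then show ?thesis using x by simp
      qed
      finally have "\<bar>log_phi z - c\<bar> * 1 \<le> \<bar>log_phi z - c\<bar> * (x / ((z - w)\<^sup>2 + x) * (d\<^sup>2 / x + 1))"
        by (intro mult_left_mono) auto
      then have "ennreal \<bar>log_phi z - c\<bar> \<le> ennreal (\<bar>log_phi z - c\<bar> * (x / ((z - w)\<^sup>2 + x)) * (d\<^sup>2 / x + 1))"
        by (intro ennreal_leI) (simp add: mult.assoc)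
      also have "\<dots> = ennreal (\<bar>log_phi z - c\<bar> * (x / ((z - w)\<^sup>2 + x))) * ennreal (d\<^sup>2 / x + 1)"
        using x pos by (intro ennreal_mult) (auto intro!: mult_nonneg_nonneg divide_nonneg_pos add_nonneg_nonneg)
      finally show ?thesis using True \<open>z \<le> x\<close> by simp
    qed simp
  qed
  also have "\<dots> = (\<integral>\<^sup>+z. ennreal (\<bar>log_phi z - c\<bar> * (x / ((z - w)\<^sup>2 + x))) * indicator {..x} z \<partial>lborel) * ennreal (d\<^sup>2 / x + 1)"
    by (rule nn_integral_multc) measurable
  finally show ?thesis by simp
qed

lemma nn_square_factor:
  assumes x: "0 < x" and s: "0 \<le> s" "s \<le> \<tau> * x"
  shows "(\<integral>\<^sup>+\<omega>. ennreal ((S s \<omega> - s)\<^sup>2 / x + 1) \<partial>M) \<le> ennreal (\<sigma>\<^sup>2 * \<tau> + 1)"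
proof -
  have [measurable]: "S s \<in> borel_measurable M" using s by simp
  have "(\<integral>\<^sup>+\<omega>. ennreal ((S s \<omega> - s)\<^sup>2 / x + 1) \<partial>M) = (\<integral>\<^sup>+\<omega>. ennreal (1 / x) * ennreal ((S s \<omega> - S 0 \<omega> - (s - 0))\<^sup>2) + 1 \<partial>M)"
  proof (rule nn_integral_cong)
    fix \<omega> assume "\<omega> \<in> space M"
    then show "ennreal ((S s \<omega> - s)\<^sup>2 / x + 1) = ennreal (1 / x) * ennreal ((S s \<omega> - S 0 \<omega> - (s - 0))\<^sup>2) + 1"
      using x by (simp add: S_zero ennreal_mult[symmetric] ennreal_1[symmetric] ennreal_plus[symmetric] del: ennreal_1 ennreal_plus)
  qed
  also have "\<dots> = ennreal (1 / x) * (\<integral>\<^sup>+\<omega>. ennreal ((S s \<omega> - S 0 \<omega> - (s - 0))\<^sup>2) \<partial>M) + 1"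
    using S_measurable[of 0] by (subst nn_integral_add) (auto simp: nn_integral_cmult emeasure_space_1)
  also have "\<dots> = ennreal (\<sigma>\<^sup>2 * s / x + 1)"
    using nn_increment_square[OF order_refl s(1)] x s
    by (simp add: ennreal_mult[symmetric] ennreal_1[symmetric] ennreal_plus[symmetric] del: ennreal_1 ennreal_plus)
  also have "\<dots> \<le> ennreal (\<sigma>\<^sup>2 * \<tau> + 1)"
  proof -
    have "\<sigma>\<^sup>2 * s \<le> \<sigma>\<^sup>2 * (\<tau> * x)" using s by (intro mult_left_mono) auto
    then show ?thesis using x by (intro ennreal_leI) (simp add: field_simps)
  qed
  finally show ?thesis .
qed

section \<open>The error terms of the compensator and their expectations\<close>

definition linearisation_error :: "real \<Rightarrow> 'a \<Rightarrow> ennreal" where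
  "linearisation_error x \<omega> = (\<integral>\<^sup>+s. ennreal \<bar>log_Phi (x - S (max 0 s) \<omega>) - log_Phi (x - s) +
    (S (max 0 s) \<omega> - s) * log_phi (x - s)\<bar> * indicator {0..x} s \<partial>lborel)"

definition late_growth :: "real \<Rightarrow> real \<Rightarrow> 'a \<Rightarrow> ennreal" where
  "late_growth x T \<omega> = (\<integral>\<^sup>+s. ennreal (log_Phi (x - S (max 0 s) \<omega>)) * indicator {x..T} s \<partial>lborel)"

text \<open>A centred random walk with \<open>m\<close> steps of integer duration \<open>k\<close>,
  a step being counted once the corresponding fraction of \<open>[0, x]\<close> has passed. For
  \<open>k = nat \<lfloor>x / m\<rfloor>\<close> the number \<open>m * k\<close> is only close to
  \<open>x\<close>, hence the norming \<open>sqrt (m * k)\<close>.\<close>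

definition step_approximation :: "real \<Rightarrow> nat \<Rightarrow> nat \<Rightarrow> real \<Rightarrow> 'a \<Rightarrow> real" where
  "step_approximation x m k s \<omega> = (\<Sum>i<m. (S (real (Suc i * k)) \<omega> - S (real (i * k)) \<omega> - real k) / sqrt (real (m * k)) *
    of_bool (real (Suc i) * x / real m \<le> s))"

definition step_error :: "real \<Rightarrow> nat \<Rightarrow> nat \<Rightarrow> 'a \<Rightarrow> ennreal" where
  "step_error x m k \<omega> = (\<integral>\<^sup>+s. ennreal (log_phi (x - s) *
    \<bar>(S (max 0 s) \<omega> - s) / sqrt x - step_approximation x m k s \<omega>\<bar>) * indicator {0..x} s \<partial>lborel)"

lemma log_Phi_measurable [measurable]: "log_Phi \<in> borel_measurable borel"
  unfolding log_Phi_def[abs_def] by measurable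

lemma error_measurable [measurable]:
  "linearisation_error x \<in> borel_measurable M" "late_growth x T \<in> borel_measurable M" "step_error x m k \<in> borel_measurable M"
  unfolding linearisation_error_def[abs_def] late_growth_def[abs_def] step_error_def[abs_def] step_approximation_def
  by measurable

context
  fixes C K y0
  assumes growth: "regular_growth log_Phi log_phi C K y0"
begin

interpretation RG: regular_growth log_Phi log_phi C K y0 by (rule growth)

text \<open>For each \<open>s\<close> the error is bounded by \<open>log_phi_between\<close> with
  \<open>d = S s - s\<close>, and the variance bounds the mean of the random factor by
  \<open>\<sigma>\<^sup>2 + 1\<close>. Substituting \<open>w = x - s\<close> leaves exactly the
  fluctuation integral.\<close>

lemma expected_linearisation_error:
  assumes x: "0 < x"
  shows "(\<integral>\<^sup>+\<omega>. linearisation_error x \<omega> \<partial>M) \<le> ennreal (\<sigma>\<^sup>2 + 1) * RG.fluctuation x"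
proof -
  define I where "I w = (\<integral>\<^sup>+z. ennreal (\<bar>log_phi z - log_phi w\<bar> * (x / ((z - w)\<^sup>2 + x))) * indicator {..x} z \<partial>lborel)" for w
  have [measurable]: "I \<in> borel_measurable borel" unfolding I_def[abs_def] by measurable
  have "(\<integral>\<^sup>+\<omega>. linearisation_error x \<omega> \<partial>M) = (\<integral>\<^sup>+s. \<integral>\<^sup>+\<omega>. ennreal \<bar>log_Phi (x - S (max 0 s) \<omega>) - log_Phi (x - s) +
      (S (max 0 s) \<omega> - s) * log_phi (x - s)\<bar> * indicator {0..x} s \<partial>M \<partial>lborel)"
    unfolding linearisation_error_def by (rule nn_integral_swap) measurable
  also have "\<dots> \<le> (\<integral>\<^sup>+s. I (x - s) * indicator {0..x} (x - s) * ennreal (\<sigma>\<^sup>2 + 1) \<partial>lborel)"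
  proof (rule nn_integral_mono)
    fix s
    show "(\<integral>\<^sup>+\<omega>. ennreal \<bar>log_Phi (x - S (max 0 s) \<omega>) - log_Phi (x - s) +
      (S (max 0 s) \<omega> - s) * log_phi (x - s)\<bar> * indicator {0..x} s \<partial>M) \<le> I (x - s) * indicator {0..x} (x - s) * ennreal (\<sigma>\<^sup>2 + 1)"
    proof (cases "s \<in> {0..x}")
      case True
      then have s: "0 \<le> s" "s \<le> x" by auto
      have [measurable]: "S s \<in> borel_measurable M" using s by simp
      have "(\<integral>\<^sup>+\<omega>. ennreal \<bar>log_Phi (x - S (max 0 s) \<omega>) - log_Phi (x - s) +
          (S (max 0 s) \<omega> - s) * log_phi (x - s)\<bar> * indicator {0..x} s \<partial>M) \<le>
          (\<integral>\<^sup>+\<omega>. I (x - s) * ennreal ((S s \<omega> - s)\<^sup>2 / x + 1) \<partial>M)"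
      proof (rule nn_integral_mono)
        fix \<omega> assume "\<omega> \<in> space M"
        then have "0 \<le> S s \<omega>" using S_nonneg s by simp
        then show "ennreal \<bar>log_Phi (x - S (max 0 s) \<omega>) - log_Phi (x - s) +
          (S (max 0 s) \<omega> - s) * log_phi (x - s)\<bar> * indicator {0..x} s \<le> I (x - s) * ennreal ((S s \<omega> - s)\<^sup>2 / x + 1)"
          using log_phi_between[OF x, of "x - s" "S s \<omega> - s" "log_phi (x - s)"] s True by (simp add: I_def)
      qed
      also have "\<dots> = I (x - s) * (\<integral>\<^sup>+\<omega>. ennreal ((S s \<omega> - s)\<^sup>2 / x + 1) \<partial>M)" by (rule nn_integral_cmult) measurable
      also have "\<dots> \<le> I (x - s) * ennreal (\<sigma>\<^sup>2 + 1)"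
        using nn_square_factor[OF x s(1), of 1] s by (intro mult_left_mono) auto
      finally show ?thesis using True by simp
    qed simp
  qed
  also have "\<dots> = (\<integral>\<^sup>+w. I w * indicator {0..x} w * ennreal (\<sigma>\<^sup>2 + 1) \<partial>lborel)"
    by (rule nn_integral_reflect) measurable
  also have "\<dots> = (\<integral>\<^sup>+w. I w * indicator {0..x} w \<partial>lborel) * ennreal (\<sigma>\<^sup>2 + 1)" by (rule nn_integral_multc) measurable
  also have "(\<integral>\<^sup>+w. I w * indicator {0..x} w \<partial>lborel) = RG.fluctuation x"
    unfolding RG.fluctuation_def I_def RG.kern_eq
    by (intro nn_integral_cong nn_integral_multc[symmetric]) measurable
  finally show ?thesis by (simp add: mult.commute)
qed

text \<open>After time \<open>x\<close> the value along the mean path,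
  \<open>log_Phi (x - s)\<close>, is at most \<open>laplace_exponent 1 * exp (x - s)\<close> and so
  has a bounded integral. The deviation from it is controlled by \<open>log_phi_between\<close> with
  \<open>c = 0\<close>, which yields the overshoot integral.\<close>

lemma expected_late_growth:
  assumes x: "0 < x" and \<tau>: "1 \<le> \<tau>"
  shows "(\<integral>\<^sup>+\<omega>. late_growth x (\<tau> * x) \<omega> \<partial>M) \<le> ennreal (laplace_exponent 1) + ennreal (\<sigma>\<^sup>2 * \<tau> + 1) * RG.overshoot x"
proof -
  define c where "c = laplace_exponent 1"
  have c: "0 \<le> c" using laplace_exponent_nat_nonneg[of 1] by (simp add: c_def)
  define I where "I w = (\<integral>\<^sup>+z. ennreal (log_phi z * (x / ((z - w)\<^sup>2 + x))) * indicator {..x} z \<partial>lborel)" for w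
  have [measurable]: "I \<in> borel_measurable borel" unfolding I_def[abs_def] by measurable
  have "(\<integral>\<^sup>+\<omega>. late_growth x (\<tau> * x) \<omega> \<partial>M) =
      (\<integral>\<^sup>+s. \<integral>\<^sup>+\<omega>. ennreal (log_Phi (x - S (max 0 s) \<omega>)) * indicator {x..\<tau> * x} s \<partial>M \<partial>lborel)"
    unfolding late_growth_def by (rule nn_integral_swap) measurable
  also have "\<dots> \<le> (\<integral>\<^sup>+s. ennreal (c * exp (x - s)) * indicator {x..\<tau> * x} s +
      I (x - s) * indicator {..0} (x - s) * ennreal (\<sigma>\<^sup>2 * \<tau> + 1) \<partial>lborel)"
  proof (rule nn_integral_mono)
    fix s
    show "(\<integral>\<^sup>+\<omega>. ennreal (log_Phi (x - S (max 0 s) \<omega>)) * indicator {x..\<tau> * x} s \<partial>M) \<le>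
      ennreal (c * exp (x - s)) * indicator {x..\<tau> * x} s + I (x - s) * indicator {..0} (x - s) * ennreal (\<sigma>\<^sup>2 * \<tau> + 1)"
    proof (cases "s \<in> {x..\<tau> * x}")
      case True
      then have s: "0 \<le> s" "x \<le> s" "s \<le> \<tau> * x" using x by auto
      have [measurable]: "S s \<in> borel_measurable M" using s by simp
      have "(\<integral>\<^sup>+\<omega>. ennreal (log_Phi (x - S (max 0 s) \<omega>)) * indicator {x..\<tau> * x} s \<partial>M) \<le>
          (\<integral>\<^sup>+\<omega>. ennreal (c * exp (x - s)) + I (x - s) * ennreal ((S s \<omega> - s)\<^sup>2 / x + 1) \<partial>M)"
      proof (rule nn_integral_mono)
        fix \<omega> assume "\<omega> \<in> space M"
        then have S0: "0 \<le> S s \<omega>" using S_nonneg s by simp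
        have "log_Phi (x - S s \<omega>) \<le> c * exp (x - s) + \<bar>log_Phi (x - S s \<omega>) - log_Phi (x - s)\<bar>"
          using log_Phi_le_exp[of "x - s"] by (simp add: c_def)
        then have "ennreal (log_Phi (x - S s \<omega>)) \<le> ennreal (c * exp (x - s)) + ennreal \<bar>log_Phi (x - S s \<omega>) - log_Phi (x - s)\<bar>"
          using c by (simp add: ennreal_plus[symmetric] ennreal_leI del: ennreal_plus)
        also have "ennreal \<bar>log_Phi (x - S s \<omega>) - log_Phi (x - s)\<bar> \<le> I (x - s) * ennreal ((S s \<omega> - s)\<^sup>2 / x + 1)"
          using log_phi_between[OF x, of "x - s" "S s \<omega> - s" 0] s S0 RG.g_pos by (simp add: I_def less_imp_le)
        finally show "ennreal (log_Phi (x - S (max 0 s) \<omega>)) * indicator {x..\<tau> * x} s \<le>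
            ennreal (c * exp (x - s)) + I (x - s) * ennreal ((S s \<omega> - s)\<^sup>2 / x + 1)"
          using s by (auto simp: add_left_mono)
      qed
      also have "\<dots> = ennreal (c * exp (x - s)) + I (x - s) * (\<integral>\<^sup>+\<omega>. ennreal ((S s \<omega> - s)\<^sup>2 / x + 1) \<partial>M)"
        by (simp add: nn_integral_add nn_integral_cmult emeasure_space_1)
      also have "\<dots> \<le> ennreal (c * exp (x - s)) + I (x - s) * ennreal (\<sigma>\<^sup>2 * \<tau> + 1)"
        using nn_square_factor[OF x s(1,3)] by (intro add_left_mono mult_left_mono) auto
      finally show ?thesis using True s by simp
    qed simp
  qed
  also have "\<dots> = (\<integral>\<^sup>+s. ennreal (c * exp (x - s)) * indicator {x..\<tau> * x} s \<partial>lborel) +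
      (\<integral>\<^sup>+s. I (x - s) * indicator {..0} (x - s) * ennreal (\<sigma>\<^sup>2 * \<tau> + 1) \<partial>lborel)"
    by (rule nn_integral_add) measurable
  also have "(\<integral>\<^sup>+s. I (x - s) * indicator {..0} (x - s) * ennreal (\<sigma>\<^sup>2 * \<tau> + 1) \<partial>lborel) =
      (\<integral>\<^sup>+w. I w * indicator {..0} w * ennreal (\<sigma>\<^sup>2 * \<tau> + 1) \<partial>lborel)"
    by (rule nn_integral_reflect) measurable
  also have "\<dots> = (\<integral>\<^sup>+w. I w * indicator {..0} w \<partial>lborel) * ennreal (\<sigma>\<^sup>2 * \<tau> + 1)" by (rule nn_integral_multc) measurable
  also have "(\<integral>\<^sup>+w. I w * indicator {..0} w \<partial>lborel) = RG.overshoot x"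
    unfolding RG.overshoot_def I_def RG.kern_eq
    by (intro nn_integral_cong nn_integral_multc[symmetric]) measurable
  also have "(\<integral>\<^sup>+s. ennreal (c * exp (x - s)) * indicator {x..\<tau> * x} s \<partial>lborel) \<le> ennreal c"
  proof -
    have "(\<integral>\<^sup>+s. ennreal (c * exp (x - s)) * indicator {x..\<tau> * x} s \<partial>lborel) =
        ennreal (- c * exp (x - \<tau> * x) - (- c * exp (x - x)))"
      by (rule nn_integral_FTC_Icc) (use c x \<tau> in \<open>auto intro!: derivative_eq_intros\<close>)
    also have "\<dots> \<le> ennreal c" using c by (intro ennreal_leI) simp
    finally show ?thesis .
  qed
  finally show ?thesis by (simp add: c_def mult.commute add_right_mono)
qed

lemma step_approximation_eq:
  assumes x: "0 < x" and m: "0 < m" and s: "0 \<le> s" "s \<le> x" and \<omega>: "\<omega> \<in> space M"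
  defines "j \<equiv> nat \<lfloor>real m * s / x\<rfloor>"
  shows "step_approximation x m k s \<omega> = (S (real (j * k)) \<omega> - real (j * k)) / sqrt (real (m * k))"
proof -
  have r: "0 \<le> real m * s / x" "real m * s / x \<le> real m" using x m s by (auto simp: field_simps)
  have j: "j \<le> m" using r unfolding j_def by linarith
  have iff: "real (Suc i) * x / real m \<le> s \<longleftrightarrow> i < j" for i
  proof -
    have "real (Suc i) * x / real m \<le> s \<longleftrightarrow> real (Suc i) \<le> real m * s / x" using x m by (simp add: field_simps)
    also have "\<dots> \<longleftrightarrow> Suc i \<le> j" unfolding j_def using r by (simp add: le_nat_iff le_floor_iff)
    finally show ?thesis by (simp add: Suc_le_eq)
  qed
  have "step_approximation x m k s \<omega> =
      (\<Sum>i\<in>{..<j}. (S (real (Suc i * k)) \<omega> - S (real (i * k)) \<omega> - real k) / sqrt (real (m * k)))"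
    unfolding step_approximation_def iff
    by (rule sum.mono_neutral_cong_right) (use j in auto)
  also have "\<dots> = ((\<Sum>i<j. S (real (Suc i * k)) \<omega> - S (real (i * k)) \<omega>) - real j * real k) / sqrt (real (m * k))"
    by (simp add: sum_divide_distrib[symmetric] sum_subtractf)
  also have "(\<Sum>i<j. S (real (Suc i * k)) \<omega> - S (real (i * k)) \<omega>) = S (real (j * k)) \<omega> - S (real (0 * k)) \<omega>"
    by (rule sum_lessThan_telescope)
  finally show ?thesis using S_zero[OF \<omega>] by simp
qed

text \<open>Two sources of error: the shift from time \<open>s\<close> to the last completed step at
  \<open>j * k\<close>, which costs \<open>2 / sqrt m\<close>, and the norming by
  \<open>sqrt (m * k)\<close> instead of \<open>sqrt x\<close>, which costs
  \<open>1 / sqrt m\<close>. Both are multiplied by \<open>\<sigma>\<close>.\<close>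

lemma expected_step_difference:
  assumes m: "0 < m" and xm: "(real m)\<^sup>2 \<le> x" and s: "0 \<le> s" "s \<le> x"
  defines "k \<equiv> nat \<lfloor>x / real m\<rfloor>"
  shows "(\<integral>\<^sup>+\<omega>. ennreal \<bar>(S s \<omega> - s) / sqrt x - step_approximation x m k s \<omega>\<bar> \<partial>M) \<le> ennreal (3 * \<sigma> / sqrt (real m))"
proof -
  have m1: "1 \<le> real m" using m by simp
  then have "1 * 1 \<le> real m * real m" by (intro mult_mono) auto
  then have x1: "1 \<le> x" using xm by (simp add: power2_eq_square)
  then have x: "0 < x" by simp
  have mx: "real m \<le> x / real m" using xm m by (simp add: field_simps power2_eq_square)
  \<comment> \<open>Here \<open>m\<^sup>2 \<le> x\<close> enters: a step is at least as long as the
    number of steps, so rounding its length down is negligible even when accumulated.\<close>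
  have "m \<le> k" unfolding k_def by (rule le_nat_floor[OF mx])
  moreover have "0 \<le> x / real m" using x by simp
  then have "real k \<le> x / real m" "x / real m < real k + 1" unfolding k_def by linarith+
  ultimately have k: "real k \<le> x / real m" "x / real m < real k + 1" "real m \<le> real k" "1 \<le> real k"
    using m1 by auto
  define j where "j = nat \<lfloor>real m * s / x\<rfloor>"
  have r: "0 \<le> real m * s / x" "real m * s / x \<le> real m" using x m s by (auto simp: field_simps)
  have j: "real j \<le> real m * s / x" "real m * s / x < real j + 1" "real j \<le> real m"
    using r unfolding j_def by linarith+
  have jx: "real j * x / real m \<le> s" "s < (real j + 1) * x / real m" using j x m by (auto simp: field_simps)
  have jk: "real (j * k) \<le> s"
  proof -
    have "real j * real k \<le> real j * (x / real m)" using k by (intro mult_left_mono) auto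
    then show ?thesis using jx by simp
  qed
  \<comment> \<open>One \<open>x / m\<close> is due to the unfinished step; the other one bounds the
    rounding loss of less than 1 in each of \<open>j \<le> m \<le> x / m\<close> steps.\<close>
  have diff: "s - real (j * k) \<le> 2 * x / real m"
  proof -
    have "real j * (x / real m) \<le> real j * (real k + 1)" using k by (intro mult_left_mono) auto
    then have "s - real (j * k) \<le> x / real m + real j" using jx by (simp add: algebra_simps add_divide_distrib)
    moreover have "real j \<le> x / real m" using j(3) mx by linarith
    ultimately show ?thesis by simp
  qed
  have mk: "real (m * k) \<le> x" "0 < real (m * k)" "real (j * k) \<le> real (m * k)"
    using k m j(3) by (auto simp: field_simps)
  have [measurable]: "S s \<in> borel_measurable M" using s by simp
  define d where "d = 1 / sqrt (real (m * k)) - 1 / sqrt x"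
  have "1 / sqrt x \<le> 1 / sqrt (real (m * k))"
    by (rule frac_le) (use mk(1) m k(4) in simp_all)
  then have d: "0 \<le> d" by (simp add: d_def)
  have "(\<integral>\<^sup>+\<omega>. ennreal \<bar>(S s \<omega> - s) / sqrt x - step_approximation x m k s \<omega>\<bar> \<partial>M) \<le>
      (\<integral>\<^sup>+\<omega>. ennreal (1 / sqrt x) * ennreal \<bar>S s \<omega> - S (real (j * k)) \<omega> - (s - real (j * k))\<bar> +
        ennreal d * ennreal \<bar>S (real (j * k)) \<omega> - S 0 \<omega> - (real (j * k) - 0)\<bar> \<partial>M)"
  proof (rule nn_integral_mono)
    fix \<omega> assume \<omega>: "\<omega> \<in> space M"
    let ?a = "S s \<omega> - S (real (j * k)) \<omega> - (s - real (j * k))" and ?b = "S (real (j * k)) \<omega> - real (j * k)"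
    have "(S s \<omega> - s) / sqrt x - step_approximation x m k s \<omega> = 1 / sqrt x * ?a - d * ?b"
      unfolding step_approximation_eq[OF x m s \<omega>] j_def[symmetric] d_def
      by (simp add: algebra_simps diff_divide_distrib add_divide_distrib)
    also have "\<bar>\<dots>\<bar> \<le> 1 / sqrt x * \<bar>?a\<bar> + d * \<bar>?b\<bar>"
      using d x abs_triangle_ineq4[of "1 / sqrt x * ?a" "d * ?b"] by (simp add: abs_mult)
    finally have "ennreal \<bar>(S s \<omega> - s) / sqrt x - step_approximation x m k s \<omega>\<bar> \<le> ennreal (1 / sqrt x * \<bar>?a\<bar> + d * \<bar>?b\<bar>)"
      by (rule ennreal_leI)
    also have "\<dots> = ennreal (1 / sqrt x) * ennreal \<bar>?a\<bar> + ennreal d * ennreal \<bar>?b\<bar>"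
      using d x by (simp add: ennreal_mult[symmetric] ennreal_plus[symmetric] del: ennreal_plus)
    finally show "ennreal \<bar>(S s \<omega> - s) / sqrt x - step_approximation x m k s \<omega>\<bar> \<le> ennreal (1 / sqrt x) * ennreal \<bar>?a\<bar> +
        ennreal d * ennreal \<bar>S (real (j * k)) \<omega> - S 0 \<omega> - (real (j * k) - 0)\<bar>"
      using S_zero[OF \<omega>] by simp
  qed
  also have "\<dots> = ennreal (1 / sqrt x) * (\<integral>\<^sup>+\<omega>. ennreal \<bar>S s \<omega> - S (real (j * k)) \<omega> - (s - real (j * k))\<bar> \<partial>M) +
        ennreal d * (\<integral>\<^sup>+\<omega>. ennreal \<bar>S (real (j * k)) \<omega> - S 0 \<omega> - (real (j * k) - 0)\<bar> \<partial>M)"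
    using S_measurable[of 0] by (simp add: nn_integral_add nn_integral_cmult)
  also have "\<dots> \<le> ennreal (1 / sqrt x) * ennreal (\<sigma> * sqrt (s - real (j * k))) + ennreal d * ennreal (\<sigma> * sqrt (real (j * k) - 0))"
    using jk by (intro add_mono mult_left_mono nn_abs_increment) auto
  also have "\<dots> = ennreal (\<sigma> * (sqrt (s - real (j * k)) / sqrt x + d * sqrt (real (j * k))))"
    using d \<sigma>_nonneg jk x by (simp add: ennreal_mult[symmetric] ennreal_plus[symmetric] algebra_simps del: ennreal_plus)
  also have "\<dots> \<le> ennreal (3 * \<sigma> / sqrt (real m))"
  proof (rule ennreal_leI)
    have "sqrt (s - real (j * k)) / sqrt x \<le> sqrt (2 / real m)"
      unfolding real_sqrt_divide[symmetric] using diff x m by (intro real_sqrt_le_mono) (simp add: field_simps)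
    also have "\<dots> \<le> 2 / sqrt (real m)"
      using real_sqrt_le_mono[of 2 4] by (simp add: real_sqrt_divide divide_right_mono)
    finally have 1: "sqrt (s - real (j * k)) / sqrt x \<le> 2 / sqrt (real m)" .
    \<comment> \<open>This quantity is at most \<open>1 - sqrt (m * k / x)\<close>, and
      \<open>r \<le> sqrt r\<close> on [0,1] reduces it to the relative rounding error
      \<open>m / x \<le> 1 / m\<close>.\<close>
    have "d * sqrt (real (j * k)) \<le> d * sqrt (real (m * k))" using d mk by (intro mult_left_mono real_sqrt_le_mono) auto
    also have "\<dots> = 1 - sqrt (real (m * k) / x)" using mk x m k(4) by (simp add: d_def left_diff_distrib real_sqrt_divide)
    also have "\<dots> \<le> 1 / real m"
    proof -
      have "x \<le> real (m * k) + real m" using k m by (simp add: field_simps)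
      then have "x / x \<le> (real (m * k) + real m) / x" using x by (intro divide_right_mono) auto
      then have "1 - real m / x \<le> real (m * k) / x" using x unfolding add_divide_distrib by simp
      moreover have "real m / x \<le> 1 / real m" using xm x m by (simp add: field_simps power2_eq_square)
      ultimately have lower: "1 - 1 / real m \<le> real (m * k) / x" by linarith
      have "r \<le> sqrt r" if "0 \<le> r" "r \<le> 1" for r :: real
        using that by (intro real_le_rsqrt) (simp add: power2_eq_square mult_left_le)
      from this[of "real (m * k) / x"] have "real (m * k) / x \<le> sqrt (real (m * k) / x)" using mk x by simp
      then show ?thesis using lower by linarith
    qed
    also have "\<dots> \<le> 1 / sqrt (real m)"
      using m1 by (intro divide_left_mono) (auto intro: real_le_lsqrt simp: power2_eq_square)
    finally have 2: "d * sqrt (real (j * k)) \<le> 1 / sqrt (real m)" .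
    have "\<sigma> * (sqrt (s - real (j * k)) / sqrt x + d * sqrt (real (j * k))) \<le> \<sigma> * (2 / sqrt (real m) + 1 / sqrt (real m))"
      using 1 2 \<sigma>_nonneg by (intro mult_left_mono add_mono) auto
    then show "\<sigma> * (sqrt (s - real (j * k)) / sqrt x + d * sqrt (real (j * k))) \<le> 3 * \<sigma> / sqrt (real m)"
      by (simp add: add_divide_distrib[symmetric] mult.commute)
  qed
  finally show ?thesis .
qed

lemma expected_step_error:
  assumes m: "0 < m" and xm: "(real m)\<^sup>2 \<le> x"
  shows "(\<integral>\<^sup>+\<omega>. step_error x m (nat \<lfloor>x / real m\<rfloor>) \<omega> \<partial>M) \<le> ennreal (log_Phi x * (3 * \<sigma> / sqrt (real m)))"
proof -
  let ?k = "nat \<lfloor>x / real m\<rfloor>"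
  have "(\<integral>\<^sup>+\<omega>. step_error x m ?k \<omega> \<partial>M) = (\<integral>\<^sup>+s. \<integral>\<^sup>+\<omega>. ennreal (log_phi (x - s) *
      \<bar>(S (max 0 s) \<omega> - s) / sqrt x - step_approximation x m ?k s \<omega>\<bar>) * indicator {0..x} s \<partial>M \<partial>lborel)"
    unfolding step_error_def step_approximation_def by (rule nn_integral_swap) measurable
  also have "\<dots> \<le> (\<integral>\<^sup>+s. ennreal (log_phi (x - s)) * indicator {..x} (x - s) * ennreal (3 * \<sigma> / sqrt (real m)) \<partial>lborel)"
  proof (rule nn_integral_mono)
    fix s
    show "(\<integral>\<^sup>+\<omega>. ennreal (log_phi (x - s) * \<bar>(S (max 0 s) \<omega> - s) / sqrt x - step_approximation x m ?k s \<omega>\<bar>) * indicator {0..x} s \<partial>M) \<le>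
      ennreal (log_phi (x - s)) * indicator {..x} (x - s) * ennreal (3 * \<sigma> / sqrt (real m))"
    proof (cases "s \<in> {0..x}")
      case True
      then have s: "0 \<le> s" "s \<le> x" by auto
      have [measurable]: "S s \<in> borel_measurable M" using s by simp
      have g: "0 \<le> log_phi (x - s)" using RG.g_pos less_imp_le by blast
      have "(\<integral>\<^sup>+\<omega>. ennreal (log_phi (x - s) * \<bar>(S (max 0 s) \<omega> - s) / sqrt x - step_approximation x m ?k s \<omega>\<bar>) * indicator {0..x} s \<partial>M) =
          (\<integral>\<^sup>+\<omega>. ennreal (log_phi (x - s)) * ennreal \<bar>(S s \<omega> - s) / sqrt x - step_approximation x m ?k s \<omega>\<bar> \<partial>M)"
        using True s g by (intro nn_integral_cong) (simp add: ennreal_mult)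
      also have "\<dots> = ennreal (log_phi (x - s)) * (\<integral>\<^sup>+\<omega>. ennreal \<bar>(S s \<omega> - s) / sqrt x - step_approximation x m ?k s \<omega>\<bar> \<partial>M)"
        unfolding step_approximation_def by (rule nn_integral_cmult) measurable
      also have "\<dots> \<le> ennreal (log_phi (x - s)) * ennreal (3 * \<sigma> / sqrt (real m))"
        by (intro mult_left_mono expected_step_difference m xm s) simp
      finally show ?thesis using True by simp
    qed simp
  qed
  also have "\<dots> = (\<integral>\<^sup>+w. ennreal (log_phi w) * indicator {..x} w * ennreal (3 * \<sigma> / sqrt (real m)) \<partial>lborel)"
    by (rule nn_integral_reflect) measurable
  also have "\<dots> = (\<integral>\<^sup>+w. ennreal (log_phi w) * indicator {..x} w \<partial>lborel) * ennreal (3 * \<sigma> / sqrt (real m))"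
    by (rule nn_integral_multc) measurable
  also have "\<dots> = ennreal (log_Phi x * (3 * \<sigma> / sqrt (real m)))"
    using \<sigma>_nonneg RG.G_pos[of x] by (simp add: RG.nn_integral_g ennreal_mult[symmetric] less_imp_le)
  finally show ?thesis .
qed

end

end

section \<open>Approximation of the normalised count\<close>

lemma ennreal_abs_integral_le:
  fixes f :: "real \<Rightarrow> real"
  assumes f: "set_integrable lborel {0..t} f" and t: "t \<le> x"
  shows "ennreal \<bar>integral {0..t} f\<bar> \<le> (\<integral>\<^sup>+s. ennreal \<bar>f s\<bar> * indicator {0..x} s \<partial>lborel)"
proof -
  have "ennreal \<bar>integral {0..t} f\<bar> = ennreal (norm (\<integral>s. indicator {0..t} s *\<^sub>R f s \<partial>lborel))"
    using set_borel_integral_eq_integral(2)[OF f] by (simp add: set_lebesgue_integral_def)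
  also have "\<dots> \<le> (\<integral>\<^sup>+s. ennreal (norm (indicator {0..t} s *\<^sub>R f s)) \<partial>lborel)"
    by (rule integral_norm_bound_ennreal) (use f in \<open>simp add: set_integrable_def\<close>)
  also have "\<dots> \<le> (\<integral>\<^sup>+s. ennreal \<bar>f s\<bar> * indicator {0..x} s \<partial>lborel)"
    using t by (intro nn_integral_mono) (auto simp: indicator_def)
  finally show ?thesis .
qed

lemma integral_scale:
  fixes f :: "real \<Rightarrow> real"
  assumes f: "f integrable_on {0..x * b}" and x: "0 < x" and b: "0 \<le> b"
  shows "x * integral {0..b} (\<lambda>v. f (x * v)) = integral {0..x * b} f"
proof -
  have "((\<lambda>v. f (x *\<^sub>R v + 0)) has_integral (1 / \<bar>x\<bar> ^ DIM(real)) *\<^sub>R integral {0..x * b} f)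
      ((\<lambda>v. (1 / x) *\<^sub>R v + - ((1 / x) *\<^sub>R 0)) ` cbox 0 (x * b))"
    by (rule has_integral_affinity) (use f x in \<open>auto simp: integrable_integral\<close>)
  moreover have "(\<lambda>v. (1 / x) *\<^sub>R v + - ((1 / x) *\<^sub>R 0)) ` cbox 0 (x * b) = {0..b}"
  proof -
    have "(\<lambda>v. (1 / x) * v) ` {0..x * b} = {0..b}"
      using x b by (subst image_mult_atLeastAtMost) auto
    then show ?thesis by simp
  qed
  ultimately have "((\<lambda>v. f (x * v)) has_integral integral {0..x * b} f / x) {0..b}" using x by simp
  then show ?thesis using x by (simp add: integral_unique)
qed

context levy_measure
begin

text \<open>The paths that approximate both processes are combinations of these functions; they
  are the primitives of the kernel \<open>h1\<close> restricted to \<open>[(i + 1) / m, 1]\<close>.\<close>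

definition coeff :: "real \<Rightarrow> nat \<Rightarrow> nat \<Rightarrow> real \<Rightarrow> real" where
  "coeff x m i u = (log_Phi (x - real (Suc i) * x / real m) -
    log_Phi (x - max (real (Suc i) * x / real m) (x * min u 1))) / log_Phi x"

lemma log_Phi_mono: "a \<le> b \<Longrightarrow> log_Phi a \<le> log_Phi b"
  unfolding log_Phi_def by (intro Phi_mono) simp

lemma log_Phi_nonneg: "0 \<le> log_Phi y"
  unfolding log_Phi_def by (intro Phi_nonneg) simp

lemma coeff_const: "1 \<le> u \<Longrightarrow> coeff x m i u = coeff x m i 1"
  by (simp add: coeff_def)

lemma continuous_log_Phi: "continuous_on A log_Phi"
  using DERIV_log_Phi by (meson DERIV_isCont continuous_at_imp_continuous_on)

lemma coeff_continuous: "continuous_on A (coeff x m i)"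
proof -
  have "continuous_on A (\<lambda>u. log_Phi (x - max (real (Suc i) * x / real m) (x * min u 1)))"
    by (rule continuous_on_compose2[OF continuous_log_Phi[of UNIV]]) (auto intro!: continuous_intros)
  then show ?thesis unfolding coeff_def[abs_def] divide_inverse
    by (intro continuous_intros)
qed

lemma coeff_bound:
  assumes "0 < x" "0 < log_Phi x" shows "\<bar>coeff x m i u\<bar> \<le> 1"
proof -
  let ?a = "real (Suc i) * x / real m" and ?b = "max (real (Suc i) * x / real m) (x * min u 1)"
  have a: "0 \<le> ?a" using assms by simp
  have "0 \<le> log_Phi (x - ?b)" "log_Phi (x - ?b) \<le> log_Phi (x - ?a)" "log_Phi (x - ?a) \<le> log_Phi x"
    using a by (auto intro!: log_Phi_nonneg log_Phi_mono)
  then show ?thesis using assms by (auto simp: coeff_def abs_le_iff field_simps)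
qed

lemma has_integral_log_phi:
  assumes "a \<le> t"
  shows "((\<lambda>s. log_phi (x - s)) has_integral log_Phi (x - a) - log_Phi (x - t)) {a..t}"
proof -
  have "((\<lambda>s. - log_Phi (x - s)) has_vector_derivative log_phi (x - s)) (at s within {a..t})" for s
  proof -
    have "((\<lambda>s. log_Phi (x - s)) has_real_derivative log_phi (x - s) * (0 - 1)) (at s)"
      by (rule DERIV_chain2[OF DERIV_log_Phi]) (auto intro!: derivative_eq_intros)
    from DERIV_minus[OF this] show ?thesis
      by (simp add: has_real_derivative_iff_has_vector_derivative[symmetric] has_field_derivative_at_within)
  qed
  from fundamental_theorem_of_calculus[OF assms this] show ?thesis by simp
qed

lemma set_integrable_log_phi_step:
  "set_integrable lborel {0..t} (\<lambda>s. log_phi (x - s) * of_bool (a \<le> s))"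
proof -
  have "continuous_on {0..t} (\<lambda>s. log_phi (x - s))"
    by (rule continuous_on_compose2[OF continuous_log_phi[of UNIV]]) (auto intro!: continuous_intros)
  then have "set_integrable lborel {0..t} (\<lambda>s. log_phi (x - s))" by (rule borel_integrable_atLeastAtMost')
  then have "integrable lborel (\<lambda>s. indicator {a..} s *\<^sub>R (indicator {0..t} s *\<^sub>R log_phi (x - s)))"
    unfolding set_integrable_def by (rule integrable_mult_indicator[rotated]) simp
  moreover have "indicator {a..} s *\<^sub>R (indicator {0..t} s *\<^sub>R log_phi (x - s)) =
      indicator {0..t} s *\<^sub>R (log_phi (x - s) * of_bool (a \<le> s))" for s
    by (simp add: indicator_def)
  ultimately show ?thesis unfolding set_integrable_def by (simp only:)
qed

lemma integral_log_phi_step: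
  assumes "0 \<le> a" "0 \<le> t"
  shows "integral {0..t} (\<lambda>s. log_phi (x - s) * of_bool (a \<le> s)) = log_Phi (x - a) - log_Phi (x - max a t)"
proof (cases "a \<le> t")
  case True
  have "((\<lambda>s. if s \<in> {a..t} then log_phi (x - s) else 0) has_integral log_Phi (x - a) - log_Phi (x - t)) {0..t}"
    using has_integral_restrict[of "{a..t}" "{0..t}" "\<lambda>s. log_phi (x - s)"] has_integral_log_phi[OF True, of x] assms by auto
  then have "integral {0..t} (\<lambda>s. if s \<in> {a..t} then log_phi (x - s) else 0) = log_Phi (x - a) - log_Phi (x - t)"
    by (rule integral_unique)
  moreover have "integral {0..t} (\<lambda>s. log_phi (x - s) * of_bool (a \<le> s)) =
      integral {0..t} (\<lambda>s. if s \<in> {a..t} then log_phi (x - s) else 0)"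
    by (rule Henstock_Kurzweil_Integration.integral_cong) auto
  ultimately show ?thesis using True by (simp add: max_def)
next
  case False
  then have "integral {0..t} (\<lambda>s. log_phi (x - s) * of_bool (a \<le> s)) = integral {0..t} (\<lambda>s. 0)"
    by (intro Henstock_Kurzweil_Integration.integral_cong) auto
  then show ?thesis using False by (simp add: max_def)
qed

text \<open>A step path integrated against \<open>log_phi\<close> becomes a combination of the
  functions \<open>coeff\<close>. Applied to the walk and to the Brownian step path alike, it gives
  both approximations the same deterministic part.\<close>

lemma integral_log_phi_steps:
  assumes x: "0 < x" and G: "0 < log_Phi x" and u: "0 \<le> u"
  shows "set_integrable lborel {0..x * min u 1} (\<lambda>s. log_phi (x - s) * (\<Sum>i<m. c i * of_bool (real (Suc i) * x / real m \<le> s)))"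
    and "integral {0..x * min u 1} (\<lambda>s. log_phi (x - s) * (\<Sum>i<m. c i * of_bool (real (Suc i) * x / real m \<le> s))) =
      log_Phi x * (\<Sum>i<m. c i * coeff x m i u)"
proof -
  let ?t = "x * min u 1"
  have eq: "log_phi (x - s) * (\<Sum>i<m. c i * of_bool (real (Suc i) * x / real m \<le> s)) =
      (\<Sum>i<m. c i * (log_phi (x - s) * of_bool (real (Suc i) * x / real m \<le> s)))" for s
    by (subst sum_distrib_left) (simp only: mult.left_commute)
  have i: "set_integrable lborel {0..?t} (\<lambda>s. c i * (log_phi (x - s) * of_bool (real (Suc i) * x / real m \<le> s)))" for i
    by (rule set_integrable_mult_right) (rule set_integrable_log_phi_step)
  then show si: "set_integrable lborel {0..?t} (\<lambda>s. log_phi (x - s) * (\<Sum>i<m. c i * of_bool (real (Suc i) * x / real m \<le> s)))"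
    unfolding eq set_integrable_def scaleR_sum_right by (intro Bochner_Integration.integrable_sum) simp
  have "integral {0..?t} (\<lambda>s. log_phi (x - s) * (\<Sum>i<m. c i * of_bool (real (Suc i) * x / real m \<le> s))) =
      (\<Sum>i<m. integral {0..?t} (\<lambda>s. c i * (log_phi (x - s) * of_bool (real (Suc i) * x / real m \<le> s))))"
    unfolding eq by (rule Henstock_Kurzweil_Integration.integral_sum) (use set_borel_integral_eq_integral(1)[OF i] in auto)
  also have "\<dots> = (\<Sum>i<m. c i * (log_Phi x * coeff x m i u))"
  proof (rule sum.cong[OF refl])
    fix i
    have "integral {0..?t} (\<lambda>s. log_phi (x - s) * of_bool (real (Suc i) * x / real m \<le> s)) = log_Phi x * coeff x m i u"
      using x u G by (subst integral_log_phi_step) (auto simp: coeff_def)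
    then show "integral {0..?t} (\<lambda>s. c i * (log_phi (x - s) * of_bool (real (Suc i) * x / real m \<le> s))) = c i * (log_Phi x * coeff x m i u)"
      by simp
  qed
  finally show "integral {0..?t} (\<lambda>s. log_phi (x - s) * (\<Sum>i<m. c i * of_bool (real (Suc i) * x / real m \<le> s))) =
      log_Phi x * (\<Sum>i<m. c i * coeff x m i u)"
    by (simp add: sum_distrib_left mult.left_commute)
qed

lemma set_integrable_log_Phi: "set_integrable lborel {0..t} (\<lambda>s. log_Phi (x - s))"
  by (rule borel_integrable_atLeastAtMost', rule continuous_on_compose2[OF continuous_log_Phi[of UNIV]])
     (auto intro!: continuous_intros)

end

section \<open>The normalised count as a random path\<close>

context occupancy
begin

lemma K1_exp:
  assumes x: "0 < x" and u: "0 \<le> u"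
  shows "K1 \<nu> S P (exp x) u \<omega> = 1 / (log_Phi x * sqrt x) *
    (real (occupied_gaps (\<lambda>t. S t \<omega>) (P (exp x) \<omega>) (u * x)) - integral {0..x * min u 1} (\<lambda>s. log_Phi (x - s)))"
proof -
  have "Phi \<nu> (exp x powr (1 - v)) = log_Phi (x - x * v)" for v
    by (simp add: log_Phi_def powr_def algebra_simps)
  moreover have "x * integral {0..min u 1} (\<lambda>v. log_Phi (x - x * v)) = integral {0..x * min u 1} (\<lambda>s. log_Phi (x - s))"
    by (rule integral_scale[OF set_borel_integral_eq_integral(1)[OF set_integrable_log_Phi] x]) (use u in simp)
  ultimately show ?thesis by (simp add: K1_def log_Phi_def)
qed

text \<open>A path is a finite sum of step functions, one for each occupied time, plus a continuous
  function that is constant from 1 on. So it is cadlag with a limit at infinity.\<close>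

lemma K1_measurable:
  assumes x: "0 < x"
  shows "(\<lambda>\<omega>. \<lambda>u\<in>{0..}. K1 \<nu> S P (exp x) u \<omega>) \<in> M \<rightarrow>\<^sub>M D0_space"
  unfolding D0_space_def
proof (rule measurable_restrict_space2)
  show "(\<lambda>\<omega>. \<lambda>u\<in>{0..}. K1 \<nu> S P (exp x) u \<omega>) \<in> M \<rightarrow>\<^sub>M (\<Pi>\<^sub>M i\<in>{0..}. borel)"
  proof (rule measurable_restrict)
    fix u :: real assume "u \<in> {0..}"
    then have u: "0 \<le> u" by simp
    have [measurable]: "(\<lambda>\<omega>. real (occupied_gaps (\<lambda>t. S t \<omega>) (P (exp x) \<omega>) (u * x))) \<in> borel_measurable M"
      by (rule occupied_gaps_measurable) (use x u in auto)
    show "K1 \<nu> S P (exp x) u \<in> borel_measurable M" unfolding K1_exp[OF x u, abs_def] by measurable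
  qed
  show "(\<lambda>\<omega>. \<lambda>u\<in>{0..}. K1 \<nu> S P (exp x) u \<omega>) \<in> space M \<rightarrow> D0"
  proof
    fix \<omega> assume \<omega>: "\<omega> \<in> space M"
    interpret path: increasing_path "\<lambda>t. S t \<omega>" by (rule increasing_path_S[OF \<omega>])
    have fin: "finite (P (exp x) \<omega>)" by (rule P_finite[OF _ \<omega>]) simp
    define E where "E = path.occupied_times (P (exp x) \<omega>)"
    have E: "finite E" unfolding E_def by (rule path.finite_occupied_times[OF fin])
    define I where "I u = integral {0..x * min u 1} (\<lambda>s. log_Phi (x - s))" for u
    define y where "y u = 1 / (log_Phi x * sqrt x) * ((\<Sum>e\<in>E. of_bool (e / x \<le> u)) + (-1) * I u)" for u
    have eq: "(\<lambda>u\<in>{0..}. K1 \<nu> S P (exp x) u \<omega>) = restrict y {0..}"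
    proof (rule restrict_ext)
      fix u :: real assume "u \<in> {0..}"
      then show "K1 \<nu> S P (exp x) u \<omega> = y u"
        using x by (simp add: K1_exp y_def I_def path.occupied_gaps_sum[OF fin] E_def[symmetric] pos_divide_le_eq)
    qed
    have Icont: "continuous_on {0..} I"
    proof -
      have "continuous_on {0..x} (\<lambda>t. integral {0..t} (\<lambda>s. log_Phi (x - s)))"
        by (rule indefinite_integral_continuous_1[OF set_borel_integral_eq_integral(1)[OF set_integrable_log_Phi]])
      then show ?thesis unfolding I_def
        by (rule continuous_on_compose2[where g="\<lambda>t. integral {0..t} (\<lambda>s. log_Phi (x - s))"])
          (use x in \<open>auto intro!: continuous_intros simp: mult_left_le min_le_iff_disj\<close>)
    qed
    have c: "cadlag y" unfolding y_def
      by (intro cadlag_cmult cadlag_add cadlag_sum E cadlag_step cadlag_continuous[OF Icont])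
    have lim: "((\<lambda>u. \<Sum>e\<in>E. of_bool (e / x \<le> u) :: real) \<longlongrightarrow> (\<Sum>e\<in>E. 1)) at_top"
    proof (rule tendsto_sum, rule tendsto_eventually)
      fix e
      show "\<forall>\<^sub>F u in at_top. (of_bool (e / x \<le> u) :: real) = 1"
        using eventually_ge_at_top[of "e / x"] by eventually_elim simp
    qed
    have "(I \<longlongrightarrow> I 1) at_top"
    proof (rule tendsto_eventually)
      show "\<forall>\<^sub>F u in at_top. I u = I 1" using eventually_ge_at_top[of 1] by eventually_elim (simp add: I_def)
    qed
    then have "(y \<longlongrightarrow> 1 / (log_Phi x * sqrt x) * ((\<Sum>e\<in>E. 1) + (-1) * I 1)) at_top"
      unfolding y_def by (intro tendsto_intros lim)
    then show "(\<lambda>u\<in>{0..}. K1 \<nu> S P (exp x) u \<omega>) \<in> D0" unfolding eq by (rule restrict_in_D0[OF c])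
  qed
qed

lemma intensity_exp: "intensity (exp x) \<omega> s = log_Phi (x - S (max 0 s) \<omega>)"
  by (simp add: intensity_def log_Phi_def exp_diff exp_minus divide_inverse)

text \<open>Both the count and the compensator increase, so that their difference is controlled by
  its values on a grid and the oscillation of the compensator between grid points.\<close>

lemma deviation_from_grid:
  assumes n: "0 < n" and \<omega>: "\<omega> \<in> space M" and T: "0 < T" and t: "0 \<le> t" "t \<le> T"
  defines "K \<equiv> \<lambda>t. real (occupied_gaps (\<lambda>t. S t \<omega>) (P n \<omega>) t)"
  shows "ennreal \<bar>K t - compensator n t \<omega>\<bar> \<le>
    (SUP j\<in>{..2 ^ p}. ennreal \<bar>K (real j * (T / 2 ^ p)) - compensator n (real j * (T / 2 ^ p)) \<omega>\<bar>) + ennreal (T / 2 ^ p * Phi \<nu> n)"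
proof -
  interpret path: increasing_path "\<lambda>t. S t \<omega>" by (rule increasing_path_S[OF \<omega>])
  define h where "h = T / 2 ^ p"
  have h: "0 < h" using T by (simp add: h_def)
  \<comment> \<open>The minimum with \<open>2 ^ p - 1\<close> assigns the right end point
    \<open>T\<close> to the last cell instead of a cell beyond the grid.\<close>
  define j where "j = min (nat \<lfloor>t / h\<rfloor>) (2 ^ p - 1)"
  have th: "0 \<le> t / h" "t / h \<le> 2 ^ p" using t h T by (auto simp: h_def field_simps)
  have j: "real j \<le> t / h" "t / h \<le> real (Suc j)" "Suc j \<le> 2 ^ p"
  proof -
    have "real (nat \<lfloor>t / h\<rfloor>) \<le> t / h" using th by linarith
    then show "real j \<le> t / h" unfolding j_def by (meson min.cobounded1 of_nat_le_iff order_trans)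
    show "Suc j \<le> 2 ^ p" unfolding j_def by (simp add: min_le_iff_disj Suc_le_eq)
        (metis One_nat_def Suc_pred less_Suc_eq_le min.cobounded2 zero_less_numeral zero_less_power)
    show "t / h \<le> real (Suc j)"
    proof (cases "nat \<lfloor>t / h\<rfloor> \<le> 2 ^ p - 1")
      case True
      then show ?thesis unfolding j_def by (simp add: min_def) linarith
    next
      case False
      then have "Suc j = 2 ^ p" unfolding j_def by (simp add: min_def)
      then show ?thesis using th by simp
    qed
  qed
  have jt: "real j * h \<le> t" "t \<le> real (Suc j) * h" using j h by (auto simp: field_simps)
  have K_mono: "K a \<le> K b" if "a \<le> b" for a b
    unfolding K_def using path.occupied_gaps_mono[OF P_finite[OF n \<omega>] that] by simp
  have A1: "compensator n (real j * h) \<omega> \<le> compensator n t \<omega>" "compensator n t \<omega> \<le> compensator n (real (Suc j) * h) \<omega>"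
    "compensator n (real (Suc j) * h) \<omega> \<le> compensator n (real j * h) \<omega> + (real (Suc j) * h - real j * h) * Phi \<nu> n"
    using jt h t by (intro compensator_le[OF n \<omega>]; simp)+
  have "real (Suc j) * h - real j * h = h" by (simp add: algebra_simps)
  \<comment> \<open>Both functions increase, so the difference at \<open>t\<close> lies between
    those at the two neighbouring grid points up to the growth of the compensator in the
    cell.\<close>
  then have bound: "\<bar>K t - compensator n t \<omega>\<bar> \<le> max \<bar>K (real j * h) - compensator n (real j * h) \<omega>\<bar>
      \<bar>K (real (Suc j) * h) - compensator n (real (Suc j) * h) \<omega>\<bar> + h * Phi \<nu> n"
    using A1 K_mono[OF jt(1)] K_mono[OF jt(2)] by (simp only:)
  have hP: "0 \<le> h * Phi \<nu> n" using h Phi_nonneg[of n] n by simp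
  have "ennreal \<bar>K t - compensator n t \<omega>\<bar> \<le> ennreal (max \<bar>K (real j * h) - compensator n (real j * h) \<omega>\<bar>
      \<bar>K (real (Suc j) * h) - compensator n (real (Suc j) * h) \<omega>\<bar>) + ennreal (h * Phi \<nu> n)"
    using bound hP by (simp add: ennreal_plus[symmetric] ennreal_leI del: ennreal_plus)
  also have "\<dots> \<le> (SUP j\<in>{..2 ^ p}. ennreal \<bar>K (real j * h) - compensator n (real j * h) \<omega>\<bar>) + ennreal (h * Phi \<nu> n)"
  proof (rule add_right_mono)
    have "ennreal \<bar>K (real i * h) - compensator n (real i * h) \<omega>\<bar> \<le>
        (SUP j\<in>{..2 ^ p}. ennreal \<bar>K (real j * h) - compensator n (real j * h) \<omega>\<bar>)" if "i \<le> 2 ^ p" for i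
      by (rule SUP_upper) (use that in simp)
    from this[of j] this[of "Suc j"] j(3)
    show "ennreal (max \<bar>K (real j * h) - compensator n (real j * h) \<omega>\<bar>
      \<bar>K (real (Suc j) * h) - compensator n (real (Suc j) * h) \<omega>\<bar>) \<le>
      (SUP j\<in>{..2 ^ p}. ennreal \<bar>K (real j * h) - compensator n (real j * h) \<omega>\<bar>)"
      by (simp only: max_def split: if_splits) simp
  qed
  finally show ?thesis unfolding h_def .
qed

text \<open>The exponential Markov inequality gives
  \<open>exp (2 * x - T * laplace_exponent 1)\<close> for the first event, and the expected number
  of points beyond \<open>2 * x\<close> is \<open>exp x * exp (- 2 * x)\<close>. Outside
  \<open>B\<close> all points lie below \<open>S T\<close>, so the count is final at time
  \<open>T\<close>.\<close>

lemma prob_late_points: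
  assumes x: "0 < x" and T: "3 * x \<le> T * laplace_exponent 1" "0 \<le> T"
  defines "B \<equiv> {\<omega> \<in> space M. S T \<omega> \<le> 2 * x} \<union> {\<omega> \<in> space M. P (exp x) \<omega> \<inter> {2 * x<..} \<noteq> {}}"
  shows "B \<in> events" "prob B \<le> 2 * exp (- x)"
proof -
  have [measurable]: "S T \<in> borel_measurable M" using T by simp
  have s: "{2 * x<..} \<in> sets (exp_intensity (exp x))" using x by (auto simp: sets_exp_intensity)
  have e2: "{\<omega> \<in> space M. P (exp x) \<omega> \<inter> {2 * x<..} \<noteq> {}} \<in> events" by (rule prob_hit(1)[OF _ s]) simp
  have e1: "{\<omega> \<in> space M. S T \<omega> \<le> 2 * x} \<in> events" by measurable
  show "B \<in> events" unfolding B_def using e1 e2 by blast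
  have p2: "prob {\<omega> \<in> space M. P (exp x) \<omega> \<inter> {2 * x<..} \<noteq> {}} \<le> exp (- x)"
  proof -
    have "prob {\<omega> \<in> space M. P (exp x) \<omega> \<inter> {2 * x<..} \<noteq> {}} = 1 - exp (- (exp x * exp (- (2 * x))))"
      using prob_hit(2)[OF _ s] measure_exp_intensity_tail[of "2 * x" "exp x"] x by simp
    also have "\<dots> \<le> exp x * exp (- (2 * x))" by (rule one_minus_exp_bounds)
    also have "\<dots> = exp (- x)" by (simp add: exp_add[symmetric])
    finally show ?thesis .
  qed
  have p1: "prob {\<omega> \<in> space M. S T \<omega> \<le> 2 * x} \<le> exp (- x)"
  proof -
    have i: "integrable M (\<lambda>\<omega>. exp (- (1 * S T \<omega>)))"
      by (rule integrable_bounded[where K=1]) (use S_nonneg T in auto)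
    have "prob {\<omega> \<in> space M. S T \<omega> \<le> 2 * x} = (\<integral>\<omega>. indicator {\<omega> \<in> space M. S T \<omega> \<le> 2 * x} \<omega> \<partial>M)"
      using e1 by simp
    also have "\<dots> \<le> (\<integral>\<omega>. exp (2 * x) * exp (- (1 * S T \<omega>)) \<partial>M)"
    proof (rule integral_mono)
      show "integrable M (indicator {\<omega> \<in> space M. S T \<omega> \<le> 2 * x} :: _ \<Rightarrow> real)" using e1 by (simp add: emeasure_eq_measure)
      show "integrable M (\<lambda>\<omega>. exp (2 * x) * exp (- (1 * S T \<omega>)))" using i by simp
      show "indicator {\<omega> \<in> space M. S T \<omega> \<le> 2 * x} \<omega> \<le> exp (2 * x) * exp (- (1 * S T \<omega>))" for \<omega>
        by (auto simp: indicator_def exp_add[symmetric])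
    qed
    also have "\<dots> = exp (2 * x) * exp (- (T * laplace_exponent 1))"
      using laplace_transform[OF T(2), of 1] by simp
    also have "\<dots> \<le> exp (- x)" using T(1) by (simp add: exp_add[symmetric])
    finally show ?thesis .
  qed
  have "prob B \<le> prob {\<omega> \<in> space M. S T \<omega> \<le> 2 * x} + prob {\<omega> \<in> space M. P (exp x) \<omega> \<inter> {2 * x<..} \<noteq> {}}"
    unfolding B_def using e1 e2 by (rule measure_Un_le)
  then show "prob B \<le> 2 * exp (- x)" using p1 p2 by linarith
qed

end

context occupancy_moments
begin

text \<open>The increments of the walk with reversed sign, as they enter
  \<open>log_Phi (x - S s)\<close> negatively.\<close>

definition noise :: "nat \<Rightarrow> nat \<Rightarrow> nat \<Rightarrow> 'a \<Rightarrow> real" where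
  "noise m k i \<omega> = - (S (real (Suc i * k)) \<omega> - S (real (i * k)) \<omega> - real k) / sqrt (real (m * k))"

definition total_error :: "real \<Rightarrow> real \<Rightarrow> nat \<Rightarrow> nat \<Rightarrow> nat \<Rightarrow> 'a \<Rightarrow> ennreal" where
  "total_error x T p m k \<omega> = ennreal (1 / (log_Phi x * sqrt x)) *
    (((SUP j\<in>{..2 ^ p}. ennreal \<bar>real (occupied_gaps (\<lambda>t. S t \<omega>) (P (exp x) \<omega>) (real j * (T / 2 ^ p))) -
      compensator (exp x) (real j * (T / 2 ^ p)) \<omega>\<bar>) + ennreal (T / 2 ^ p * log_Phi x)) +
    (late_growth x T \<omega> + (linearisation_error x \<omega> + ennreal (sqrt x) * step_error x m k \<omega>)))"

text \<open>The difference splits into count minus compensator, growth of the compensator after time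
  \<open>x\<close>, and the integrated error of replacing the intensity by its linear approximation
  along the walk. Each part is bounded uniformly in \<open>u\<close>.\<close>

lemma pathwise_bound:
  assumes x: "0 < x" and T: "x \<le> T" and \<omega>: "\<omega> \<in> space M" and u: "0 \<le> u"
    and no_late: "P (exp x) \<omega> \<inter> {S T \<omega><..} = {}"
  shows "ennreal \<bar>K1 \<nu> S P (exp x) u \<omega> - (\<Sum>i<m. noise m k i \<omega> * coeff x m i u)\<bar> \<le> total_error x T p m k \<omega>"
proof -
  define G where "G = log_Phi x"
  have G: "0 < G" using Phi_pos[OF A1, of "exp x"] by (simp add: G_def log_Phi_def)
  define n where "n = exp x"
  have n: "0 < n" by (simp add: n_def)
  have G_eq: "G = Phi \<nu> n" by (simp add: G_def n_def log_Phi_def)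
  define K where "K t = real (occupied_gaps (\<lambda>t. S t \<omega>) (P n \<omega>) t)" for t
  define A where "A t = compensator n t \<omega>" for t
  define t where "t = x * min u 1"
  \<comment> \<open>The rescaled time is cut at \<open>T\<close> for the count and at
    \<open>x\<close> for the centring. The two cuts \<open>v\<close> and \<open>t\<close> can differ
    only if \<open>t = x\<close>.\<close>
  define v where "v = min (u * x) T"
  have t: "0 \<le> t" "t \<le> x" "t \<le> v" "v \<le> T" "0 \<le> v"
  proof -
    have "x * min u 1 \<le> u * x" "x * min u 1 \<le> x" "0 \<le> u * x" "0 \<le> x * min u 1"
      using x u mult_left_mono[of "min u 1" u x] mult_left_mono[of "min u 1" 1 x] by (simp_all add: mult.commute)
    then show "0 \<le> t" "t \<le> x" "t \<le> v" "v \<le> T" "0 \<le> v" using x T unfolding t_def v_def by linarith+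
  qed
  have tv: "t = v \<or> t = x"
  proof (cases "u \<le> 1")
    case True
    then have "x * u \<le> x" using x by (simp add: mult_left_le)
    then have "x * u \<le> T" using T by linarith
    then show ?thesis using True by (simp add: t_def v_def mult.commute)
  qed (simp add: t_def)
  interpret path: increasing_path "\<lambda>t. S t \<omega>" by (rule increasing_path_S[OF \<omega>])
  have Kv: "K (u * x) = K v"
  proof (cases "u * x \<le> T")
    case False
    then have "K (u * x) = K T"
      unfolding K_def n_def using path.occupied_gaps_const[OF no_late, of "u * x"] x T by simp
    then show ?thesis using False by (simp add: v_def)
  qed (simp add: v_def)
  let ?st = "\<lambda>s. step_approximation x m k s \<omega>"
  \<comment> \<open>Intensity minus its linear approximation, with the walk in place of the centred
    subordinator; its two error parts are separated below.\<close>
  define f where "f s = intensity n \<omega> s - log_Phi (x - s) + log_phi (x - s) * (sqrt x * ?st s)" for s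
  define \<zeta> where "\<zeta> i = sqrt x * ((S (real (Suc i * k)) \<omega> - S (real (i * k)) \<omega> - real k) / sqrt (real (m * k)))" for i
  have st: "sqrt x * ?st s = (\<Sum>i<m. \<zeta> i * of_bool (real (Suc i) * x / real m \<le> s))" for s
    by (simp add: step_approximation_def \<zeta>_def sum_distrib_left mult.assoc)
  note steps = integral_log_phi_steps[OF x G[unfolded G_def] u, where c = \<zeta> and m = m, folded t_def st]
  have i1: "set_integrable lborel {0..t} (intensity n \<omega>)" by (rule set_integrable_intensity[OF n \<omega>])
  have i2: "set_integrable lborel {0..t} (\<lambda>s. log_Phi (x - s))" by (rule set_integrable_log_Phi)
  have fi: "set_integrable lborel {0..t} f"
    unfolding f_def by (intro set_integral_add(1) set_integral_diff(1) i1 i2 steps(1))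
  have "integral {0..t} f = A t - integral {0..t} (\<lambda>s. log_Phi (x - s)) + G * (\<Sum>i<m. \<zeta> i * coeff x m i u)"
    unfolding f_def A_def compensator_def G_def steps(2)[symmetric]
    by (subst Henstock_Kurzweil_Integration.integral_add, intro Henstock_Kurzweil_Integration.integrable_diff
        set_borel_integral_eq_integral(1) i1 i2, rule set_borel_integral_eq_integral(1)[OF steps(1)],
        subst Henstock_Kurzweil_Integration.integral_diff, rule set_borel_integral_eq_integral(1)[OF i1],
        rule set_borel_integral_eq_integral(1)[OF i2]) simp
  moreover have "(\<Sum>i<m. \<zeta> i * coeff x m i u) = - sqrt x * (\<Sum>i<m. noise m k i \<omega> * coeff x m i u)"
    unfolding sum_distrib_left
    by (rule sum.cong[OF refl]) (simp only: \<zeta>_def noise_def minus_divide_left[symmetric] mult_minus_left mult_minus_right minus_minus mult.assoc)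
  ultimately have If: "integral {0..t} f = A t - integral {0..t} (\<lambda>s. log_Phi (x - s)) - G * sqrt x * (\<Sum>i<m. noise m k i \<omega> * coeff x m i u)"
    by simp
  have decomposition: "K1 \<nu> S P (exp x) u \<omega> - (\<Sum>i<m. noise m k i \<omega> * coeff x m i u) =
      1 / (G * sqrt x) * ((K v - A v) + ((A v - A t) + integral {0..t} f))"
  proof -
    have "K1 \<nu> S P (exp x) u \<omega> = 1 / (G * sqrt x) * (K v - integral {0..t} (\<lambda>s. log_Phi (x - s)))"
      using K1_exp[OF x u] Kv by (simp add: G_def K_def n_def t_def)
    moreover have "1 / r * (a - b) - q = 1 / r * ((a - c) + ((c - d) + (d - b - r * q)))" if "r \<noteq> 0" for a b c d q r :: real
      using that by (simp add: field_simps)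
    ultimately show ?thesis unfolding If using G x by (simp only: mult_eq_0_iff real_sqrt_eq_0_iff simp_thms less_imp_neq[symmetric])
  qed
  have b1: "ennreal \<bar>K v - A v\<bar> \<le> (SUP j\<in>{..2 ^ p}. ennreal \<bar>K (real j * (T / 2 ^ p)) - A (real j * (T / 2 ^ p))\<bar>) + ennreal (T / 2 ^ p * G)"
    unfolding K_def A_def G_eq using deviation_from_grid[OF n \<omega> _ t(5,4)] x T by simp
  have b2: "ennreal \<bar>A v - A t\<bar> \<le> late_growth x T \<omega>"
  proof (cases "t = v")
    case False
    then have tx: "t = x" using tv by simp
    have i: "set_integrable lborel {x..v} (intensity n \<omega>)"
      by (rule set_integrable_subset[OF set_integrable_intensity[OF n \<omega>, of v]]) (use x in auto)
    have "A v - A t = integral {x..v} (intensity n \<omega>)"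
      using Henstock_Kurzweil_Integration.integral_combine[OF _ _ integrable_intensity[OF n \<omega>, of v], of x] x t tx
      unfolding A_def compensator_def by (simp add: algebra_simps)
    also have "\<dots> = (\<integral>s. indicator {x..v} s *\<^sub>R intensity n \<omega> s \<partial>lborel)"
      using set_borel_integral_eq_integral(2)[OF i] by (simp add: set_lebesgue_integral_def)
    finally have "ennreal \<bar>A v - A t\<bar> = ennreal (norm (\<integral>s. indicator {x..v} s *\<^sub>R intensity n \<omega> s \<partial>lborel))" by simp
    also have "\<dots> \<le> (\<integral>\<^sup>+s. ennreal (norm (indicator {x..v} s *\<^sub>R intensity n \<omega> s)) \<partial>lborel)"
      by (rule integral_norm_bound_ennreal) (use i in \<open>simp add: set_integrable_def\<close>)
    also have "\<dots> \<le> late_growth x T \<omega>"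
      unfolding late_growth_def n_def intensity_exp
      by (intro nn_integral_mono) (use t in \<open>auto simp: indicator_def log_Phi_nonneg\<close>)
    finally show ?thesis .
  qed simp
  have b3: "ennreal \<bar>integral {0..t} f\<bar> \<le> linearisation_error x \<omega> + ennreal (sqrt x) * step_error x m k \<omega>"
  proof -
    have [measurable]: "(\<lambda>s. S (max 0 s) \<omega>) \<in> borel_measurable borel"
      by (rule S_joint_measurable') (use \<omega> in auto)
    have [measurable]: "?st \<in> borel_measurable borel" unfolding step_approximation_def[abs_def] by measurable
    have "ennreal \<bar>integral {0..t} f\<bar> \<le> (\<integral>\<^sup>+s. ennreal \<bar>f s\<bar> * indicator {0..x} s \<partial>lborel)"
      by (rule ennreal_abs_integral_le[OF fi t(2)])
    also have "\<dots> \<le> (\<integral>\<^sup>+s. ennreal \<bar>log_Phi (x - S (max 0 s) \<omega>) - log_Phi (x - s) +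
          (S (max 0 s) \<omega> - s) * log_phi (x - s)\<bar> * indicator {0..x} s +
        ennreal (sqrt x) * (ennreal (log_phi (x - s) * \<bar>(S (max 0 s) \<omega> - s) / sqrt x - ?st s\<bar>) * indicator {0..x} s) \<partial>lborel)"
    proof (rule nn_integral_mono)
      fix s
      have g: "0 \<le> log_phi (x - s)" using Phi_moment_nonneg[of 1 "exp (x - s)"] by (simp add: log_phi_def)
      have "f s = (log_Phi (x - S (max 0 s) \<omega>) - log_Phi (x - s) + (S (max 0 s) \<omega> - s) * log_phi (x - s)) -
          sqrt x * (log_phi (x - s) * ((S (max 0 s) \<omega> - s) / sqrt x - ?st s))"
      proof -
        have "b - c + g * (sqrt x * q) = (b - c + z * g) - sqrt x * (g * (z / sqrt x - q))" for b c g q z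
          using x by (simp add: right_diff_distrib)
        then show ?thesis unfolding f_def n_def intensity_exp by blast
      qed
      then have "\<bar>f s\<bar> \<le> \<bar>log_Phi (x - S (max 0 s) \<omega>) - log_Phi (x - s) + (S (max 0 s) \<omega> - s) * log_phi (x - s)\<bar> +
          \<bar>sqrt x * (log_phi (x - s) * ((S (max 0 s) \<omega> - s) / sqrt x - ?st s))\<bar>"
        by (simp only: abs_triangle_ineq4)
      also have "\<bar>sqrt x * (log_phi (x - s) * ((S (max 0 s) \<omega> - s) / sqrt x - ?st s))\<bar> =
          sqrt x * (log_phi (x - s) * \<bar>(S (max 0 s) \<omega> - s) / sqrt x - ?st s\<bar>)"
        using g x by (simp add: abs_mult)
      finally have "ennreal \<bar>f s\<bar> \<le> ennreal \<bar>log_Phi (x - S (max 0 s) \<omega>) - log_Phi (x - s) + (S (max 0 s) \<omega> - s) * log_phi (x - s)\<bar> +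
          ennreal (sqrt x) * ennreal (log_phi (x - s) * \<bar>(S (max 0 s) \<omega> - s) / sqrt x - ?st s\<bar>)"
        using g x by (simp add: ennreal_mult[symmetric] ennreal_plus[symmetric] ennreal_leI del: ennreal_plus)
      then show "ennreal \<bar>f s\<bar> * indicator {0..x} s \<le> ennreal \<bar>log_Phi (x - S (max 0 s) \<omega>) - log_Phi (x - s) +
          (S (max 0 s) \<omega> - s) * log_phi (x - s)\<bar> * indicator {0..x} s +
        ennreal (sqrt x) * (ennreal (log_phi (x - s) * \<bar>(S (max 0 s) \<omega> - s) / sqrt x - ?st s\<bar>) * indicator {0..x} s)"
        by (cases "s \<in> {0..x}") (simp_all only: indicator_simps simp_thms mult_1_right mult_zero_right add_0_right order_refl)
    qed
    also have "\<dots> = linearisation_error x \<omega> + ennreal (sqrt x) * step_error x m k \<omega>"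
      unfolding linearisation_error_def step_error_def
      by (subst nn_integral_add) (auto simp: nn_integral_cmult)
    finally show ?thesis .
  qed
  have "ennreal \<bar>(K v - A v) + ((A v - A t) + integral {0..t} f)\<bar> \<le>
      ennreal \<bar>K v - A v\<bar> + (ennreal \<bar>A v - A t\<bar> + ennreal \<bar>integral {0..t} f\<bar>)"
    by (simp add: ennreal_plus[symmetric] ennreal_leI del: ennreal_plus)
  also have "\<dots> \<le> ((SUP j\<in>{..2 ^ p}. ennreal \<bar>K (real j * (T / 2 ^ p)) - A (real j * (T / 2 ^ p))\<bar>) + ennreal (T / 2 ^ p * G)) +
      (late_growth x T \<omega> + (linearisation_error x \<omega> + ennreal (sqrt x) * step_error x m k \<omega>))"
    by (intro add_mono b1 b2 b3)
  finally have main: "ennreal \<bar>(K v - A v) + ((A v - A t) + integral {0..t} f)\<bar> \<le>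
      ((SUP j\<in>{..2 ^ p}. ennreal \<bar>K (real j * (T / 2 ^ p)) - A (real j * (T / 2 ^ p))\<bar>) + ennreal (T / 2 ^ p * G)) +
      (late_growth x T \<omega> + (linearisation_error x \<omega> + ennreal (sqrt x) * step_error x m k \<omega>))" .
  have "ennreal \<bar>K1 \<nu> S P (exp x) u \<omega> - (\<Sum>i<m. noise m k i \<omega> * coeff x m i u)\<bar> =
      ennreal (1 / (G * sqrt x)) * ennreal \<bar>(K v - A v) + ((A v - A t) + integral {0..t} f)\<bar>"
    unfolding decomposition using G x by (simp only: abs_mult) (simp add: ennreal_mult[symmetric])
  also have "\<dots> \<le> total_error x T p m k \<omega>"
    unfolding total_error_def G_def[symmetric] n_def[symmetric] K_def[symmetric] A_def[symmetric]
    by (rule mult_left_mono[OF main]) simp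
  finally show ?thesis .
qed

context
  fixes C K y0
  assumes growth: "regular_growth log_Phi log_phi C K y0"
begin

interpretation RG: regular_growth log_Phi log_phi C K y0 by (rule growth)

lemma total_error_measurable:
  assumes "0 \<le> T" shows "total_error x T p m k \<in> borel_measurable M"
proof -
  have [measurable]: "(\<lambda>\<omega>. real (occupied_gaps (\<lambda>t. S t \<omega>) (P (exp x) \<omega>) (real j * (T / 2 ^ p)))) \<in> borel_measurable M" for j
    by (rule occupied_gaps_measurable) (use assms in auto)
  have [measurable]: "compensator (exp x) t \<in> borel_measurable M" for t by (rule compensator_measurable) simp
  show ?thesis unfolding total_error_def[abs_def] by measurable
qed

text \<open>The terms stem, in this order, from the maximal inequality, the growth of the
  compensator within a mesh cell, its growth along the mean path after time \<open>x\<close>,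
  fluctuation and overshoot together, and the step approximation.\<close>

lemma expected_total_error:
  assumes m: "0 < m" and xm: "(real m)\<^sup>2 \<le> x" and \<tau>: "1 \<le> \<tau>" and e: "0 \<le> e"
    and small: "RG.fluctuation x \<le> ennreal (e * (log_Phi x * sqrt x))" "RG.overshoot x \<le> ennreal (e * (log_Phi x * sqrt x))"
  shows "(\<integral>\<^sup>+\<omega>. total_error x (\<tau> * x) p m (nat \<lfloor>x / real m\<rfloor>) \<omega> \<partial>M) \<le>
    ennreal ((real p + 1) * sqrt \<tau> / sqrt (log_Phi x) + \<tau> * sqrt x / 2 ^ p + laplace_exponent 1 / (log_Phi x * sqrt x) +
      (\<sigma>\<^sup>2 * (\<tau> + 1) + 2) * e + 3 * \<sigma> / sqrt (real m))"
proof -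
  let ?k = "nat \<lfloor>x / real m\<rfloor>" and ?T = "\<tau> * x"
  define G where "G = log_Phi x"
  define r where "r = G * sqrt x"
  define c where "c = laplace_exponent 1"
  have G: "0 < G" using RG.G_pos by (simp add: G_def)
  have x: "0 < x" using xm m zero_less_power[of "real m" 2] by linarith
  have r: "0 < r" using G x by (simp add: r_def)
  have c: "0 \<le> c" using laplace_exponent_nat_nonneg[of 1] by (simp add: c_def)
  have T: "0 < ?T" using \<tau> x by simp
  have [measurable]: "(\<lambda>\<omega>. real (occupied_gaps (\<lambda>t. S t \<omega>) (P (exp x) \<omega>) (real j * (?T / 2 ^ p)))) \<in> borel_measurable M" for j
    by (rule occupied_gaps_measurable) (use T in auto)
  have [measurable]: "compensator (exp x) t \<in> borel_measurable M" for t by (rule compensator_measurable) simp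
  define D where "D \<omega> = (SUP j\<in>{..2 ^ p}. ennreal \<bar>real (occupied_gaps (\<lambda>t. S t \<omega>) (P (exp x) \<omega>) (real j * (?T / 2 ^ p))) -
      compensator (exp x) (real j * (?T / 2 ^ p)) \<omega>\<bar>)" for \<omega>
  have [measurable]: "D \<in> borel_measurable M" unfolding D_def[abs_def] by measurable
  have D: "(\<integral>\<^sup>+\<omega>. D \<omega> \<partial>M) \<le> ennreal ((real p + 1) * sqrt (?T * G))"
    unfolding D_def G_def log_Phi_def by (rule expected_maximal_deviation) (use T in auto)
  have late: "(\<integral>\<^sup>+\<omega>. late_growth x ?T \<omega> \<partial>M) \<le> ennreal c + ennreal (\<sigma>\<^sup>2 * \<tau> + 1) * ennreal (e * r)"
    by (rule order_trans[OF expected_late_growth[OF growth x \<tau>]])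
       (use small in \<open>auto simp: c_def r_def G_def intro!: add_left_mono mult_left_mono\<close>)
  have lin: "(\<integral>\<^sup>+\<omega>. linearisation_error x \<omega> \<partial>M) \<le> ennreal (\<sigma>\<^sup>2 + 1) * ennreal (e * r)"
    by (rule order_trans[OF expected_linearisation_error[OF growth x]])
       (use small in \<open>auto simp: r_def G_def intro!: mult_left_mono\<close>)
  have step: "(\<integral>\<^sup>+\<omega>. step_error x m ?k \<omega> \<partial>M) \<le> ennreal (G * (3 * \<sigma> / sqrt (real m)))"
    unfolding G_def by (rule expected_step_error[OF growth m xm])
  have "(\<integral>\<^sup>+\<omega>. total_error x ?T p m ?k \<omega> \<partial>M) = ennreal (1 / r) * (((\<integral>\<^sup>+\<omega>. D \<omega> \<partial>M) + ennreal (?T / 2 ^ p * G)) +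
      ((\<integral>\<^sup>+\<omega>. late_growth x ?T \<omega> \<partial>M) + ((\<integral>\<^sup>+\<omega>. linearisation_error x \<omega> \<partial>M) + ennreal (sqrt x) * (\<integral>\<^sup>+\<omega>. step_error x m ?k \<omega> \<partial>M))))"
    unfolding total_error_def D_def[symmetric] G_def[symmetric] r_def[symmetric]
    by (simp add: nn_integral_cmult nn_integral_add emeasure_space_1)
  also have "\<dots> \<le> ennreal (1 / r) * ((ennreal ((real p + 1) * sqrt (?T * G)) + ennreal (?T / 2 ^ p * G)) +
      ((ennreal c + ennreal (\<sigma>\<^sup>2 * \<tau> + 1) * ennreal (e * r)) + (ennreal (\<sigma>\<^sup>2 + 1) * ennreal (e * r) +
        ennreal (sqrt x) * ennreal (G * (3 * \<sigma> / sqrt (real m))))))"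
    by (intro mult_left_mono add_mono D late lin step order_refl) auto
  also have "\<dots> = ennreal (1 / r * (((real p + 1) * sqrt (?T * G) + ?T / 2 ^ p * G) +
      ((c + (\<sigma>\<^sup>2 * \<tau> + 1) * (e * r)) + ((\<sigma>\<^sup>2 + 1) * (e * r) + sqrt x * (G * (3 * \<sigma> / sqrt (real m)))))))"
  proof -
    have "0 \<le> (real p + 1) * sqrt (?T * G)" "0 \<le> ?T / 2 ^ p * G" "0 \<le> \<sigma>\<^sup>2 * \<tau> + 1" "0 \<le> e * r" "0 \<le> sqrt x"
      "0 \<le> G * (3 * \<sigma> / sqrt (real m))" "0 \<le> 1 / r" "0 \<le> \<sigma>\<^sup>2 + 1"
      using T G e r \<tau> \<sigma>_nonneg x by auto
    with c show ?thesis
      by (simp only: ennreal_mult[symmetric] ennreal_plus[symmetric] add_nonneg_nonneg mult_nonneg_nonneg)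
  qed
  also have "1 / r * (((real p + 1) * sqrt (?T * G) + ?T / 2 ^ p * G) +
      ((c + (\<sigma>\<^sup>2 * \<tau> + 1) * (e * r)) + ((\<sigma>\<^sup>2 + 1) * (e * r) + sqrt x * (G * (3 * \<sigma> / sqrt (real m)))))) =
      (real p + 1) * sqrt \<tau> / sqrt G + \<tau> * sqrt x / 2 ^ p + c / r + (\<sigma>\<^sup>2 * (\<tau> + 1) + 2) * e + 3 * \<sigma> / sqrt (real m)"
  proof -
    have 1: "1 / r * ((real p + 1) * sqrt (?T * G)) = (real p + 1) * sqrt \<tau> / sqrt G"
    proof -
      have "1 / (g * g * h) * (a * (t * h * g)) = a * t / g" if "0 < g" "0 < h" for a g h t :: real
        using that by (simp add: field_simps)
      from this[of "sqrt G" "sqrt x" "real p + 1" "sqrt \<tau>"] show ?thesis using G x by (simp add: r_def real_sqrt_mult)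
    qed
    have 2: "1 / r * (?T / 2 ^ p * G) = \<tau> * sqrt x / 2 ^ p"
      using G x real_sqrt_mult_self[of x] by (simp add: r_def field_simps)
    have 3: "1 / r * (sqrt x * (G * (3 * \<sigma> / sqrt (real m)))) = 3 * \<sigma> / sqrt (real m)"
      using G x by (simp add: r_def)
    have 4: "1 / r * ((\<sigma>\<^sup>2 * \<tau> + 1) * (e * r)) + 1 / r * ((\<sigma>\<^sup>2 + 1) * (e * r)) = (\<sigma>\<^sup>2 * (\<tau> + 1) + 2) * e"
      using r by (simp add: algebra_simps)
    show ?thesis unfolding distrib_left[of "1 / r"] 1 2 3 using 4 by simp
  qed
  finally show ?thesis by (simp add: G_def r_def c_def)
qed

lemma upper_integral_K1:
  assumes f: "bounded_lipschitz D0 \<rho>0 f"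
    and m: "0 < m" and xm: "(real m)\<^sup>2 \<le> x" and \<tau>: "1 \<le> \<tau>" "3 \<le> \<tau> * laplace_exponent 1" and e: "0 \<le> e"
    and small: "RG.fluctuation x \<le> ennreal (e * (log_Phi x * sqrt x))" "RG.overshoot x \<le> ennreal (e * (log_Phi x * sqrt x))"
  shows "\<bar>upper_integral (process_law M (K1 \<nu> S P (exp x))) f -
      (\<integral>\<omega>. f (span_path m (coeff x m) (\<lambda>i. noise m (nat \<lfloor>x / real m\<rfloor>) i \<omega>)) \<partial>M)\<bar> \<le>
    ((real p + 1) * sqrt \<tau> / sqrt (log_Phi x) + \<tau> * sqrt x / 2 ^ p + laplace_exponent 1 / (log_Phi x * sqrt x) +
      (\<sigma>\<^sup>2 * (\<tau> + 1) + 2) * e + 3 * \<sigma> / sqrt (real m)) + 4 * exp (- x)"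
    (is "_ \<le> ?b + _")
proof -
  let ?k = "nat \<lfloor>x / real m\<rfloor>" and ?T = "\<tau> * x"
  have x: "0 < x" using xm m zero_less_power[of "real m" 2] by linarith
  have G: "0 < log_Phi x" by (rule RG.G_pos)
  have T: "0 \<le> ?T" "x \<le> ?T" using \<tau> x by auto
  have "3 * x \<le> \<tau> * laplace_exponent 1 * x" using \<tau>(2) x by (intro mult_right_mono) auto
  then have Tc: "3 * x \<le> ?T * laplace_exponent 1" by (simp add: mult_ac)
  define B where "B = {\<omega> \<in> space M. S ?T \<omega> \<le> 2 * x} \<union> {\<omega> \<in> space M. P (exp x) \<omega> \<inter> {2 * x<..} \<noteq> {}}"
  have B[measurable]: "B \<in> events" and PB: "prob B \<le> 2 * exp (- x)"
    unfolding B_def by (rule prob_late_points[OF x Tc T(1)])+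
  have [measurable]: "total_error x ?T p m ?k \<in> borel_measurable M" by (rule total_error_measurable[OF T(1)])
  have [measurable]: "noise m ?k i \<in> borel_measurable M" for i unfolding noise_def[abs_def] by measurable
  have b: "0 \<le> ?b" using \<tau> G e x \<sigma>_nonneg laplace_exponent_nat_nonneg[of 1] by (intro add_nonneg_nonneg) auto
  show ?thesis
  proof (rule upper_integral_process_law[OF prob_space_axioms K1_measurable[OF x] f,
      where G = "\<lambda>\<omega>. total_error x ?T p m ?k \<omega> + 2 * indicator B \<omega>"])
    fix \<omega> assume \<omega>: "\<omega> \<in> space M"
    show "2 \<le> total_error x ?T p m ?k \<omega> + 2 * indicator B \<omega> \<or>
        (\<forall>u\<ge>0. ennreal \<bar>K1 \<nu> S P (exp x) u \<omega> - (\<Sum>i<m. noise m ?k i \<omega> * coeff x m i u)\<bar> \<le>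
          total_error x ?T p m ?k \<omega> + 2 * indicator B \<omega>)"
    proof (cases "\<omega> \<in> B")
      case False
      then have "P (exp x) \<omega> \<inter> {S ?T \<omega><..} = {}" using \<omega> by (fastforce simp: B_def)
      from pathwise_bound[OF x T(2) \<omega> _ this] show ?thesis using False by simp
    qed simp
  next
    have "(\<integral>\<^sup>+\<omega>. total_error x ?T p m ?k \<omega> + 2 * indicator B \<omega> \<partial>M) =
        (\<integral>\<^sup>+\<omega>. total_error x ?T p m ?k \<omega> \<partial>M) + 2 * ennreal (prob B)"
      by (simp add: nn_integral_add nn_integral_cmult emeasure_eq_measure)
    also have "\<dots> \<le> ennreal ?b + 2 * ennreal (2 * exp (- x))"
      using PB by (intro add_mono expected_total_error[OF m xm \<tau>(1) e small] mult_left_mono ennreal_leI) auto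
    also have "\<dots> = ennreal ?b + ennreal (4 * exp (- x))"
    proof -
      have "2 * ennreal (2 * exp (- x)) = ennreal 2 * ennreal (2 * exp (- x))" by simp
      also have "\<dots> = ennreal (4 * exp (- x))" by (subst ennreal_mult[symmetric]) auto
      finally show ?thesis by simp
    qed
    also have "\<dots> = ennreal (?b + 4 * exp (- x))" by (rule ennreal_plus[OF b, symmetric]) simp
    finally show "(\<integral>\<^sup>+\<omega>. total_error x ?T p m ?k \<omega> + 2 * indicator B \<omega> \<partial>M) \<le> ennreal (?b + 4 * exp (- x))" .
    show "0 \<le> ?b + 4 * exp (- x)" using b by (rule add_nonneg_nonneg) simp
  next
    show "(\<lambda>\<omega>. total_error x ?T p m ?k \<omega> + 2 * indicator B \<omega>) \<in> borel_measurable M" by measurable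
    show "coeff x m i u = coeff x m i 1" if "1 \<le> u" for i u by (rule coeff_const[OF that])
  qed (use coeff_continuous coeff_bound[OF x G] in simp_all)
qed

end

end

section \<open>Approximation of the Brownian functional\<close>

locale brownian_motion = prob_space M for M :: "'b measure" +
  fixes W :: "real \<Rightarrow> 'b \<Rightarrow> real"
  assumes brownian: "standard_brownian_motion M W"
begin

lemma W_measurable [measurable]: "0 \<le> t \<Longrightarrow> W t \<in> borel_measurable M"
  and W_zero: "\<omega> \<in> space M \<Longrightarrow> W 0 \<omega> = 0"
  and W_continuous: "\<omega> \<in> space M \<Longrightarrow> continuous_on {0..} (\<lambda>t. W t \<omega>)"
  and W_increment: "0 \<le> s \<Longrightarrow> s < t \<Longrightarrow> distributed M lborel (\<lambda>\<omega>. W t \<omega> - W s \<omega>)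
        (\<lambda>x. ennreal (normal_density 0 (sqrt (t - s)) x))"
  and W_indep: "0 \<le> r 0 \<Longrightarrow> (\<And>i. i < k \<Longrightarrow> r i \<le> r (Suc i)) \<Longrightarrow>
    indep_vars (\<lambda>_. borel) (\<lambda>i \<omega>. W (r (Suc i)) \<omega> - W (r i) \<omega>) {..<k}"
  using brownian by (auto simp: standard_brownian_motion_def independent_increments_def)

lemma W_joint_measurable: "(\<lambda>z. W (max 0 (snd z)) (fst z)) \<in> borel_measurable (M \<Otimes>\<^sub>M borel)"
  by (rule right_continuous_joint_measurable)
     (use cadlag_continuous[OF W_continuous] in \<open>auto simp: cadlag_def\<close>)

lemma W_joint_measurable' [measurable (raw)]:
  assumes "f \<in> N \<rightarrow>\<^sub>M M" "g \<in> borel_measurable N"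
  shows "(\<lambda>x. W (max 0 (g x)) (f x)) \<in> borel_measurable N"
  using measurable_compose[OF measurable_Pair[OF assms] W_joint_measurable] by simp

lemma expected_abs_increment:
  assumes "0 \<le> s" "s \<le> t"
  shows "(\<integral>\<^sup>+\<omega>. ennreal \<bar>W t \<omega> - W s \<omega>\<bar> \<partial>M) \<le> ennreal (sqrt (t - s))"
proof (cases "s = t")
  case False
  then have st: "s < t" using assms by simp
  have b: "has_bochner_integral lborel (\<lambda>x. normal_density 0 (sqrt (t - s)) x * \<bar>x\<bar>) (sqrt (t - s) * sqrt (2 / pi))"
    using normal_moment_abs_odd[of "sqrt (t - s)" 0 0] st by simp
  have "(\<integral>\<^sup>+\<omega>. ennreal \<bar>W t \<omega> - W s \<omega>\<bar> \<partial>M) = (\<integral>\<^sup>+x. ennreal (normal_density 0 (sqrt (t - s)) x) * ennreal \<bar>x\<bar> \<partial>lborel)"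
    by (rule distributed_nn_integral[OF W_increment[OF assms(1) st], symmetric]) simp
  also have "\<dots> = (\<integral>\<^sup>+x. ennreal (normal_density 0 (sqrt (t - s)) x * \<bar>x\<bar>) \<partial>lborel)"
    by (simp add: ennreal_mult)
  also have "\<dots> = ennreal (sqrt (t - s) * sqrt (2 / pi))"
    using nn_integral_eq_integral[OF integrable.intros[OF b]] has_bochner_integral_integral_eq[OF b]
    by simp
  also have "\<dots> \<le> ennreal (sqrt (t - s))"
    using st pi_gt3 by (intro ennreal_leI) (simp add: mult_left_le)
  finally show ?thesis .
qed simp

definition step_path :: "nat \<Rightarrow> real \<Rightarrow> 'b \<Rightarrow> real" where
  "step_path m r \<omega> = (\<Sum>i<m. (W (real (Suc i) / real m) \<omega> - W (real i / real m) \<omega>) * of_bool (real (Suc i) / real m \<le> r))"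

lemma step_path_eq:
  assumes m: "0 < m" and r: "0 \<le> r" "r \<le> 1" and \<omega>: "\<omega> \<in> space M"
  shows "step_path m r \<omega> = W (real (nat \<lfloor>real m * r\<rfloor>) / real m) \<omega>"
proof -
  define j where "j = nat \<lfloor>real m * r\<rfloor>"
  have r': "0 \<le> real m * r" "real m * r \<le> real m" using m r by (auto simp: mult_left_le)
  have j: "j \<le> m" using r' unfolding j_def by linarith
  have iff: "real (Suc i) / real m \<le> r \<longleftrightarrow> i < j" for i
  proof -
    have "real (Suc i) / real m \<le> r \<longleftrightarrow> real (Suc i) \<le> real m * r" using m by (simp add: field_simps)
    also have "\<dots> \<longleftrightarrow> Suc i \<le> j" unfolding j_def using r' by (simp add: le_nat_iff le_floor_iff)
    finally show ?thesis by (simp add: Suc_le_eq)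
  qed
  have "step_path m r \<omega> = (\<Sum>i\<in>{..<j}. W (real (Suc i) / real m) \<omega> - W (real i / real m) \<omega>)"
    unfolding step_path_def iff by (rule sum.mono_neutral_cong_right) (use j in auto)
  also have "\<dots> = W (real j / real m) \<omega> - W (real 0 / real m) \<omega>"
    by (rule sum_lessThan_telescope)
  finally show ?thesis using W_zero[OF \<omega>] by (simp add: j_def)
qed

lemma expected_step_path_error:
  assumes m: "0 < m" and r: "0 \<le> r" "r \<le> 1"
  shows "(\<integral>\<^sup>+\<omega>. ennreal \<bar>W r \<omega> - step_path m r \<omega>\<bar> \<partial>M) \<le> ennreal (1 / sqrt (real m))"
proof -
  define j where "j = nat \<lfloor>real m * r\<rfloor>"
  have "0 \<le> real m * r" using m r by simp
  then have j: "real j \<le> real m * r" "real m * r < real j + 1" unfolding j_def by linarith+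
  then have jr: "0 \<le> real j / real m" "real j / real m \<le> r" "r \<le> (real j + 1) / real m"
    using m by (auto simp: field_simps)
  then have jr3: "r - real j / real m \<le> 1 / real m" by (simp add: add_divide_distrib)
  have "(\<integral>\<^sup>+\<omega>. ennreal \<bar>W r \<omega> - step_path m r \<omega>\<bar> \<partial>M) = (\<integral>\<^sup>+\<omega>. ennreal \<bar>W r \<omega> - W (real j / real m) \<omega>\<bar> \<partial>M)"
    by (intro nn_integral_cong) (simp add: step_path_eq[OF m r] j_def)
  also have "\<dots> \<le> ennreal (sqrt (r - real j / real m))" by (rule expected_abs_increment[OF jr(1,2)])
  also have "\<dots> \<le> ennreal (sqrt (1 / real m))" by (intro ennreal_leI real_sqrt_le_mono jr3)
  finally show ?thesis by (simp add: real_sqrt_divide)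
qed

end

locale brownian_functional = brownian_motion M W + levy_measure \<nu>
  for M :: "'b measure" and W \<nu> +
  fixes \<sigma> :: real
  assumes \<sigma>_nonneg: "0 \<le> \<sigma>" and A1: "assumption_A1 \<nu>"
begin

lemma log_Phi_pos: "0 < log_Phi x" unfolding log_Phi_def by (rule Phi_pos[OF A1]) simp

lemma log_phi_pos: "0 < log_phi x" unfolding log_phi_def using Phi_moment_pos[OF A1, of 1] by simp

lemma continuous_W_scaled:
  assumes "\<omega> \<in> space M" "0 < x" shows "continuous_on {0..} (\<lambda>s. log_phi (x - s) * W (s / x) \<omega>)"
proof (rule continuous_on_mult)
  show "continuous_on {0..} (\<lambda>s. log_phi (x - s))"
    by (rule continuous_on_compose2[OF continuous_log_phi[of UNIV]]) (auto intro!: continuous_intros)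
  show "continuous_on {0..} (\<lambda>s. W (s / x) \<omega>)"
    by (rule continuous_on_compose2[OF W_continuous[OF assms(1)]]) (use assms in \<open>auto intro!: continuous_intros\<close>)
qed

lemma set_integrable_W:
  assumes "\<omega> \<in> space M" "0 < x" shows "set_integrable lborel {0..t} (\<lambda>s. log_phi (x - s) * W (s / x) \<omega>)"
  by (rule borel_integrable_atLeastAtMost', rule continuous_on_subset[OF continuous_W_scaled[OF assms]]) auto

text \<open>On the logarithmic scale the factor \<open>L\<close> in the denominator of
  \<open>h1\<close> cancels \<open>log_Phi\<close> and leaves its derivative, so \<open>h1\<close>
  at \<open>v\<close> is \<open>x * log_phi (x - x * v) / log_Phi x\<close>.\<close>

lemma Y1_exp:
  assumes \<omega>: "\<omega> \<in> space M" and x: "0 < x" and u: "0 \<le> u"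
  shows "Y1 \<nu> \<sigma> W (exp x) u \<omega> = \<sigma> / log_Phi x * integral {0..x * min u 1} (\<lambda>s. log_phi (x - s) * W (s / x) \<omega>)"
proof -
  have e: "exp x powr (1 - v) = exp (x - x * v)" for v by (simp add: powr_def algebra_simps)
  have "h1 \<nu> (exp x) v = x / log_Phi x * log_phi (x - x * v)" for v
    using log_Phi_pos[of "x - x * v"]
    unfolding h1_def e L_fun_exp by (simp add: log_Phi_def)
  then have "Y1 \<nu> \<sigma> W (exp x) u \<omega> = \<sigma> * integral {0..min u 1} (\<lambda>v. x / log_Phi x * (log_phi (x - x * v) * W (x * v / x) \<omega>))"
    using x by (simp add: Y1_def mult.assoc)
  also have "\<dots> = \<sigma> / log_Phi x * (x * integral {0..min u 1} (\<lambda>v. log_phi (x - x * v) * W (x * v / x) \<omega>))"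
    by (subst integral_mult_right) simp
  also have "x * integral {0..min u 1} (\<lambda>v. log_phi (x - x * v) * W (x * v / x) \<omega>) =
      integral {0..x * min u 1} (\<lambda>s. log_phi (x - s) * W (s / x) \<omega>)"
    by (rule integral_scale[OF set_borel_integral_eq_integral(1)[OF set_integrable_W[OF \<omega> x]] x]) (use u in simp)
  finally show ?thesis .
qed

lemma Y1_measurable:
  assumes x: "0 < x"
  shows "(\<lambda>\<omega>. \<lambda>u\<in>{0..}. Y1 \<nu> \<sigma> W (exp x) u \<omega>) \<in> M \<rightarrow>\<^sub>M D0_space"
  unfolding D0_space_def
proof (rule measurable_restrict_space2)
  show "(\<lambda>\<omega>. \<lambda>u\<in>{0..}. Y1 \<nu> \<sigma> W (exp x) u \<omega>) \<in> M \<rightarrow>\<^sub>M (\<Pi>\<^sub>M i\<in>{0..}. borel)"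
  proof (rule measurable_restrict)
    fix u :: real assume "u \<in> {0..}"
    then have u: "0 \<le> u" by simp
    \<comment> \<open>Clipping the time gives joint measurability on all of the real line and
      changes nothing on the range of integration.\<close>
    have "(\<lambda>\<omega>. \<sigma> / log_Phi x * (\<integral>s. indicator {0..x * min u 1} s *\<^sub>R (log_phi (x - s) * W (max 0 (s / x)) \<omega>) \<partial>lborel)) \<in> borel_measurable M"
      by measurable
    then show "Y1 \<nu> \<sigma> W (exp x) u \<in> borel_measurable M"
    proof (rule measurable_cong[THEN iffD1, rotated])
      fix \<omega> assume \<omega>: "\<omega> \<in> space M"
      have "(\<integral>s. indicator {0..x * min u 1} s *\<^sub>R (log_phi (x - s) * W (max 0 (s / x)) \<omega>) \<partial>lborel) =
          (\<integral>s. indicator {0..x * min u 1} s *\<^sub>R (log_phi (x - s) * W (s / x) \<omega>) \<partial>lborel)"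
        using x by (intro Bochner_Integration.integral_cong) (auto simp: indicator_def max_def)
      then show "\<sigma> / log_Phi x * (\<integral>s. indicator {0..x * min u 1} s *\<^sub>R (log_phi (x - s) * W (max 0 (s / x)) \<omega>) \<partial>lborel) =
          Y1 \<nu> \<sigma> W (exp x) u \<omega>"
        using set_borel_integral_eq_integral(2)[OF set_integrable_W[OF \<omega> x]]
        by (simp add: Y1_exp[OF \<omega> x u] set_lebesgue_integral_def)
    qed
  qed
  show "(\<lambda>\<omega>. \<lambda>u\<in>{0..}. Y1 \<nu> \<sigma> W (exp x) u \<omega>) \<in> space M \<rightarrow> D0"
  proof
    fix \<omega> assume \<omega>: "\<omega> \<in> space M"
    define I where "I u = integral {0..x * min u 1} (\<lambda>s. log_phi (x - s) * W (s / x) \<omega>)" for u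
    have "continuous_on {0..x} (\<lambda>t. integral {0..t} (\<lambda>s. log_phi (x - s) * W (s / x) \<omega>))"
      by (rule indefinite_integral_continuous_1[OF set_borel_integral_eq_integral(1)[OF set_integrable_W[OF \<omega> x]]])
    then have "continuous_on {0..} I" unfolding I_def
      by (rule continuous_on_compose2[where g="\<lambda>t. integral {0..t} (\<lambda>s. log_phi (x - s) * W (s / x) \<omega>)"])
         (use x in \<open>auto intro!: continuous_intros simp: mult_left_le min_le_iff_disj\<close>)
    then have "restrict (\<lambda>u. \<sigma> / log_Phi x * I u) {0..} \<in> D0"
      by (intro D0I continuous_on_mult_left) (simp_all add: I_def)
    moreover have "(\<lambda>u\<in>{0..}. Y1 \<nu> \<sigma> W (exp x) u \<omega>) = restrict (\<lambda>u. \<sigma> / log_Phi x * I u) {0..}"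
      by (rule restrict_ext) (simp add: Y1_exp[OF \<omega> x] I_def)
    ultimately show "(\<lambda>u\<in>{0..}. Y1 \<nu> \<sigma> W (exp x) u \<omega>) \<in> D0" by simp
  qed
qed

definition brownian_error :: "real \<Rightarrow> nat \<Rightarrow> 'b \<Rightarrow> ennreal" where
  "brownian_error x m \<omega> = ennreal (\<sigma> / log_Phi x) *
    (\<integral>\<^sup>+s. ennreal (log_phi (x - s) * \<bar>W (max 0 (s / x)) \<omega> - step_path m (s / x) \<omega>\<bar>) * indicator {0..x} s \<partial>lborel)"

lemma brownian_error_measurable [measurable]: "brownian_error x m \<in> borel_measurable M"
  unfolding brownian_error_def[abs_def] step_path_def by measurable

lemma pathwise_brownian_bound:
  assumes \<omega>: "\<omega> \<in> space M" and x: "0 < x" and u: "0 \<le> u"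
  shows "ennreal \<bar>Y1 \<nu> \<sigma> W (exp x) u \<omega> -
      (\<Sum>i<m. \<sigma> * (W (real (Suc i) / real m) \<omega> - W (real i / real m) \<omega>) * coeff x m i u)\<bar> \<le> brownian_error x m \<omega>"
proof -
  define \<xi> where "\<xi> i = W (real (Suc i) / real m) \<omega> - W (real i / real m) \<omega>" for i
  let ?t = "x * min u 1" and ?st = "\<lambda>s. step_path m (s / x) \<omega>"
  have t: "?t \<le> x" using x by (simp add: mult_left_le)
  have st: "?st s = (\<Sum>i<m. \<xi> i * of_bool (real (Suc i) * x / real m \<le> s))" for s
  proof -
    have "real (Suc i) / real m \<le> s / x \<longleftrightarrow> real (Suc i) * x / real m \<le> s" for i using x by (simp add: field_simps)
    then show ?thesis by (simp add: step_path_def \<xi>_def)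
  qed
  note steps = integral_log_phi_steps[OF x log_Phi_pos u, where c = \<xi> and m = m, folded st]
  note w = set_integrable_W[OF \<omega> x, of ?t]
  define f where "f s = log_phi (x - s) * W (s / x) \<omega> - log_phi (x - s) * ?st s" for s
  have fi: "set_integrable lborel {0..?t} f" unfolding f_def by (rule set_integral_diff(1)[OF w steps(1)])
  have "integral {0..?t} f = integral {0..?t} (\<lambda>s. log_phi (x - s) * W (s / x) \<omega>) - log_Phi x * (\<Sum>i<m. \<xi> i * coeff x m i u)"
    unfolding f_def steps(2)[symmetric]
    by (rule Henstock_Kurzweil_Integration.integral_diff[OF set_borel_integral_eq_integral(1)[OF w] set_borel_integral_eq_integral(1)[OF steps(1)]])
  then have "\<sigma> / log_Phi x * integral {0..?t} f = Y1 \<nu> \<sigma> W (exp x) u \<omega> - \<sigma> * (\<Sum>i<m. \<xi> i * coeff x m i u)"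
    using log_Phi_pos[of x] by (simp add: Y1_exp[OF \<omega> x u] right_diff_distrib)
  also have "\<sigma> * (\<Sum>i<m. \<xi> i * coeff x m i u) = (\<Sum>i<m. \<sigma> * \<xi> i * coeff x m i u)"
    by (simp add: sum_distrib_left mult.assoc)
  finally have eq: "\<sigma> / log_Phi x * integral {0..?t} f = Y1 \<nu> \<sigma> W (exp x) u \<omega> - (\<Sum>i<m. \<sigma> * \<xi> i * coeff x m i u)" .
  have "ennreal \<bar>Y1 \<nu> \<sigma> W (exp x) u \<omega> - (\<Sum>i<m. \<sigma> * \<xi> i * coeff x m i u)\<bar> = ennreal (\<sigma> / log_Phi x * \<bar>integral {0..?t} f\<bar>)"
    unfolding eq[symmetric] using \<sigma>_nonneg log_Phi_pos[of x] by (simp add: abs_mult)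
  also have "\<dots> = ennreal (\<sigma> / log_Phi x) * ennreal \<bar>integral {0..?t} f\<bar>"
    using \<sigma>_nonneg log_Phi_pos[of x] by (intro ennreal_mult) auto
  also have "\<dots> \<le> ennreal (\<sigma> / log_Phi x) * (\<integral>\<^sup>+s. ennreal \<bar>f s\<bar> * indicator {0..x} s \<partial>lborel)"
    by (intro mult_left_mono ennreal_abs_integral_le[OF fi t]) simp
  also have "(\<integral>\<^sup>+s. ennreal \<bar>f s\<bar> * indicator {0..x} s \<partial>lborel) =
      (\<integral>\<^sup>+s. ennreal (log_phi (x - s) * \<bar>W (max 0 (s / x)) \<omega> - ?st s\<bar>) * indicator {0..x} s \<partial>lborel)"
  proof (rule nn_integral_cong)
    fix s
    show "ennreal \<bar>f s\<bar> * indicator {0..x} s =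
        ennreal (log_phi (x - s) * \<bar>W (max 0 (s / x)) \<omega> - ?st s\<bar>) * indicator {0..x} s"
    proof (cases "s \<in> {0..x}")
      case True
      then have "max 0 (s / x) = s / x" using x by (simp add: max_def)
      moreover have "\<bar>f s\<bar> = log_phi (x - s) * \<bar>W (s / x) \<omega> - ?st s\<bar>"
        using log_phi_pos[of "x - s"] by (simp add: f_def right_diff_distrib[symmetric] abs_mult)
      ultimately show ?thesis by simp
    qed simp
  qed
  finally show ?thesis by (simp add: brownian_error_def \<xi>_def)
qed

text \<open>At every time the step path misses by at most \<open>1 / sqrt m\<close> in mean. The
  weight \<open>log_phi (x - s)\<close> has total mass at most \<open>log_Phi x\<close>, which
  cancels the normalisation.\<close>

lemma expected_brownian_error:
  assumes m: "0 < m" and x: "0 < x" and growth: "regular_growth log_Phi log_phi C K y0"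
  shows "(\<integral>\<^sup>+\<omega>. brownian_error x m \<omega> \<partial>M) \<le> ennreal (\<sigma> / sqrt (real m))"
proof -
  interpret RG: regular_growth log_Phi log_phi C K y0 by (rule growth)
  have swap: "(\<integral>\<^sup>+\<omega>. \<integral>\<^sup>+s. ennreal (log_phi (x - s) * \<bar>W (max 0 (s / x)) \<omega> - step_path m (s / x) \<omega>\<bar>) * indicator {0..x} s \<partial>lborel \<partial>M) =
      (\<integral>\<^sup>+s. \<integral>\<^sup>+\<omega>. ennreal (log_phi (x - s) * \<bar>W (max 0 (s / x)) \<omega> - step_path m (s / x) \<omega>\<bar>) * indicator {0..x} s \<partial>M \<partial>lborel)"
    unfolding step_path_def by (rule nn_integral_swap) measurable
  have "(\<integral>\<^sup>+s. \<integral>\<^sup>+\<omega>. ennreal (log_phi (x - s) * \<bar>W (max 0 (s / x)) \<omega> - step_path m (s / x) \<omega>\<bar>) * indicator {0..x} s \<partial>M \<partial>lborel) \<le>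
      (\<integral>\<^sup>+s. ennreal (log_phi (x - s)) * indicator {..x} (x - s) * ennreal (1 / sqrt (real m)) \<partial>lborel)"
  proof (rule nn_integral_mono)
    fix s
    show "(\<integral>\<^sup>+\<omega>. ennreal (log_phi (x - s) * \<bar>W (max 0 (s / x)) \<omega> - step_path m (s / x) \<omega>\<bar>) * indicator {0..x} s \<partial>M) \<le>
      ennreal (log_phi (x - s)) * indicator {..x} (x - s) * ennreal (1 / sqrt (real m))"
    proof (cases "s \<in> {0..x}")
      case True
      then have s: "0 \<le> s / x" "s / x \<le> 1" using x by auto
      have [measurable]: "W (s / x) \<in> borel_measurable M" using s by simp
      have g: "0 \<le> log_phi (x - s)" using log_phi_pos less_imp_le by blast
      have "(\<integral>\<^sup>+\<omega>. ennreal (log_phi (x - s) * \<bar>W (max 0 (s / x)) \<omega> - step_path m (s / x) \<omega>\<bar>) * indicator {0..x} s \<partial>M) =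
          (\<integral>\<^sup>+\<omega>. ennreal (log_phi (x - s)) * ennreal \<bar>W (s / x) \<omega> - step_path m (s / x) \<omega>\<bar> \<partial>M)"
        using True s g by (intro nn_integral_cong) (simp add: ennreal_mult max_def)
      also have "\<dots> = ennreal (log_phi (x - s)) * (\<integral>\<^sup>+\<omega>. ennreal \<bar>W (s / x) \<omega> - step_path m (s / x) \<omega>\<bar> \<partial>M)"
        unfolding step_path_def by (rule nn_integral_cmult) measurable
      also have "\<dots> \<le> ennreal (log_phi (x - s)) * ennreal (1 / sqrt (real m))"
        by (intro mult_left_mono expected_step_path_error m s) simp
      finally show ?thesis using True by simp
    qed simp
  qed
  also have "\<dots> = (\<integral>\<^sup>+w. ennreal (log_phi w) * indicator {..x} w * ennreal (1 / sqrt (real m)) \<partial>lborel)"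
    by (rule nn_integral_reflect) measurable
  also have "\<dots> = (\<integral>\<^sup>+w. ennreal (log_phi w) * indicator {..x} w \<partial>lborel) * ennreal (1 / sqrt (real m))"
    by (rule nn_integral_multc) measurable
  also have "\<dots> = ennreal (log_Phi x * (1 / sqrt (real m)))"
    using log_Phi_pos[of x] by (simp add: RG.nn_integral_g ennreal_mult[symmetric] less_imp_le)
  finally have le: "(\<integral>\<^sup>+\<omega>. \<integral>\<^sup>+s. ennreal (log_phi (x - s) * \<bar>W (max 0 (s / x)) \<omega> - step_path m (s / x) \<omega>\<bar>) * indicator {0..x} s \<partial>lborel \<partial>M) \<le>
      ennreal (log_Phi x * (1 / sqrt (real m)))" unfolding swap .
  have "(\<integral>\<^sup>+\<omega>. brownian_error x m \<omega> \<partial>M) = ennreal (\<sigma> / log_Phi x) *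
      (\<integral>\<^sup>+\<omega>. \<integral>\<^sup>+s. ennreal (log_phi (x - s) * \<bar>W (max 0 (s / x)) \<omega> - step_path m (s / x) \<omega>\<bar>) * indicator {0..x} s \<partial>lborel \<partial>M)"
    unfolding brownian_error_def step_path_def by (rule nn_integral_cmult) measurable
  also have "\<dots> \<le> ennreal (\<sigma> / log_Phi x) * ennreal (log_Phi x * (1 / sqrt (real m)))"
    by (intro mult_left_mono le) simp
  also have "\<dots> = ennreal (\<sigma> / sqrt (real m))"
    using \<sigma>_nonneg log_Phi_pos[of x] by (simp add: ennreal_mult[symmetric])
  finally show ?thesis .
qed

lemma upper_integral_Y1:
  assumes f: "bounded_lipschitz D0 \<rho>0 f" and m: "0 < m" and x: "0 < x" and growth: "regular_growth log_Phi log_phi C K y0"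
  shows "\<bar>upper_integral (process_law M (Y1 \<nu> \<sigma> W (exp x))) f -
      (\<integral>\<omega>. f (span_path m (coeff x m) (\<lambda>i. \<sigma> * (W (real (Suc i) / real m) \<omega> - W (real i / real m) \<omega>))) \<partial>M)\<bar> \<le> \<sigma> / sqrt (real m)"
proof (rule upper_integral_process_law[OF prob_space_axioms Y1_measurable[OF x] f, where G = "brownian_error x m"])
  show "(\<lambda>\<omega>. \<sigma> * (W (real (Suc i) / real m) \<omega> - W (real i / real m) \<omega>)) \<in> borel_measurable M" for i
    by measurable
  show "2 \<le> brownian_error x m \<omega> \<or> (\<forall>u\<ge>0. ennreal \<bar>Y1 \<nu> \<sigma> W (exp x) u \<omega> -
      (\<Sum>i<m. \<sigma> * (W (real (Suc i) / real m) \<omega> - W (real i / real m) \<omega>) * coeff x m i u)\<bar> \<le> brownian_error x m \<omega>)"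
    if "\<omega> \<in> space M" for \<omega>
    using pathwise_brownian_bound[OF that x] by blast
  show "coeff x m i u = coeff x m i 1" if "1 \<le> u" for i u by (rule coeff_const[OF that])
qed (use coeff_continuous coeff_bound[OF x log_Phi_pos] expected_brownian_error[OF m x growth] \<sigma>_nonneg in simp_all)

end

section \<open>Comparison of the two laws\<close>

text \<open>One-sided limits give a bound near each point, bisection glues these on compact
  intervals, and the limit at infinity covers the rest. So the supremum in \<open>\<rho>0\<close> is
  taken over a bounded set.\<close>

lemma D0_bounded:
  assumes "y \<in> D0" shows "\<exists>B. \<forall>t\<ge>0. \<bar>y t\<bar> \<le> B"
proof -
  obtain l where c: "cadlag y" and l: "(y \<longlongrightarrow> l) at_top" using assms by (auto simp: D0_def)
  have near: "\<forall>\<^sub>F t in F. \<bar>y t\<bar> \<le> \<bar>a\<bar> + 1" if "(y \<longlongrightarrow> a) F" for a F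
  proof -
    have "\<forall>\<^sub>F t in F. dist (y t) a < 1" using that by (rule tendstoD) simp
    then show ?thesis by eventually_elim (auto simp: dist_real_def)
  qed
  from near[OF l] obtain N where N: "\<And>t. N \<le> t \<Longrightarrow> \<bar>y t\<bar> \<le> \<bar>l\<bar> + 1" by (auto simp: eventually_at_top_linorder)
  define bdd where "bdd a b \<longleftrightarrow> (\<exists>B. \<forall>t. a \<le> t \<and> t \<le> b \<and> 0 \<le> t \<longrightarrow> \<bar>y t\<bar> \<le> B)" for a b
  have "bdd 0 (max 0 N)"
  proof (rule Bolzano)
    fix a b c assume "bdd a b" "bdd b c"
    then obtain B B' where "\<forall>t. a \<le> t \<and> t \<le> b \<and> 0 \<le> t \<longrightarrow> \<bar>y t\<bar> \<le> B" "\<forall>t. b \<le> t \<and> t \<le> c \<and> 0 \<le> t \<longrightarrow> \<bar>y t\<bar> \<le> B'"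
      unfolding bdd_def by blast
    then have "\<forall>t. a \<le> t \<and> t \<le> c \<and> 0 \<le> t \<longrightarrow> \<bar>y t\<bar> \<le> max B B'" by (metis linear max.coboundedI1 max.coboundedI2)
    then show "bdd a c" unfolding bdd_def by blast
  next
    fix x :: real assume x: "0 \<le> x" "x \<le> max 0 N"
    have "(y \<longlongrightarrow> y x) (at_right x)" using c x by (auto simp: cadlag_def)
    from near[OF this] obtain r where r: "x < r" "\<And>t. x < t \<Longrightarrow> t < r \<Longrightarrow> \<bar>y t\<bar> \<le> \<bar>y x\<bar> + 1"
      by (auto simp: eventually_at_right_field)
    obtain q B where q: "q < x" "\<And>t. 0 \<le> t \<Longrightarrow> q < t \<Longrightarrow> t < x \<Longrightarrow> \<bar>y t\<bar> \<le> B"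
    proof (cases "x = 0")
      case True then show ?thesis using that[of "-1" 0] by auto
    next
      case False
      then have "0 < x" using x by simp
      then obtain a where "(y \<longlongrightarrow> a) (at_left x)" using c unfolding cadlag_def by blast
      from near[OF this] show ?thesis using that[of _ "\<bar>a\<bar> + 1"] by (auto simp: eventually_at_left_field)
    qed
    have "bdd a b" if "a \<le> x" "x \<le> b" "b - a < min (r - x) (x - q)" for a b
      unfolding bdd_def
    proof (intro exI[of _ "max B (\<bar>y x\<bar> + 1)"] allI impI)
      fix t assume t: "a \<le> t \<and> t \<le> b \<and> 0 \<le> t"
      consider "t < x" | "t = x" | "x < t" by linarith
      then show "\<bar>y t\<bar> \<le> max B (\<bar>y x\<bar> + 1)"
      proof cases
        case 1 then show ?thesis using q(2)[of t] t that by auto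
      next
        case 3 then show ?thesis using r(2)[of t] t that by auto
      qed auto
    qed
    then show "\<exists>d>0. \<forall>a b. a \<le> x \<and> x \<le> b \<and> b - a < d \<longrightarrow> bdd a b"
      using r(1) q(1) by (intro exI[of _ "min (r - x) (x - q)"]) auto
  qed simp
  then obtain B where B: "\<And>t. 0 \<le> t \<Longrightarrow> t \<le> max 0 N \<Longrightarrow> \<bar>y t\<bar> \<le> B" unfolding bdd_def by blast
  have "\<bar>y t\<bar> \<le> max B (\<bar>l\<bar> + 1)" if "0 \<le> t" for t using B[OF that] N[of t] by (cases "N \<le> t") (simp_all add: le_max_iff_disj)
  then show ?thesis by blast
qed

lemma \<rho>0_nonneg:
  assumes "x \<in> D0" "y \<in> D0" shows "0 \<le> \<rho>0 x y"
proof -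
  obtain B B' where B: "\<And>t. 0 \<le> t \<Longrightarrow> \<bar>x t\<bar> \<le> B" "\<And>t. 0 \<le> t \<Longrightarrow> \<bar>y t\<bar> \<le> B'"
    using D0_bounded[OF assms(1)] D0_bounded[OF assms(2)] by blast
  have "bdd_above ((\<lambda>t. \<bar>x t - y t\<bar>) ` {0..})"
  proof (rule bdd_aboveI2)
    fix t :: real assume "t \<in> {0..}"
    then show "\<bar>x t - y t\<bar> \<le> B + B'" using B(1)[of t] B(2)[of t] by auto
  qed
  then have "\<bar>x 0 - y 0\<bar> \<le> \<rho>0 x y" unfolding \<rho>0_def by (rule cSUP_upper[rotated]) simp
  then show ?thesis by linarith
qed

lemma d_BW0_le:
  assumes Q: "prob_space Q" "prob_space Q'" "space Q = D0" "space Q' = D0"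
    and e: "\<And>f. bounded_lipschitz D0 \<rho>0 f \<Longrightarrow> \<bar>upper_integral Q f - upper_integral Q' f\<bar> \<le> e"
  shows "\<bar>d_BW0 Q Q'\<bar> \<le> e"
proof -
  let ?F = "{f. bounded_lipschitz (space Q) \<rho>0 f}"
  \<comment> \<open>The constant 0 makes the class of test functions nonempty and also shows that
    the distance is nonnegative.\<close>
  have zero: "(\<lambda>_. 0) \<in> ?F" using \<rho>0_nonneg by (simp add: bounded_lipschitz_def Q)
  have "d_BW0 Q Q' \<le> e" unfolding d_BW_def
    by (rule cSUP_least) (use zero e Q(3) in auto)
  moreover have "\<bar>upper_integral Q (\<lambda>_. 0) - upper_integral Q' (\<lambda>_. 0)\<bar> \<le> d_BW0 Q Q'"
    unfolding d_BW_def by (rule cSUP_upper[OF zero d_BW_bdd_above]) (use Q in simp_all)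
  ultimately show ?thesis by linarith
qed

context occupancy_moments
begin

lemma noise_indep: "indep_vars (\<lambda>_. borel) (noise m k) {..<m}"
proof -
  have "indep_vars (\<lambda>_. borel) (\<lambda>i \<omega>. S (real (Suc i * k)) \<omega> - S (real (i * k)) \<omega>) {..<m}"
    by (rule increments_indep) auto
  from indep_vars_compose2[OF this, of "\<lambda>_ y. - (y - real k) / sqrt (real (m * k))" "\<lambda>_. borel"]
  show ?thesis unfolding noise_def[abs_def] by simp
qed

text \<open>Stationarity removes the index, and splitting \<open>sqrt (m * k)\<close> exposes the
  variable of the central limit theorem at time \<open>k\<close>.\<close>

lemma noise_law:
  "distr M borel (noise m k i) = distr M borel (\<lambda>\<omega>. - (S (real k) \<omega> - real k) / sqrt (real k) / sqrt (real m))"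
proof -
  let ?g = "\<lambda>y. - (y - real k) / sqrt (real (m * k))"
  have "distr M borel (noise m k i) = distr (distr M borel (\<lambda>\<omega>. S (real (Suc i * k)) \<omega> - S (real (i * k)) \<omega>)) borel ?g"
    by (subst distr_distr) (auto simp: noise_def[abs_def] comp_def)
  also have "distr M borel (\<lambda>\<omega>. S (real (Suc i * k)) \<omega> - S (real (i * k)) \<omega>) = distr M borel (S (real k))"
    using increments_stationary[of "real (i * k)" "real (Suc i * k)"] by (simp add: algebra_simps)
  also have "distr (distr M borel (S (real k))) borel ?g = distr M borel (\<lambda>\<omega>. ?g (S (real k) \<omega>))"
    by (subst distr_distr) (auto simp: comp_def)
  finally show ?thesis by (simp add: real_sqrt_mult mult.commute)
qed

end

lemma (in brownian_motion) scaled_increment_law: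
  assumes m: "0 < m" and \<sigma>: "0 < \<sigma>"
  shows "distr M borel (\<lambda>\<omega>. \<sigma> * (W (real (Suc i) / real m) \<omega> - W (real i / real m) \<omega>)) =
    density lborel (normal_density 0 (\<sigma> / sqrt (real m)))"
proof -
  have "distributed M lborel (\<lambda>\<omega>. W (real (Suc i) / real m) \<omega> - W (real i / real m) \<omega>) (normal_density 0 (sqrt (1 / real m)))"
    using W_increment[of "real i / real m" "real (Suc i) / real m"] m
    by (simp add: diff_divide_distrib[symmetric] divide_strict_right_mono)
  from normal_density_affine[OF this, of \<sigma> 0] m \<sigma>
  have "distributed M lborel (\<lambda>\<omega>. \<sigma> * (W (real (Suc i) / real m) \<omega> - W (real i / real m) \<omega>)) (normal_density 0 (\<sigma> / sqrt (real m)))"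
    by (simp add: real_sqrt_divide)
  then have "distr M lborel (\<lambda>\<omega>. \<sigma> * (W (real (Suc i) / real m) \<omega> - W (real i / real m) \<omega>)) =
      density lborel (normal_density 0 (\<sigma> / sqrt (real m)))"
    by (simp add: distributed_def)
  then show ?thesis by (simp cong: distr_cong)
qed

lemma (in prob_space) scaled_normal_law:
  fixes Z :: "'a \<Rightarrow> real"
  assumes Z: "Z \<in> borel_measurable M" "distr M borel Z = density lborel (normal_density 0 \<sigma>)" and m: "0 < m" and \<sigma>: "0 < \<sigma>"
  shows "distr M borel (\<lambda>\<omega>. Z \<omega> / sqrt (real m)) = density lborel (normal_density 0 (\<sigma> / sqrt (real m)))"
proof -
  have "distr M lborel Z = distr M borel Z" by (rule distr_cong) auto
  then have "distributed M lborel Z (normal_density 0 \<sigma>)" using Z by (simp add: distributed_def)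
  from normal_density_affine[OF this \<sigma>, of "1 / sqrt (real m)" 0] m
  have "distributed M lborel (\<lambda>\<omega>. Z \<omega> / sqrt (real m)) (normal_density 0 (\<sigma> / sqrt (real m)))" by simp
  then have "distr M lborel (\<lambda>\<omega>. Z \<omega> / sqrt (real m)) = density lborel (normal_density 0 (\<sigma> / sqrt (real m)))"
    by (simp add: distributed_def)
  then show ?thesis by (simp cong: distr_cong)
qed

text \<open>By \<open>G_lower\<close> the denominator grows at least like
  \<open>x powr (1 / (2 * C))\<close>, which beats the logarithmic numerator.\<close>

lemma (in regular_growth) logarithm_negligible:
  "((\<lambda>x. (real (nat \<lceil>log 2 x\<rceil>) + 1) * c / sqrt (G x)) \<longlongrightarrow> 0) at_top"
proof (rule Lim_null_comparison)
  define a where "a = 1 / (2 * C)"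
  define b where "b = \<bar>c\<bar> / sqrt (G y0 / y0 powr (1 / C))"
  have a: "0 < a" using C by (simp add: a_def)
  have G0: "0 < G y0 / y0 powr (1 / C)" using G_pos y0 by simp
  show "\<forall>\<^sub>F x in at_top. norm ((real (nat \<lceil>log 2 x\<rceil>) + 1) * c / sqrt (G x)) \<le> b * ((log 2 x + 2) / x powr a)"
    using eventually_ge_at_top[of y0]
  proof eventually_elim
    case (elim x)
    have x: "1 \<le> x" using elim y0 by simp
    have p: "real (nat \<lceil>log 2 x\<rceil>) + 1 \<le> log 2 x + 2"
      using of_int_ceiling_le_add_one[of "log 2 x"] x by (simp add: zero_le_log_cancel_iff add.commute)
    have "sqrt (G y0 / y0 powr (1 / C)) * x powr a = sqrt (G y0 / y0 powr (1 / C) * x powr (1 / C))"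
    proof -
      have "sqrt (x powr (1 / C)) = x powr a" using x by (simp add: a_def powr_half_sqrt[symmetric] powr_powr mult.commute)
      then show ?thesis by (simp only: real_sqrt_mult)
    qed
    also have "\<dots> \<le> sqrt (G x)" by (intro real_sqrt_le_mono G_lower elim)
    finally have s: "sqrt (G y0 / y0 powr (1 / C)) * x powr a \<le> sqrt (G x)" .
    have pos: "0 < sqrt (G y0 / y0 powr (1 / C)) * x powr a" using G0 x by simp
    have "norm ((real (nat \<lceil>log 2 x\<rceil>) + 1) * c / sqrt (G x)) = (real (nat \<lceil>log 2 x\<rceil>) + 1) * \<bar>c\<bar> / sqrt (G x)"
      using G_pos[of x] by (simp add: abs_mult)
    also have "\<dots> \<le> (log 2 x + 2) * \<bar>c\<bar> / (sqrt (G y0 / y0 powr (1 / C)) * x powr a)"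
      using p s pos x by (intro frac_le mult_right_mono) auto
    finally show ?case by (simp add: b_def mult_ac)
  qed
  have "((\<lambda>x. (log 2 x + 2) / x powr a) \<longlongrightarrow> 0) at_top" using a by real_asymp
  from tendsto_mult_left[OF this, of b] show "((\<lambda>x. b * ((log 2 x + 2) / x powr a)) \<longlongrightarrow> 0) at_top" by simp
qed

text \<open>Both upper integrals are close to expectations of one function of \<open>m\<close>
  independent coordinates, and the coupling compares these. The bound does not depend on the test
  function \<open>f\<close>.\<close>

lemma (in occupancy_moments) upper_integral_difference:
  fixes Z Z' :: "'c \<Rightarrow> real" and W :: "real \<Rightarrow> 'b \<Rightarrow> real"
  assumes growth: "regular_growth log_Phi log_phi C K y0"
    and W: "prob_space M'" "standard_brownian_motion M' W"
    and f: "bounded_lipschitz D0 \<rho>0 f"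
    and m: "0 < m" and xm: "(real m)\<^sup>2 \<le> x" and \<tau>: "1 \<le> \<tau>" "3 \<le> \<tau> * laplace_exponent 1" and e: "0 \<le> e"
    and small: "regular_growth.fluctuation log_phi x \<le> ennreal (e * (log_Phi x * sqrt x))"
      "regular_growth.overshoot log_phi x \<le> ennreal (e * (log_Phi x * sqrt x))"
    and \<Lambda>: "prob_space \<Lambda>" and Z[measurable]: "Z \<in> borel_measurable \<Lambda>" and Z'[measurable]: "Z' \<in> borel_measurable \<Lambda>"
    and law: "distr \<Lambda> borel Z = distr M borel (\<lambda>\<omega>. - (S (real (nat \<lfloor>x / real m\<rfloor>)) \<omega> - real (nat \<lfloor>x / real m\<rfloor>)) / sqrt (real (nat \<lfloor>x / real m\<rfloor>)))"
    and law': "distr \<Lambda> borel Z' = density lborel (normal_density 0 \<sigma>)"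
  shows "\<bar>upper_integral (process_law M (K1 \<nu> S P (exp x))) f - upper_integral (process_law M' (Y1 \<nu> \<sigma> W (exp x))) f\<bar> \<le>
    ((real p + 1) * sqrt \<tau> / sqrt (log_Phi x) + \<tau> * sqrt x / 2 ^ p + laplace_exponent 1 / (log_Phi x * sqrt x) +
      (\<sigma>\<^sup>2 * (\<tau> + 1) + 2) * e + 3 * \<sigma> / sqrt (real m)) + 4 * exp (- x) +
    real m * (\<integral>z. min 2 \<bar>Z z - Z' z\<bar> \<partial>\<Lambda>) + \<sigma> / sqrt (real m)"
proof -
  let ?k = "nat \<lfloor>x / real m\<rfloor>"
  have x: "0 < x" using xm m zero_less_power[of "real m" 2] by linarith
  interpret W: brownian_functional M' W \<nu> \<sigma>
    by (intro brownian_functional.intro brownian_motion.intro brownian_functional_axioms.intro brownian_motion_axioms.intro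
        W \<sigma>_nonneg A1 levy_measure_axioms)
  interpret \<Lambda>: prob_space \<Lambda> by fact
  let ?F = "\<lambda>z. f (span_path m (coeff x m) z)" and ?\<xi> = "\<lambda>i \<omega>. \<sigma> * (W (real (Suc i) / real m) \<omega> - W (real i / real m) \<omega>)"
  have G: "0 < log_Phi x" by (rule W.log_Phi_pos)
  note span = bounded_lipschitz_span_path[OF f coeff_continuous coeff_const coeff_bound[OF x G]]
  have W_indep: "prob_space.indep_vars M' (\<lambda>_. borel) ?\<xi> {..<m}"
  proof -
    have "W.indep_vars (\<lambda>_. borel) (\<lambda>i \<omega>. W (real (Suc i) / real m) \<omega> - W (real i / real m) \<omega>) {..<m}"
      by (rule W.W_indep) (simp_all add: divide_right_mono)
    from W.indep_vars_compose2[OF this, of "\<lambda>_ y. \<sigma> * y" "\<lambda>_. borel"] show ?thesis by simp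
  qed
  have "\<bar>(\<integral>\<omega>. ?F (\<lambda>i. noise m ?k i \<omega>) \<partial>M) - (\<integral>\<omega>. ?F (\<lambda>i. ?\<xi> i \<omega>) \<partial>M')\<bar> \<le>
      real m * (\<integral>z. min 2 \<bar>Z z / sqrt (real m) - Z' z / sqrt (real m)\<bar> \<partial>\<Lambda>)"
  proof (rule iid_comparison[OF span m prob_space_axioms noise_indep W(1) W_indep \<Lambda>])
    have "distr \<Lambda> borel (\<lambda>z. Z z / sqrt (real m)) = distr (distr \<Lambda> borel Z) borel (\<lambda>y. y / sqrt (real m))"
      by (subst distr_distr) (auto simp: comp_def)
    also have "\<dots> = distr M borel (\<lambda>\<omega>. - (S (real ?k) \<omega> - real ?k) / sqrt (real ?k) / sqrt (real m))"
      unfolding law by (subst distr_distr) (auto simp: comp_def)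
    finally show "distr M borel (noise m ?k i) = distr \<Lambda> borel (\<lambda>z. Z z / sqrt (real m))" for i
      unfolding noise_law by simp
    show "distr M' borel (?\<xi> i) = distr \<Lambda> borel (\<lambda>z. Z' z / sqrt (real m))" for i
      unfolding W.scaled_increment_law[OF m \<sigma>_pos] by (rule \<Lambda>.scaled_normal_law[OF Z' law' m \<sigma>_pos, symmetric])
  qed (measurable)
  also have "\<dots> \<le> real m * (\<integral>z. min 2 \<bar>Z z - Z' z\<bar> \<partial>\<Lambda>)"
  proof (intro mult_left_mono integral_mono)
    show "min 2 \<bar>Z z / sqrt (real m) - Z' z / sqrt (real m)\<bar> \<le> min 2 \<bar>Z z - Z' z\<bar>" for z
    proof -
      have "\<bar>Z z - Z' z\<bar> / sqrt (real m) \<le> \<bar>Z z - Z' z\<bar>" using m by (simp add: divide_le_eq mult_le_cancel_left1)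
      then show ?thesis by (auto simp: diff_divide_distrib[symmetric] min_def)
    qed
  qed (auto intro!: \<Lambda>.integrable_const_bound[where B=2])
  finally have "\<bar>(\<integral>\<omega>. ?F (\<lambda>i. noise m ?k i \<omega>) \<partial>M) - (\<integral>\<omega>. ?F (\<lambda>i. ?\<xi> i \<omega>) \<partial>M')\<bar> \<le> real m * (\<integral>z. min 2 \<bar>Z z - Z' z\<bar> \<partial>\<Lambda>)" .
  then show ?thesis
    using upper_integral_K1[OF growth f m xm \<tau> e small, of p] W.upper_integral_Y1[OF f m x growth] by linarith
qed

theorem theorem6p1:
  fixes M :: "'a measure" and M' :: "'b measure"
    and S :: "real \<Rightarrow> 'a \<Rightarrow> real" and \<nu>0 :: "real measure" and \<sigma> :: real
    and P :: "real \<Rightarrow> 'a \<Rightarrow> real set" and W :: "real \<Rightarrow> 'b \<Rightarrow> real"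
  assumes "prob_space M"
    and "driftless_subordinator M S \<nu>0"
    and "\<And>t. 0 \<le> t \<Longrightarrow> integrable M (\<lambda>\<omega>. (S t \<omega>)\<^sup>2)"
    and "\<And>t. 0 \<le> t \<Longrightarrow> prob_space.expectation M (S t) = t"
    and "\<And>t. 0 \<le> t \<Longrightarrow> prob_space.variance M (S t) = \<sigma>\<^sup>2 * t"
    and "0 \<le> \<sigma>"
    and "\<And>n. 0 < n \<Longrightarrow> finite_poisson_process M (exp_intensity n) (P n)"
    and "\<And>n. 0 < n \<Longrightarrow> indep_process_points M S (exp_intensity n) (P n)"
    and "assumption_A1 \<nu>0" and "assumption_A2 \<nu>0"
    and "(\<lambda>n. L_fun \<nu>0 n) \<in> O(\<lambda>n. ln n)" and "(\<lambda>n. ln n) \<in> O(\<lambda>n. L_fun \<nu>0 n)"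
    and "prob_space M'"
    and "standard_brownian_motion M' W"
  shows "((\<lambda>n. d_BW0 (process_law M (K1 \<nu>0 S P n)) (process_law M' (Y1 \<nu>0 \<sigma> W n)))
    \<longlongrightarrow> 0) at_top"
proof -
  interpret prob_space M by fact
  interpret occupancy_moments M \<nu>0 S P \<sigma>
  proof
    show "subordinator_levy_measure \<nu>0" using assms(2) by (simp add: driftless_subordinator_def)
  qed (use assms in auto)
  interpret W: brownian_functional M' W \<nu>0 \<sigma>
    by (intro brownian_functional.intro brownian_motion.intro brownian_functional_axioms.intro brownian_motion_axioms.intro
        assms levy_measure_axioms)
  obtain C K y0 where growth: "regular_growth log_Phi log_phi C K y0"
    using regular_growth_log_Phi[OF assms(9-12)] by blast
  interpret RG: regular_growth log_Phi log_phi C K y0 by (rule growth)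
  define c where "c = laplace_exponent 1"
  \<comment> \<open>The horizon \<open>\<tau> * x\<close> has to be at least \<open>x\<close> and to
    satisfy the requirement of \<open>prob_late_points\<close> with its factor 3.\<close>
  define \<tau> where "\<tau> = 1 + 3 / c"
  have c: "0 < c" unfolding c_def laplace_exponent_one by (rule Phi_moment_pos[OF A1]) simp
  have \<tau>: "1 \<le> \<tau>" "3 \<le> \<tau> * laplace_exponent 1" using c by (auto simp: \<tau>_def c_def[symmetric] field_simps)
  obtain \<Lambda> :: "real measure" and Z Z' where \<Lambda>: "prob_space \<Lambda>"
    and Z: "\<And>k. Z k \<in> borel_measurable \<Lambda>" "Z' \<in> borel_measurable \<Lambda>"
      "\<And>k. 0 < k \<Longrightarrow> distr \<Lambda> borel (Z k) = distr M borel (\<lambda>\<omega>. - (S (real k) \<omega> - real k) / sqrt (real k))"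
      "distr \<Lambda> borel Z' = density lborel (normal_density 0 \<sigma>)"
    and coupling: "(\<lambda>k. \<integral>z. min 2 \<bar>Z k z - Z' z\<bar> \<partial>\<Lambda>) \<longlonglongrightarrow> 0"
    by (rule clt_coupling[OF square_integrable mean var \<sigma>_pos]) blast+
  define d where "d n = d_BW0 (process_law M (K1 \<nu>0 S P n)) (process_law M' (Y1 \<nu>0 \<sigma> W n))" for n
  have "((\<lambda>x. d (exp x)) \<longlongrightarrow> 0) at_top"
  proof (rule tendstoI)
    fix \<epsilon> :: real assume \<epsilon>: "0 < \<epsilon>"
    \<comment> \<open>The 4 adds the step error \<open>3 * \<sigma> / sqrt m\<close> of the
      subordinator and \<open>\<sigma> / sqrt m\<close> of the Brownian motion.\<close>
    have "(\<lambda>m. 4 * \<sigma> / sqrt (real m)) \<longlonglongrightarrow> 0" by real_asymp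
    then have "\<forall>\<^sub>F m in sequentially. 4 * \<sigma> / sqrt (real m) < \<epsilon> / 3 \<and> 0 < m"
      using \<epsilon> by (intro eventually_conj order_tendstoD eventually_gt_at_top) auto
    from eventually_happens'[OF sequentially_bot this] obtain m where m: "4 * \<sigma> / sqrt (real m) < \<epsilon> / 3" "0 < m" by blast
    \<comment> \<open>With \<open>2 ^ p \<ge> x\<close> the mesh \<open>\<tau> * x / 2 ^ p\<close>
      stays bounded, while the maximal inequality only sees the logarithm \<open>p\<close>.\<close>
    define p where "p x = nat \<lceil>log 2 x\<rceil>" for x :: real
    define e where "e = \<epsilon> / 3 / (\<sigma>\<^sup>2 * (\<tau> + 1) + 2)"
    have pos: "0 < \<sigma>\<^sup>2 * (\<tau> + 1) + 2" using \<tau> by (intro add_nonneg_pos mult_nonneg_nonneg) auto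
    have "q * (r / q) = r" if "0 < q" for q r :: real using that by simp
    from this[OF pos, of "\<epsilon> / 3"] have e: "0 < e" "(\<sigma>\<^sup>2 * (\<tau> + 1) + 2) * e = \<epsilon> / 3"
      unfolding e_def using \<epsilon> pos by (simp_all only: divide_pos_pos zero_less_numeral)
    \<comment> \<open>Collects what vanishes as \<open>x\<close> grows with \<open>m\<close> fixed.
      The factor \<open>m\<close> in front of the coupling cost is therefore harmless.\<close>
    define b where "b x = (real (p x) + 1) * sqrt \<tau> / sqrt (log_Phi x) + \<tau> * sqrt x / 2 ^ p x + c / (log_Phi x * sqrt x) +
      4 * exp (- x) + real m * (\<integral>z. min 2 \<bar>Z (nat \<lfloor>x / real m\<rfloor>) z - Z' z\<bar> \<partial>\<Lambda>)" for x
    have b: "(b \<longlongrightarrow> 0) at_top"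
    proof -
      have 1: "((\<lambda>x. (real (p x) + 1) * sqrt \<tau> / sqrt (log_Phi x)) \<longlongrightarrow> 0) at_top"
        unfolding p_def by (rule RG.logarithm_negligible)
      have 2: "((\<lambda>x. \<tau> * sqrt x / 2 ^ p x) \<longlongrightarrow> 0) at_top"
      proof (rule Lim_null_comparison)
        show "\<forall>\<^sub>F x in at_top. norm (\<tau> * sqrt x / 2 ^ p x) \<le> \<tau> / sqrt x"
          using eventually_gt_at_top[of 0]
        proof eventually_elim
          case (elim x)
          have "x = 2 powr log 2 x" using elim by simp
          also have "\<dots> \<le> 2 powr real (p x)" unfolding p_def by (intro powr_mono) (simp_all add: of_nat_ceiling)
          finally have "x \<le> 2 ^ p x" by (simp add: powr_realpow)
          then have "\<tau> * sqrt x / 2 ^ p x \<le> \<tau> * sqrt x / x" using elim \<tau> by (intro divide_left_mono) auto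
          also have "\<dots> = \<tau> / sqrt x" using real_div_sqrt[of x] elim by (simp add: field_simps)
          finally show ?case using \<tau> elim by simp
        qed
      qed real_asymp
      have 3: "((\<lambda>x. c / (log_Phi x * sqrt x)) \<longlongrightarrow> 0) at_top"
      proof (rule Lim_null_comparison)
        show "\<forall>\<^sub>F x in at_top. norm (c / (log_Phi x * sqrt x)) \<le> c / log_Phi 1 / sqrt x"
          using eventually_ge_at_top[of 1]
        proof eventually_elim
          case (elim x)
          then have "c / (log_Phi x * sqrt x) \<le> c / (log_Phi 1 * sqrt x)"
            using c RG.G_pos[of x] RG.G_pos[of 1] by (intro divide_left_mono mult_right_mono log_Phi_mono) auto
          then show ?case using c RG.G_pos[of x] elim by simp
        qed
        show "((\<lambda>x. c / log_Phi 1 / sqrt x) \<longlongrightarrow> 0) at_top" by real_asymp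
      qed
      have 4: "((\<lambda>x. 4 * exp (- x) :: real) \<longlongrightarrow> 0) at_top" by real_asymp
      have "filterlim (\<lambda>x. nat \<lfloor>x / real m\<rfloor>) sequentially at_top"
        using m(2) by (intro filterlim_compose[OF filterlim_nat_sequentially] filterlim_compose[OF filterlim_floor_sequentially]) real_asymp
      from filterlim_compose[OF coupling this] have 5: "((\<lambda>x. \<integral>z. min 2 \<bar>Z (nat \<lfloor>x / real m\<rfloor>) z - Z' z\<bar> \<partial>\<Lambda>) \<longlongrightarrow> 0) at_top" .
      show ?thesis unfolding b_def
        using tendsto_add[OF tendsto_add[OF tendsto_add[OF tendsto_add[OF 1 2] 3] 4] tendsto_mult_left[OF 5, of "real m"]] by simp
    qed
    from order_tendstoD(2)[OF b, of "\<epsilon> / 3"] \<epsilon> have "\<forall>\<^sub>F x in at_top. b x < \<epsilon> / 3" by simp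
    then show "\<forall>\<^sub>F x in at_top. dist (d (exp x)) 0 < \<epsilon>"
      using RG.errors_negligible[OF e(1)] eventually_ge_at_top[of "(real m)\<^sup>2"]
    proof eventually_elim
      case (elim x)
      let ?Q = "process_law M (K1 \<nu>0 S P (exp x))" and ?Q' = "process_law M' (Y1 \<nu>0 \<sigma> W (exp x))"
      have x: "0 < x" using elim(3) m zero_less_power[of "real m" 2] by linarith
      have "1 * real m \<le> real m * real m" using m by (intro mult_right_mono) auto
      then have "real m \<le> x" using elim(3) unfolding power2_eq_square by linarith
      then have "1 \<le> x / real m" using m by simp
      then have k: "0 < nat \<lfloor>x / real m\<rfloor>" by simp
      have bound: "\<bar>upper_integral ?Q f - upper_integral ?Q' f\<bar> \<le> b x + (\<sigma>\<^sup>2 * (\<tau> + 1) + 2) * e + 4 * \<sigma> / sqrt (real m)"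
        if "bounded_lipschitz D0 \<rho>0 f" for f
        using upper_integral_difference[OF growth assms(13,14) that m(2) elim(3) \<tau> less_imp_le[OF e(1)] conjunct1[OF elim(2)] conjunct2[OF elim(2)]
            \<Lambda> Z(1,2) Z(3)[OF k] Z(4), of "p x"] by (simp add: b_def c_def)
      have "\<bar>d (exp x)\<bar> \<le> b x + (\<sigma>\<^sup>2 * (\<tau> + 1) + 2) * e + 4 * \<sigma> / sqrt (real m)"
        unfolding d_def
      proof (rule d_BW0_le[OF _ _ _ _ bound])
        show "prob_space ?Q" unfolding process_law_def by (rule prob_space_distr[OF K1_measurable[OF x]])
        show "prob_space ?Q'" unfolding process_law_def by (rule W.prob_space_distr[OF W.Y1_measurable[OF x]])
      qed (simp_all add: process_law_def space_D0_space)
      then show ?case using elim(1) m(1) e(2) by (simp add: dist_real_def)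
    qed
  qed
  \<comment> \<open>Everything was proved for \<open>n = exp x\<close>; now \<open>x = ln n\<close>
    is substituted.\<close>
  from filterlim_compose[OF this ln_at_top] have "((\<lambda>n. d (exp (ln n))) \<longlongrightarrow> 0) at_top" .
  then have "(d \<longlongrightarrow> 0) at_top"
    by (rule Lim_transform_eventually) (rule eventually_mono[OF eventually_gt_at_top[of 0]], simp)
  then show ?thesis by (simp add: d_def[abs_def])
qed

end
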